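(* Consider an asymptotic end of an initial data set $(\mathcal S,h_{ab},K_{ab})$ for the vacuum Einstein equations on which there is an asymptotically Cartesian coordinate system such that the asymptotically Schwarzschildean decay conditions (D) of the context hold (with timelike ADM 4-momentum $p_\mu=(E,p_i)$ and $m=\sqrt{p_\mu p^\mu}$). Then there exists a symmetric spinor $$\kappa_{\mathbf{AB}}=o_\infty(r^{3/2})$$ such that $$\xi_{\mathbf{ABCD}}=o_\infty(r^{-3/2}),\qquad \xi_{\mathbf{AB}}=\pm\frac{\sqrt2\,p_{\mathbf{AB}}}{m}+o_\infty(r^{-1/2}),\qquad \xi=\pm\frac{\sqrt2E}{m}+o_\infty(r^{-1/2}),$$ where $\xi\equiv\nabla^{PQ}\kappa_{PQ}$, $\xi_{AB}\equiv\frac32\nabla_{(A}{}^D\kappa_{B)D}$, $\xi_{ABCD}\equiv\nabla_{(AB}\kappa_{CD)}$. Moreover, the spinor $\kappa_{\mathbf{AB}}$ is unique up to order $o_\infty(r^{-1/2})$, apart from a (complex) constant term.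
   Context: Space spinors. Spinor conventions are those of Penrose and Rindler; round brackets on indices denote symmetrisation. $(\mathcal S,h_{ab},K_{ab})$ is a smooth vacuum initial data set, regarded as a spacelike hypersurface of its vacuum development of signature $(+,-,-,-)$; $h_{ab}$ is negative definite with Levi-Civita connection $D_a$. The normal $\tau^\mu$ is normalised by $\tau_\mu\tau^\mu=2$, $h_{\mu\nu}=g_{\mu\nu}-\frac12\tau_\mu\tau_\nu$, and the symmetric tensor $K_{ab}$ is the pull-back of $K_{\mu\nu}=-h_\mu{}^\lambda h_\nu{}^\rho\nabla_\lambda\tau_\rho$. The spatial solder form $\sigma^\mu{}_{AB}=\tau_{(B}{}^{A'}\sigma^\mu{}_{A)A'}$ satisfies $h_{ab}\sigma^a{}_{AB}\sigma^b{}_{CD}=\frac12(\epsilon_{AC}\epsilon_{BD}+\epsilon_{AD}\epsilon_{BC})$; spatial tensors become spinors by contraction with it ($K_{ABCD}$, $D_{AB}=\sigma^a{}_{AB}D_a$). The Sen connection is $\nabla_{AB}=\tau^{A'}{}_{(A}\nabla_{B)A'}$; on $\mathcal S$, $\nabla_{AB}\pi_C=D_{AB}\pi_C+\frac12K_{ABC}{}^D\pi_D$, extended to higher valence as usual. Bold indices denote components with respect to the asymptotically Cartesian spin frame; $p_{\mathbf{AB}}=\sigma^i{}_{\mathbf{AB}}p_i$ with $p_i$ extended as a constant covector. The sign $\pm$ is fixed for the end: $+$ on an end labelled $(+)$ and $-$ on an end labelled $(-)$. Weighted spaces. $\sigma(x)=(1+d(O,x)^2)^{1/2}$ with $O\in\mathcal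 S$ fixed and $d$ the Riemannian distance; $\|u\|_\delta=(\int|u|^2\sigma^{-2\delta-3}dx)^{1/2}$; $H^s_\delta$ has norm $\sum_{|\alpha|\le s}\|D^\alpha u\|_{\delta-|\alpha|}$; $H^\infty_\delta=\bigcap_sH^s_\delta$. $u=o_\infty(r^\delta)$ means $u\in H^\infty_\delta$ at the asymptotic end. A spinor or tensor belongs to a space if its norm does. Decay conditions (D). The asymptotic end is an open set diffeomorphic to the complement of a closed ball in $\mathbb R^3$, with coordinates $x^i$, $r^2=\delta_{ij}x^ix^j$, $x_i=\delta_{ij}x^j$, such that $$h_{ij}=-\Big(1+\frac{2A}{r}\Big)\delta_{ij}-\frac{\alpha}{r}\Big(\frac{2x_ix_j}{r^2}-\delta_{ij}\Big)+o_\infty(r^{-3/2}),\qquad K_{ij}=\frac{\beta}{r^2}\Big(\frac{2x_ix_j}{r^2}-\delta_{ij}\Big)+o_\infty(r^{-5/2}),$$ $$A=E,\quad \alpha=\frac{2m^2+4(n\cdot p)^2}{\sqrt{m^2+(n\cdot p)^2}}-2E,\quad \beta=\frac{(n\cdot p)E(3m^2+2(n\cdot p)^2)}{(m^2+(n\cdot p)^2)^{3/2}},\qquad n\cdot p=r^{-1}x^ip_i,$$ where $E=-\frac1{16\pi}\int_{\partial\mathcal S_\infty}\delta^{ij}(\partial_ih_{jk}-\partial_kh_{ij})\frac{x^k}{r}dS$ and $p_i=\frac1{8\pi}\int_{\partial\mathcal S_\infty}(K_{ij}-Kh_{ij})\frac{x^j}{r}dS$ form the ADM 4-momentum $p_\mu=(E,p_i)$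 of the end (here $K=K_i{}^i$), assumed timelike: $p_\mu p^\mu=E^2-\delta^{ij}p_ip_j>0$.
   Formalization: The spinor K_ABCD in the Sen connection formula is taken as the contraction of −K_ab (that is, of ∇_aτ_b) with the solder forms, since contracting +K_ab contradicts K_ab = −∇_aτ_b and ∇_AB = τ^{A'}_(A∇_B)A'. *)

theory Defs
  imports "HOL-Analysis.Analysis"
begin

section \<open>Smooth functions of three variables\<close>

definition pd :: "3 \<Rightarrow> (real^3 \<Rightarrow> 'b::real_normed_vector) \<Rightarrow> real^3 \<Rightarrow> 'b" where
  "pd i f x = frechet_derivative f (at x) (axis i 1)"

primrec pds :: "3 list \<Rightarrow> (real^3 \<Rightarrow> 'b::real_normed_vector) \<Rightarrow> real^3 \<Rightarrow> 'b" where
  "pds [] f = f"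
| "pds (i # is) f = pd i (pds is f)"

text \<open>Used for open \<open>U\<close> only.\<close>

definition smooth_on :: "(real^3) set \<Rightarrow> (real^3 \<Rightarrow> 'b::real_normed_vector) \<Rightarrow> bool" where
  "smooth_on U f \<longleftrightarrow> (\<forall>is. pds is f differentiable_on U)"


section \<open>Vacuum initial data sets\<close>

text \<open>The manifold \<open>\<S>\<close> is the whole type \<open>'a\<close>. A chart is a pair of its
  domain and its coordinate map; a covariant 2-tensor field is given by its matrix of components,
  a function of the coordinates, in each chart of the atlas.\<close>

type_synonym 'a chart = "'a set \<times> ('a \<Rightarrow> real^3)"

abbreviation chart_image :: "'a chart \<Rightarrow> (real^3) set" where
  "chart_image c \<equiv> snd c ` fst c"

definition chart_inv :: "'a chart \<Rightarrow> real^3 \<Rightarrow> 'a" where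
  "chart_inv c = inv_into (fst c) (snd c)"

definition transition :: "'a chart \<Rightarrow> 'a chart \<Rightarrow> real^3 \<Rightarrow> real^3" where
  "transition c d = snd d \<circ> chart_inv c"

definition smooth_atlas :: "'a::topological_space chart set \<Rightarrow> bool" where
  "smooth_atlas \<A> \<longleftrightarrow>
     (\<Union>c\<in>\<A>. fst c) = UNIV \<and>
     (\<forall>c\<in>\<A>. open (fst c) \<and> open (chart_image c) \<and>
        homeomorphism (fst c) (chart_image c) (snd c) (chart_inv c)) \<and>
     (\<forall>c\<in>\<A>. \<forall>d\<in>\<A>. smooth_on (snd c ` (fst c \<inter> fst d)) (transition c d))"

definition symmetric_tensor_field ::
    "'a chart set \<Rightarrow> ('a chart \<Rightarrow> real^3 \<Rightarrow> real^3^3) \<Rightarrow> bool" where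
  "symmetric_tensor_field \<A> T \<longleftrightarrow>
     (\<forall>c\<in>\<A>. \<forall>i j. smooth_on (chart_image c) (\<lambda>x. T c x $ i $ j)) \<and>
     (\<forall>c\<in>\<A>. \<forall>x\<in>chart_image c. transpose (T c x) = T c x) \<and>
     (\<forall>c\<in>\<A>. \<forall>d\<in>\<A>. \<forall>x\<in>snd c ` (fst c \<inter> fst d).
        let J = jacobian (transition c d) (at x)
        in T c x = transpose J ** T d (transition c d x) ** J)"

text \<open>Levi-Civita calculus in one chart; \<open>g\<close> is a matrix of metric components. The first argument
  \<open>k\<close> of \<open>christoffel g x k i j\<close> is the upper index. The Riemann tensor has the sign for which the
  round sphere with positive definite metric has positive Ricci tensor.\<close>

definition christoffel :: "(real^3 \<Rightarrow> real^3^3) \<Rightarrow> real^3 \<Rightarrow> 3 \<Rightarrow> 3 \<Rightarrow> 3 \<Rightarrow> real" where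
  "christoffel g x k i j = (\<Sum>l\<in>UNIV. matrix_inv (g x) $ k $ l *
     (pd i (\<lambda>y. g y $ j $ l) x + pd j (\<lambda>y. g y $ i $ l) x - pd l (\<lambda>y. g y $ i $ j) x)) / 2"

definition ricci :: "(real^3 \<Rightarrow> real^3^3) \<Rightarrow> real^3 \<Rightarrow> 3 \<Rightarrow> 3 \<Rightarrow> real" where
  "ricci g x i j =
     (\<Sum>k\<in>UNIV. pd k (\<lambda>y. christoffel g y k i j) x - pd j (\<lambda>y. christoffel g y k i k) x) +
     (\<Sum>k\<in>UNIV. \<Sum>l\<in>UNIV. christoffel g x k k l * christoffel g x l i j
                        - christoffel g x k j l * christoffel g x l i k)"

definition trace_wrt :: "real^3^3 \<Rightarrow> (3 \<Rightarrow> 3 \<Rightarrow> real) \<Rightarrow> real" where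
  "trace_wrt M T = (\<Sum>i\<in>UNIV. \<Sum>j\<in>UNIV. matrix_inv M $ i $ j * T i j)"

definition cov_deriv ::
    "(real^3 \<Rightarrow> real^3^3) \<Rightarrow> (real^3 \<Rightarrow> real^3^3) \<Rightarrow> real^3 \<Rightarrow> 3 \<Rightarrow> 3 \<Rightarrow> 3 \<Rightarrow> real" where
  "cov_deriv g T x a i j = pd a (\<lambda>y. T y $ i $ j) x
     - (\<Sum>l\<in>UNIV. christoffel g x l a i * T x $ l $ j + christoffel g x l a j * T x $ i $ l)"

text \<open>The contraction \<open>K = K\<^sub>i\<^sup>i\<close>.\<close>

definition mean_curv :: "(real^3 \<Rightarrow> real^3^3) \<Rightarrow> (real^3 \<Rightarrow> real^3^3) \<Rightarrow> real^3 \<Rightarrow> real" where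
  "mean_curv h K x = trace_wrt (h x) (\<lambda>i j. K x $ i $ j)"

text \<open>Vacuum constraints for negative definite \<open>h\<close> and a normal with
  \<open>\<tau>\<^sub>\<mu> \<tau>\<^sup>\<mu> = 2\<close>, so that \<open>K\<^sub>a\<^sub>b\<close> is \<open>\<surd>2\<close> times the extrinsic curvature defined by the
  unit normal. This is the origin of the factor 1/2; the scalar curvature of \<open>h\<close> is minus that
  of the Riemannian metric \<open>-h\<close>.\<close>

definition hamiltonian_constraint ::
    "(real^3 \<Rightarrow> real^3^3) \<Rightarrow> (real^3 \<Rightarrow> real^3^3) \<Rightarrow> real^3 \<Rightarrow> bool" where
  "hamiltonian_constraint h K x \<longleftrightarrow>
     trace_wrt (h x) (ricci h x) =
       ((mean_curv h K x)\<^sup>2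
        - (\<Sum>a\<in>UNIV. \<Sum>b\<in>UNIV.
             K x $ a $ b * (matrix_inv (h x) ** K x ** matrix_inv (h x)) $ a $ b)) / 2"

definition momentum_constraint ::
    "(real^3 \<Rightarrow> real^3^3) \<Rightarrow> (real^3 \<Rightarrow> real^3^3) \<Rightarrow> real^3 \<Rightarrow> bool" where
  "momentum_constraint h K x \<longleftrightarrow>
     (\<forall>b. trace_wrt (h x) (\<lambda>a c. cov_deriv h K x a c b) = pd b (mean_curv h K) x)"

definition vacuum_initial_data ::
    "'a::{t2_space,second_countable_topology} chart set \<Rightarrow>
     ('a chart \<Rightarrow> real^3 \<Rightarrow> real^3^3) \<Rightarrow> ('a chart \<Rightarrow> real^3 \<Rightarrow> real^3^3) \<Rightarrow> bool" where
  "vacuum_initial_data \<A> h K \<longleftrightarrow>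
     connected (UNIV :: 'a set) \<and> smooth_atlas \<A> \<and>
     symmetric_tensor_field \<A> h \<and> symmetric_tensor_field \<A> K \<and>
     (\<forall>c\<in>\<A>. \<forall>x\<in>chart_image c.
        (\<forall>v. v \<noteq> 0 \<longrightarrow> v \<bullet> (h c x *v v) < 0) \<and>
        hamiltonian_constraint (h c) (K c) x \<and> momentum_constraint (h c) (K c) x)"

text \<open>The end is the domain of the chart \<open>c\<close>, with coordinates \<open>x\<^sup>i\<close>.\<close>

definition asymptotic_end :: "'a chart set \<Rightarrow> 'a chart \<Rightarrow> real \<Rightarrow> bool" where
  "asymptotic_end \<A> c R \<longleftrightarrow> c \<in> \<A> \<and> 0 < R \<and> chart_image c = {x. R < norm x}"


section \<open>Riemannian distance and weighted Sobolev spaces\<close>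

definition has_length ::
    "'a::topological_space chart set \<Rightarrow> ('a chart \<Rightarrow> real^3 \<Rightarrow> real^3^3) \<Rightarrow>
     (real \<Rightarrow> 'a) \<Rightarrow> real \<Rightarrow> bool" where
  "has_length \<A> h \<gamma> L \<longleftrightarrow> continuous_on {0..1} \<gamma> \<and>
     (\<exists>F speed. finite F \<and> (speed has_integral L) {0..1} \<and>
        (\<forall>t\<in>{0<..<1} - F. \<forall>c\<in>\<A>. \<gamma> t \<in> fst c \<longrightarrow>
           (\<exists>e>0. (snd c \<circ> \<gamma>) C1_differentiable_on ball t e) \<and>
           (let v = vector_derivative (snd c \<circ> \<gamma>) (at t)
            in speed t = sqrt (- (v \<bullet> (h c (snd c (\<gamma> t)) *v v))))))"

definition riem_dist ::
    "'a::topological_space chart set \<Rightarrow> ('a chart \<Rightarrow> real^3 \<Rightarrow> real^3^3) \<Rightarrow> 'a \<Rightarrow> 'a \<Rightarrow> real" where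
  "riem_dist \<A> h p q = Inf {L. \<exists>\<gamma>. \<gamma> 0 = p \<and> \<gamma> 1 = q \<and> has_length \<A> h \<gamma> L}"

text \<open>The weight \<open>\<sigma>\<close> in the coordinates of the end; \<open>z\<close> is the base point.\<close>

definition end_weight ::
    "'a::topological_space chart set \<Rightarrow> ('a chart \<Rightarrow> real^3 \<Rightarrow> real^3^3) \<Rightarrow> 'a \<Rightarrow> 'a chart \<Rightarrow>
     real^3 \<Rightarrow> real" where
  "end_weight \<A> h z c x = sqrt (1 + (riem_dist \<A> h z (chart_inv c x))\<^sup>2)"

definition weighted_norm_finite ::
    "(real^3 \<Rightarrow> real) \<Rightarrow> (real^3) set \<Rightarrow> real \<Rightarrow> (real^3 \<Rightarrow> 'b::real_normed_vector) \<Rightarrow> bool" where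
  "weighted_norm_finite w V \<delta> u \<longleftrightarrow>
     (\<integral>\<^sup>+x\<in>V. ennreal ((norm (u x))\<^sup>2 * w x powr (- 2 * \<delta> - 3)) \<partial>lborel) < \<infinity>"

text \<open>Words in the indices replace multi-indices; as mixed partial derivatives commute, this
  changes the norm only by multiplicities.\<close>

definition weighted_sobolev ::
    "(real^3 \<Rightarrow> real) \<Rightarrow> (real^3) set \<Rightarrow> nat \<Rightarrow> real \<Rightarrow> (real^3 \<Rightarrow> 'b::real_normed_vector) \<Rightarrow> bool" where
  "weighted_sobolev w V s \<delta> u \<longleftrightarrow>
     (\<forall>is. length is \<le> s \<longrightarrow> weighted_norm_finite w V (\<delta> - real (length is)) (pds is u))"

text \<open>\<open>o_inf w R \<delta> u\<close> renders \<open>u = o\<^sub>\<infinity>(r\<^sup>\<delta>)\<close>: \<open>u\<close> is in \<open>H\<^sup>\<infinity>\<^sub>\<delta>\<close> outside a larger ball, so that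
  nothing is required at the inner boundary of the end. Elements of \<open>H\<^sup>\<infinity>\<^sub>\<delta>\<close> are taken in their
  smooth representatives.\<close>

definition o_inf ::
    "(real^3 \<Rightarrow> real) \<Rightarrow> real \<Rightarrow> real \<Rightarrow> (real^3 \<Rightarrow> 'b::real_normed_vector) \<Rightarrow> bool" where
  "o_inf w R \<delta> u \<longleftrightarrow> smooth_on {x. R < norm x} u \<and>
     (\<exists>R'>R. \<forall>s. weighted_sobolev w {x. R' < norm x} s \<delta> u)"


section \<open>ADM 4-momentum and decay conditions\<close>

definition sphere_integral :: "real \<Rightarrow> (real^3 \<Rightarrow> real) \<Rightarrow> real" where
  "sphere_integral \<rho> f = integral (cbox (0, 0) (pi, 2 * pi))
     (\<lambda>(\<theta>, \<phi>). f (\<rho> *\<^sub>R vector [sin \<theta> * cos \<phi>, sin \<theta> * sin \<phi>, cos \<theta>]) * (\<rho>\<^sup>2 * sin \<theta>))"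

definition adm_energy :: "(real^3 \<Rightarrow> real^3^3) \<Rightarrow> real \<Rightarrow> bool" where
  "adm_energy h E \<longleftrightarrow>
     ((\<lambda>\<rho>. - 1 / (16 * pi) * sphere_integral \<rho> (\<lambda>x. \<Sum>k\<in>UNIV. \<Sum>i\<in>UNIV.
        (pd i (\<lambda>y. h y $ i $ k) x - pd k (\<lambda>y. h y $ i $ i) x) * (x $ k / norm x)))
      \<longlongrightarrow> E) at_top"

definition adm_momentum ::
    "(real^3 \<Rightarrow> real^3^3) \<Rightarrow> (real^3 \<Rightarrow> real^3^3) \<Rightarrow> real^3 \<Rightarrow> bool" where
  "adm_momentum h K p \<longleftrightarrow> (\<forall>i.
     ((\<lambda>\<rho>. 1 / (8 * pi) * sphere_integral \<rho> (\<lambda>x. \<Sum>j\<in>UNIV.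
        (K x $ i $ j - mean_curv h K x * h x $ i $ j) * (x $ j / norm x)))
      \<longlongrightarrow> p $ i) at_top)"

definition adm_mass :: "real \<Rightarrow> real^3 \<Rightarrow> real" where
  "adm_mass E p = sqrt (E\<^sup>2 - p \<bullet> p)"

definition n_dot :: "real^3 \<Rightarrow> real^3 \<Rightarrow> real" where
  "n_dot p x = (x \<bullet> p) / norm x"

definition decay_alpha :: "real \<Rightarrow> real^3 \<Rightarrow> real^3 \<Rightarrow> real" where
  "decay_alpha E p x = (let m = adm_mass E p; q = n_dot p x in
     (2 * m\<^sup>2 + 4 * q\<^sup>2) / sqrt (m\<^sup>2 + q\<^sup>2) - 2 * E)"

definition decay_beta :: "real \<Rightarrow> real^3 \<Rightarrow> real^3 \<Rightarrow> real" where
  "decay_beta E p x = (let m = adm_mass E p; q = n_dot p x in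
     q * E * (3 * m\<^sup>2 + 2 * q\<^sup>2) / (m\<^sup>2 + q\<^sup>2) powr (3/2))"

definition kronecker :: "3 \<Rightarrow> 3 \<Rightarrow> real" where
  "kronecker i j = (if i = j then 1 else 0)"

definition schwarzschildean_decay ::
    "(real^3 \<Rightarrow> real) \<Rightarrow> real \<Rightarrow> (real^3 \<Rightarrow> real^3^3) \<Rightarrow> (real^3 \<Rightarrow> real^3^3) \<Rightarrow>
     real \<Rightarrow> real^3 \<Rightarrow> bool" where
  "schwarzschildean_decay w R h K E p \<longleftrightarrow> (\<forall>i j.
     o_inf w R (- 3/2) (\<lambda>x. h x $ i $ j -
       (- (1 + 2 * E / norm x) * kronecker i j
        - decay_alpha E p x / norm x * (2 * x $ i * x $ j / (norm x)\<^sup>2 - kronecker i j))) \<and>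
     o_inf w R (- 5/2) (\<lambda>x. K x $ i $ j -
       decay_beta E p x / (norm x)\<^sup>2 * (2 * x $ i * x $ j / (norm x)\<^sup>2 - kronecker i j)))"


section \<open>Space spinors\<close>

text \<open>Spinor indices take the values 1, 2 (in the order of the values 0, 1 of Penrose and Rindler).
  Conventions: \<open>\<epsilon>\<^sub>A\<^sub>B\<close> and \<open>\<epsilon>\<^sup>A\<^sup>B\<close> have the same components, \<open>\<psi>\<^sup>A = \<epsilon>\<^sup>A\<^sup>B \<psi>\<^sub>B\<close> and
  \<open>\<psi>\<^sub>B = \<psi>\<^sup>A \<epsilon>\<^sub>A\<^sub>B\<close>.\<close>

definition eps :: "2 \<Rightarrow> 2 \<Rightarrow> complex" where
  "eps A B = (if A = B then 0 else if A = 1 then 1 else - 1)"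

text \<open>Components \<open>\<sigma>\<^sub>k\<^sup>A\<^sup>A'\<close> of the Infeld-van der Waerden symbols of Penrose and Rindler for the
  spatial members of an orthonormal tetrad.\<close>

definition ivdw_up :: "3 \<Rightarrow> 2 \<Rightarrow> 2 \<Rightarrow> complex" where
  "ivdw_up k A A' = complex_of_real (1 / sqrt 2) *
     (if k = 1 then (if A = A' then 0 else 1)
      else if k = 2 then (if A = A' then 0 else if A = 1 then \<i> else - \<i>)
      else (if A \<noteq> A' then 0 else if A = 1 then 1 else - 1))"

text \<open>\<open>\<sigma>\<^sup>k\<^sub>A\<^sub>A'\<close>; the sign is \<open>g\<^sup>k\<^sup>k = - 1\<close>.\<close>

definition ivdw :: "3 \<Rightarrow> 2 \<Rightarrow> 2 \<Rightarrow> complex" where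
  "ivdw k A A' = - (\<Sum>B\<in>UNIV. \<Sum>B'\<in>UNIV. ivdw_up k B B' * eps B A * eps B' A')"

text \<open>The spin frame is adapted to the normal: \<open>\<tau>\<^sub>A\<^sub>A'\<close> is the unit matrix.\<close>

definition tau :: "2 \<Rightarrow> 2 \<Rightarrow> complex" where
  "tau A A' = (if A = A' then 1 else 0)"

text \<open>\<open>\<tau>\<^sub>A\<^sup>A'\<close>\<close>

definition tau_mixed :: "2 \<Rightarrow> 2 \<Rightarrow> complex" where
  "tau_mixed A A' = (\<Sum>B'\<in>UNIV. eps A' B' * tau A B')"

text \<open>\<open>\<sigma>\<^sup>k\<^sub>A\<^sub>B = \<tau>\<^sub>(\<^sub>B\<^sup>A' \<sigma>\<^sup>k\<^sub>A\<^sub>)\<^sub>A'\<close>\<close>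

definition solder0 :: "3 \<Rightarrow> 2 \<Rightarrow> 2 \<Rightarrow> complex" where
  "solder0 k A B =
     (\<Sum>A'\<in>UNIV. tau_mixed B A' * ivdw k A A' + tau_mixed A A' * ivdw k B A') / 2"

lemma solder0_values:
  "solder0 1 1 1 = - 1 / sqrt 2" "solder0 1 1 2 = 0" "solder0 1 2 1 = 0" "solder0 1 2 2 = 1 / sqrt 2"
  "solder0 2 1 1 = \<i> / sqrt 2" "solder0 2 1 2 = 0" "solder0 2 2 1 = 0" "solder0 2 2 2 = \<i> / sqrt 2"
  "solder0 3 1 1 = 0" "solder0 3 1 2 = 1 / sqrt 2" "solder0 3 2 1 = 1 / sqrt 2" "solder0 3 2 2 = 0"
  by (simp_all add: solder0_def tau_mixed_def tau_def ivdw_def ivdw_up_def eps_def sum_2)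

lemma solder0_normalisation:
  "- (\<Sum>k\<in>UNIV. solder0 k A B * solder0 k C D) = (eps A C * eps B D + eps A D * eps B C) / 2"
proof -
  have "\<forall>A B C D. - (\<Sum>k\<in>UNIV. solder0 k A B * solder0 k C D) =
      (eps A C * eps B D + eps A D * eps B C) / 2"
    unfolding forall_2 sum_3
    by (simp add: solder0_values eps_def field_simps flip: of_real_mult)
  then show ?thesis by blast
qed

text \<open>An asymptotically Cartesian spin frame is the lift of an \<open>h\<close>-orthonormal frame \<open>e\<^sub>k\<close> that
  approaches the coordinate frame; \<open>e x $ k $ i\<close> is \<open>e\<^sub>k\<^sup>i\<close>. All spinors below are given by
  their components in this spin frame.\<close>

definition asymptotically_cartesian_frame ::
    "(real^3 \<Rightarrow> real) \<Rightarrow> real \<Rightarrow> (real^3 \<Rightarrow> real^3^3) \<Rightarrow> (real^3 \<Rightarrow> real^3^3) \<Rightarrow> bool" where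
  "asymptotically_cartesian_frame w R h e \<longleftrightarrow>
     (\<forall>x. R < norm x \<longrightarrow> (\<forall>k l. (e x $ k) \<bullet> (h x *v (e x $ l)) = - kronecker k l)) \<and>
     (\<forall>k i. o_inf w R (- 1/2) (\<lambda>x. e x $ k $ i - kronecker k i))"

definition solder :: "(real^3 \<Rightarrow> real^3^3) \<Rightarrow> real^3 \<Rightarrow> 3 \<Rightarrow> 2 \<Rightarrow> 2 \<Rightarrow> complex" where
  "solder e x i A B = (\<Sum>k\<in>UNIV. complex_of_real (e x $ k $ i) * solder0 k A B)"

definition covector_spinor ::
    "(real^3 \<Rightarrow> real^3^3) \<Rightarrow> real^3 \<Rightarrow> real^3 \<Rightarrow> 2 \<Rightarrow> 2 \<Rightarrow> complex" where
  "covector_spinor e p x A B = (\<Sum>i\<in>UNIV. solder e x i A B * complex_of_real (p $ i))"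

text \<open>Spin connection coefficients of \<open>D\<^sub>a\<close>:
  \<open>D\<^sub>a \<pi>\<^sub>C = \<partial>\<^sub>a \<pi>\<^sub>C - \<Gamma>\<^sub>a\<^sub>C\<^sup>D \<pi>\<^sub>D\<close>. They are determined uniquely on
  the end by \<open>D\<^sub>a \<epsilon>\<^sub>A\<^sub>B = 0\<close> and \<open>D\<^sub>a \<sigma>\<^sup>b\<^sub>A\<^sub>B = 0\<close>, namely
  \<open>\<Gamma>\<^sub>a\<^sub>C\<^sub>E = \<epsilon>\<^sup>D\<^sup>F \<sigma>\<^sub>b\<^sub>E\<^sub>F (\<partial>\<^sub>a \<sigma>\<^sup>b\<^sub>C\<^sub>D + \<Gamma>\<^sup>b\<^sub>a\<^sub>c \<sigma>\<^sup>c\<^sub>C\<^sub>D) / 2\<close>.\<close>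

definition spin_connection ::
    "real \<Rightarrow> (real^3 \<Rightarrow> real^3^3) \<Rightarrow> (real^3 \<Rightarrow> real^3^3) \<Rightarrow>
     (real^3 \<Rightarrow> 3 \<Rightarrow> 2 \<Rightarrow> 2 \<Rightarrow> complex) \<Rightarrow> bool" where
  "spin_connection R h e \<Gamma> \<longleftrightarrow> (\<forall>x. R < norm x \<longrightarrow>
     (\<forall>a. (\<Sum>C\<in>UNIV. \<Gamma> x a C C) = 0) \<and>
     (\<forall>a b A B. pd a (\<lambda>y. solder e y b A B) x
        + (\<Sum>c\<in>UNIV. complex_of_real (christoffel h x b a c) * solder e x c A B)
        - (\<Sum>Q\<in>UNIV. \<Gamma> x a A Q * solder e x b Q B + \<Gamma> x a B Q * solder e x b A Q) = 0))"

text \<open>The spinor \<open>K\<^sub>A\<^sub>B\<^sub>C\<^sub>D\<close> of the Sen connection formula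
  \<open>\<nabla>\<^sub>A\<^sub>B \<pi>\<^sub>C = D\<^sub>A\<^sub>B \<pi>\<^sub>C + 1/2 K\<^sub>A\<^sub>B\<^sub>C\<^sup>D \<pi>\<^sub>D\<close> is
  \<open>\<tau>\<^sub>D\<^sup>C' \<nabla>\<^sub>A\<^sub>B \<tau>\<^sub>C\<^sub>C'\<close>: this is the only choice for which the formula gives
  \<open>\<tau>\<^sup>A'\<^sub>(\<^sub>A \<nabla>\<^sub>B\<^sub>)\<^sub>A'\<close> (see \<open>sen_derivative_tau\<close> below). As
  \<open>K\<^sub>a\<^sub>b = - \<nabla>\<^sub>a \<tau>\<^sub>b\<close> on the hypersurface, it is the contraction of \<open>- K\<^sub>a\<^sub>b\<close> with the
  solder forms.\<close>

definition grad_tau :: "(real^3 \<Rightarrow> real^3^3) \<Rightarrow> real^3 \<Rightarrow> 3 \<Rightarrow> 3 \<Rightarrow> real" where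
  "grad_tau K x a b = - K x $ a $ b"

definition K_spinor ::
    "(real^3 \<Rightarrow> real^3^3) \<Rightarrow> (real^3 \<Rightarrow> real^3^3) \<Rightarrow> real^3 \<Rightarrow> 2 \<Rightarrow> 2 \<Rightarrow> 2 \<Rightarrow> 2 \<Rightarrow> complex" where
  "K_spinor e K x A B C D = (\<Sum>a\<in>UNIV. \<Sum>b\<in>UNIV.
     solder e x a A B * solder e x b C D * complex_of_real (grad_tau K x a b))"

text \<open>\<open>K\<^sub>A\<^sub>B\<^sub>C\<^sup>D\<close>\<close>

definition K_spinor_up ::
    "(real^3 \<Rightarrow> real^3^3) \<Rightarrow> (real^3 \<Rightarrow> real^3^3) \<Rightarrow> real^3 \<Rightarrow> 2 \<Rightarrow> 2 \<Rightarrow> 2 \<Rightarrow> 2 \<Rightarrow> complex" where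
  "K_spinor_up e K x A B C D = (\<Sum>F\<in>UNIV. eps D F * K_spinor e K x A B C F)"

text \<open>Check of the sign. \<open>D\<^sub>a\<close> annihilates \<open>\<tau>\<^sub>A\<^sub>A'\<close>, so for real coefficients
  \<open>v\<^sub>k = e\<^sub>k\<^sup>b \<nabla>\<^sub>a \<tau>\<^sub>b\<close> the Sen connection acts on \<open>\<tau>\<^sub>A\<^sub>A'\<close> by the left-hand side below
  (unprimed index and complex conjugate on the primed index). The result is the gradient of
  \<open>\<tau>\<close> with its sign.\<close>

lemma sen_derivative_tau:
  fixes v :: "3 \<Rightarrow> real"
  defines "M \<equiv> \<lambda>A Q. \<Sum>F\<in>UNIV. eps Q F * (\<Sum>k\<in>UNIV. v k * solder0 k A F)"
  shows "1/2 * (\<Sum>Q\<in>UNIV. M A Q * tau Q A') + 1/2 * (\<Sum>Q\<in>UNIV. cnj (M A' Q) * tau A Q)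
         = (\<Sum>k\<in>UNIV. v k * ivdw k A A')"
proof -
  have "\<forall>A A'. 1/2 * (\<Sum>Q\<in>UNIV. M A Q * tau Q A') + 1/2 * (\<Sum>Q\<in>UNIV. cnj (M A' Q) * tau A Q)
         = (\<Sum>k\<in>UNIV. v k * ivdw k A A')"
    unfolding forall_2 M_def sum_2 sum_3
    by (simp add: solder0_values eps_def tau_def ivdw_def ivdw_up_def sum_2 field_simps)
  then show ?thesis by blast
qed

text \<open>\<open>D\<^sub>A\<^sub>B \<kappa>\<^sub>C\<^sub>D\<close> and \<open>\<nabla>\<^sub>A\<^sub>B \<kappa>\<^sub>C\<^sub>D\<close>; the background arguments \<open>e \<Gamma> K\<close> come first.\<close>

definition D_spinor where
  "D_spinor (e :: real^3 \<Rightarrow> real^3^3) (\<Gamma> :: real^3 \<Rightarrow> 3 \<Rightarrow> 2 \<Rightarrow> 2 \<Rightarrow> complex)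
     (\<kappa> :: real^3 \<Rightarrow> 2 \<Rightarrow> 2 \<Rightarrow> complex) x A B C D =
     (\<Sum>a\<in>UNIV. solder e x a A B * (pd a (\<lambda>y. \<kappa> y C D) x
        - (\<Sum>Q\<in>UNIV. \<Gamma> x a C Q * \<kappa> x Q D + \<Gamma> x a D Q * \<kappa> x C Q)))"

definition sen where
  "sen e \<Gamma> (K :: real^3 \<Rightarrow> real^3^3) \<kappa> x A B C D = D_spinor e \<Gamma> \<kappa> x A B C D
     + 1/2 * (\<Sum>Q\<in>UNIV. K_spinor_up e K x A B C Q * \<kappa> x Q D + K_spinor_up e K x A B D Q * \<kappa> x C Q)"

text \<open>\<open>\<nabla>\<^sub>A\<^sup>D \<kappa>\<^sub>B\<^sub>D\<close>\<close>

definition sen_curl where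
  "sen_curl e \<Gamma> K \<kappa> x A B = (\<Sum>D\<in>UNIV. \<Sum>F\<in>UNIV. eps D F * sen e \<Gamma> K \<kappa> x A F B D)"

text \<open>\<open>\<xi>\<close>, \<open>\<xi>\<^sub>A\<^sub>B\<close> and \<open>\<xi>\<^sub>A\<^sub>B\<^sub>C\<^sub>D\<close>\<close>

definition xi0 where
  "xi0 e \<Gamma> K \<kappa> x = (\<Sum>P\<in>UNIV. \<Sum>Q\<in>UNIV. \<Sum>A\<in>UNIV. \<Sum>B\<in>UNIV.
     eps P A * eps Q B * sen e \<Gamma> K \<kappa> x A B P Q)"

definition xi2 where
  "xi2 e \<Gamma> K \<kappa> x A B = 3/2 * ((sen_curl e \<Gamma> K \<kappa> x A B + sen_curl e \<Gamma> K \<kappa> x B A) / 2)"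

definition symmetrise4 :: "(2 \<Rightarrow> 2 \<Rightarrow> 2 \<Rightarrow> 2 \<Rightarrow> complex) \<Rightarrow> 2 \<Rightarrow> 2 \<Rightarrow> 2 \<Rightarrow> 2 \<Rightarrow> complex" where
  "symmetrise4 T A B C D = (\<Sum>\<pi> | \<pi> permutes {..<4::nat}.
     let X = (\<lambda>i. [A, B, C, D] ! \<pi> i) in T (X 0) (X 1) (X 2) (X 3)) / 24"

definition xi4 where
  "xi4 e \<Gamma> K \<kappa> x = symmetrise4 (sen e \<Gamma> K \<kappa> x)"

definition symmetric_spinor :: "real \<Rightarrow> (real^3 \<Rightarrow> 2 \<Rightarrow> 2 \<Rightarrow> complex) \<Rightarrow> bool" where
  "symmetric_spinor R \<kappa> \<longleftrightarrow> (\<forall>x. R < norm x \<longrightarrow> (\<forall>A B. \<kappa> x A B = \<kappa> x B A))"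

text \<open>The asymptotic conditions on \<open>\<kappa>\<^sub>A\<^sub>B\<close>; \<open>s\<close> is the sign \<open>\<plusminus>1\<close> of the end.\<close>

definition asymptotic_killing_spinor where
  "asymptotic_killing_spinor w R e \<Gamma> K E p s \<kappa> \<longleftrightarrow>
     symmetric_spinor R \<kappa> \<and>
     (\<forall>A B. o_inf w R (3/2) (\<lambda>x. \<kappa> x A B)) \<and>
     (\<forall>A B C D. o_inf w R (- 3/2) (\<lambda>x. xi4 e \<Gamma> K \<kappa> x A B C D)) \<and>
     (\<forall>A B. o_inf w R (- 1/2) (\<lambda>x. xi2 e \<Gamma> K \<kappa> x A B
        - complex_of_real (s * sqrt 2 / adm_mass E p) * covector_spinor e p x A B)) \<and>
     o_inf w R (- 1/2) (\<lambda>x. xi0 e \<Gamma> K \<kappa> x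
        - complex_of_real (s * sqrt 2 * E / adm_mass E p))"

end

theory Submission
  imports Defs
begin

text \<open>A symmetric spinor is written as \<open>\<kappa>\<^sub>A\<^sub>B = \<sigma>\<^sup>b\<^sub>A\<^sub>B h\<^sub>b\<^sub>a X\<^sup>a\<close> with a complex vector field \<open>X\<close>. Then
  \<open>\<xi>\<^sub>A\<^sub>B\<^sub>C\<^sub>D\<close> is the trace-free part of the Lie derivative of \<open>h\<close> along \<open>X\<close>, corrected by the symmetric
  part of a commutator of \<open>K\<close> with \<open>X\<close>, while \<open>\<xi>\<close> and \<open>\<xi>\<^sub>A\<^sub>B\<close> are the divergence and the curl.

  For existence, take
    \<open>X\<^sup>a = (t E / \<surd>2) (x\<^sup>a - \<alpha> n\<^sup>a) + \<i> t (p \<times> x)\<^sup>a\<close> with \<open>t = \<plusminus>2 / (3 m)\<close>.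
  The dilation and the rotation about \<open>p\<close> are conformal symmetries of the leading metric up to a
  trace and the term in \<open>\<alpha>\<close>, which the radial vector \<open>\<alpha> n\<close> removes. What is left is a shear
  proportional to \<open>E \<alpha>'\<close>, the derivative being with respect to \<open>n \<cdot> p\<close>, and it cancels against the
  contribution of \<open>K\<close> because \<open>E \<alpha>' = 2 \<beta>\<close>.

  For uniqueness, the difference of two solutions is given by a vector field with small first
  derivatives and small image under the flat conformal Killing operator. This operator is of
  finite type, so all second derivatives are small, and integration from infinity shows that the
  field is constant up to a small term; one iteration improves the error to the required order.

  The weight, which is defined by the Riemannian distance, is comparable to \<open>r\<close>. This rests on the
  decay of \<open>h\<close> without weights, for which only \<open>w \<ge> 1\<close> is used.\<close>

text \<open>Decay is measured in weighted square integrals, while integration along rays needs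
  pointwise bounds. Two scales are used side by side: \<open>symb a\<close>, all derivatives bounded
  by powers, and \<open>small \<delta>\<close>, weighted square integrable. Sobolev's inequality
  puts \<open>small \<delta>\<close> inside \<open>symb \<delta>\<close>, but \<open>symb a\<close>
  lies in \<open>small \<delta>\<close> only for \<open>a < \<delta>\<close>; Hardy's inequality
  integrates from infinity without this loss. The spin frame is known only up to order -1/2. An
  error of order -3/2 is therefore reached only if terms of order 0 are never moved between frame
  and coordinates: in the solution this term is an exact multiple of the full metric, whose frame
  components are constants. The strict \<open>a < \<delta>\<close> also forces the iteration for
  uniqueness: growth of order 1/2 puts the flat operator into every order above -3/2, but the
  argument stops short of -3/2 itself. The constant \<open>2 / (3 m)\<close> makes
  \<open>3 t / \<surd>2\<close>, the factor of \<open>E\<close> and \<open>p\<close> in the result,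
  equal to \<open>\<surd>2 / m\<close>, up to the sign of the end.\<close>

abbreviation ext :: "real \<Rightarrow> (real^3) set" where
  "ext R \<equiv> {x. R < norm x}"

section \<open>Calculus of partial derivatives on open sets\<close>

lemma open_ext [simp, intro]: "open (ext R)"
  using open_Collect_less[OF continuous_on_const continuous_on_norm_id, of R] by simp

text \<open>No differentiability is assumed: both functions have the same derivatives at
  \<open>x\<close>, if any, so the choice behind \<open>frechet_derivative\<close> gives the same
  value.\<close>

lemma frechet_derivative_cong_open:
  assumes "open U" "x \<in> U" "\<And>y. y \<in> U \<Longrightarrow> f y = g y"
  shows "frechet_derivative f (at x) = frechet_derivative g (at x)"
proof -
  have "(f has_derivative f') (at x) \<longleftrightarrow> (g has_derivative f') (at x)" for f'
    using assms has_derivative_transform_within_open[of f f' x UNIV U g]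
      has_derivative_transform_within_open[of g f' x UNIV U f] by auto
  then show ?thesis unfolding frechet_derivative_def by simp
qed

lemma pd_cong_open:
  assumes "open U" "x \<in> U" "\<And>y. y \<in> U \<Longrightarrow> f y = g y"
  shows "pd i f x = pd i g x"
  using frechet_derivative_cong_open[OF assms] by (simp add: pd_def)

lemma pd_eqI: "(f has_derivative f') (at x) \<Longrightarrow> pd i f x = f' (axis i 1)"
  unfolding pd_def by (metis frechet_derivative_at)

lemma frechet_derivative_worksI:
  "f differentiable F \<Longrightarrow> (f has_derivative frechet_derivative f F) F"
  by (simp add: frechet_derivative_works)

lemma differentiable_on_openD:
  "f differentiable_on U \<Longrightarrow> open U \<Longrightarrow> x \<in> U \<Longrightarrow> f differentiable at x"
  by (simp add: differentiable_on_eq_differentiable_at)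

lemma differentiable_on_cong:
  assumes "open U" "f differentiable_on U" "\<And>y. y \<in> U \<Longrightarrow> f y = g y"
  shows "g differentiable_on U"
  using assms unfolding differentiable_on_def
  by (metis differentiable_transform_within zero_less_one)

lemma pd_add:
  assumes "f differentiable at x" "g differentiable at x"
  shows "pd i (\<lambda>x. f x + g x) x = pd i f x + pd i g x"
  using pd_eqI[OF has_derivative_add[OF assms[THEN frechet_derivative_worksI]]] by (simp add: pd_def)

lemma pd_diff:
  assumes "f differentiable at x" "g differentiable at x"
  shows "pd i (\<lambda>x. f x - g x) x = pd i f x - pd i g x"
  using pd_eqI[OF has_derivative_diff[OF assms[THEN frechet_derivative_worksI]]] by (simp add: pd_def)

lemma pd_mult:
  fixes f g :: "real^3 \<Rightarrow> 'b::real_normed_algebra"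
  assumes "f differentiable at x" "g differentiable at x"
  shows "pd i (\<lambda>x. f x * g x) x = pd i f x * g x + f x * pd i g x"
proof -
  have "((\<lambda>x. f x * g x) has_derivative
      (\<lambda>h. f x * frechet_derivative g (at x) h + frechet_derivative f (at x) h * g x)) (at x)"
    using has_derivative_mult[of f _ x UNIV g] assms by (simp add: frechet_derivative_works)
  from pd_eqI[OF this] show ?thesis by (simp add: pd_def)
qed

lemma pd_bounded_linear:
  assumes "bounded_linear T" "f differentiable at x"
  shows "pd i (\<lambda>x. T (f x)) x = T (pd i f x)"
  using pd_eqI[OF bounded_linear.has_derivative[OF assms(1) frechet_derivative_worksI[OF assms(2)]]]
  by (simp add: pd_def)

lemma pd_const [simp]: "pd i (\<lambda>x. c) x = 0"
  using pd_eqI[OF has_derivative_const] by auto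

lemma pd_coord: "pd i (\<lambda>x. x $ j) x = kronecker i j"
proof -
  have "((\<lambda>x::real^3. x $ j) has_derivative (\<lambda>h. h $ j)) (at x)"
    by (simp add: bounded_linear_imp_has_derivative bounded_linear_vec_nth)
  from pd_eqI[OF this] show ?thesis by (auto simp: kronecker_def axis_def)
qed

lemma pd_sum:
  assumes "finite I" "\<And>k. k \<in> I \<Longrightarrow> f k differentiable at x"
  shows "pd i (\<lambda>x. \<Sum>k\<in>I. f k x) x = (\<Sum>k\<in>I. pd i (f k) x)"
  using assms by (induction I) (auto simp: pd_add)

lemma frechet_derivative_eq_pd:
  fixes f :: "real^3 \<Rightarrow> 'b::real_normed_vector"
  assumes "f differentiable at x"
  shows "frechet_derivative f (at x) v = (\<Sum>i\<in>UNIV. v $ i *\<^sub>R pd i f x)"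
proof -
  interpret linear "frechet_derivative f (at x)"
    using assms by (rule linear_frechet_derivative)
  have "v = (\<Sum>i\<in>UNIV. v $ i *\<^sub>R axis i 1)"
    by (simp add: basis_expansion scalar_mult_eq_scaleR flip: scalar_mult_eq_scaleR)
  then have "frechet_derivative f (at x) v = frechet_derivative f (at x) (\<Sum>i\<in>UNIV. v $ i *\<^sub>R axis i 1)"
    by simp
  then show ?thesis by (simp only: sum scaleR pd_def)
qed

lemma has_derivative_pd:
  fixes f :: "real^3 \<Rightarrow> 'b::real_normed_vector"
  assumes "f differentiable at x"
  shows "(f has_derivative (\<lambda>v. \<Sum>i\<in>UNIV. v $ i *\<^sub>R pd i f x)) (at x)"
  using frechet_derivative_worksI[OF assms] frechet_derivative_eq_pd[OF assms]
  by (metis (no_types, lifting) ext)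

text \<open>The head of the word is the derivative taken last; \<open>jet\<close> peels off the one
  taken first, which is the last letter.\<close>

lemma pds_snoc: "pds (is @ [i]) f = pds is (pd i f)"
  by (induction "is") auto

text \<open>A family of function classes indexed by an order is closed up so that each derivative lowers
  the order by one; \<open>n\<close> counts the derivatives controlled. Smoothness, symbol bounds and weighted
  square integrability are all of this form, so that closure properties are proved only once.\<close>

primrec jet :: "nat \<Rightarrow> (real \<Rightarrow> (real^3 \<Rightarrow> 'b::real_normed_vector) \<Rightarrow> bool) \<Rightarrow> real \<Rightarrow>
    (real^3 \<Rightarrow> 'b) \<Rightarrow> bool" where
  "jet 0 G a f \<longleftrightarrow> G a f"
| "jet (Suc n) G a f \<longleftrightarrow> G a f \<and> (\<forall>i. jet n G (a - 1) (pd i f))"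

lemma jet_pds: "jet n G a f \<longleftrightarrow> (\<forall>is. length is \<le> n \<longrightarrow> G (a - real (length is)) (pds is f))"
proof (induction n arbitrary: a f)
  case (Suc n)
  have "(\<forall>is. length is \<le> Suc n \<longrightarrow> G (a - real (length is)) (pds is f)) \<longleftrightarrow>
    G a f \<and> (\<forall>i is. length is \<le> n \<longrightarrow> G (a - 1 - real (length is)) (pds is (pd i f)))"
    (is "?L \<longleftrightarrow> ?R")
  proof
    assume L: ?L
    have "G (a - 1 - real (length is)) (pds is (pd i f))" if "length is \<le> n" for i "is"
      using L[rule_format, of "is @ [i]"] that by (simp add: pds_snoc algebra_simps)
    with L[rule_format, of "[]"] show ?R by auto
  next
    assume R: ?R
    show ?L
    proof (intro allI impI)
      fix "is" :: "3 list" assume l: "length is \<le> Suc n"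
      show "G (a - real (length is)) (pds is f)"
      proof (cases "is" rule: rev_cases)
        case (snoc js j)
        with R l have "G (a - 1 - real (length js)) (pds js (pd j f))" by auto
        with snoc show ?thesis by (simp add: pds_snoc algebra_simps)
      qed (use R in auto)
    qed
  qed
  with Suc show ?case by auto
qed simp

lemma jet_SucD: "jet (Suc n) G a f \<Longrightarrow> jet n G a f"
  by (auto simp: jet_pds)

lemma jet_0D: "jet n G a f \<Longrightarrow> G a f"
  by (cases n) auto

text \<open>\<open>G_diff\<close> is part of the interface because the sum and product rules for
  \<open>pd\<close> hold only where the functions are differentiable.\<close>

locale jet_class =
  fixes U :: "(real^3) set" and G :: "real \<Rightarrow> (real^3 \<Rightarrow> 'b::real_normed_vector) \<Rightarrow> bool"
  assumes open_U: "open U"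
    and G_cong: "\<And>a f g. G a f \<Longrightarrow> (\<And>x. x \<in> U \<Longrightarrow> f x = g x) \<Longrightarrow> G a g"
    and G_diff: "\<And>a f. G a f \<Longrightarrow> f differentiable_on U"
    and G_add: "\<And>a f g. G a f \<Longrightarrow> G a g \<Longrightarrow> G a (\<lambda>x. f x + g x)"
begin

lemma G_diffat: "G a f \<Longrightarrow> x \<in> U \<Longrightarrow> f differentiable at x"
  using G_diff open_U differentiable_on_openD by blast

lemma jet_cong: "jet n G a f \<Longrightarrow> (\<And>x. x \<in> U \<Longrightarrow> f x = g x) \<Longrightarrow> jet n G a g"
proof (induction n arbitrary: a f g)
  case (Suc n)
  have "jet n G (a - 1) (pd i g)" for i
    by (rule Suc.IH[of "a - 1" "pd i f"]) (use Suc.prems pd_cong_open[OF open_U, of _ f g] in auto)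
  moreover have "G a g" by (rule G_cong[of a f]) (use Suc.prems in auto)
  ultimately show ?case by simp
next
  case 0
  then show ?case using G_cong[of a f g] by simp
qed

lemma jet_add: "jet n G a f \<Longrightarrow> jet n G a g \<Longrightarrow> jet n G a (\<lambda>x. f x + g x)"
proof (induction n arbitrary: a f g)
  case (Suc n)
  have "jet n G (a - 1) (pd i (\<lambda>x. f x + g x))" for i
  proof (rule jet_cong[OF Suc.IH[of "a - 1" "pd i f" "pd i g"]])
    fix x assume "x \<in> U"
    then have "f differentiable at x" "g differentiable at x"
      using Suc.prems G_diffat by auto
    then show "pd i f x + pd i g x = pd i (\<lambda>x. f x + g x) x" by (simp add: pd_add)
  qed (use Suc.prems in auto)
  moreover have "G a (\<lambda>x. f x + g x)" using Suc.prems by (intro G_add) auto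
  ultimately show ?case by simp
next
  case 0
  then show ?case using G_add[of a f g] by simp
qed

end

text \<open>Leibniz rule: both \<open>(a - 1) + b\<close> and \<open>a + (b - 1)\<close> are one
  below \<open>a + b\<close>. The three classes may differ, so that a symbol can multiply a square
  integrable function.\<close>

lemma jet_mult:
  fixes f g :: "real^3 \<Rightarrow> 'b::real_normed_algebra"
  assumes 1: "jet_class U G1" and 2: "jet_class U G2" and 3: "jet_class U G3"
    and m: "\<And>a b f g. G1 a f \<Longrightarrow> G2 b g \<Longrightarrow> G3 (a + b) (\<lambda>x. f x * g x)"
  shows "jet n G1 a f \<Longrightarrow> jet n G2 b g \<Longrightarrow> jet n G3 (a + b) (\<lambda>x. f x * g x)"
proof (induction n arbitrary: a b f g)
  case (Suc n)
  have "jet n G3 (a + b - 1) (pd i (\<lambda>x. f x * g x))" for i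
  proof (rule jet_class.jet_cong[OF 3 jet_class.jet_add[OF 3]])
    have p: "jet n G1 (a - 1) (pd i f)" "jet n G1 a f" "jet n G2 (b - 1) (pd i g)" "jet n G2 b g"
      using Suc.prems(1,2)[THEN jet_SucD] Suc.prems by simp_all
    have "jet n G3 ((a - 1) + b) (\<lambda>x. pd i f x * g x)"
      by (rule Suc.IH[OF p(1,4)])
    then show "jet n G3 (a + b - 1) (\<lambda>x. pd i f x * g x)" by (simp add: algebra_simps)
    have "jet n G3 (a + (b - 1)) (\<lambda>x. f x * pd i g x)"
      by (rule Suc.IH[OF p(2,3)])
    then show "jet n G3 (a + b - 1) (\<lambda>x. f x * pd i g x)" by (simp add: algebra_simps)
    show "pd i f x * g x + f x * pd i g x = pd i (\<lambda>x. f x * g x) x" if "x \<in> U" for x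
      using pd_mult[of f x g i] jet_class.G_diffat[OF 1 _ that, of a f]
        jet_class.G_diffat[OF 2 _ that, of b g] Suc.prems by simp
  qed
  moreover have "G3 (a + b) (\<lambda>x. f x * g x)" using Suc.prems by (intro m) auto
  ultimately show ?case by simp
next
  case 0
  then show ?case using m[of a f b g] by simp
qed

lemma jet_bounded_linear:
  assumes "bounded_linear T" "jet_class U G1" "jet_class U G2"
    and m: "\<And>a f. G1 a f \<Longrightarrow> G2 a (\<lambda>x. T (f x))"
  shows "jet n G1 a f \<Longrightarrow> jet n G2 a (\<lambda>x. T (f x))"
proof (induction n arbitrary: a f)
  case (Suc n)
  have "jet n G2 (a - 1) (pd i (\<lambda>x. T (f x)))" for i
  proof (rule jet_class.jet_cong[OF assms(3) Suc.IH[of "a - 1" "pd i f"]])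
    show "T (pd i f x) = pd i (\<lambda>x. T (f x)) x" if "x \<in> U" for x
      using pd_bounded_linear[OF assms(1)] jet_class.G_diffat[OF assms(2) _ that, of a f] Suc.prems
      by simp
  qed (use Suc.prems in auto)
  moreover have "G2 a (\<lambda>x. T (f x))" using Suc.prems by (intro m) auto
  ultimately show ?case by simp
next
  case 0
  then show ?case using m[of a f] by simp
qed

subsection \<open>Smooth functions\<close>

lemma jet_class_smooth: "open U \<Longrightarrow> jet_class U (\<lambda>a f. f differentiable_on U)"
  by unfold_locales (auto intro: differentiable_on_cong)

text \<open>Differentiability does not see the order, so the \<open>0\<close> is an arbitrary
  choice; the calculus of jets then yields the closure properties of smooth functions.\<close>

lemma smooth_on_jet: "smooth_on U f \<longleftrightarrow> (\<forall>n. jet n (\<lambda>a f. f differentiable_on U) 0 f)"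
  unfolding smooth_on_def jet_pds by auto

lemma smooth_on_cong:
  "open U \<Longrightarrow> smooth_on U f \<Longrightarrow> (\<And>x. x \<in> U \<Longrightarrow> f x = g x) \<Longrightarrow> smooth_on U g"
  unfolding smooth_on_jet using jet_class.jet_cong[OF jet_class_smooth] by blast

lemma smooth_on_add:
  "open U \<Longrightarrow> smooth_on U f \<Longrightarrow> smooth_on U g \<Longrightarrow> smooth_on U (\<lambda>x. f x + g x)"
  unfolding smooth_on_jet using jet_class.jet_add[OF jet_class_smooth] by blast

lemma smooth_on_bounded_linear:
  "open U \<Longrightarrow> bounded_linear T \<Longrightarrow> smooth_on U f \<Longrightarrow> smooth_on U (\<lambda>x. T (f x))"
  unfolding smooth_on_jet
proof (intro allI, erule_tac x = n in allE)
  fix n assume *: "open U" "bounded_linear T" "jet n (\<lambda>a f. f differentiable_on U) 0 f"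
  show "jet n (\<lambda>a f. f differentiable_on U) 0 (\<lambda>x. T (f x))"
  proof (rule jet_bounded_linear[OF *(2) jet_class_smooth[OF *(1)] jet_class_smooth[OF *(1)] _ *(3)])
    fix g :: "real^3 \<Rightarrow> 'a" assume "g differentiable_on U"
    then show "(\<lambda>x. T (g x)) differentiable_on U"
      unfolding differentiable_on_def differentiable_def
      using bounded_linear.has_derivative[OF *(2)] by blast
  qed
qed

lemma smooth_on_minus: "open U \<Longrightarrow> smooth_on U f \<Longrightarrow> smooth_on U (\<lambda>x. - f x)"
  by (intro smooth_on_bounded_linear[of U "\<lambda>x. - x"]) (auto intro: bounded_linear_minus bounded_linear_ident)

lemma smooth_on_diff:
  "open U \<Longrightarrow> smooth_on U f \<Longrightarrow> smooth_on U g \<Longrightarrow> smooth_on U (\<lambda>x. f x - g x)"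
  using smooth_on_add[of U f "\<lambda>x. - g x"] smooth_on_minus[of U g] by simp

lemma smooth_on_mult:
  fixes f g :: "real^3 \<Rightarrow> 'b::real_normed_algebra"
  shows "open U \<Longrightarrow> smooth_on U f \<Longrightarrow> smooth_on U g \<Longrightarrow> smooth_on U (\<lambda>x. f x * g x)"
  unfolding smooth_on_jet
  using jet_mult[OF jet_class_smooth jet_class_smooth jet_class_smooth, of U _ 0 f 0 g]
  by (auto intro: differentiable_mult simp: differentiable_on_def)

lemma smooth_on_pd: "smooth_on U f \<Longrightarrow> smooth_on U (pd i f)"
  unfolding smooth_on_def using pds_snoc by metis

lemma smooth_on_subset: "smooth_on U f \<Longrightarrow> V \<subseteq> U \<Longrightarrow> smooth_on V f"
  unfolding smooth_on_def using differentiable_on_subset by blast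

lemma smooth_on_imp_diff: "open U \<Longrightarrow> smooth_on U f \<Longrightarrow> x \<in> U \<Longrightarrow> f differentiable at x"
  unfolding smooth_on_def by (metis pds.simps(1) differentiable_on_openD)

lemma smooth_on_pds_diff: "open U \<Longrightarrow> smooth_on U f \<Longrightarrow> x \<in> U \<Longrightarrow> pds is f differentiable at x"
  unfolding smooth_on_def by (metis differentiable_on_openD)

lemma smooth_on_imp_continuous: "smooth_on U f \<Longrightarrow> continuous_on U f"
  unfolding smooth_on_def by (metis pds.simps(1) differentiable_imp_continuous_on)

lemma smooth_on_const [simp]: "smooth_on U (\<lambda>x. c)"
proof -
  have "\<exists>c. pds is (\<lambda>x. c0) = (\<lambda>x. c)" for "is" and c0 :: 'a
    by (induction "is") auto
  then show ?thesis unfolding smooth_on_def by (metis differentiable_on_const)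
qed

lemma smooth_on_coord [simp]: "open U \<Longrightarrow> smooth_on U (\<lambda>x. x $ j)"
proof -
  assume "open U"
  have "smooth_on U (pd i (\<lambda>x. x $ j))" for i
    using pd_coord[of i j] by (subst ext[of "pd i (\<lambda>x. x $ j)" "\<lambda>x. kronecker i j"]) auto
  moreover have "(\<lambda>x. x $ j) differentiable_on U"
    by (simp add: bounded_linear_imp_differentiable_on bounded_linear_vec_nth)
  ultimately show ?thesis unfolding smooth_on_def by (metis pds.simps(1) pds_snoc rev_exhaust)
qed

lemma smooth_on_sum:
  "open U \<Longrightarrow> (\<And>k. k \<in> I \<Longrightarrow> smooth_on U (f k)) \<Longrightarrow> smooth_on U (\<lambda>x. \<Sum>k\<in>I. f k x)"
  by (induction I rule: infinite_finite_induct) (auto intro: smooth_on_add)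

lemma pd_powr:
  fixes f :: "real^3 \<Rightarrow> real"
  assumes "f differentiable at x" "f x > 0"
  shows "pd i (\<lambda>x. f x powr a) x = a * f x powr (a - 1) * pd i f x"
proof -
  have "((\<lambda>x. f x powr a) has_derivative
      (\<lambda>h. a * f x powr (a - 1) * frechet_derivative f (at x) h)) (at x)"
    using has_derivative_powr[of f _ x UNIV "\<lambda>_. a", OF frechet_derivative_worksI[OF assms(1)] has_derivative_const] assms
    by (simp add: powr_diff algebra_simps)
  from pd_eqI[OF this] show ?thesis by (simp add: pd_def)
qed

text \<open>Induction over the jet with \<open>a\<close> generalised, for the derivative contains
  the power \<open>a - 1\<close>.\<close>

lemma smooth_on_powr:
  assumes U: "open U" and f: "smooth_on U f" and pos: "\<And>x. x \<in> U \<Longrightarrow> f x > 0"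
  shows "smooth_on U (\<lambda>x. f x powr a :: real)"
proof -
  have d: "(\<lambda>x. f x powr a) differentiable_on U" for a
  proof -
    have "(\<lambda>x. f x powr a) differentiable at x" if "x \<in> U" for x
      using has_derivative_powr[of f _ x UNIV "\<lambda>_. a", OF frechet_derivative_worksI[OF smooth_on_imp_diff[OF U f that]]
          has_derivative_const] pos[OF that] unfolding differentiable_def by blast
    then show ?thesis by (simp add: U differentiable_on_eq_differentiable_at)
  qed
  let ?J = "\<lambda>n. jet n (\<lambda>a f. f differentiable_on U) 0"
  have "?J n (\<lambda>x. f x powr a)" for n
  proof (induction n arbitrary: a)
    case 0
    show ?case using d by simp
  next
    case (Suc n)
    have "?J n (pd i (\<lambda>x. f x powr a))" for i
    proof (rule jet_class.jet_cong[OF jet_class_smooth[OF U]])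
      have "?J n (\<lambda>x. a * f x powr (a - 1))"
        by (rule jet_bounded_linear[of "\<lambda>x. a * x", OF bounded_linear_mult_right
            jet_class_smooth[OF U] jet_class_smooth[OF U]]) (auto intro: Suc)
      moreover have "?J n (pd i f)" using smooth_on_pd[OF f] unfolding smooth_on_jet by blast
      ultimately have "jet n (\<lambda>a f. f differentiable_on U) (0 + 0) (\<lambda>x. a * f x powr (a - 1) * pd i f x)"
        by (intro jet_mult[OF jet_class_smooth[OF U] jet_class_smooth[OF U] jet_class_smooth[OF U]])
          (auto intro: differentiable_mult simp: differentiable_on_def)
      then show "?J n (\<lambda>x. a * f x powr (a - 1) * pd i f x)" by simp
      show "a * f x powr (a - 1) * pd i f x = pd i (\<lambda>x. f x powr a) x" if "x \<in> U" for x
        using pd_powr[OF smooth_on_imp_diff[OF U f that] pos[OF that]] by simp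
    qed
    moreover have "jet n (\<lambda>a f. f differentiable_on U) (- 1) g \<longleftrightarrow> ?J n g" for g :: "real^3 \<Rightarrow> real"
      by (simp add: jet_pds)
    ultimately show ?case using d[of a] by simp
  qed
  then show ?thesis unfolding smooth_on_jet by blast
qed

lemma smooth_on_norm: "open U \<Longrightarrow> 0 \<notin> U \<Longrightarrow> smooth_on U (norm :: real^3 \<Rightarrow> real)"
proof -
  assume U: "open U" "0 \<notin> U"
  have "smooth_on U (\<lambda>x. (\<Sum>i\<in>UNIV. x $ i * x $ i) powr (1/2))"
  proof (rule smooth_on_powr[OF U(1)])
    fix x assume "x \<in> U"
    then have "x \<bullet> x > 0" using U by auto
    then show "(\<Sum>i\<in>UNIV. x $ i * x $ i) > 0" by (simp add: inner_vec_def)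
  qed (use U in \<open>auto intro!: smooth_on_sum smooth_on_mult smooth_on_coord\<close>)
  then show ?thesis
    by (rule smooth_on_cong[OF U(1)]) (simp add: norm_eq_sqrt_inner inner_vec_def powr_half_sqrt sum_nonneg)
qed

section \<open>Sobolev's inequality on a ball\<close>

lemma measurable_ennreal_indicator:
  fixes f :: "'a::topological_space \<Rightarrow> real"
  assumes "continuous_on S f" "S \<in> sets borel"
  shows "(\<lambda>x. ennreal (f x) * indicator S x) \<in> borel_measurable borel"
proof -
  have "(\<lambda>x. ennreal (indicator S x *\<^sub>R f x)) \<in> borel_measurable borel"
    by (intro measurable_compose[OF borel_measurable_continuous_on_indicator measurable_ennreal] assms)
  then show ?thesis by (rule measurable_cong[THEN iffD1, rotated]) (simp add: indicator_def)
qed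

lemma powr_minus_half: "0 < t \<Longrightarrow> t powr (- 1/2) = 1 / sqrt t" for t :: real
  using powr_minus_divide[of t "1/2"] powr_half_sqrt[of t] by simp

lemma nn_integral_lborel_affine3:
  fixes g :: "real^3 \<Rightarrow> ennreal"
  assumes [measurable]: "g \<in> borel_measurable borel" and c: "c > 0"
  shows "(\<integral>\<^sup>+y. g (x + c *\<^sub>R y) \<partial>lborel) = ennreal (1 / c ^ 3) * (\<integral>\<^sup>+z. g z \<partial>lborel)"
proof -
  have "(\<integral>\<^sup>+z. g z \<partial>lborel) = ennreal (c ^ 3) * (\<integral>\<^sup>+y. g (x + c *\<^sub>R y) \<partial>lborel)"
    using c by (subst lborel_affine[of c x]) (simp_all add: nn_integral_density nn_integral_distr nn_integral_cmult)
  moreover have "ennreal (1 / c ^ 3) * ennreal (c ^ 3) = 1"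
    using c by (simp flip: ennreal_mult')
  ultimately show ?thesis by (simp flip: mult.assoc)
qed

lemma has_vector_derivative_line:
  fixes f :: "real^3 \<Rightarrow> 'b::real_normed_vector"
  assumes "f differentiable at (x + t *\<^sub>R y)"
  shows "((\<lambda>t. f (x + t *\<^sub>R y)) has_vector_derivative (\<Sum>i\<in>UNIV. y $ i *\<^sub>R pd i f (x + t *\<^sub>R y)))
    (at t within S)"
proof -
  have g: "((\<lambda>t. x + t *\<^sub>R y) has_derivative (\<lambda>h. h *\<^sub>R y)) (at t within S)"
    by (auto intro!: derivative_eq_intros)
  have "((\<lambda>t. f (x + t *\<^sub>R y)) has_derivative
      (\<lambda>h. \<Sum>i\<in>UNIV. (h *\<^sub>R y) $ i *\<^sub>R pd i f (x + t *\<^sub>R y))) (at t within S)"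
    by (rule has_derivative_compose[OF g has_derivative_pd[OF assms]])
  moreover have "(\<lambda>h. \<Sum>i\<in>UNIV. (h *\<^sub>R y) $ i *\<^sub>R pd i f (x + t *\<^sub>R y)) =
      (\<lambda>h. h *\<^sub>R (\<Sum>i\<in>UNIV. y $ i *\<^sub>R pd i f (x + t *\<^sub>R y)))"
    by (simp add: scaleR_sum_right)
  ultimately show ?thesis unfolding has_vector_derivative_def by simp
qed

lemma norm_sum_scaleR_le:
  fixes y :: "real^3"
  assumes "norm y \<le> l"
  shows "norm (\<Sum>i\<in>UNIV. y $ i *\<^sub>R g i) \<le> l * (\<Sum>i\<in>UNIV. norm (g i))"
  unfolding sum_distrib_left
proof (rule sum_norm_le)
  fix i
  have "\<bar>y $ i\<bar> \<le> l" using component_le_norm_cart[of y i] assms by simp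
  then show "norm (y $ i *\<^sub>R g i) \<le> l * norm (g i)" by (simp add: mult_right_mono)
qed

text \<open>A bound, for \<open>t\<close> between 0 and 1, of the second derivative of
  \<open>(1 - t)\<^sup>2 *\<^sub>R f (x + t *\<^sub>R y)\<close> when \<open>norm y \<le> l\<close>:
  the coefficients 2, 4 and 1 come from differentiating \<open>(1 - t)\<^sup>2\<close> twice, once
  and not at all.\<close>

definition sob_density :: "real \<Rightarrow> (real^3 \<Rightarrow> 'b::real_normed_vector) \<Rightarrow> real^3 \<Rightarrow> real" where
  "sob_density l f z = 2 * norm (f z) + 4 * l * (\<Sum>i\<in>UNIV. norm (pd i f z))
     + l\<^sup>2 * (\<Sum>i\<in>UNIV. \<Sum>j\<in>UNIV. norm (pd j (pd i f) z))"

lemma continuous_on_sob_density: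
  assumes "open U" "smooth_on U f"
  shows "continuous_on U (sob_density l f)"
  unfolding sob_density_def
  by (intro continuous_intros smooth_on_imp_continuous smooth_on_pd assms)

text \<open>Taylor's formula for the cut-off function \<open>G t = (1 - t)\<^sup>2 f (x + t y)\<close>, in the form
  \<open>f x = \<integral> t G'' t dt\<close>. The factor \<open>t\<close> is what makes the average over \<open>y\<close> converge.\<close>

lemma sob_line:
  fixes f :: "real^3 \<Rightarrow> 'b::banach"
  assumes U: "open U" "smooth_on U f" and b: "ball x l \<subseteq> U" and y: "norm y < l"
  shows "ennreal ((norm (f x))\<^sup>2) \<le>
    2 * (\<integral>\<^sup>+t. ennreal (t\<^sup>2 * sqrt t * (sob_density l f (x + t *\<^sub>R y))\<^sup>2) * indicator {0..1} t \<partial>lborel)"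
proof -
  define A where "A t = f (x + t *\<^sub>R y)" for t
  define B where "B t = (\<Sum>i\<in>UNIV. y $ i *\<^sub>R pd i f (x + t *\<^sub>R y))" for t
  define C where "C t = (\<Sum>i\<in>UNIV. y $ i *\<^sub>R (\<Sum>j\<in>UNIV. y $ j *\<^sub>R pd j (pd i f) (x + t *\<^sub>R y)))" for t
  define H where "H t = sob_density l f (x + t *\<^sub>R y)" for t
  have l: "l > 0" using y by (smt (verit) norm_ge_zero)
  have in_U: "x + t *\<^sub>R y \<in> U" if "t \<in> {0..1}" for t
  proof -
    have "norm (t *\<^sub>R y) \<le> norm y" using that by (simp add: mult_left_le_one_le)
    then have "x + t *\<^sub>R y \<in> ball x l" using y by (simp add: dist_norm)
    then show ?thesis using b by blast
  qed
  have A': "(A has_vector_derivative B t) (at t within {0..1})" if "t \<in> {0..1}" for t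
    unfolding A_def B_def by (intro has_vector_derivative_line smooth_on_imp_diff[OF U] in_U that)
  have B': "(B has_vector_derivative C t) (at t within {0..1})" if "t \<in> {0..1}" for t
    unfolding B_def C_def
    by (intro has_vector_derivative_sum bounded_linear.has_vector_derivative[OF bounded_linear_scaleR_right]
        has_vector_derivative_line smooth_on_imp_diff[OF U(1)] smooth_on_pd U in_U that)
  \<comment> \<open>This is \<open>t G' t - G t\<close> for the cut-off function \<open>G\<close>.
    Its derivative is \<open>t G'' t\<close>; it vanishes at 1 and equals \<open>- f x\<close> at
    0.\<close>
  define \<Phi> where "\<Phi> t = (t * (- 2 * (1 - t)) - (1 - t)\<^sup>2) *\<^sub>R A t + (t * (1 - t)\<^sup>2) *\<^sub>R B t" for t
  define D where "D t = t *\<^sub>R (2 *\<^sub>R A t - (4 * (1 - t)) *\<^sub>R B t + (1 - t)\<^sup>2 *\<^sub>R C t)" for t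
  have "(\<Phi> has_vector_derivative D t) (at t within {0..1})" if t: "t \<in> {0..1}" for t
  proof -
    have "(\<Phi> has_vector_derivative
        ((t * (- 2 * (1 - t)) - (1 - t)\<^sup>2) *\<^sub>R B t + (2 * t) *\<^sub>R A t
         + ((t * (1 - t)\<^sup>2) *\<^sub>R C t + ((1 - t)\<^sup>2 - 2 * t * (1 - t)) *\<^sub>R B t))) (at t within {0..1})"
      unfolding \<Phi>_def
      by (intro has_vector_derivative_add has_vector_derivative_scaleR A' B' t)
        (auto intro!: derivative_eq_intros simp: algebra_simps power2_eq_square)
    moreover have "(t * (- 2 * (1 - t)) - (1 - t)\<^sup>2) *\<^sub>R B t + (2 * t) *\<^sub>R A t
         + ((t * (1 - t)\<^sup>2) *\<^sub>R C t + ((1 - t)\<^sup>2 - 2 * t * (1 - t)) *\<^sub>R B t) = D t"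
    proof -
      have "(t * (- 2 * (1 - t)) - (1 - t)\<^sup>2) + ((1 - t)\<^sup>2 - 2 * t * (1 - t)) = - (t * (4 * (1 - t)))"
        by (simp add: algebra_simps)
      then have "(t * (- 2 * (1 - t)) - (1 - t)\<^sup>2) *\<^sub>R B t + ((1 - t)\<^sup>2 - 2 * t * (1 - t)) *\<^sub>R B t
          = - (t * (4 * (1 - t))) *\<^sub>R B t"
        by (simp only: flip: scaleR_add_left)
      moreover have "D t = (2 * t) *\<^sub>R A t + (- (t * (4 * (1 - t))) *\<^sub>R B t + (t * (1 - t)\<^sup>2) *\<^sub>R C t)"
        unfolding D_def by (simp add: scaleR_diff_right scaleR_add_right mult.commute)
      moreover have "u + v + (w' + z) = v + ((u + z) + w')" for u v w' z :: 'b
        by (simp add: add_ac)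
      ultimately show ?thesis by (simp only:)
    qed
    ultimately show ?thesis by simp
  qed
  then have "(D has_integral (\<Phi> 1 - \<Phi> 0)) {0..1}"
    by (intro fundamental_theorem_of_calculus) auto
  then have D: "(D has_integral f x) {0..1}" by (simp add: \<Phi>_def A_def)
  have contH: "continuous_on {0..1} H" unfolding H_def
    by (rule continuous_on_compose2[OF continuous_on_sob_density[OF U]])
      (use in_U in \<open>auto intro!: continuous_intros\<close>)
  have Dle: "norm (D t) \<le> t * H t" if t: "t \<in> {0..1}" for t
  proof -
    have B1: "norm (B t) \<le> l * (\<Sum>i\<in>UNIV. norm (pd i f (x + t *\<^sub>R y)))"
      unfolding B_def using y by (intro norm_sum_scaleR_le) auto
    have "norm (C t) \<le> l * (\<Sum>i\<in>UNIV. norm (\<Sum>j\<in>UNIV. y $ j *\<^sub>R pd j (pd i f) (x + t *\<^sub>R y)))"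
      unfolding C_def using y by (intro norm_sum_scaleR_le) auto
    also have "\<dots> \<le> l * (\<Sum>i\<in>UNIV. l * (\<Sum>j\<in>UNIV. norm (pd j (pd i f) (x + t *\<^sub>R y))))"
      using y l by (intro mult_left_mono sum_mono norm_sum_scaleR_le) auto
    finally have C1: "norm (C t) \<le> l\<^sup>2 * (\<Sum>i\<in>UNIV. \<Sum>j\<in>UNIV. norm (pd j (pd i f) (x + t *\<^sub>R y)))"
      by (simp add: sum_distrib_left power2_eq_square mult.assoc)
    have "norm (2 *\<^sub>R A t - (4 * (1 - t)) *\<^sub>R B t + (1 - t)\<^sup>2 *\<^sub>R C t)
        \<le> norm (2 *\<^sub>R A t) + norm ((4 * (1 - t)) *\<^sub>R B t) + norm ((1 - t)\<^sup>2 *\<^sub>R C t)"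
      by (meson add_mono norm_triangle_ineq norm_triangle_ineq4 order_refl order_trans)
    also have "\<dots> \<le> 2 * norm (A t) + 4 * norm (B t) + norm (C t)"
    proof -
      have "4 * (1 - t) * norm (B t) \<le> 4 * norm (B t)" using t by (intro mult_right_mono) auto
      moreover have "(1 - t)\<^sup>2 * norm (C t) \<le> norm (C t)"
        using t by (intro mult_left_le_one_le power_le_one) auto
      ultimately show ?thesis using t by simp
    qed
    also have "\<dots> \<le> H t" using B1 C1 by (simp add: H_def sob_density_def A_def)
    finally show ?thesis using t unfolding D_def by (simp add: mult_left_mono)
  qed
  define J where "J = integral {0..1} (\<lambda>t. t\<^sup>2 * sqrt t * (H t)\<^sup>2)"
  have J: "((\<lambda>t. t\<^sup>2 * sqrt t * (H t)\<^sup>2) has_integral J) {0..1}"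
    unfolding J_def by (intro integrable_integral integrable_continuous_interval continuous_intros contH)
  have J0: "J \<ge> 0" unfolding J_def by (intro integral_nonneg has_integral_integrable[OF J]) auto
  define n where "n = norm (f x)"
  have "n\<^sup>2 \<le> 2 * J"
  proof (cases "n = 0")
    case False
    then have n: "n > 0" by (simp add: n_def)
    \<comment> \<open>The arithmetic-geometric mean inequality. The first term integrates to
      \<open>n / 2\<close>, which the left-hand side absorbs; the power
      \<open>t\<^sup>2 * sqrt t\<close> in the second beats the factor \<open>1 / t ^ 3\<close> that
      averaging over \<open>y\<close> will produce.\<close>
    have bnd: "norm (D t) \<le> n / 4 * t powr (- 1/2) + 1 / n * (t\<^sup>2 * sqrt t * (H t)\<^sup>2)"
      if t: "t \<in> {0..1}" for t
    proof (cases "t = 0")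
      case True then show ?thesis by (simp add: D_def)
    next
      case False
      then have t0: "t > 0" using t by simp
      \<comment> \<open>The fourth root makes all powers of \<open>t\<close> integral powers of
        \<open>q\<close>.\<close>
      define q where "q = sqrt (sqrt t)"
      have q: "q > 0" "t = q ^ 4" "sqrt t = q\<^sup>2" using t0 by (simp_all add: q_def) (metis numeral_Bit0 power_add power2_eq_square real_sqrt_pow2 real_sqrt_ge_zero less_imp_le)
      have p: "t powr (- 1/2) = 1 / q\<^sup>2"
        using powr_minus_half[OF t0] q(3) by simp
      have "0 \<le> (n / (2 * q) - q ^ 5 * H t)\<^sup>2 / n" using n by simp
      also have "\<dots> = n / 4 * (1 / q\<^sup>2) + 1 / n * (t\<^sup>2 * q\<^sup>2 * (H t)\<^sup>2) - t * H t"
        using n q by (simp add: q(2) power2_eq_square field_simps eval_nat_numeral)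
      finally show ?thesis using Dle[OF t] p q(3) by simp
    qed
    have "((\<lambda>t::real. t powr (- 1/2)) has_integral 2) {0..1}"
      using has_integral_powr_from_0[of "- 1/2" 1] by simp
    from has_integral_add[OF has_integral_mult_right[OF this, of "n / 4"] has_integral_mult_right[OF J, of "1 / n"]]
    have I: "((\<lambda>t. n / 4 * t powr (- 1/2) + 1 / n * (t\<^sup>2 * sqrt t * (H t)\<^sup>2)) has_integral
        (n / 4 * 2 + 1 / n * J)) {0..1}" .
    have "norm (integral {0..1} D) \<le> integral {0..1} (\<lambda>t. n / 4 * t powr (- 1/2) + 1 / n * (t\<^sup>2 * sqrt t * (H t)\<^sup>2))"
      by (rule integral_norm_bound_integral[OF has_integral_integrable[OF D] has_integral_integrable[OF I] bnd])
    then have "n \<le> n / 4 * 2 + 1 / n * J"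
      using integral_unique[OF D] integral_unique[OF I] by (simp add: n_def)
    then show ?thesis using n by (simp add: field_simps power2_eq_square)
  qed (use J0 in simp)
  moreover have "(\<integral>\<^sup>+t. ennreal (t\<^sup>2 * sqrt t * (H t)\<^sup>2) * indicator {0..1} t \<partial>lborel) = ennreal J"
    by (rule nn_integral_has_integral_lebesgue'[OF _ J]) auto
  ultimately show ?thesis unfolding H_def n_def
    by (simp add: ennreal_mult[of 2, simplified, symmetric] J0 ennreal_leI)
qed

text \<open>\<open>sob_line\<close> is integrated over \<open>y\<close> in the ball of radius
  \<open>l\<close> and the integrals are swapped. For fixed \<open>t\<close> the substitution
  \<open>z = x + t y\<close> costs \<open>1 / t ^ 3\<close>; what remains,
  \<open>t powr (- 1/2)\<close>, has integral 2.\<close>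

lemma sobolev_ball:
  fixes f :: "real^3 \<Rightarrow> 'b::banach"
  assumes U: "open U" "smooth_on U f" and b: "ball x l \<subseteq> U" and l: "l > 0"
  shows "ennreal ((norm (f x))\<^sup>2 * (unit_ball_vol 3 * l ^ 3)) \<le>
    4 * (\<integral>\<^sup>+z. ennreal ((sob_density l f z)\<^sup>2) * indicator (ball x l) z \<partial>lborel)" (is "_ \<le> 4 * ?I")
proof -
  define h where "h z = ennreal (indicator (ball x l) z *\<^sub>R (sob_density l f z)\<^sup>2)" for z
  have h_eq: "h z = ennreal ((sob_density l f z)\<^sup>2) * indicator (ball x l) z" for z
    by (simp add: h_def indicator_def)
  have [measurable]: "h \<in> borel_measurable borel" unfolding h_def
    by (intro measurable_compose[OF borel_measurable_continuous_on_indicator measurable_ennreal] continuous_intros)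
      (use continuous_on_sob_density[OF U] continuous_on_subset b in \<open>auto intro!: continuous_intros\<close>)
  define F where "F t y = ennreal (t\<^sup>2 * sqrt t) * h (x + t *\<^sub>R y) * indicator {0<..1} t" for t :: real and y
  have [measurable]: "case_prod F \<in> borel_measurable (lborel \<Otimes>\<^sub>M lborel)"
    unfolding F_def by measurable
  have [measurable]: "(\<lambda>y. \<integral>\<^sup>+t. F t y \<partial>lborel) \<in> borel_measurable lborel"
    unfolding F_def by measurable
  have swap: "(\<integral>\<^sup>+y. (\<integral>\<^sup>+t. F t y \<partial>lborel) \<partial>lborel) = (\<integral>\<^sup>+t. (\<integral>\<^sup>+y. F t y \<partial>lborel) \<partial>lborel)"
    by (rule lborel_pair.Fubini') measurable
  have line: "ennreal ((norm (f x))\<^sup>2) \<le> 2 * (\<integral>\<^sup>+t. F t y \<partial>lborel)" if y: "y \<in> ball 0 l" for y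
  proof -
    have yl: "norm y < l" using y by simp
    have "(\<integral>\<^sup>+t. ennreal (t\<^sup>2 * sqrt t * (sob_density l f (x + t *\<^sub>R y))\<^sup>2) * indicator {0..1} t \<partial>lborel)
      = (\<integral>\<^sup>+t. F t y \<partial>lborel)"
    proof (rule nn_integral_cong)
      fix t :: real
      show "ennreal (t\<^sup>2 * sqrt t * (sob_density l f (x + t *\<^sub>R y))\<^sup>2) * indicator {0..1} t = F t y"
      proof (cases "t \<in> {0<..1}")
        case True
        have "norm (t *\<^sub>R y) \<le> norm y" using True by (simp add: mult_left_le_one_le)
        then have "x + t *\<^sub>R y \<in> ball x l" using yl by (simp add: dist_norm)
        then show ?thesis using True by (simp add: F_def h_eq ennreal_mult)
      next
        case False
        then show ?thesis by (cases "t = 0") (auto simp: F_def indicator_def)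
      qed
    qed
    then show ?thesis using sob_line[OF U b yl] by simp
  qed
  have "ennreal ((norm (f x))\<^sup>2 * (unit_ball_vol 3 * l ^ 3)) = ennreal ((norm (f x))\<^sup>2) * emeasure lborel (ball (0::real^3) l)"
    using l by (simp add: emeasure_ball ennreal_mult)
  also have "\<dots> = (\<integral>\<^sup>+y. ennreal ((norm (f x))\<^sup>2) * indicator (ball (0::real^3) l) y \<partial>lborel)"
    by (simp add: nn_integral_cmult_indicator)
  also have "\<dots> \<le> (\<integral>\<^sup>+y. 2 * (\<integral>\<^sup>+t. F t y \<partial>lborel) \<partial>lborel)"
    using line by (intro nn_integral_mono) (auto simp: indicator_def)
  also have "\<dots> = 2 * (\<integral>\<^sup>+t. (\<integral>\<^sup>+y. F t y \<partial>lborel) \<partial>lborel)"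
    by (simp add: nn_integral_cmult swap)
  also have "(\<integral>\<^sup>+t. (\<integral>\<^sup>+y. F t y \<partial>lborel) \<partial>lborel) =
      (\<integral>\<^sup>+t. ennreal (t powr (- 1/2)) * indicator {0..1} t * (\<integral>\<^sup>+z. h z \<partial>lborel) \<partial>lborel)"
  proof (rule nn_integral_cong)
    fix t :: real
    show "(\<integral>\<^sup>+y. F t y \<partial>lborel) = ennreal (t powr (- 1/2)) * indicator {0..1} t * (\<integral>\<^sup>+z. h z \<partial>lborel)"
    proof (cases "t \<in> {0<..1}")
      case True
      have "(\<integral>\<^sup>+y. F t y \<partial>lborel) = ennreal (t\<^sup>2 * sqrt t) * (\<integral>\<^sup>+y. h (x + t *\<^sub>R y) \<partial>lborel)"
        using True by (simp add: F_def nn_integral_cmult)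
      also have "\<dots> = (ennreal (t\<^sup>2 * sqrt t) * ennreal (1 / t ^ 3)) * (\<integral>\<^sup>+z. h z \<partial>lborel)"
        using True by (subst nn_integral_lborel_affine3) (simp_all add: mult.assoc)
      also have "ennreal (t\<^sup>2 * sqrt t) * ennreal (1 / t ^ 3) = ennreal (t\<^sup>2 * sqrt t * (1 / t ^ 3))"
        using True by (intro ennreal_mult[symmetric]) auto
      also have "t\<^sup>2 * sqrt t * (1 / t ^ 3) = t powr (- 1/2)"
      proof -
        have "t\<^sup>2 * sqrt t * (1 / t ^ 3) = sqrt t / t"
          using True by (simp add: eval_nat_numeral)
        also have "\<dots> = 1 / sqrt t" using True by (simp add: real_div_sqrt field_simps)
        also have "\<dots> = t powr (- 1/2)" using True powr_minus_half[of t] by simp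
        finally show ?thesis .
      qed
      finally show ?thesis using True by simp
    next
      case False
      then show ?thesis by (cases "t = 0") (auto simp: F_def indicator_def)
    qed
  qed
  also have "\<dots> = (\<integral>\<^sup>+t. ennreal (t powr (- 1/2)) * indicator {0..1} t \<partial>lborel) * (\<integral>\<^sup>+z. h z \<partial>lborel)"
    by (simp add: nn_integral_multc)
  also have "(\<integral>\<^sup>+t. ennreal (t powr (- 1/2)) * indicator {0..1::real} t \<partial>lborel) = ennreal 2"
    using has_integral_powr_from_0[of "- 1/2" 1]
    by (intro nn_integral_has_integral_lebesgue') auto
  also have "2 * (ennreal 2 * (\<integral>\<^sup>+z. h z \<partial>lborel)) = 4 * ?I"
    unfolding h_eq by (simp flip: mult.assoc)
  finally show ?thesis .
qed

subsection \<open>Hardy's inequality at infinity\<close>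

text \<open>\<open>f x\<close> is minus the integral of the radial derivative along the ray to
  infinity. The weight \<open>t powr (1 + d)\<close> is admissible because its inverse has integral
  \<open>1 / d\<close> on \<open>{1..}\<close>.\<close>

lemma hardy_line:
  fixes f :: "real^3 \<Rightarrow> 'b::banach"
  assumes U: "smooth_on (ext \<rho>) f" and r: "\<rho> \<ge> 0" and x: "\<rho> < norm x" and d: "d > 0"
    and lim: "((\<lambda>t. f (t *\<^sub>R x)) \<longlongrightarrow> 0) at_top"
  shows "ennreal ((norm (f x))\<^sup>2) \<le> ennreal (1 / d) * (\<integral>\<^sup>+t. ennreal (t powr (1 + d) *
    (norm x * (\<Sum>i\<in>UNIV. norm (pd i f (t *\<^sub>R x))))\<^sup>2) * indicator {1..} t \<partial>lborel)" (is "_ \<le> _ * ?I")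
proof -
  define k where "k t = norm x * (\<Sum>i\<in>UNIV. norm (pd i f (t *\<^sub>R x)))" for t
  define B where "B t = (\<Sum>i\<in>UNIV. x $ i *\<^sub>R pd i f (t *\<^sub>R x))" for t
  have ex: "t *\<^sub>R x \<in> ext \<rho>" if "1 \<le> t" for t
  proof -
    have "norm x \<le> t * norm x" using that by (simp add: mult_le_cancel_right1)
    then show ?thesis using that x by simp
  qed
  have contk: "continuous_on {1..T} k" for T unfolding k_def
    by (intro continuous_intros continuous_on_compose2[OF smooth_on_imp_continuous[OF smooth_on_pd[OF U]]])
      (use ex in auto)
  define n where "n = norm (f x)"
  \<comment> \<open>Up to a finite \<open>T\<close> there is a boundary term, which disappears in
    the limit. The estimate is in \<open>ennreal\<close> since the integral to infinity may
    diverge.\<close>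
  have fin: "ennreal n \<le> ennreal (n / 2) + ennreal (1 / (2 * d * n)) * ?I + ennreal (norm (f (T *\<^sub>R x)))"
    if n: "n > 0" and T: "T \<ge> 1" for T
  proof -
    have "((\<lambda>t. f (0 + t *\<^sub>R x)) has_vector_derivative B t) (at t within {1..T})" if "t \<in> {1..T}" for t
      using has_vector_derivative_line[of f 0 t x "{1..T}"] smooth_on_imp_diff[OF open_ext U ex] that
      by (simp add: B_def)
    then have B: "(B has_integral (f (T *\<^sub>R x) - f x)) {1..T}"
      using fundamental_theorem_of_calculus[OF T, of "\<lambda>t. f (t *\<^sub>R x)" B] by simp
    define q where "q = (\<lambda>t. t powr (1 + d) * (k t)\<^sup>2)"
    have contq: "continuous_on {1..T} q"
      unfolding q_def by (intro continuous_intros contk) auto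
    have Q: "(q has_integral integral {1..T} q) {1..T}"
      by (intro integrable_integral integrable_continuous_interval contq)
    have W: "((\<lambda>t. t powr (- 1 - d)) has_integral (1 - T powr (- d)) / d) {1..T}"
    proof -
      have "((\<lambda>t. t powr (- 1 - d)) has_integral (- (T powr (- d)) / d - - (1 powr (- d)) / d)) {1..T}"
      proof (rule fundamental_theorem_of_calculus[OF T])
        fix t assume "t \<in> {1..T}"
        then show "((\<lambda>t. - (t powr (- d)) / d) has_vector_derivative t powr (- 1 - d)) (at t within {1..T})"
          using d unfolding has_real_derivative_iff_has_vector_derivative[symmetric]
          by (auto intro!: derivative_eq_intros simp: powr_diff powr_minus field_simps)
      qed
      then show ?thesis by (simp add: diff_divide_distrib)
    qed
    \<comment> \<open>The arithmetic-geometric mean inequality again, with constants such that the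
      first term integrates to at most \<open>n / 2\<close>.\<close>
    have bnd: "norm (B t) \<le> d * n / 2 * t powr (- 1 - d) + 1 / (2 * d * n) * q t" if t: "t \<in> {1..T}" for t
    proof -
      define p where "p = t powr (1 + d)"
      have p: "p > 0" "t powr (- 1 - d) = 1 / p" using t
        by (simp_all add: p_def powr_minus_divide[symmetric])
      have "norm (B t) \<le> k t" unfolding B_def k_def by (rule norm_sum_scaleR_le) simp
      moreover have "0 \<le> (d * n - p * k t)\<^sup>2 / (2 * d * n * p)" using n d p by simp
      moreover have "(d * n - p * k t)\<^sup>2 / (2 * d * n * p) = d * n / 2 * (1 / p) + 1 / (2 * d * n) * (p * (k t)\<^sup>2) - k t"
        using n d p by (simp add: power2_eq_square field_simps)
      ultimately show ?thesis unfolding q_def p(2) p_def[symmetric] by linarith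
    qed
    note I = has_integral_add[OF has_integral_mult_right[OF W, of "d * n / 2"] has_integral_mult_right[OF Q, of "1 / (2 * d * n)"]]
    have "norm (integral {1..T} B) \<le> integral {1..T} (\<lambda>t. d * n / 2 * t powr (- 1 - d) + 1 / (2 * d * n) * q t)"
      by (rule integral_norm_bound_integral[OF has_integral_integrable[OF B] has_integral_integrable[OF I] bnd])
    then have "norm (f (T *\<^sub>R x) - f x) \<le> d * n / 2 * ((1 - T powr (- d)) / d) + 1 / (2 * d * n) * integral {1..T} q"
      using integral_unique[OF B] integral_unique[OF I] by simp
    also have "d * n / 2 * ((1 - T powr (- d)) / d) \<le> n / 2"
      using n d by (simp add: field_simps)
    finally have 1: "n \<le> n / 2 + 1 / (2 * d * n) * integral {1..T} q + norm (f (T *\<^sub>R x))"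
      using norm_triangle_ineq2[of "f x" "f (T *\<^sub>R x)"] by (simp add: n_def norm_minus_commute)
    have q0: "q t \<ge> 0" if "t \<in> {1..T}" for t using that by (simp add: q_def)
    have Q0: "integral {1..T} q \<ge> 0" by (rule integral_nonneg[OF has_integral_integrable[OF Q] q0])
    have "ennreal (integral {1..T} q) = (\<integral>\<^sup>+t. ennreal (q t) * indicator {1..T} t \<partial>lborel)"
      by (rule nn_integral_has_integral_lebesgue'[OF q0 Q, symmetric])
    also have "\<dots> \<le> ?I" unfolding q_def k_def
      by (intro nn_integral_mono) (auto simp: indicator_def)
    finally have 2: "ennreal (integral {1..T} q) \<le> ?I" .
    have "ennreal n \<le> ennreal (n / 2 + 1 / (2 * d * n) * integral {1..T} q + norm (f (T *\<^sub>R x)))"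
      using 1 by (rule ennreal_leI)
    also have "\<dots> = ennreal (n / 2) + ennreal (1 / (2 * d * n)) * ennreal (integral {1..T} q) + ennreal (norm (f (T *\<^sub>R x)))"
      using n d Q0 by (simp flip: ennreal_plus ennreal_mult')
    also have "\<dots> \<le> ennreal (n / 2) + ennreal (1 / (2 * d * n)) * ?I + ennreal (norm (f (T *\<^sub>R x)))"
      using 2 by (intro add_mono mult_left_mono) auto
    finally show ?thesis .
  qed
  show ?thesis
  proof (cases "n > 0")
    case True
    have L: "((\<lambda>T. ennreal (n / 2) + ennreal (1 / (2 * d * n)) * ?I + ennreal (norm (f (T *\<^sub>R x)))) \<longlongrightarrow>
        ennreal (n / 2) + ennreal (1 / (2 * d * n)) * ?I + ennreal 0) at_top"
      using tendsto_norm[OF lim] by (intro tendsto_intros) auto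
    then have le: "ennreal n \<le> ennreal (n / 2) + ennreal (1 / (2 * d * n)) * ?I"
      using tendsto_lowerbound[OF L eventually_at_top_linorderI[of 1]] fin[OF True] by simp
    show ?thesis
    proof (cases "?I = top")
      case True
      then show ?thesis using d by (simp add: ennreal_mult_top)
    next
      case False
      then obtain J where J: "?I = ennreal J" "J \<ge> 0" by (cases ?I) auto
      have "ennreal n \<le> ennreal (n / 2 + 1 / (2 * d * n) * J)"
        using le[unfolded J] J(2) True d by (simp flip: ennreal_plus ennreal_mult')
      then have "n \<le> n / 2 + 1 / (2 * d * n) * J" using True d J by (subst (asm) ennreal_le_iff) auto
      then have "n\<^sup>2 \<le> 1 / d * J" using True d by (simp add: field_simps power2_eq_square)
      then show ?thesis unfolding J n_def[symmetric] using d J by (simp add: ennreal_leI flip: ennreal_mult')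
    qed
  qed (simp add: n_def)
qed

text \<open>\<open>hardy_line\<close> with \<open>d = - \<delta>\<close> is multiplied by the weight
  and integrated over \<open>x\<close>. After swapping the integrals, the substitution
  \<open>z = t x\<close> leaves \<open>t powr (\<delta> - 1)\<close>, integrable on
  \<open>{1..}\<close> because \<open>\<delta> < 0\<close>. Unlike an argument through pointwise
  bounds, this loses nothing in the order.\<close>

lemma hardy:
  fixes f :: "real^3 \<Rightarrow> 'b::banach"
  assumes U: "smooth_on (ext \<rho>) f" and r: "\<rho> > 0" and d: "\<delta> < 0"
    and lim: "\<And>x. \<rho> < norm x \<Longrightarrow> ((\<lambda>t. f (t *\<^sub>R x)) \<longlongrightarrow> 0) at_top"
    and P: "\<And>i. weighted_norm_finite norm (ext \<rho>) (\<delta> - 1) (pd i f)"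
  shows "weighted_norm_finite norm (ext \<rho>) \<delta> f"
proof -
  define S where "S z = (\<Sum>i\<in>UNIV. norm (pd i f z))" for z
  \<comment> \<open>The exponent \<open>- 2 * \<delta> - 1\<close> is that of the weight at order
    \<open>\<delta> - 1\<close>.\<close>
  define g where "g z = ennreal (indicator (ext \<rho>) z *\<^sub>R (norm z powr (- 2 * \<delta> - 1) * (S z)\<^sup>2))" for z
  have [measurable]: "g \<in> borel_measurable borel"
    unfolding g_def S_def using r
    by (intro measurable_compose[OF borel_measurable_continuous_on_indicator measurable_ennreal] continuous_intros
       smooth_on_imp_continuous[OF smooth_on_pd[OF U]]) auto
  have g_fin: "(\<integral>\<^sup>+z. g z \<partial>lborel) < \<infinity>"
  proof -
    define h where "h i z = ennreal ((norm (pd i f z))\<^sup>2 * norm z powr (- 2 * (\<delta> - 1) - 3)) * indicator (ext \<rho>) z" for i z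
    have e: "- 2 * (\<delta> - 1) - 3 = - 2 * \<delta> - 1" by simp
    have le: "g z \<le> (\<Sum>i\<in>UNIV. 3 * h i z)" for z
    proof (cases "z \<in> ext \<rho>")
      case True
      have "(S z)\<^sup>2 \<le> (\<Sum>i\<in>(UNIV::3 set). 1) * (\<Sum>i\<in>UNIV. (norm (pd i f z))\<^sup>2)"
        unfolding S_def using Cauchy_Schwarz_ineq_sum[of "\<lambda>_. 1" "\<lambda>i. norm (pd i f z)" UNIV] by simp
      then have "norm z powr (- 2 * \<delta> - 1) * (S z)\<^sup>2 \<le> norm z powr (- 2 * \<delta> - 1) * (3 * (\<Sum>i\<in>UNIV. (norm (pd i f z))\<^sup>2))"
        by (intro mult_left_mono) auto
      also have "\<dots> = (\<Sum>i\<in>UNIV. 3 * ((norm (pd i f z))\<^sup>2 * norm z powr (- 2 * (\<delta> - 1) - 3)))"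
        unfolding e by (simp add: sum_distrib_left mult_ac)
      finally have "g z \<le> ennreal \<dots>" using True by (simp add: g_def ennreal_leI)
      also have "\<dots> = (\<Sum>i\<in>UNIV. 3 * h i z)" using True
        by (simp add: h_def ennreal_mult flip: sum_ennreal)
      finally show ?thesis .
    qed (simp add: g_def)
    have [measurable]: "h i \<in> borel_measurable borel" for i
      unfolding h_def using r by (intro measurable_ennreal_indicator continuous_intros
           smooth_on_imp_continuous[OF smooth_on_pd[OF U]]) auto
    have "(\<integral>\<^sup>+z. g z \<partial>lborel) \<le> (\<integral>\<^sup>+z. (\<Sum>i\<in>UNIV. 3 * h i z) \<partial>lborel)"
      by (intro nn_integral_mono le)
    also have "\<dots> = (\<Sum>i\<in>UNIV. 3 * (\<integral>\<^sup>+z. h i z \<partial>lborel))"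
      by (subst nn_integral_sum) (auto simp: nn_integral_cmult)
    also have "\<dots> < \<infinity>"
      using P unfolding weighted_norm_finite_def h_def by (auto simp: ennreal_mult_less_top less_top)
    finally show ?thesis .
  qed
  define F where "F t x = ennreal (t powr \<delta> * t powr 2) * g (t *\<^sub>R x) * indicator {1..} t" for t x
  have [measurable]: "case_prod F \<in> borel_measurable (lborel \<Otimes>\<^sub>M lborel)"
    unfolding F_def by measurable
  have [measurable]: "(\<lambda>x. \<integral>\<^sup>+t. F t x \<partial>lborel) \<in> borel_measurable lborel"
    unfolding F_def by measurable
  have swap: "(\<integral>\<^sup>+x. (\<integral>\<^sup>+t. F t x \<partial>lborel) \<partial>lborel) = (\<integral>\<^sup>+t. (\<integral>\<^sup>+x. F t x \<partial>lborel) \<partial>lborel)"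
    by (rule lborel_pair.Fubini') measurable
  have line: "ennreal ((norm (f x))\<^sup>2 * norm x powr (- 2 * \<delta> - 3)) \<le> ennreal (1 / (- \<delta>)) * (\<integral>\<^sup>+t. F t x \<partial>lborel)"
    if x: "x \<in> ext \<rho>" for x
  proof -
    have nx: "norm x > 0" using less_trans[OF r, of "norm x"] x by blast
    have ex0: "\<rho> < t * norm x" if "1 \<le> t" for t
    proof -
      have "norm x \<le> t * norm x" using that by (simp add: mult_le_cancel_right1)
      then show ?thesis using x by simp
    qed
    have "ennreal (norm x powr (- 2 * \<delta> - 3)) * (\<integral>\<^sup>+t. ennreal (t powr (1 + - \<delta>) *
      (norm x * (\<Sum>i\<in>UNIV. norm (pd i f (t *\<^sub>R x))))\<^sup>2) * indicator {1..} t \<partial>lborel) \<le> (\<integral>\<^sup>+t. F t x \<partial>lborel)"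
    proof (subst nn_integral_cmult[symmetric])
      have "(\<lambda>t. ennreal (t powr (1 + - \<delta>) *
      (norm x * (\<Sum>i\<in>UNIV. norm (pd i f (t *\<^sub>R x))))\<^sup>2) * indicator {1..} t) \<in> borel_measurable borel"
        by (intro measurable_ennreal_indicator continuous_intros
           continuous_on_compose2[OF smooth_on_imp_continuous[OF smooth_on_pd[OF U]]])
          (use nx ex0 in auto)
      then show "(\<lambda>t. ennreal (t powr (1 + - \<delta>) *
      (norm x * (\<Sum>i\<in>UNIV. norm (pd i f (t *\<^sub>R x))))\<^sup>2) * indicator {1..} t) \<in> borel_measurable lborel" by simp
      show "(\<integral>\<^sup>+t. ennreal (norm x powr (- 2 * \<delta> - 3)) * (ennreal (t powr (1 + - \<delta>) *
        (norm x * (\<Sum>i\<in>UNIV. norm (pd i f (t *\<^sub>R x))))\<^sup>2) * indicator {1..} t) \<partial>lborel) \<le> (\<integral>\<^sup>+t. F t x \<partial>lborel)"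
      proof (rule nn_integral_mono)
        fix t :: real
        show "ennreal (norm x powr (- 2 * \<delta> - 3)) * (ennreal (t powr (1 + - \<delta>) *
          (norm x * (\<Sum>i\<in>UNIV. norm (pd i f (t *\<^sub>R x))))\<^sup>2) * indicator {1..} t) \<le> F t x"
        proof (cases "t \<ge> 1")
          case True
          have "norm x \<le> t * norm x" using True by (simp add: mult_le_cancel_right1)
          then have ex: "t *\<^sub>R x \<in> ext \<rho>" using True x by simp
          have e1: "norm x powr (- 2 * \<delta> - 1) = norm x powr (- 2 * \<delta> - 3) * (norm x)\<^sup>2"
          proof -
            have "- 2 * \<delta> - 1 = (- 2 * \<delta> - 3) + 2" by simp
            then have "norm x powr (- 2 * \<delta> - 1) = norm x powr (- 2 * \<delta> - 3) * norm x powr 2"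
              by (simp only: powr_add)
            then show ?thesis using nx by (simp add: powr_numeral)
          qed
          have e2: "t powr \<delta> * t powr 2 * t powr (- 2 * \<delta> - 1) = t powr (1 + - \<delta>)"
            by (simp flip: powr_add)
          have "norm x powr (- 2 * \<delta> - 3) * (t powr (1 + - \<delta>) * (norm x * S (t *\<^sub>R x))\<^sup>2)
            = t powr \<delta> * t powr 2 * (norm (t *\<^sub>R x) powr (- 2 * \<delta> - 1) * (S (t *\<^sub>R x))\<^sup>2)"
            using True nx unfolding e2[symmetric] by (simp add: powr_mult e1[simplified] power_mult_distrib)
          then show ?thesis using True ex unfolding S_def F_def g_def
            by (simp flip: ennreal_mult')
        qed simp
      qed
    qed
    then have "ennreal (1 / - \<delta>) * (ennreal (norm x powr (- 2 * \<delta> - 3)) * (\<integral>\<^sup>+t. ennreal (t powr (1 + - \<delta>) *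
      (norm x * (\<Sum>i\<in>UNIV. norm (pd i f (t *\<^sub>R x))))\<^sup>2) * indicator {1..} t \<partial>lborel)) \<le> ennreal (1 / - \<delta>) * (\<integral>\<^sup>+t. F t x \<partial>lborel)"
      by (intro mult_left_mono) auto
    moreover have "ennreal ((norm (f x))\<^sup>2) * ennreal (norm x powr (- 2 * \<delta> - 3)) \<le>
      (ennreal (1 / - \<delta>) * (\<integral>\<^sup>+t. ennreal (t powr (1 + - \<delta>) *
      (norm x * (\<Sum>i\<in>UNIV. norm (pd i f (t *\<^sub>R x))))\<^sup>2) * indicator {1..} t \<partial>lborel)) * ennreal (norm x powr (- 2 * \<delta> - 3))"
      using x r d lim by (intro mult_right_mono hardy_line[OF U]) auto
    ultimately show ?thesis by (simp add: ennreal_mult mult_ac)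
  qed
  have "(\<integral>\<^sup>+x. ennreal ((norm (f x))\<^sup>2 * norm x powr (- 2 * \<delta> - 3)) * indicator (ext \<rho>) x \<partial>lborel)
      \<le> (\<integral>\<^sup>+x. ennreal (1 / (- \<delta>)) * (\<integral>\<^sup>+t. F t x \<partial>lborel) \<partial>lborel)"
    using line by (intro nn_integral_mono) (simp add: indicator_def)
  also have "\<dots> = ennreal (1 / (- \<delta>)) * (\<integral>\<^sup>+t. (\<integral>\<^sup>+x. F t x \<partial>lborel) \<partial>lborel)"
    by (simp add: nn_integral_cmult swap)
  also have "(\<integral>\<^sup>+t. (\<integral>\<^sup>+x. F t x \<partial>lborel) \<partial>lborel) =
      (\<integral>\<^sup>+t. ennreal (t powr (\<delta> - 1)) * indicator {1..} t * (\<integral>\<^sup>+z. g z \<partial>lborel) \<partial>lborel)"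
  proof (rule nn_integral_cong)
    fix t :: real
    show "(\<integral>\<^sup>+x. F t x \<partial>lborel) = ennreal (t powr (\<delta> - 1)) * indicator {1..} t * (\<integral>\<^sup>+z. g z \<partial>lborel)"
    proof (cases "t \<ge> 1")
      case True
      have "(\<integral>\<^sup>+x. F t x \<partial>lborel) = ennreal (t powr \<delta> * t powr 2) * (\<integral>\<^sup>+x. g (0 + t *\<^sub>R x) \<partial>lborel)"
        using True by (simp add: F_def nn_integral_cmult)
      also have "\<dots> = (ennreal (t powr \<delta> * t powr 2) * ennreal (1 / t ^ 3)) * (\<integral>\<^sup>+z. g z \<partial>lborel)"
        using True by (subst nn_integral_lborel_affine3) (simp_all add: mult.assoc)
      also have "ennreal (t powr \<delta> * t powr 2) * ennreal (1 / t ^ 3) = ennreal (t powr \<delta> * t powr 2 * (1 / t ^ 3))"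
        using True by (intro ennreal_mult[symmetric]) auto
      also have "t powr \<delta> * t powr 2 * (1 / t ^ 3) = t powr (\<delta> - 1)"
        using True by (simp add: powr_diff powr_numeral eval_nat_numeral)
      finally show ?thesis using True by simp
    qed (simp add: F_def)
  qed
  also have "\<dots> = (\<integral>\<^sup>+t. ennreal (t powr (\<delta> - 1)) * indicator {1..} t \<partial>lborel) * (\<integral>\<^sup>+z. g z \<partial>lborel)"
    by (simp add: nn_integral_multc)
  also have "(\<integral>\<^sup>+t. ennreal (t powr (\<delta> - 1)) * indicator {1..} t \<partial>lborel) = ennreal (- (1 powr (\<delta> - 1 + 1)) / (\<delta> - 1 + 1))"
    by (intro nn_integral_has_integral_lebesgue' has_integral_powr_to_inf) (use d in auto)
  also have "ennreal (1 / (- \<delta>)) * (ennreal (- (1 powr (\<delta> - 1 + 1)) / (\<delta> - 1 + 1)) * (\<integral>\<^sup>+z. g z \<partial>lborel)) < \<infinity>"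
    using g_fin by (simp add: ennreal_mult_less_top less_top)
  finally show ?thesis unfolding weighted_norm_finite_def .
qed

subsection \<open>Symbols and weighted Sobolev classes\<close>

definition bnd :: "real \<Rightarrow> real \<Rightarrow> (real^3 \<Rightarrow> 'b::real_normed_vector) \<Rightarrow> bool" where
  "bnd \<rho> a f \<longleftrightarrow> f differentiable_on ext \<rho> \<and> (\<exists>C. \<forall>x. \<rho> < norm x \<longrightarrow> norm (f x) \<le> C * norm x powr a)"

definition sqi :: "real \<Rightarrow> real \<Rightarrow> (real^3 \<Rightarrow> 'b::real_normed_vector) \<Rightarrow> bool" where
  "sqi \<rho> \<delta> f \<longleftrightarrow> f differentiable_on ext \<rho> \<and> weighted_norm_finite norm (ext \<rho>) \<delta> f"

text \<open>One radius serves all derivatives in the estimates, whereas smoothness is required on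
  the whole end; this is the pattern of \<open>o_inf\<close>.\<close>

definition cls :: "(real \<Rightarrow> real \<Rightarrow> (real^3 \<Rightarrow> 'b::real_normed_vector) \<Rightarrow> bool) \<Rightarrow> real \<Rightarrow> real \<Rightarrow>
    (real^3 \<Rightarrow> 'b) \<Rightarrow> bool" where
  "cls G R a f \<longleftrightarrow> smooth_on (ext R) f \<and> (\<exists>\<rho>>R. \<forall>n. jet n (G \<rho>) a f)"

lemma jet_mono: "(\<And>a f. G a f \<Longrightarrow> H a f) \<Longrightarrow> jet n G a f \<Longrightarrow> jet n H a f"
  by (induction n arbitrary: a f) auto

lemma jet_shift: "(\<And>a f. G a f \<Longrightarrow> H (a + d) f) \<Longrightarrow> jet n G a f \<Longrightarrow> jet n H (a + d) f"
proof (induction n arbitrary: a f)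
  case (Suc n)
  have "jet n H (a - 1 + d) (pd i f)" for i using Suc by auto
  moreover have "a - 1 + d = a + d - 1" by simp
  ultimately show ?case using Suc.prems by auto
qed auto

lemma bnd_antimono: "bnd \<rho> a f \<Longrightarrow> \<rho> \<le> \<sigma> \<Longrightarrow> bnd \<sigma> a f"
  unfolding bnd_def using differentiable_on_subset[of f "ext \<rho>" "ext \<sigma>"]
  by (auto intro: less_imp_le simp: subset_iff) (meson le_less_trans)

lemma weighted_norm_finite_subset:
  "weighted_norm_finite w V \<delta> f \<Longrightarrow> W \<subseteq> V \<Longrightarrow> weighted_norm_finite w W \<delta> f"
  unfolding weighted_norm_finite_def
  by (erule le_less_trans[rotated], rule nn_integral_mono) (auto simp: indicator_def)

lemma sqi_antimono: "sqi \<rho> a f \<Longrightarrow> \<rho> \<le> \<sigma> \<Longrightarrow> sqi \<sigma> a f"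
  unfolding sqi_def by (auto elim: differentiable_on_subset weighted_norm_finite_subset)

text \<open>Only the dominating integrand has to be measurable, for the constant is drawn out of its
  integral.\<close>

lemma weighted_norm_finite_dominated:
  assumes fin: "weighted_norm_finite w V \<delta> g" and [measurable]: "V \<in> sets borel"
    and m: "(\<lambda>x. ennreal ((norm (g x))\<^sup>2 * w x powr (- 2 * \<delta> - 3)) * indicator V x) \<in> borel_measurable borel"
    and le: "\<And>x. x \<in> V \<Longrightarrow> (norm (f x))\<^sup>2 * v x powr (- 2 * \<epsilon> - 3)
      \<le> C * ((norm (g x))\<^sup>2 * w x powr (- 2 * \<delta> - 3))"
  shows "weighted_norm_finite v V \<epsilon> f"
proof -
  have "(\<integral>\<^sup>+x\<in>V. ennreal ((norm (f x))\<^sup>2 * v x powr (- 2 * \<epsilon> - 3)) \<partial>lborel)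
    \<le> (\<integral>\<^sup>+x. ennreal C * (ennreal ((norm (g x))\<^sup>2 * w x powr (- 2 * \<delta> - 3)) * indicator V x) \<partial>lborel)"
  proof (rule nn_integral_mono)
    fix x :: "real^3"
    show "ennreal ((norm (f x))\<^sup>2 * v x powr (- 2 * \<epsilon> - 3)) * indicator V x
      \<le> ennreal C * (ennreal ((norm (g x))\<^sup>2 * w x powr (- 2 * \<delta> - 3)) * indicator V x)"
      using ennreal_leI[OF le[of x]] by (auto simp: indicator_def ennreal_mult'')
  qed
  also have "\<dots> = ennreal C * (\<integral>\<^sup>+x\<in>V. ennreal ((norm (g x))\<^sup>2 * w x powr (- 2 * \<delta> - 3)) \<partial>lborel)"
    using m by (intro nn_integral_cmult) simp
  also have "\<dots> < \<infinity>" using fin unfolding weighted_norm_finite_def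
    by (simp add: ennreal_mult_less_top)
  finally show ?thesis unfolding weighted_norm_finite_def .
qed

lemma measurable_weighted:
  assumes "continuous_on (ext \<rho>) f" "\<rho> > 0"
  shows "(\<lambda>x. ennreal ((norm (f x))\<^sup>2 * norm x powr (- 2 * \<delta> - 3)) * indicator (ext \<rho>) x) \<in> borel_measurable borel"
  using assms by (intro measurable_ennreal_indicator continuous_intros) auto

lemma sqi_imp_continuous: "sqi \<rho> \<delta> f \<Longrightarrow> continuous_on (ext \<rho>) f"
  unfolding sqi_def by (simp add: differentiable_imp_continuous_on)

lemma bnd_times_sqi:
  fixes f g :: "real^3 \<Rightarrow> 'b::real_normed_algebra"
  assumes "\<rho> > 0" "bnd \<rho> a f" "sqi \<rho> \<delta> g"
  shows "sqi \<rho> (a + \<delta>) (\<lambda>x. f x * g x)"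
proof -
  obtain C where C: "\<And>x. \<rho> < norm x \<Longrightarrow> norm (f x) \<le> C * norm x powr a"
    using assms(2) unfolding bnd_def by blast
  have "weighted_norm_finite norm (ext \<rho>) (a + \<delta>) (\<lambda>x. f x * g x)"
  proof (rule weighted_norm_finite_dominated[where C = "C\<^sup>2"])
    show "weighted_norm_finite norm (ext \<rho>) \<delta> g" using assms(3) by (simp add: sqi_def)
    show "(norm (f x * g x))\<^sup>2 * norm x powr (- 2 * (a + \<delta>) - 3)
        \<le> C\<^sup>2 * ((norm (g x))\<^sup>2 * norm x powr (- 2 * \<delta> - 3))" if x: "x \<in> ext \<rho>" for x
    proof -
      have "norm (f x * g x) \<le> C * norm x powr a * norm (g x)"
        using C[of x] x by (auto intro!: order_trans[OF norm_mult_ineq] mult_right_mono)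
      then have "(norm (f x * g x))\<^sup>2 \<le> (C * norm x powr a * norm (g x))\<^sup>2"
        by (intro power_mono) auto
      then have "(norm (f x * g x))\<^sup>2 * norm x powr (- 2 * (a + \<delta>) - 3) \<le>
        (C * norm x powr a * norm (g x))\<^sup>2 * norm x powr (- 2 * (a + \<delta>) - 3)"
        by (rule mult_right_mono) simp
      also have "\<dots> = C\<^sup>2 * (norm (g x))\<^sup>2 * ((norm x powr a * norm x powr a) * norm x powr (- 2 * (a + \<delta>) - 3))"
        by (simp add: power2_eq_square)
      also have "(norm x powr a * norm x powr a) * norm x powr (- 2 * (a + \<delta>) - 3) = norm x powr (- 2 * \<delta> - 3)"
        by (simp flip: powr_add)
      finally show ?thesis by (simp add: mult.assoc)
    qed
  qed (use measurable_weighted[OF sqi_imp_continuous[OF assms(3)] assms(1)] in auto)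
  then show ?thesis using assms unfolding sqi_def bnd_def
    by (auto simp: differentiable_on_def intro!: differentiable_mult)
qed

lemma bnd_times_bnd:
  fixes f g :: "real^3 \<Rightarrow> 'b::real_normed_algebra"
  assumes "bnd \<rho> a f" "bnd \<rho> b g"
  shows "bnd \<rho> (a + b) (\<lambda>x. f x * g x)"
proof -
  obtain C D where C: "\<And>x. \<rho> < norm x \<Longrightarrow> norm (f x) \<le> C * norm x powr a"
    and D: "\<And>x. \<rho> < norm x \<Longrightarrow> norm (g x) \<le> D * norm x powr b"
    using assms unfolding bnd_def by blast
  have "norm (f x * g x) \<le> (C * D) * norm x powr (a + b)" if x: "\<rho> < norm x" for x
  proof -
    have "norm (f x * g x) \<le> norm (f x) * norm (g x)" by (rule norm_mult_ineq)
    also have "\<dots> \<le> (C * norm x powr a) * (D * norm x powr b)"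
      using C[OF x] D[OF x] norm_ge_zero order_trans by (intro mult_mono) blast+
    finally show ?thesis by (simp add: powr_add mult_ac)
  qed
  then show ?thesis using assms unfolding bnd_def
    by (auto simp: differentiable_on_def intro!: differentiable_mult)
qed

lemma jet_class_bnd: "jet_class (ext \<rho>) (bnd \<rho>)"
proof
  fix a and f g :: "real^3 \<Rightarrow> 'a"
  assume "bnd \<rho> a f" "bnd \<rho> a g"
  then obtain C D where C: "\<And>x. \<rho> < norm x \<Longrightarrow> norm (f x) \<le> C * norm x powr a"
    and D: "\<And>x. \<rho> < norm x \<Longrightarrow> norm (g x) \<le> D * norm x powr a"
    unfolding bnd_def by blast
  have "norm (f x + g x) \<le> (C + D) * norm x powr a" if "\<rho> < norm x" for x
    using C[OF that] D[OF that] norm_triangle_ineq[of "f x" "g x"] by (simp add: algebra_simps)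
  with \<open>bnd \<rho> a f\<close> \<open>bnd \<rho> a g\<close> show "bnd \<rho> a (\<lambda>x. f x + g x)"
    unfolding bnd_def by auto
next
  fix a and f g :: "real^3 \<Rightarrow> 'a"
  assume "bnd \<rho> a f" "\<And>x. x \<in> ext \<rho> \<Longrightarrow> f x = g x"
  then show "bnd \<rho> a g" unfolding bnd_def
    using differentiable_on_cong[of "ext \<rho>" f g] by auto
qed (auto simp: bnd_def)

text \<open>With \<open>\<rho> > 0\<close> the origin is kept away and the weighted integrands are
  continuous, hence measurable; splitting the integral of the sum uses this.\<close>

lemma jet_class_sqi:
  assumes r: "\<rho> > 0"
  shows "jet_class (ext \<rho>) (sqi \<rho>)"
proof
  fix a and f g :: "real^3 \<Rightarrow> 'a"
  assume s: "sqi \<rho> a f" "sqi \<rho> a g"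
  define w where "w f x = ennreal ((norm (f x))\<^sup>2 * norm x powr (- 2 * a - 3)) * indicator (ext \<rho>) x"
    for f :: "real^3 \<Rightarrow> 'a" and x
  have [measurable]: "w f \<in> borel_measurable borel" "w g \<in> borel_measurable borel"
    unfolding w_def
    by (rule measurable_weighted[OF sqi_imp_continuous[OF s(1)] r])
      (rule measurable_weighted[OF sqi_imp_continuous[OF s(2)] r])
  have "(\<integral>\<^sup>+x. w (\<lambda>x. f x + g x) x \<partial>lborel) \<le> (\<integral>\<^sup>+x. 2 * w f x + 2 * w g x \<partial>lborel)"
  proof (rule nn_integral_mono)
    fix x
    have "(norm (f x + g x))\<^sup>2 \<le> (norm (f x) + norm (g x))\<^sup>2"
      by (intro power_mono norm_triangle_ineq) simp
    also have "\<dots> \<le> 2 * (norm (f x))\<^sup>2 + 2 * (norm (g x))\<^sup>2"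
      using sum_squares_bound[of "norm (f x)" "norm (g x)"] by (simp add: power2_sum)
    finally have "(norm (f x + g x))\<^sup>2 * norm x powr (- 2 * a - 3) \<le>
        (2 * (norm (f x))\<^sup>2 + 2 * (norm (g x))\<^sup>2) * norm x powr (- 2 * a - 3)"
      by (rule mult_right_mono) simp
    also have "\<dots> = 2 * ((norm (f x))\<^sup>2 * norm x powr (- 2 * a - 3)) + 2 * ((norm (g x))\<^sup>2 * norm x powr (- 2 * a - 3))"
      by (simp only: distrib_right mult.assoc)
    finally have "ennreal ((norm (f x + g x))\<^sup>2 * norm x powr (- 2 * a - 3)) \<le> ennreal \<dots>"
      by (rule ennreal_leI)
    then show "w (\<lambda>x. f x + g x) x \<le> 2 * w f x + 2 * w g x"
      by (simp add: w_def indicator_def ennreal_plus ennreal_mult'')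
  qed
  also have "\<dots> = 2 * (\<integral>\<^sup>+x. w f x \<partial>lborel) + 2 * (\<integral>\<^sup>+x. w g x \<partial>lborel)"
    by (subst nn_integral_add) (simp_all add: nn_integral_cmult)
  also have "\<dots> < \<infinity>" using s unfolding sqi_def weighted_norm_finite_def w_def
    by (simp add: ennreal_mult_less_top)
  finally show "sqi \<rho> a (\<lambda>x. f x + g x)"
    using s unfolding sqi_def weighted_norm_finite_def w_def by auto
next
  fix a and f g :: "real^3 \<Rightarrow> 'a"
  assume s: "sqi \<rho> a f" and e: "\<And>x. x \<in> ext \<rho> \<Longrightarrow> f x = g x"
  have "weighted_norm_finite norm (ext \<rho>) a g"
    using s e weighted_norm_finite_dominated[of norm "ext \<rho>" a f g norm a 1]
      measurable_weighted[OF sqi_imp_continuous[OF s] r] by (auto simp: sqi_def)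
  then show "sqi \<rho> a g" using s e differentiable_on_cong[of "ext \<rho>" f g]
    unfolding sqi_def by auto
qed (auto simp: sqi_def)

lemma bounded_linear_differentiable_on:
  "bounded_linear T \<Longrightarrow> f differentiable_on S \<Longrightarrow> (\<lambda>x. T (f x)) differentiable_on S"
  unfolding differentiable_on_def differentiable_def
  using bounded_linear.has_derivative by blast

lemma bnd_bounded_linear:
  assumes "bounded_linear T" "bnd \<rho> a f"
  shows "bnd \<rho> a (\<lambda>x. T (f x))"
proof -
  obtain C where C: "\<And>x. \<rho> < norm x \<Longrightarrow> norm (f x) \<le> C * norm x powr a"
    using assms unfolding bnd_def by blast
  obtain K where K: "\<And>x. norm (T x) \<le> norm x * K" "K > 0"
    using bounded_linear.pos_bounded[OF assms(1)] by blast
  have "norm (T (f x)) \<le> (C * K) * norm x powr a" if "\<rho> < norm x" for x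
  proof -
    have "norm (T (f x)) \<le> norm (f x) * K" by (rule K)
    also have "\<dots> \<le> C * norm x powr a * K" using C[OF that] K(2) by (intro mult_right_mono) auto
    finally show ?thesis by (simp add: mult_ac)
  qed
  then show ?thesis using assms bounded_linear_differentiable_on unfolding bnd_def by blast
qed

lemma sqi_bounded_linear:
  assumes "bounded_linear T" "sqi \<rho> \<delta> f" "\<rho> > 0"
  shows "sqi \<rho> \<delta> (\<lambda>x. T (f x))"
proof -
  obtain K where K: "\<And>x. norm (T x) \<le> norm x * K" "K > 0"
    using bounded_linear.pos_bounded[OF assms(1)] by blast
  have "weighted_norm_finite norm (ext \<rho>) \<delta> (\<lambda>x. T (f x))"
  proof (rule weighted_norm_finite_dominated[where C = "K\<^sup>2"])
    show "(norm (T (f x)))\<^sup>2 * norm x powr (- 2 * \<delta> - 3)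
        \<le> K\<^sup>2 * ((norm (f x))\<^sup>2 * norm x powr (- 2 * \<delta> - 3))" for x
    proof -
      have "(norm (T (f x)))\<^sup>2 \<le> (norm (f x) * K)\<^sup>2" by (intro power_mono K) auto
      then have "(norm (T (f x)))\<^sup>2 * norm x powr (- 2 * \<delta> - 3) \<le> (norm (f x) * K)\<^sup>2 * norm x powr (- 2 * \<delta> - 3)"
        by (rule mult_right_mono) simp
      then show ?thesis by (simp add: power_mult_distrib mult_ac)
    qed
  qed (use assms measurable_weighted[OF sqi_imp_continuous[OF assms(2)] assms(3)] in \<open>auto simp: sqi_def\<close>)
  then show ?thesis using assms bounded_linear_differentiable_on unfolding sqi_def by blast
qed

subsubsection \<open>Integrability of powers at infinity\<close>

text \<open>Comparison with a dyadic series: between the radii \<open>\<rho> * 2 ^ k\<close> and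
  \<open>\<rho> * 2 ^ Suc k\<close> the integrand is at most \<open>c k\<close>, the volume of the
  enclosing ball grows like \<open>8 ^ k\<close>, and the resulting ratio
  \<open>2 powr (3 - b)\<close> is less than 1.\<close>

lemma nn_integral_powr_at_infinity:
  assumes r: "\<rho> > 0" and b: "b > 3"
  shows "(\<integral>\<^sup>+x\<in>ext \<rho>. ennreal (norm x powr (- b)) \<partial>lborel) < \<infinity>"
proof -
  define c where "c k = (\<rho> * 2 ^ k) powr (- b)" for k :: nat
  have le: "ennreal (norm x powr (- b)) * indicator (ext \<rho>) x \<le>
      (\<Sum>k. ennreal (c k) * indicator (cball 0 (\<rho> * 2 ^ Suc k)) x)" for x :: "real^3"
  proof (cases "x \<in> ext \<rho>")
    case True
    obtain n where n: "norm x / \<rho> < 2 ^ n" using real_arch_pow[of 2 "norm x / \<rho>"] by auto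
    then have ex: "\<exists>n. norm x \<le> \<rho> * 2 ^ n" using r by (auto simp: field_simps intro!: exI[of _ n])
    define m where "m = (LEAST n. norm x \<le> \<rho> * 2 ^ n)"
    have m: "norm x \<le> \<rho> * 2 ^ m" unfolding m_def using ex by (rule LeastI_ex)
    have "m \<noteq> 0" using m True by (cases m) auto
    then obtain k where k: "m = Suc k" by (cases m) auto
    have "\<not> norm x \<le> \<rho> * 2 ^ k" using not_less_Least[of k "\<lambda>n. norm x \<le> \<rho> * 2 ^ n"] k unfolding m_def by auto
    then have "norm x powr (- b) \<le> c k" unfolding c_def using r b by (intro powr_mono2') auto
    then have "ennreal (norm x powr (- b)) \<le> ennreal (c k) * indicator (cball 0 (\<rho> * 2 ^ Suc k)) x"
      using m k by (simp add: ennreal_leI)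
    also have "\<dots> \<le> (\<Sum>k. ennreal (c k) * indicator (cball 0 (\<rho> * 2 ^ Suc k)) x)"
      using sum_le_suminf[OF summableI, of "{k}" "\<lambda>k. ennreal (c k) * indicator (cball 0 (\<rho> * 2 ^ Suc k)) x"]
      by (simp only: sum.insert finite.emptyI empty_iff not_False_eq_True sum.empty add_0_right
          finite.insertI zero_le ball_simps simp_thms)
    finally show ?thesis using True by simp
  qed simp
  have "(\<integral>\<^sup>+x\<in>ext \<rho>. ennreal (norm x powr (- b)) \<partial>lborel) \<le>
      (\<integral>\<^sup>+x. (\<Sum>k. ennreal (c k) * indicator (cball 0 (\<rho> * 2 ^ Suc k)) x) \<partial>(lborel :: (real^3) measure))"
    by (intro nn_integral_mono le)
  also have "\<dots> = (\<Sum>k. (\<integral>\<^sup>+x. ennreal (c k) * indicator (cball 0 (\<rho> * 2 ^ Suc k)) x \<partial>(lborel :: (real^3) measure)))"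
    by (rule nn_integral_suminf) (measurable, auto)
  also have "\<dots> = (\<Sum>k. ennreal (8 * unit_ball_vol 3 * \<rho> powr (3 - b) * (2 powr (3 - b)) ^ k))"
  proof (rule suminf_cong)
    fix k
    have "(\<integral>\<^sup>+x. ennreal (c k) * indicator (cball 0 (\<rho> * 2 ^ Suc k)) x \<partial>(lborel :: (real^3) measure)) =
      ennreal (c k) * ennreal (unit_ball_vol 3 * (\<rho> * 2 ^ Suc k) ^ 3)"
      using r by (simp add: nn_integral_cmult_indicator emeasure_cball)
    also have "\<dots> = ennreal (c k * (unit_ball_vol 3 * (\<rho> * 2 ^ Suc k) ^ 3))"
      using r by (intro ennreal_mult[symmetric]) (auto simp: c_def)
    also have "c k * (unit_ball_vol 3 * (\<rho> * 2 ^ Suc k) ^ 3) = 8 * unit_ball_vol 3 * (c k * (\<rho> * 2 ^ k) powr 3)"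
      using r by (simp add: powr_numeral power_mult_distrib)
    also have "c k * (\<rho> * 2 ^ k) powr 3 = (\<rho> * 2 ^ k) powr (3 - b)"
      unfolding c_def by (simp flip: powr_add)
    also have "\<dots> = \<rho> powr (3 - b) * (2 powr (3 - b)) ^ k"
      using r by (simp add: powr_mult powr_realpow[symmetric] powr_powr mult.commute)
    finally show "(\<integral>\<^sup>+x. ennreal (c k) * indicator (cball 0 (\<rho> * 2 ^ Suc k)) x \<partial>(lborel :: (real^3) measure)) =
      ennreal (8 * unit_ball_vol 3 * \<rho> powr (3 - b) * (2 powr (3 - b)) ^ k)" by (simp add: mult.assoc)
  qed
  also have "\<dots> < \<infinity>"
  proof -
    have "2 powr (3 - b) < (1::real)" using b powr_less_mono[of "3 - b" 0 2] by simp
    then have "summable (\<lambda>k. 8 * unit_ball_vol 3 * \<rho> powr (3 - b) * (2 powr (3 - b)) ^ k)"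
      by (intro summable_mult summable_geometric) auto
    then show ?thesis
      by (subst suminf_ennreal2) auto
  qed
  finally show ?thesis .
qed

text \<open>The squared bound times the weight is a multiple of
  \<open>norm x powr (- 2 * (\<delta> - a) - 3)\<close>, which is integrable at infinity just when
  \<open>a < \<delta>\<close>.\<close>

lemma bnd_imp_sqi:
  assumes r: "\<rho> > 0" and a: "a < \<delta>" and f: "bnd \<rho> a f"
  shows "sqi \<rho> \<delta> f"
proof -
  obtain C where C: "\<And>x. \<rho> < norm x \<Longrightarrow> norm (f x) \<le> C * norm x powr a"
    using f unfolding bnd_def by blast
  have "weighted_norm_finite norm (ext \<rho>) \<delta> f"
  proof (rule weighted_norm_finite_dominated[where C = "C\<^sup>2" and g = "\<lambda>_. 1 :: real" and \<delta> = "\<delta> - a" and w = norm])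
    have e: "- 2 * (\<delta> - a) - 3 = - (2 * (\<delta> - a) + 3)" by simp
    show "weighted_norm_finite norm (ext \<rho>) (\<delta> - a) (\<lambda>_. 1 :: real)"
      unfolding weighted_norm_finite_def e norm_one one_power2 mult_1_left
      using a by (intro nn_integral_powr_at_infinity[OF r]) simp
    show "(norm (f x))\<^sup>2 * norm x powr (- 2 * \<delta> - 3) \<le> C\<^sup>2 * ((norm (1::real))\<^sup>2 * norm x powr (- 2 * (\<delta> - a) - 3))"
      if x: "x \<in> ext \<rho>" for x
    proof -
      have "(norm (f x))\<^sup>2 \<le> (C * norm x powr a)\<^sup>2" using C x by (intro power_mono) auto
      then have "(norm (f x))\<^sup>2 * norm x powr (- 2 * \<delta> - 3) \<le> (C * norm x powr a)\<^sup>2 * norm x powr (- 2 * \<delta> - 3)"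
        by (rule mult_right_mono) simp
      also have "\<dots> = C\<^sup>2 * (norm x powr a * norm x powr a * norm x powr (- 2 * \<delta> - 3))"
        by (simp add: power2_eq_square)
      also have "norm x powr a * norm x powr a * norm x powr (- 2 * \<delta> - 3) = norm x powr (- 2 * (\<delta> - a) - 3)"
        by (simp add: algebra_simps flip: powr_add)
      finally show ?thesis by simp
    qed
  qed (use measurable_weighted[of \<rho> "\<lambda>_. 1 :: real"] r in auto)
  then show ?thesis using f unfolding sqi_def bnd_def by blast
qed

lemma bnd_mono:
  assumes "\<rho> > 0" "a \<le> b" "bnd \<rho> a f"
  shows "bnd \<rho> b f"
proof -
  obtain C where C: "\<And>x. \<rho> < norm x \<Longrightarrow> norm (f x) \<le> C * norm x powr a"
    using assms(3) unfolding bnd_def by blast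
  have "norm (f x) \<le> (\<bar>C\<bar> * \<rho> powr (a - b)) * norm x powr b" if x: "\<rho> < norm x" for x
  proof -
    have "norm x powr a = norm x powr (a - b) * norm x powr b" by (simp flip: powr_add)
    also have "\<dots> \<le> \<rho> powr (a - b) * norm x powr b"
      using assms x by (intro mult_right_mono powr_mono2') auto
    finally have "\<bar>C\<bar> * norm x powr a \<le> \<bar>C\<bar> * (\<rho> powr (a - b) * norm x powr b)"
      by (intro mult_left_mono) auto
    moreover have "C * norm x powr a \<le> \<bar>C\<bar> * norm x powr a" by (intro mult_right_mono) auto
    ultimately show ?thesis using C[OF x] by (simp add: mult.assoc)
  qed
  then show ?thesis using assms(3) unfolding bnd_def by blast
qed

subsubsection \<open>Weighted Sobolev embedding\<close>

lemma sum_sq_le: "(\<Sum>i\<in>(UNIV::3 set). u i)\<^sup>2 \<le> 3 * (\<Sum>i\<in>UNIV. (u i)\<^sup>2)" for u :: "3 \<Rightarrow> real"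
  using Cauchy_Schwarz_ineq_sum[of "\<lambda>_. 1" u UNIV] by simp

text \<open>The quadratic counterpart of \<open>sob_density\<close>, with derivatives scaled by the
  length \<open>l\<close>.\<close>

definition jet_sq :: "(real^3 \<Rightarrow> 'b::real_normed_vector) \<Rightarrow> real \<Rightarrow> real^3 \<Rightarrow> real" where
  "jet_sq f l z = (norm (f z))\<^sup>2 + l\<^sup>2 * (\<Sum>i\<in>UNIV. (norm (pd i f z))\<^sup>2)
     + l ^ 4 * (\<Sum>i\<in>UNIV. \<Sum>j\<in>UNIV. (norm (pd j (pd i f) z))\<^sup>2)"

text \<open>Squaring a sum of three terms costs 3, the inner sums cost 3 and 9. Of the resulting
  coefficients 12, 144 and 27 the largest is kept.\<close>

lemma sob_density_sq_le: "(sob_density l f z)\<^sup>2 \<le> 144 * jet_sq f l z"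
proof -
  define a b c where "a = norm (f z)" and "b = (\<Sum>i\<in>UNIV. norm (pd i f z))"
    and "c = (\<Sum>i\<in>UNIV. \<Sum>j\<in>UNIV. norm (pd j (pd i f) z))"
  have b: "b\<^sup>2 \<le> 3 * (\<Sum>i\<in>UNIV. (norm (pd i f z))\<^sup>2)" unfolding b_def by (rule sum_sq_le)
  have "c\<^sup>2 \<le> 3 * (\<Sum>i\<in>UNIV. (\<Sum>j\<in>UNIV. norm (pd j (pd i f) z))\<^sup>2)"
    unfolding c_def by (rule sum_sq_le)
  also have "\<dots> \<le> 3 * (\<Sum>i\<in>UNIV. 3 * (\<Sum>j\<in>UNIV. (norm (pd j (pd i f) z))\<^sup>2))"
    by (intro mult_left_mono sum_mono sum_sq_le) simp
  finally have c: "c\<^sup>2 \<le> 9 * (\<Sum>i\<in>UNIV. \<Sum>j\<in>UNIV. (norm (pd j (pd i f) z))\<^sup>2)"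
    by (simp add: sum_distrib_left)
  have "(sob_density l f z)\<^sup>2 = (2 * a + 4 * l * b + l\<^sup>2 * c)\<^sup>2"
    unfolding sob_density_def a_def b_def c_def ..
  also have "\<dots> \<le> 3 * ((2 * a)\<^sup>2 + (4 * l * b)\<^sup>2 + (l\<^sup>2 * c)\<^sup>2)"
    using sum_squares_bound[of "2 * a" "4 * l * b"] sum_squares_bound[of "2 * a" "l\<^sup>2 * c"]
      sum_squares_bound[of "4 * l * b" "l\<^sup>2 * c"]
    by (simp add: power2_sum algebra_simps)
  also have "\<dots> = 12 * a\<^sup>2 + 48 * (l\<^sup>2 * b\<^sup>2) + 3 * (l ^ 4 * c\<^sup>2)"
    by (simp add: power_mult_distrib)
  also have "\<dots> \<le> 12 * a\<^sup>2 + 48 * (l\<^sup>2 * (3 * (\<Sum>i\<in>UNIV. (norm (pd i f z))\<^sup>2)))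
      + 3 * (l ^ 4 * (9 * (\<Sum>i\<in>UNIV. \<Sum>j\<in>UNIV. (norm (pd j (pd i f) z))\<^sup>2)))"
    using b c by (intro add_mono mult_left_mono) auto
  also have "\<dots> \<le> 144 * jet_sq f l z" unfolding jet_sq_def a_def
    by (simp add: algebra_simps) (auto intro!: add_nonneg_nonneg sum_nonneg mult_nonneg_nonneg)
  finally show ?thesis .
qed

lemma jet_sq_mono: "0 \<le> l \<Longrightarrow> l \<le> l' \<Longrightarrow> jet_sq f l z \<le> jet_sq f l' z"
  unfolding jet_sq_def by (intro add_mono mult_right_mono power_mono sum_nonneg) auto

lemma jet_sq_nonneg: "jet_sq f l z \<ge> 0"
  unfolding jet_sq_def by (auto intro!: add_nonneg_nonneg sum_nonneg mult_nonneg_nonneg)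

text \<open>With \<open>l = norm z\<close> the scaling in \<open>jet_sq\<close> turns the weight of
  order \<open>\<delta>\<close> into those of order \<open>\<delta> - 1\<close> and
  \<open>\<delta> - 2\<close> on the first and second derivatives.\<close>

lemma jet_sq_integral_finite:
  fixes f :: "real^3 \<Rightarrow> 'b::real_normed_vector"
  assumes r: "\<rho> > 0" and f: "smooth_on (ext \<rho>) f"
    and 0: "weighted_norm_finite norm (ext \<rho>) \<delta> f"
    and 1: "\<And>i. weighted_norm_finite norm (ext \<rho>) (\<delta> - 1) (pd i f)"
    and 2: "\<And>i j. weighted_norm_finite norm (ext \<rho>) (\<delta> - 2) (pd j (pd i f))"
  shows "(\<integral>\<^sup>+z\<in>ext \<rho>. ennreal (norm z powr (- 2 * \<delta> - 3) * jet_sq f (norm z) z) \<partial>lborel) < \<infinity>"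
proof -
  define W where "W d g z = ennreal ((norm (g z))\<^sup>2 * norm z powr (- 2 * d - 3)) * indicator (ext \<rho>) z"
    for d and g :: "real^3 \<Rightarrow> 'b" and z :: "real^3"
  have [measurable]: "W d f \<in> borel_measurable borel" "W d (pd i f) \<in> borel_measurable borel"
      "W d (pd j (pd i f)) \<in> borel_measurable borel" for d i j
    unfolding W_def using r f
    by (intro measurable_weighted smooth_on_imp_continuous smooth_on_pd; simp)+
  have "ennreal (norm z powr (- 2 * \<delta> - 3) * jet_sq f (norm z) z) * indicator (ext \<rho>) z
      = W \<delta> f z + ((\<Sum>i\<in>UNIV. W (\<delta> - 1) (pd i f) z) + (\<Sum>i\<in>UNIV. \<Sum>j\<in>UNIV. W (\<delta> - 2) (pd j (pd i f)) z))" for z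
  proof (cases "z \<in> ext \<rho>")
    case True
    define n where "n = norm z"
    have n: "n > 0" using True r unfolding n_def by (meson mem_Collect_eq order_less_trans)
    have e1: "n powr (- 2 * (\<delta> - 1) - 3) = n powr (- 2 * \<delta> - 3) * n\<^sup>2"
    proof -
      have "- 2 * (\<delta> - 1) - 3 = (- 2 * \<delta> - 3) + 2" by simp
      then show ?thesis using n by (simp only: powr_add) (simp add: powr_numeral)
    qed
    have e2: "n powr (- 2 * (\<delta> - 2) - 3) = n powr (- 2 * \<delta> - 3) * n ^ 4"
    proof -
      have "- 2 * (\<delta> - 2) - 3 = (- 2 * \<delta> - 3) + 4" by simp
      then show ?thesis using n by (simp only: powr_add) (simp add: powr_numeral)
    qed
    have "n powr (- 2 * \<delta> - 3) * jet_sq f n z = (norm (f z))\<^sup>2 * n powr (- 2 * \<delta> - 3) +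
      ((\<Sum>i\<in>UNIV. (norm (pd i f z))\<^sup>2 * n powr (- 2 * (\<delta> - 1) - 3)) +
       (\<Sum>i\<in>UNIV. \<Sum>j\<in>UNIV. (norm (pd j (pd i f) z))\<^sup>2 * n powr (- 2 * (\<delta> - 2) - 3)))"
      unfolding jet_sq_def e1 e2 by (simp add: distrib_left sum_distrib_left sum_distrib_right mult_ac)
    then show ?thesis using True unfolding W_def n_def
      by (simp add: sum_nonneg sum_ennreal flip: ennreal_plus)
  qed (simp add: W_def)
  then have "(\<integral>\<^sup>+z\<in>ext \<rho>. ennreal (norm z powr (- 2 * \<delta> - 3) * jet_sq f (norm z) z) \<partial>lborel) =
      integral\<^sup>N lborel (W \<delta> f) + ((\<Sum>i\<in>UNIV. integral\<^sup>N lborel (W (\<delta> - 1) (pd i f)))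
       + (\<Sum>i\<in>UNIV. \<Sum>j\<in>UNIV. integral\<^sup>N lborel (W (\<delta> - 2) (pd j (pd i f)))))"
    by (simp add: nn_integral_add nn_integral_sum)
  also have "\<dots> < \<infinity>"
    using 0[unfolded weighted_norm_finite_def, folded W_def] 1[unfolded weighted_norm_finite_def, folded W_def]
      2[unfolded weighted_norm_finite_def, folded W_def]
    by (simp add: less_top)
  finally show ?thesis .
qed

text \<open>On the ball about \<open>x\<close> of radius \<open>norm x / 2\<close> the weight is
  comparable to its value at the centre. The inequality on this ball, whose volume absorbs the 3 in
  the exponent of the weight, is the pointwise bound.\<close>

lemma weighted_sobolev_bound:
  fixes f :: "real^3 \<Rightarrow> 'b::banach"
  assumes r: "\<rho> > 0" and f: "smooth_on (ext \<rho>) f"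
    and fin: "(\<integral>\<^sup>+z\<in>ext \<rho>. ennreal (norm z powr (- 2 * \<delta> - 3) * jet_sq f (norm z) z) \<partial>lborel) < \<infinity>"
  shows "\<exists>C. \<forall>x. 2 * \<rho> < norm x \<longrightarrow> norm (f x) \<le> C * norm x powr \<delta>"
proof -
  define N where "N z = norm z powr (- 2 * \<delta> - 3) * jet_sq f (norm z) z" for z
  have N0: "N z \<ge> 0" for z unfolding N_def by (intro mult_nonneg_nonneg jet_sq_nonneg) simp
  obtain M where M: "(\<integral>\<^sup>+z\<in>ext \<rho>. ennreal (N z) \<partial>lborel) = ennreal M" "M \<ge> 0"
    using fin[folded N_def] by (cases "\<integral>\<^sup>+z\<in>ext \<rho>. ennreal (N z) \<partial>lborel") auto
  \<comment> \<open>One summand for each sign of the exponent \<open>2 * \<delta> + 3\<close>, as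
    \<open>norm z\<close> lies between 1/2 and 3/2 of \<open>norm x\<close>.\<close>
  define c where "c = (1/2) powr (2 * \<delta> + 3) + (3/2) powr (2 * \<delta> + 3)"
  define V where "V = unit_ball_vol 3"
  have V: "V > 0" unfolding V_def by simp
  define C where "C = sqrt (8 * (4 * (144 * c)) * M / V)"
  have "norm (f x) \<le> C * norm x powr \<delta>" if x: "2 * \<rho> < norm x" for x
  proof -
    define n where "n = norm x"
    define l where "l = n / 2"
    have l: "l > 0" "n > 0" "2 * \<rho> < n" using x r by (auto simp: l_def n_def)
    have ball: "l < norm z \<and> norm z < 3 * l" if "z \<in> ball x l" for z
    proof -
      have "norm (z - x) < l" using that by (simp add: dist_norm norm_minus_commute)
      then show ?thesis
        using norm_triangle_ineq2[of x z] norm_triangle_ineq2[of z x] by (auto simp: l_def n_def norm_minus_commute)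
    qed
    have sub: "ball x l \<subseteq> ext \<rho>" using ball l by (force simp: l_def)
    have pw: "(sob_density l f z)\<^sup>2 \<le> 144 * c * n powr (2 * \<delta> + 3) * N z" if z: "z \<in> ball x l" for z
    proof -
      have zl: "l < norm z" "norm z < 3 * l" using ball[OF z] by auto
      have "norm z powr (2 * \<delta> + 3) \<le> c * n powr (2 * \<delta> + 3)"
      proof (cases "2 * \<delta> + 3 \<ge> 0")
        case True
        have "norm z powr (2 * \<delta> + 3) \<le> (3/2 * n) powr (2 * \<delta> + 3)"
          using zl True by (intro powr_mono2) (auto simp: l_def)
        also have "\<dots> \<le> c * n powr (2 * \<delta> + 3)"
          using l by (subst powr_mult) (auto simp: c_def intro!: mult_right_mono)
        finally show ?thesis .
      next
        case False
        have "norm z powr (2 * \<delta> + 3) \<le> (1/2 * n) powr (2 * \<delta> + 3)"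
          using zl l False by (intro powr_mono2') (auto simp: l_def)
        also have "\<dots> \<le> c * n powr (2 * \<delta> + 3)"
          using l by (subst powr_mult) (auto simp: c_def intro!: mult_right_mono)
        finally show ?thesis .
      qed
      then have "norm z powr (2 * \<delta> + 3) * N z \<le> c * n powr (2 * \<delta> + 3) * N z"
        by (rule mult_right_mono) (rule N0)
      moreover have "norm z powr (2 * \<delta> + 3) * N z = jet_sq f (norm z) z"
      proof -
        have "norm z powr (2 * \<delta> + 3) * norm z powr (- 2 * \<delta> - 3) = 1"
        proof -
          have "norm z \<noteq> 0" using zl(1) l(1) by linarith
          then show ?thesis by (simp flip: powr_add)
        qed
        then show ?thesis unfolding N_def by (simp flip: mult.assoc)
      qed
      moreover have "(sob_density l f z)\<^sup>2 \<le> 144 * jet_sq f l z" by (rule sob_density_sq_le)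
      moreover have "jet_sq f l z \<le> jet_sq f (norm z) z" using zl l by (intro jet_sq_mono) auto
      ultimately show ?thesis by (simp add: mult.assoc)
    qed
    have c0: "144 * c * n powr (2 * \<delta> + 3) \<ge> 0" unfolding c_def by simp
    have "ennreal ((norm (f x))\<^sup>2 * (V * l ^ 3)) \<le>
        4 * (\<integral>\<^sup>+z. ennreal ((sob_density l f z)\<^sup>2) * indicator (ball x l) z \<partial>lborel)"
      unfolding V_def by (rule sobolev_ball[OF open_ext f sub l(1)])
    also have "\<dots> \<le> 4 * (\<integral>\<^sup>+z. ennreal (144 * c * n powr (2 * \<delta> + 3)) * (ennreal (N z) * indicator (ext \<rho>) z) \<partial>lborel)"
    proof (intro mult_left_mono nn_integral_mono)
      fix z
      show "ennreal ((sob_density l f z)\<^sup>2) * indicator (ball x l) z \<le>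
          ennreal (144 * c * n powr (2 * \<delta> + 3)) * (ennreal (N z) * indicator (ext \<rho>) z)"
        using ennreal_leI[OF pw[of z]] sub c0 N0
        by (auto simp: indicator_def ennreal_mult'')
    qed simp
    also have "\<dots> = 4 * (ennreal (144 * c * n powr (2 * \<delta> + 3)) * ennreal M)"
    proof -
      have "continuous_on (ext \<rho>) N" unfolding N_def jet_sq_def using r
        by (intro continuous_intros smooth_on_imp_continuous smooth_on_pd f) auto
      then have "(\<lambda>z. ennreal (N z) * indicator (ext \<rho>) z) \<in> borel_measurable lborel"
        using measurable_ennreal_indicator[of "ext \<rho>" N] by simp
      then show ?thesis by (subst nn_integral_cmult) (simp_all add: M)
    qed
    also have "\<dots> = ennreal 4 * ennreal (144 * c * n powr (2 * \<delta> + 3) * M)"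
      by (simp only: ennreal_mult[OF c0 M(2)] ennreal_numeral)
    also have "\<dots> = ennreal (4 * (144 * c * n powr (2 * \<delta> + 3) * M))"
      using mult_nonneg_nonneg[OF c0 M(2)] by (intro ennreal_mult[symmetric]) auto
    finally have "(norm (f x))\<^sup>2 * (V * l ^ 3) \<le> 4 * (144 * c * n powr (2 * \<delta> + 3) * M)"
      using c0 M(2) by (subst (asm) ennreal_le_iff) auto
    also have "n powr (2 * \<delta> + 3) = (n powr \<delta>)\<^sup>2 * (8 * l ^ 3)"
    proof -
      have "n powr (2 * \<delta> + 3) = n powr (\<delta> + \<delta>) * n powr 3" by (simp flip: powr_add)
      also have "n powr (\<delta> + \<delta>) = (n powr \<delta>)\<^sup>2" by (simp only: powr_add power2_eq_square)
      also have "n powr 3 = 8 * l ^ 3" using l by (simp add: powr_numeral l_def power_divide)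
      finally show ?thesis .
    qed
    finally have "(norm (f x))\<^sup>2 * V * l ^ 3 \<le> (4 * (144 * c * ((n powr \<delta>)\<^sup>2 * 8) * M)) * l ^ 3"
      by (simp add: mult_ac)
    then have "(norm (f x))\<^sup>2 * V \<le> 4 * (144 * c * ((n powr \<delta>)\<^sup>2 * 8) * M)"
      using l by simp
    then have "(norm (f x))\<^sup>2 \<le> (8 * (4 * (144 * c)) * M / V) * (n powr \<delta>)\<^sup>2"
      using V by (simp add: field_simps)
    then have "norm (f x) \<le> sqrt ((8 * (4 * (144 * c)) * M / V) * (n powr \<delta>)\<^sup>2)"
      by (rule real_le_rsqrt)
    then show ?thesis unfolding C_def real_sqrt_mult[of _ "(n powr \<delta>)\<^sup>2"] real_sqrt_abs
      by (simp add: n_def)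
  qed
  then show ?thesis by blast
qed

section \<open>Closure properties shared by symbols and weighted square integrable functions\<close>

locale decay_class =
  fixes G :: "real \<Rightarrow> real \<Rightarrow> (real^3 \<Rightarrow> 'b::real_normed_vector) \<Rightarrow> bool"
  assumes jet_class_G: "\<And>\<rho>. \<rho> > 0 \<Longrightarrow> jet_class (ext \<rho>) (G \<rho>)"
    and G_antimono: "\<And>\<rho> \<sigma> a f. G \<rho> a f \<Longrightarrow> \<rho> \<le> \<sigma> \<Longrightarrow> G \<sigma> a f"
begin

lemma jet_antimono: "jet n (G \<rho>) a f \<Longrightarrow> \<rho> \<le> \<sigma> \<Longrightarrow> jet n (G \<sigma>) a f"
  using jet_mono[of "G \<rho>" "G \<sigma>"] G_antimono by blast

lemma cls_cong:
  assumes "cls G R a f" "\<And>x. R < norm x \<Longrightarrow> f x = g x" "0 < R"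
  shows "cls G R a g"
proof -
  obtain \<rho> where r: "\<rho> > R" "\<And>n. jet n (G \<rho>) a f" using assms(1) unfolding cls_def by blast
  have "jet n (G \<rho>) a g" for n
    by (rule jet_class.jet_cong[OF jet_class_G r(2)]) (use r assms in auto)
  moreover have "smooth_on (ext R) g"
    using assms smooth_on_cong[of "ext R" f g] by (auto simp: cls_def)
  ultimately show ?thesis using r(1) unfolding cls_def by blast
qed

lemma cls_add:
  assumes "cls G R a f" "cls G R a g" "0 < R"
  shows "cls G R a (\<lambda>x. f x + g x)"
proof -
  obtain \<rho> where r: "\<rho> > R" "\<And>n. jet n (G \<rho>) a f" using assms(1) unfolding cls_def by blast
  obtain \<sigma> where s: "\<sigma> > R" "\<And>n. jet n (G \<sigma>) a g" using assms(2) unfolding cls_def by blast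
  have "jet n (G (max \<rho> \<sigma>)) a (\<lambda>x. f x + g x)" for n
    using r s assms(3)
    by (intro jet_class.jet_add[OF jet_class_G] jet_antimono[OF r(2)] jet_antimono[OF s(2)]) auto
  then show ?thesis using assms smooth_on_add[of "ext R" f g] r(1) unfolding cls_def
    by (auto intro!: exI[of _ "max \<rho> \<sigma>"])
qed

lemma cls_pd: "cls G R a f \<Longrightarrow> cls G R (a - 1) (pd i f)"
  unfolding cls_def using smooth_on_pd by (metis jet.simps(2))

text \<open>Only finitely many radii, one for each partial derivative and one for \<open>f\<close>,
  have to be merged into a single one.\<close>

lemma cls_SucI:
  assumes f: "smooth_on (ext R) f" "\<rho> > R" "G \<rho> a f" and d: "\<And>i. cls G R (a - 1) (pd i f)"
  shows "cls G R a f"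
proof -
  from d have "\<forall>i. \<exists>\<rho>>R. \<forall>n. jet n (G \<rho>) (a - 1) (pd i f)" unfolding cls_def by blast
  then obtain r where r: "\<And>i. r i > R" "\<And>i n. jet n (G (r i)) (a - 1) (pd i f)" by metis
  define \<sigma> where "\<sigma> = max \<rho> (Max (range r))"
  have s: "r i \<le> \<sigma>" "\<rho> \<le> \<sigma>" for i unfolding \<sigma>_def by (auto simp: le_max_iff_disj)
  have "jet n (G \<sigma>) a f" for n
    by (cases n) (use G_antimono[OF f(3) s(2)] jet_antimono[OF r(2) s(1)] in auto)
  then show ?thesis using f s unfolding cls_def by (meson less_le_trans)
qed

end

interpretation bnd: decay_class bnd
  by (rule decay_class.intro[OF jet_class_bnd bnd_antimono])

interpretation sqi: decay_class sqi
  by (rule decay_class.intro[OF jet_class_sqi sqi_antimono])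

lemma cls_mult:
  fixes f g :: "real^3 \<Rightarrow> 'b::real_normed_algebra"
  assumes G: "decay_class G1" "decay_class G2" "decay_class G3"
    and m: "\<And>\<rho> a b f g. 0 < \<rho> \<Longrightarrow> G1 \<rho> a f \<Longrightarrow> G2 \<rho> b g \<Longrightarrow> G3 \<rho> (a + b) (\<lambda>x. f x * g x)"
    and fg: "cls G1 R a f" "cls G2 R b g" and R: "0 < R"
  shows "cls G3 R (a + b) (\<lambda>x. f x * g x)"
proof -
  obtain \<rho> where r: "\<rho> > R" "\<And>n. jet n (G1 \<rho>) a f" using fg(1) unfolding cls_def by blast
  obtain \<sigma> where s: "\<sigma> > R" "\<And>n. jet n (G2 \<sigma>) b g" using fg(2) unfolding cls_def by blast
  let ?m = "max \<rho> \<sigma>"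
  have m0: "?m > 0" using r R by auto
  have "jet n (G3 ?m) (a + b) (\<lambda>x. f x * g x)" for n
    by (rule jet_mult[OF decay_class.jet_class_G[OF G(1) m0] decay_class.jet_class_G[OF G(2) m0]
        decay_class.jet_class_G[OF G(3) m0] m[OF m0]
        decay_class.jet_antimono[OF G(1) r(2)] decay_class.jet_antimono[OF G(2) s(2)]]) auto
  then show ?thesis using fg smooth_on_mult[of "ext R" f g] r(1) unfolding cls_def
    by (auto intro!: exI[of _ "max \<rho> \<sigma>"])
qed

lemma cls_bounded_linear:
  assumes "bounded_linear T" and G: "decay_class G1" "decay_class G2"
    and m: "\<And>\<rho> a f. 0 < \<rho> \<Longrightarrow> G1 \<rho> a f \<Longrightarrow> G2 \<rho> a (\<lambda>x. T (f x))"
    and f: "cls G1 R a f" and R: "0 < R"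
  shows "cls G2 R a (\<lambda>x. T (f x))"
proof -
  obtain \<rho> where r: "\<rho> > R" "\<And>n. jet n (G1 \<rho>) a f" using f unfolding cls_def by blast
  have m0: "\<rho> > 0" using r R by auto
  have "jet n (G2 \<rho>) a (\<lambda>x. T (f x))" for n
    by (rule jet_bounded_linear[OF assms(1) decay_class.jet_class_G[OF G(1) m0]
          decay_class.jet_class_G[OF G(2) m0] m[OF m0] r(2)])
  then show ?thesis using f smooth_on_bounded_linear[OF open_ext assms(1)] r(1) unfolding cls_def by blast
qed

text \<open>Words and jets describe the same derivatives; smoothness provides the differentiability
  built into \<open>sqi\<close>.\<close>

lemma o_inf_cls: "o_inf norm R \<delta> f \<longleftrightarrow> cls sqi R \<delta> f"
proof -
  have "(\<forall>s. weighted_sobolev norm (ext \<rho>) s \<delta> f) \<longleftrightarrow> (\<forall>n. jet n (sqi \<rho>) \<delta> f)"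
    if "smooth_on (ext R) f" "R < \<rho>" for \<rho>
  proof -
    have "smooth_on (ext \<rho>) f" using that by (auto elim: smooth_on_subset)
    then show ?thesis unfolding jet_pds weighted_sobolev_def sqi_def smooth_on_def by auto
  qed
  then show ?thesis unfolding o_inf_def cls_def by blast
qed

lemma smooth_on_ext_antimono: "smooth_on (ext R) f \<Longrightarrow> R \<le> \<rho> \<Longrightarrow> smooth_on (ext \<rho>) f"
  by (erule smooth_on_subset) auto

lemma pds_append: "pds (js @ is) f = pds js (pds is f)"
  by (induction js) auto

lemma smooth_on_pds: "smooth_on U f \<Longrightarrow> smooth_on U (pds is f)"
  unfolding smooth_on_def by (metis pds_append)

lemma cls_bnd_iff: "cls bnd R a f \<longleftrightarrow> smooth_on (ext R) f \<and> (\<exists>\<rho>>R. \<forall>is. \<exists>C. \<forall>x. \<rho> < norm x \<longrightarrow>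
    norm (pds is f x) \<le> C * norm x powr (a - real (length is)))"
proof -
  have "(\<forall>n. jet n (bnd \<rho>) a f) \<longleftrightarrow> (\<forall>is. \<exists>C. \<forall>x. \<rho> < norm x \<longrightarrow>
    norm (pds is f x) \<le> C * norm x powr (a - real (length is)))"
    if "smooth_on (ext R) f" "R < \<rho>" for \<rho>
  proof -
    have "smooth_on (ext \<rho>) f" using that smooth_on_ext_antimono[of R f \<rho>] by auto
    then show ?thesis unfolding jet_pds bnd_def smooth_on_def by auto
  qed
  then show ?thesis unfolding cls_def by blast
qed

subsection \<open>Radial integration\<close>

text \<open>The derivative along the ray is compared with that of
  \<open>3 * M / a * r powr a\<close>, the 3 counting the partial derivatives. Either sign of
  \<open>a\<close> is allowed: for \<open>a < 0\<close> both factors of the bound are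
  nonpositive.\<close>

lemma radial_increment:
  fixes f :: "real^3 \<Rightarrow> 'b::real_normed_vector"
  assumes f: "\<And>z. \<rho> < norm z \<Longrightarrow> f differentiable at z"
    and M: "\<And>z i. \<rho> < norm z \<Longrightarrow> norm (pd i f z) \<le> M * norm z powr (a - 1)"
    and a: "a \<noteq> 0" and st: "0 < s" "s \<le> t" and x: "0 \<le> \<rho>" "\<rho> < norm (s *\<^sub>R x)"
  shows "norm (f (t *\<^sub>R x) - f (s *\<^sub>R x)) \<le> 3 * M / a * (norm (t *\<^sub>R x) powr a - norm (s *\<^sub>R x) powr a)"
proof (cases "s = t")
  case False
  have x0: "norm x > 0" using x by auto
  have ex: "\<rho> < norm (u *\<^sub>R x)" if "s \<le> u" for u
  proof -
    have "s * norm x \<le> u * norm x" using that x0 by simp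
    then show ?thesis using that st x by simp
  qed
  have d: "((\<lambda>t. f (t *\<^sub>R x)) has_vector_derivative (\<Sum>i\<in>UNIV. x $ i *\<^sub>R pd i f (u *\<^sub>R x))) (at u within S)"
    if "s \<le> u" for u S
    using has_vector_derivative_line[of f 0 u x S] f[OF ex[OF that]] by simp
  let ?p = "\<lambda>t. 3 * M / a * (t * norm x) powr a"
  have p: "(?p has_vector_derivative 3 * M * norm x * (u * norm x) powr (a - 1)) (at u)" if "s < u" for u
    using that st x0 a unfolding has_real_derivative_iff_has_vector_derivative[symmetric]
    by (auto intro!: derivative_eq_intros simp: powr_diff field_simps)
  have "norm (f (t *\<^sub>R x) - f (s *\<^sub>R x)) \<le> ?p t - ?p s"
  proof (rule differentiable_bound_general[where f' = "\<lambda>u. \<Sum>i\<in>UNIV. x $ i *\<^sub>R pd i f (u *\<^sub>R x)"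
        and \<phi>' = "\<lambda>u. 3 * M * norm x * (u * norm x) powr (a - 1)"])
    show "s < t" using False st by simp
    show "continuous_on {s..t} (\<lambda>t. f (t *\<^sub>R x))"
      using d by (auto simp: continuous_on_eq_continuous_within intro!: has_vector_derivative_continuous)
    show "continuous_on {s..t} ?p" using st x0 by (intro continuous_intros) auto
    fix u assume u: "s < u" "u < t"
    show "((\<lambda>t. f (t *\<^sub>R x)) has_vector_derivative (\<Sum>i\<in>UNIV. x $ i *\<^sub>R pd i f (u *\<^sub>R x))) (at u)"
      using d[of u] u by simp
    show "(?p has_vector_derivative 3 * M * norm x * (u * norm x) powr (a - 1)) (at u)" using p u by simp
    have "norm (\<Sum>i\<in>UNIV. x $ i *\<^sub>R pd i f (u *\<^sub>R x)) \<le> norm x * (\<Sum>i\<in>UNIV. norm (pd i f (u *\<^sub>R x)))"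
      by (rule norm_sum_scaleR_le) simp
    also have "\<dots> \<le> norm x * (\<Sum>i\<in>(UNIV::3 set). M * norm (u *\<^sub>R x) powr (a - 1))"
      using M[OF ex] u by (intro mult_left_mono sum_mono) auto
    finally show "norm (\<Sum>i\<in>UNIV. x $ i *\<^sub>R pd i f (u *\<^sub>R x)) \<le> 3 * M * norm x * (u * norm x) powr (a - 1)"
      using u st by (simp add: mult_ac)
  qed
  then show ?thesis using st by (simp add: right_diff_distrib)
qed simp

text \<open>The bound on the derivative is integrable along each ray, so a limit exists there. The
  point is that it is the same for all rays: on an arc-like path at radius \<open>r\<close> the
  function varies by at most a multiple of \<open>r powr \<delta>\<close>.\<close>

lemma limit_at_infinity:
  fixes f :: "real^3 \<Rightarrow> 'b::banach"
  assumes f: "\<And>z. \<rho> < norm z \<Longrightarrow> f differentiable at z"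
    and M: "\<And>z i. \<rho> < norm z \<Longrightarrow> norm (pd i f z) \<le> M * norm z powr (\<delta> - 1)"
    and \<delta>: "\<delta> < 0" and r: "\<rho> > 0"
  shows "\<exists>C K. \<forall>x. \<rho> < norm x \<longrightarrow> norm (f x - C) \<le> K * norm x powr \<delta>"
proof -
  have M0: "M \<ge> 0"
  proof -
    have "0 \<le> M * norm ((\<rho> + 1) *\<^sub>R axis 1 1 :: real^3) powr (\<delta> - 1)"
      using M[of "(\<rho> + 1) *\<^sub>R axis 1 1" 1] r by (intro order_trans[OF norm_ge_zero]) (auto simp: norm_axis_1)
    then show ?thesis using r by (auto simp: zero_le_mult_iff norm_axis_1)
  qed
  define K where "K = 3 * M / (- \<delta>)"
  have K0: "K \<ge> 0" unfolding K_def using M0 \<delta> by (intro divide_nonneg_pos) auto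
  have inc: "norm (f (t *\<^sub>R x) - f (s *\<^sub>R x)) \<le> K * norm (s *\<^sub>R x) powr \<delta>"
    if "1 \<le> s" "s \<le> t" "\<rho> < norm x" for s t x
  proof -
    have "norm x \<le> s * norm x" using that by (simp add: mult_le_cancel_right1)
    then have "\<rho> < norm (s *\<^sub>R x)" using that by simp
    then have "norm (f (t *\<^sub>R x) - f (s *\<^sub>R x)) \<le> 3 * M / \<delta> * (norm (t *\<^sub>R x) powr \<delta> - norm (s *\<^sub>R x) powr \<delta>)"
      using that r \<delta> by (intro radial_increment[OF f M]) auto
    also have "\<dots> = K * norm (s *\<^sub>R x) powr \<delta> - K * norm (t *\<^sub>R x) powr \<delta>"
      using \<delta> by (simp add: K_def field_simps)
    also have "\<dots> \<le> K * norm (s *\<^sub>R x) powr \<delta>" using K0 by simp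
    finally show ?thesis .
  qed
  have small: "\<exists>s\<ge>1. \<forall>t\<ge>s. K' * norm (t *\<^sub>R x) powr \<delta> < e" if "e > 0" "\<rho> < norm x" for e x K'
  proof -
    have "((\<lambda>t. K' * (t * norm x) powr \<delta>) \<longlongrightarrow> K' * 0) at_top"
      using that r \<delta> by (intro tendsto_intros tendsto_neg_powr filterlim_tendsto_pos_mult_at_top[OF tendsto_const, of "norm x", unfolded mult.commute[of "norm x"]] filterlim_ident) auto
    then have "eventually (\<lambda>t. K' * (t * norm x) powr \<delta> < e) at_top"
      using that by (intro order_tendstoD(2)) auto
    then obtain N where N: "\<And>t. t \<ge> N \<Longrightarrow> K' * (t * norm x) powr \<delta> < e"
      by (auto simp: eventually_at_top_linorder)
    show ?thesis by (rule exI[of _ "max 1 N"]) (use N in auto)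
  qed
  have "\<exists>L. \<forall>s\<ge>1. norm (f (s *\<^sub>R x) - L) \<le> K * norm (s *\<^sub>R x) powr \<delta>" if x: "\<rho> < norm x" for x
  proof -
    have "Cauchy (\<lambda>n. f (real (Suc n) *\<^sub>R x))"
    proof (rule metric_CauchyI)
      fix e :: real assume "e > 0"
      then obtain s where s: "s \<ge> 1" "\<And>t. t \<ge> s \<Longrightarrow> K * norm (t *\<^sub>R x) powr \<delta> < e"
        using small x by blast
      obtain N where N: "s \<le> real N" using real_arch_simple by blast
      have *: "dist (f (real (Suc m) *\<^sub>R x)) (f (real (Suc n) *\<^sub>R x)) < e" if "m \<ge> N" "n \<le> m" "n \<ge> N" for m n
      proof -
        have "norm (f (real (Suc m) *\<^sub>R x) - f (real (Suc n) *\<^sub>R x)) \<le> K * norm (real (Suc n) *\<^sub>R x) powr \<delta>"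
          using that s N x by (intro inc) auto
        also have "\<dots> < e" using that s N by (intro s(2)) auto
        finally show ?thesis by (simp add: dist_norm)
      qed
      show "\<exists>N. \<forall>m\<ge>N. \<forall>n\<ge>N. dist (f (real (Suc m) *\<^sub>R x)) (f (real (Suc n) *\<^sub>R x)) < e"
        using * by (metis dist_commute linear)
    qed
    then obtain L where L: "(\<lambda>n. f (real (Suc n) *\<^sub>R x)) \<longlonglongrightarrow> L"
      using Cauchy_convergent convergent_def by blast
    have "norm (f (s *\<^sub>R x) - L) \<le> K * norm (s *\<^sub>R x) powr \<delta>" if s: "s \<ge> 1" for s
    proof (rule tendsto_upperbound)
      show "(\<lambda>n. norm (f (s *\<^sub>R x) - f (real (Suc n) *\<^sub>R x))) \<longlonglongrightarrow> norm (f (s *\<^sub>R x) - L)"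
        by (intro tendsto_intros L)
      obtain N where N: "s \<le> real N" using real_arch_simple by blast
      show "\<forall>\<^sub>F n in sequentially. norm (f (s *\<^sub>R x) - f (real (Suc n) *\<^sub>R x)) \<le> K * norm (s *\<^sub>R x) powr \<delta>"
        by (rule eventually_sequentiallyI[of N], subst norm_minus_commute, rule inc) (use s N x in auto)
    qed simp
    then show ?thesis by blast
  qed
  then obtain L where L: "\<And>x s. \<rho> < norm x \<Longrightarrow> s \<ge> 1 \<Longrightarrow> norm (f (s *\<^sub>R x) - L x) \<le> K * norm (s *\<^sub>R x) powr \<delta>"
    by metis
  \<comment> \<open>Two limits agree once \<open>f\<close> at corresponding points differs by a
    multiple of a negative power; \<open>c\<close> admits different scalings of the two
    rays.\<close>
  have eq: "L x = L y"
    if x: "\<rho> < norm x" and y: "\<rho> < norm y" and "c \<ge> 1"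
      and close: "\<And>s. s \<ge> 2 \<Longrightarrow> norm (f (s *\<^sub>R c *\<^sub>R x) - f (s *\<^sub>R y)) \<le> K' * norm (s *\<^sub>R x) powr \<delta>" for x y c K'
  proof (rule ccontr)
    assume "L x \<noteq> L y"
    then have e: "norm (L x - L y) / 3 > 0" by simp
    obtain s1 where s1: "s1 \<ge> 1" "\<And>t. t \<ge> s1 \<Longrightarrow> K * norm (t *\<^sub>R x) powr \<delta> < norm (L x - L y) / 3"
      using small[OF e x, of K] by blast
    obtain s2 where s2: "s2 \<ge> 1" "\<And>t. t \<ge> s2 \<Longrightarrow> K * norm (t *\<^sub>R y) powr \<delta> < norm (L x - L y) / 3"
      using small[OF e y, of K] by blast
    obtain s3 where s3: "s3 \<ge> 1" "\<And>t. t \<ge> s3 \<Longrightarrow> K' * norm (t *\<^sub>R x) powr \<delta> < norm (L x - L y) / 3"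
      using small[OF e x, of K'] by blast
    define t where "t = max 2 (max s1 (max s2 s3))"
    have t: "t \<ge> 2" "t \<ge> s1" "t \<ge> s2" "t \<ge> s3" by (auto simp: t_def)
    have tc: "t \<le> t * c" using t that(3) by (simp add: mult_le_cancel_left1)
    have "norm (f ((t * c) *\<^sub>R x) - L x) < norm (L x - L y) / 3"
      using L[OF x, of "t * c"] s1(2)[of "t * c"] t tc by auto
    moreover have "norm (f (t *\<^sub>R y) - L y) < norm (L x - L y) / 3"
      using L[OF y, of t] s2(2)[of t] t by auto
    moreover have "norm (f ((t * c) *\<^sub>R x) - f (t *\<^sub>R y)) < norm (L x - L y) / 3"
      using close[of t] s3(2)[of t] t by auto
    moreover have "L x - L y = (f ((t * c) *\<^sub>R x) - f (t *\<^sub>R y)) - (f ((t * c) *\<^sub>R x) - L x) + (f (t *\<^sub>R y) - L y)" by simp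
    then have "norm (L x - L y) \<le> norm ((f ((t * c) *\<^sub>R x) - f (t *\<^sub>R y)) - (f ((t * c) *\<^sub>R x) - L x)) + norm (f (t *\<^sub>R y) - L y)"
      using norm_triangle_ineq by metis
    ultimately show False
      using norm_triangle_ineq4[of "f ((t * c) *\<^sub>R x) - f (t *\<^sub>R y)" "f ((t * c) *\<^sub>R x) - L x"] by linarith
  qed
  have scale: "L (c *\<^sub>R x) = L x" if "\<rho> < norm x" "c \<ge> 1" for x c
  proof (rule eq[of x "c *\<^sub>R x" c 0, symmetric])
    have "norm x \<le> c * norm x" using that by (simp add: mult_le_cancel_right1)
    then show "\<rho> < norm (c *\<^sub>R x)" using that by simp
  qed (use that in auto)
  \<comment> \<open>The angle is at most 90 degrees, so the segment from \<open>s x\<close> to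
    \<open>s y\<close> keeps at least half the radius. With \<open>s \<ge> 2\<close> it stays in the
    domain, and its length times the bound on the derivative is of order
    \<open>\<delta>\<close>.\<close>
  have turn: "L x = L y" if x: "\<rho> < norm x" and y: "norm y = norm x" and xy: "x \<bullet> y \<ge> 0" for x y
  proof (rule eq[of x y 1 "3 * M * 2 * (1/2) powr (\<delta> - 1)"])
    fix s :: real assume s: "s \<ge> 2"
    define n where "n = s * norm x"
    have n: "n > 2 * \<rho>"
    proof -
      have "2 * norm x \<le> s * norm x" using s by (intro mult_right_mono) auto
      then show ?thesis using x by (simp add: n_def)
    qed
    define p q where "p = s *\<^sub>R x" and "q = s *\<^sub>R y - s *\<^sub>R x"
    have q: "norm q \<le> 2 * n" unfolding q_def n_def using norm_triangle_ineq4[of "s *\<^sub>R y" "s *\<^sub>R x"] s y by simp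
    have low: "n / 2 \<le> norm (p + t *\<^sub>R q)" if t: "0 \<le> t" "t \<le> 1" for t
    proof (rule power2_le_imp_le)
      have "p + t *\<^sub>R q = s *\<^sub>R ((1 - t) *\<^sub>R x + t *\<^sub>R y)" unfolding p_def q_def by (simp add: algebra_simps)
      then have "(norm (p + t *\<^sub>R q))\<^sup>2 = s\<^sup>2 * (norm ((1 - t) *\<^sub>R x + t *\<^sub>R y))\<^sup>2"
        by (simp add: power_mult_distrib)
      also have "(norm ((1 - t) *\<^sub>R x + t *\<^sub>R y))\<^sup>2 = (1 - t)\<^sup>2 * (norm x)\<^sup>2 + t\<^sup>2 * (norm y)\<^sup>2 + 2 * ((1 - t) * t * (x \<bullet> y))"
        unfolding power2_norm_eq_inner by (simp add: inner_add_left inner_add_right inner_commute power2_eq_square algebra_simps)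
      finally have E: "(norm (p + t *\<^sub>R q))\<^sup>2 = s\<^sup>2 * ((1 - t)\<^sup>2 * (norm x)\<^sup>2 + t\<^sup>2 * (norm y)\<^sup>2 + 2 * ((1 - t) * t * (x \<bullet> y)))" .
      have "((1 - t)\<^sup>2 + t\<^sup>2) * (norm x)\<^sup>2 \<le> (1 - t)\<^sup>2 * (norm x)\<^sup>2 + t\<^sup>2 * (norm y)\<^sup>2 + 2 * ((1 - t) * t * (x \<bullet> y))"
        using t xy y by (simp add: distrib_right)
      then have "s\<^sup>2 * (((1 - t)\<^sup>2 + t\<^sup>2) * (norm x)\<^sup>2) \<le> (norm (p + t *\<^sub>R q))\<^sup>2"
        unfolding E by (rule mult_left_mono) simp
      moreover have "(1 - t)\<^sup>2 + t\<^sup>2 \<ge> 1 / 4"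
      proof -
        have "(1 - t)\<^sup>2 + t\<^sup>2 = 1/2 + 2 * (t - 1/2)\<^sup>2" by (simp add: power2_eq_square algebra_simps)
        then show ?thesis by simp
      qed
      then have "s\<^sup>2 * (((1 - t)\<^sup>2 + t\<^sup>2) * (norm x)\<^sup>2) \<ge> s\<^sup>2 * (1/4 * (norm x)\<^sup>2)"
        by (intro mult_left_mono mult_right_mono) auto
      ultimately show "(n / 2)\<^sup>2 \<le> (norm (p + t *\<^sub>R q))\<^sup>2"
        by (simp add: n_def power_divide power_mult_distrib)
    qed simp
    have ex: "\<rho> < norm (p + t *\<^sub>R q)" if "0 \<le> t" "t \<le> 1" for t using low[OF that] n by simp
    have n0: "n > 0" using n r by simp
    have d: "((\<lambda>t. f (p + t *\<^sub>R q)) has_vector_derivative (\<Sum>i\<in>UNIV. q $ i *\<^sub>R pd i f (p + t *\<^sub>R q))) (at t within S)"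
      if "0 \<le> t" "t \<le> 1" for t S
      by (rule has_vector_derivative_line[OF f[OF ex[OF that]]])
    let ?B = "3 * M * (2 * n) * (n / 2) powr (\<delta> - 1)"
    have "norm (f (p + 1 *\<^sub>R q) - f (p + 0 *\<^sub>R q)) \<le> ?B * 1 - ?B * 0"
    proof (rule differentiable_bound_general[where f' = "\<lambda>t. \<Sum>i\<in>UNIV. q $ i *\<^sub>R pd i f (p + t *\<^sub>R q)" and \<phi>' = "\<lambda>t. ?B" and \<phi> = "\<lambda>t. ?B * t" and f = "\<lambda>t. f (p + t *\<^sub>R q)"])
      show "continuous_on {0..1} (\<lambda>t. f (p + t *\<^sub>R q))"
        using d by (auto simp: continuous_on_eq_continuous_within intro!: has_vector_derivative_continuous)
      fix t :: real assume t: "0 < t" "t < 1"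
      have "norm (\<Sum>i\<in>UNIV. q $ i *\<^sub>R pd i f (p + t *\<^sub>R q)) \<le> (2 * n) * (\<Sum>i\<in>UNIV. norm (pd i f (p + t *\<^sub>R q)))"
        by (rule norm_sum_scaleR_le[OF q])
      also have "\<dots> \<le> (2 * n) * (\<Sum>i\<in>(UNIV::3 set). M * (n / 2) powr (\<delta> - 1))"
      proof (intro mult_left_mono sum_mono)
        fix i :: 3
        have "norm (pd i f (p + t *\<^sub>R q)) \<le> M * norm (p + t *\<^sub>R q) powr (\<delta> - 1)" using t by (intro M ex) auto
        also have "\<dots> \<le> M * (n / 2) powr (\<delta> - 1)" using M0 n0 low[of t] t \<delta>
          by (intro mult_left_mono powr_mono2') auto
        finally show "norm (pd i f (p + t *\<^sub>R q)) \<le> M * (n / 2) powr (\<delta> - 1)" .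
      qed (use n0 in simp)
      finally show "norm (\<Sum>i\<in>UNIV. q $ i *\<^sub>R pd i f (p + t *\<^sub>R q)) \<le> ?B" by (simp add: mult_ac)
      show "((\<lambda>t. f (p + t *\<^sub>R q)) has_vector_derivative (\<Sum>i\<in>UNIV. q $ i *\<^sub>R pd i f (p + t *\<^sub>R q))) (at t)"
        using d t by simp
      show "((\<lambda>t. ?B * t) has_vector_derivative ?B) (at t)"
        by (auto intro!: derivative_eq_intros)
    qed (auto intro!: continuous_intros)
    also have "?B * 1 - ?B * 0 = 3 * M * 2 * (1/2) powr (\<delta> - 1) * n powr \<delta>"
    proof -
      have "(n / 2) powr (\<delta> - 1) = (1/2) powr (\<delta> - 1) * n powr (\<delta> - 1)"
        using n0 powr_mult[of "1/2" n "\<delta> - 1"] by simp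
      moreover have "n powr \<delta> = n * n powr (\<delta> - 1)" using n0 powr_mult_base[of n "\<delta> - 1"] by simp
      ultimately show ?thesis by (simp add: mult_ac)
    qed
    finally show "norm (f (s *\<^sub>R 1 *\<^sub>R x) - f (s *\<^sub>R y)) \<le> 3 * M * 2 * (1/2) powr (\<delta> - 1) * norm (s *\<^sub>R x) powr \<delta>"
      using s by (simp add: p_def q_def n_def norm_minus_commute)
  qed (use x y in auto)
  have const: "L x = L y" if x: "\<rho> < norm x" and y: "\<rho> < norm y" for x y
  proof -
    define m where "m = max (norm x) (norm y)"
    define x' y' where "x' = (m / norm x) *\<^sub>R x" and "y' = (m / norm y) *\<^sub>R y"
    have n: "norm x > 0" "norm y > 0" "m > \<rho>" "m > 0" using x y r by (auto simp: m_def)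
    have nx: "norm x' = m" "norm y' = m" unfolding x'_def y'_def using n by auto
    have L': "L x' = L x" "L y' = L y" unfolding x'_def y'_def
      using n by (intro scale x y; simp add: m_def field_simps)+
    \<comment> \<open>Arbitrary directions are joined through one orthogonal to the first: this
      vector or its negative makes at most a right angle with the second.\<close>
    obtain z0 where z0: "z0 \<noteq> 0" "orthogonal x' z0"
      using orthogonal_to_vector_exists[of x'] by auto
    define z where "z = (m / norm z0) *\<^sub>R z0"
    have z: "norm z = m" "x' \<bullet> z = 0" using z0 n by (auto simp: z_def orthogonal_def)
    show ?thesis
    proof (cases "z \<bullet> y' \<ge> 0")
      case True
      then have "L x' = L z" "L z = L y'" using turn[of x' z] turn[of z y'] z nx n by auto
      then show ?thesis using L' by simp
    next
      case False
      then have "L x' = L (- z)" "L (- z) = L y'" using turn[of x' "- z"] turn[of "- z" y'] z nx n by auto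
      then show ?thesis using L' by simp
    qed
  qed
  let ?e = "(\<rho> + 1) *\<^sub>R axis 1 1 :: real^3"
  have e: "\<rho> < norm ?e" using r by (simp add: norm_axis_1)
  have "norm (f x - L ?e) \<le> K * norm x powr \<delta>" if "\<rho> < norm x" for x
    using L[OF that, of 1] const[OF that e] by simp
  then show ?thesis by blast
qed

section \<open>Symbols and small functions on a fixed end\<close>

locale exterior =
  fixes R :: real
  assumes R_pos: "0 < R"
begin

abbreviation symb :: "real \<Rightarrow> (real^3 \<Rightarrow> 'b::real_normed_vector) \<Rightarrow> bool" where
  "symb \<equiv> cls bnd R"

text \<open>By \<open>o_inf_cls\<close> this is \<open>o_inf\<close> with the weight
  \<open>norm\<close>.\<close>

abbreviation small :: "real \<Rightarrow> (real^3 \<Rightarrow> 'b::real_normed_vector) \<Rightarrow> bool" where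
  "small \<equiv> cls sqi R"

abbreviation smooth :: "(real^3 \<Rightarrow> 'b::real_normed_vector) \<Rightarrow> bool" where
  "smooth \<equiv> smooth_on (ext R)"

lemma symb_smooth: "symb a f \<Longrightarrow> smooth f" and small_smooth: "small \<delta> f \<Longrightarrow> smooth f"
  by (auto simp: cls_def)

lemmas symb_cong = bnd.cls_cong[OF _ _ R_pos]
lemmas small_cong = sqi.cls_cong[OF _ _ R_pos]
lemmas symb_add = bnd.cls_add[OF _ _ R_pos]
lemmas small_add = sqi.cls_add[OF _ _ R_pos]
lemmas symb_pd = bnd.cls_pd[of R]
lemmas small_pd = sqi.cls_pd[of R]

lemma symb_bounded_linear: "bounded_linear T \<Longrightarrow> symb a f \<Longrightarrow> symb a (\<lambda>x. T (f x))"
  by (rule cls_bounded_linear[OF _ bnd.decay_class_axioms bnd.decay_class_axioms _ _ R_pos])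
    (auto intro: bnd_bounded_linear)

lemma small_bounded_linear: "bounded_linear T \<Longrightarrow> small a f \<Longrightarrow> small a (\<lambda>x. T (f x))"
  by (rule cls_bounded_linear[OF _ sqi.decay_class_axioms sqi.decay_class_axioms _ _ R_pos])
    (auto intro: sqi_bounded_linear)

lemma symb_mult:
  fixes f g :: "real^3 \<Rightarrow> 'b::real_normed_algebra"
  shows "symb a f \<Longrightarrow> symb b g \<Longrightarrow> symb (a + b) (\<lambda>x. f x * g x)"
  by (rule cls_mult[OF bnd.decay_class_axioms bnd.decay_class_axioms bnd.decay_class_axioms _ _ _ R_pos])
    (auto intro: bnd_times_bnd)

lemma symb_small_mult:
  fixes f g :: "real^3 \<Rightarrow> 'b::real_normed_algebra"
  shows "symb a f \<Longrightarrow> small b g \<Longrightarrow> small (a + b) (\<lambda>x. f x * g x)"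
  by (rule cls_mult[OF bnd.decay_class_axioms sqi.decay_class_axioms sqi.decay_class_axioms _ _ _ R_pos])
    (auto intro: bnd_times_sqi)

lemma symb_minus: "symb a f \<Longrightarrow> symb a (\<lambda>x. - f x)"
  by (rule symb_bounded_linear[OF bounded_linear_minus[OF bounded_linear_ident]])

lemma small_minus: "small a f \<Longrightarrow> small a (\<lambda>x. - f x)"
  by (rule small_bounded_linear[OF bounded_linear_minus[OF bounded_linear_ident]])

lemma symb_diff: "symb a f \<Longrightarrow> symb a g \<Longrightarrow> symb a (\<lambda>x. f x - g x)"
  using symb_add[of a f "\<lambda>x. - g x"] symb_minus[of a g] by simp

lemma small_diff: "small a f \<Longrightarrow> small a g \<Longrightarrow> small a (\<lambda>x. f x - g x)"
  using small_add[of a f "\<lambda>x. - g x"] small_minus[of a g] by simp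

lemma symb_cmult: "symb a f \<Longrightarrow> symb a (\<lambda>x. c * f x :: 'b::real_normed_algebra)"
  by (rule symb_bounded_linear[OF bounded_linear_mult_right])

lemma small_cmult: "small a f \<Longrightarrow> small a (\<lambda>x. c * f x :: 'b::real_normed_algebra)"
  by (rule small_bounded_linear[OF bounded_linear_mult_right])

lemma symb_of_real: "symb a f \<Longrightarrow> symb a (\<lambda>x. complex_of_real (f x))"
  by (rule symb_bounded_linear[OF bounded_linear_of_real])

lemma small_of_real: "small a f \<Longrightarrow> small a (\<lambda>x. complex_of_real (f x))"
  by (rule small_bounded_linear[OF bounded_linear_of_real])

lemma symb_imp_small:
  assumes "a < \<delta>" "symb a f"
  shows "small \<delta> f"
proof -
  obtain \<rho> where r: "\<rho> > R" "\<And>n. jet n (bnd \<rho>) a f" using assms unfolding cls_def by blast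
  have "jet n (sqi \<rho>) (a + (\<delta> - a)) f" for n
    by (rule jet_shift[OF _ r(2)], erule bnd_imp_sqi[rotated 2]) (use assms r R_pos in auto)
  then show ?thesis using assms r unfolding cls_def by auto
qed

lemma symb_mono:
  assumes "a \<le> b" "symb a f"
  shows "symb b f"
proof -
  obtain \<rho> where r: "\<rho> > R" "\<And>n. jet n (bnd \<rho>) a f" using assms unfolding cls_def by blast
  have "jet n (bnd \<rho>) (a + (b - a)) f" for n
    by (rule jet_shift[OF _ r(2)], erule bnd_mono[rotated 2]) (use assms r R_pos in auto)
  then show ?thesis using assms r unfolding cls_def by auto
qed

text \<open>The weighted Sobolev bound for each derivative in turn. The order is kept; only the
  radius is doubled.\<close>

lemma small_imp_symb:
  fixes f :: "real^3 \<Rightarrow> 'b::banach"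
  assumes "small \<delta> f"
  shows "symb \<delta> f"
proof -
  obtain \<rho> where r: "\<rho> > R" "\<And>n. jet n (sqi \<rho>) \<delta> f" using assms unfolding cls_def by blast
  have r0: "\<rho> > 0" using r R_pos by simp
  have f: "smooth f" using assms by (rule small_smooth)
  have w: "weighted_norm_finite norm (ext \<rho>) (\<delta> - real (length is)) (pds is f)" for "is"
    using r(2)[of "length is"] unfolding jet_pds sqi_def by auto
  have "\<exists>C. \<forall>x. 2 * \<rho> < norm x \<longrightarrow> norm (pds is f x) \<le> C * norm x powr (\<delta> - real (length is))" for "is"
  proof (rule weighted_sobolev_bound[OF r0])
    show s: "smooth_on (ext \<rho>) (pds is f)"
      using smooth_on_ext_antimono[OF smooth_on_pds[OF f]] r(1) by auto
    show "(\<integral>\<^sup>+z\<in>ext \<rho>. ennreal (norm z powr (- 2 * (\<delta> - real (length is)) - 3) * jet_sq (pds is f) (norm z) z) \<partial>lborel) < \<infinity>"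
    proof (rule jet_sq_integral_finite[OF r0 s w])
      show "weighted_norm_finite norm (ext \<rho>) (\<delta> - real (length is) - 1) (pd i (pds is f))" for i
        using w[of "i # is"] by (simp add: algebra_simps)
      show "weighted_norm_finite norm (ext \<rho>) (\<delta> - real (length is) - 2) (pd j (pd i (pds is f)))" for i j
        using w[of "j # i # is"] by (simp add: algebra_simps)
    qed
  qed
  moreover have "2 * \<rho> > R" using r R_pos by simp
  ultimately show ?thesis unfolding cls_bnd_iff using f by blast
qed

lemma small_symb_mult:
  fixes f g :: "real^3 \<Rightarrow> 'b::real_normed_field"
  shows "small a f \<Longrightarrow> symb b g \<Longrightarrow> small (a + b) (\<lambda>x. f x * g x)"
  using symb_small_mult[of b g a f] by (simp add: mult.commute add.commute)

lemma symb_zero: "symb a (\<lambda>x. 0 :: 'b::real_normed_vector)"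
proof -
  have b: "bnd \<rho> a (\<lambda>x. 0 :: 'b)" for \<rho> a by (auto simp: bnd_def intro!: exI[of _ 0])
  have z: "pd i (\<lambda>x. 0 :: 'b) = (\<lambda>x. 0)" for i by auto
  have "jet n (bnd \<rho>) a (\<lambda>x. 0 :: 'b)" for n \<rho>
    by (induction n arbitrary: a) (simp_all add: b z)
  then show ?thesis unfolding cls_def by (auto intro!: exI[of _ "R + 1"])
qed

lemma small_zero: "small a (\<lambda>x. 0)"
  by (rule symb_imp_small[of "a - 1"]) (auto intro: symb_zero)

lemma symb_const: "symb 0 (\<lambda>x. c)"
proof (rule bnd.cls_SucI[where \<rho> = "R + 1"])
  show "bnd (R + 1) 0 (\<lambda>x. c)" unfolding bnd_def
    using R_pos by (intro conjI exI[of _ "norm c"]) auto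
  have "pd i (\<lambda>x. c) = (\<lambda>x. 0)" for i by auto
  then show "symb (0 - 1) (pd i (\<lambda>x. c))" for i using symb_zero by simp
qed auto

lemma symb_sum: "(\<And>k. k \<in> I \<Longrightarrow> symb a (f k)) \<Longrightarrow> symb a (\<lambda>x. \<Sum>k\<in>I. f k x)"
  by (induction I rule: infinite_finite_induct) (auto intro: symb_zero symb_add)

lemma small_sum: "(\<And>k. k \<in> I \<Longrightarrow> small a (f k)) \<Longrightarrow> small a (\<lambda>x. \<Sum>k\<in>I. f k x)"
  by (induction I rule: infinite_finite_induct) (auto intro: small_zero small_add)

lemma symb_bound:
  assumes "symb a f"
  obtains \<rho> C where "\<rho> > R" "\<And>x. \<rho> < norm x \<Longrightarrow> norm (f x) \<le> C * norm x powr a"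
  using assms unfolding cls_def by (metis jet.simps(1) bnd_def)

lemma pd_homogeneous:
  assumes f: "smooth_on (- {0}) f" and h: "\<And>t x. t > 0 \<Longrightarrow> x \<noteq> 0 \<Longrightarrow> f (t *\<^sub>R x) = t powr a *\<^sub>R f x"
    and t: "t > 0" "x \<noteq> 0"
  shows "pd i f (t *\<^sub>R x) = t powr (a - 1) *\<^sub>R pd i f x"
proof -
  have o: "open (- {0 :: real^3})" by auto
  have d: "f differentiable at y" if "y \<noteq> 0" for y using smooth_on_imp_diff[OF o f, of y] that by auto
  have "((\<lambda>y. f (t *\<^sub>R y)) has_derivative (\<lambda>h. frechet_derivative f (at (t *\<^sub>R x)) (t *\<^sub>R h))) (at x)"
    by (rule has_derivative_compose[OF _ frechet_derivative_worksI[OF d]])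
      (use t in \<open>auto intro!: derivative_eq_intros\<close>)
  from pd_eqI[OF this, of i] have "pd i (\<lambda>y. f (t *\<^sub>R y)) x = t *\<^sub>R pd i f (t *\<^sub>R x)"
    using linear_scale[OF linear_frechet_derivative[OF d, of "t *\<^sub>R x"]] t by (simp add: pd_def)
  moreover have "pd i (\<lambda>y. f (t *\<^sub>R y)) x = pd i (\<lambda>y. t powr a *\<^sub>R f y) x"
    by (rule pd_cong_open[OF o]) (use h t in auto)
  moreover have "\<dots> = t powr a *\<^sub>R pd i f x"
    by (rule pd_bounded_linear[OF bounded_linear_scaleR_right d[OF t(2)]])
  ultimately have "(1 / t) *\<^sub>R (t *\<^sub>R pd i f (t *\<^sub>R x)) = (1 / t) *\<^sub>R (t powr a *\<^sub>R pd i f x)" by simp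
  then show ?thesis using t by (simp add: powr_diff)
qed

text \<open>Each derivative lowers the degree of homogeneity by one and is bounded on the unit
  sphere by compactness. All leading terms enter the calculus in this way.\<close>

lemma symb_homogeneous:
  assumes f: "smooth_on (- {0}) f" and h: "\<And>t x. t > 0 \<Longrightarrow> x \<noteq> 0 \<Longrightarrow> f (t *\<^sub>R x) = t powr a *\<^sub>R f x"
  shows "symb a f"
proof -
  have "- {0} \<supseteq> ext R" using R_pos by auto
  then have sf: "smooth f" using f smooth_on_subset by blast
  have "\<exists>C. \<forall>x. R + 1 < norm x \<longrightarrow> norm (pds is f x) \<le> C * norm x powr (a - real (length is))" for "is"
  proof -
  have hom: "pds is f (t *\<^sub>R x) = t powr (a - real (length is)) *\<^sub>R pds is f x" if "t > 0" "x \<noteq> 0" for t x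
    using that
  proof (induction "is" arbitrary: t x)
    case (Cons i "is")
    have "pd i (pds is f) (t *\<^sub>R x) = t powr (a - real (length is) - 1) *\<^sub>R pd i (pds is f) x"
      by (rule pd_homogeneous[OF smooth_on_pds[OF f] Cons.IH Cons.prems])
    then show ?case by (simp add: algebra_simps)
  qed (use h in auto)
  have "compact (pds is f ` sphere 0 1)"
    by (intro compact_continuous_image continuous_on_subset[OF smooth_on_imp_continuous[OF smooth_on_pds[OF f]]]) auto
  then obtain B where B: "\<And>y. norm y = 1 \<Longrightarrow> norm (pds is f y) \<le> B"
    using compact_imp_bounded[THEN bounded_iff[THEN iffD1]] by (metis image_eqI mem_sphere_0)
  have "norm (pds is f x) \<le> B * norm x powr (a - real (length is))" if "R + 1 < norm x" for x
  proof -
    have x: "norm x > 0" using that R_pos by linarith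
    then have "pds is f x = norm x powr (a - real (length is)) *\<^sub>R pds is f (x /\<^sub>R norm x)"
      using hom[of "norm x" "x /\<^sub>R norm x"] by auto
    also have "norm \<dots> \<le> norm x powr (a - real (length is)) * B"
      using x by (auto intro!: mult_left_mono B)
    finally show ?thesis by (simp add: mult.commute)
  qed
  then show ?thesis by blast
  qed
  moreover have "R < R + 1" by simp
  ultimately show ?thesis unfolding cls_bnd_iff using sf by blast
qed

lemma symb_coord: "symb 1 (\<lambda>x. x $ j)"
  by (rule symb_homogeneous) (auto intro!: smooth_on_coord)

lemma symb_norm_powr: "symb a (\<lambda>x. norm x powr a)"
  by (rule symb_homogeneous) (auto intro!: smooth_on_powr smooth_on_norm simp: powr_mult)

text \<open>Integration along the ray from the sphere of radius \<open>\<rho> + 1\<close>. The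
  values on this sphere are bounded by compactness, and for \<open>a > 0\<close> the growing power
  absorbs them.\<close>

lemma symb_integrate_outwards:
  fixes f :: "real^3 \<Rightarrow> 'b::real_normed_vector"
  assumes f: "smooth f" and a: "a > 0" and d: "\<And>i. symb (a - 1) (pd i f)"
  shows "symb a f"
proof -
  have "\<exists>\<rho> C. \<rho> > R \<and> (\<forall>x. \<rho> < norm x \<longrightarrow> norm (pd i f x) \<le> C * norm x powr (a - 1))" for i
    by (rule symb_bound[OF d[of i]]) blast
  then obtain r C where rC: "\<And>i. r i > R" "\<And>i x. r i < norm x \<Longrightarrow> norm (pd i f x) \<le> C i * norm x powr (a - 1)"
    by metis
  define \<rho> where "\<rho> = Max (range r)"
  define M where "M = (\<Sum>i\<in>UNIV. \<bar>C i\<bar>)"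
  have r: "r i \<le> \<rho>" for i unfolding \<rho>_def by auto
  have \<rho>: "\<rho> > R" "\<rho> > 0" using rC(1)[of 1] r[of 1] R_pos by auto
  have CM: "C i \<le> M" for i unfolding M_def using member_le_sum[of i UNIV "\<lambda>i. \<bar>C i\<bar>"] by simp
  have M: "norm (pd i f z) \<le> M * norm z powr (a - 1)" if "\<rho> < norm z" for z i
  proof -
    have "norm (pd i f z) \<le> C i * norm z powr (a - 1)" using rC(2) r[of i] that by auto
    also have "\<dots> \<le> M * norm z powr (a - 1)" by (intro mult_right_mono CM) simp
    finally show ?thesis .
  qed
  have M0: "M \<ge> 0" unfolding M_def by (simp add: sum_nonneg)
  have df: "f differentiable at z" if "\<rho> < norm z" for z
    using smooth_on_imp_diff[OF open_ext f, of z] that \<rho> by auto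
  have "compact (f ` sphere 0 (\<rho> + 1))"
    by (intro compact_continuous_image continuous_on_subset[OF smooth_on_imp_continuous[OF f]]) (use \<rho> in auto)
  then obtain B where B: "\<And>y. norm y = \<rho> + 1 \<Longrightarrow> norm (f y) \<le> B"
    using compact_imp_bounded[THEN bounded_iff[THEN iffD1]] by (metis image_eqI mem_sphere_0)
  have "norm (f x) \<le> (B / (\<rho> + 1) powr a + 3 * M / a) * norm x powr a" if x: "\<rho> + 1 < norm x" for x
  proof -
    define y where "y = ((\<rho> + 1) / norm x) *\<^sub>R x"
    have x0: "norm x > 0" using x \<rho> by linarith
    have y: "norm y = \<rho> + 1" using x0 \<rho> by (simp add: y_def)
    have B0: "B \<ge> 0" using B[OF y] norm_ge_zero order_trans by blast
    have "norm (f (1 *\<^sub>R x) - f (((\<rho> + 1) / norm x) *\<^sub>R x)) \<le>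
        3 * M / a * (norm (1 *\<^sub>R x) powr a - norm (((\<rho> + 1) / norm x) *\<^sub>R x) powr a)"
      by (rule radial_increment[OF df M]) (use x x0 \<rho> a y in \<open>auto simp: y_def\<close>)
    then have "norm (f x - f y) \<le> 3 * M / a * norm x powr a - 3 * M / a * (\<rho> + 1) powr a"
      using y by (simp add: y_def[symmetric] right_diff_distrib)
    moreover have "3 * M / a * (\<rho> + 1) powr a \<ge> 0" using M0 a by simp
    ultimately have "norm (f x) \<le> B + 3 * M / a * norm x powr a"
      using B[OF y] norm_triangle_ineq2[of "f x" "f y"] by linarith
    moreover have "B \<le> B / (\<rho> + 1) powr a * norm x powr a"
    proof -
      have "B * (\<rho> + 1) powr a \<le> B * norm x powr a" using B0 x \<rho> a by (intro mult_left_mono powr_mono2) auto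
      then show ?thesis using \<rho> by (simp add: field_simps)
    qed
    ultimately show ?thesis by (simp add: distrib_right)
  qed
  moreover have "f differentiable_on ext (\<rho> + 1)"
    using df by (auto simp: differentiable_on_eq_differentiable_at)
  ultimately have "bnd (\<rho> + 1) a f" unfolding bnd_def by blast
  then show ?thesis using \<rho> by (intro bnd.cls_SucI[OF f _ _ d]) auto
qed

text \<open>The pointwise bounds supply the constant through \<open>limit_at_infinity\<close>;
  Hardy's inequality then gives membership at the order \<open>\<delta>\<close> itself, which the
  pointwise bounds give only at larger orders.\<close>

lemma small_integrate_inwards:
  fixes f :: "real^3 \<Rightarrow> 'b::banach"
  assumes f: "smooth f" and \<delta>: "\<delta> < 0" and d: "\<And>i. small (\<delta> - 1) (pd i f)"
  shows "\<exists>C. small \<delta> (\<lambda>x. f x - C)"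
proof -
  have "\<exists>\<rho> C. \<rho> > R \<and> (\<forall>x. \<rho> < norm x \<longrightarrow> norm (pd i f x) \<le> C * norm x powr (\<delta> - 1))" for i
    by (rule symb_bound[OF small_imp_symb[OF d[of i]]]) blast
  then obtain r C where rC: "\<And>i. r i > R" "\<And>i x. r i < norm x \<Longrightarrow> norm (pd i f x) \<le> C i * norm x powr (\<delta> - 1)"
    by metis
  from d have "\<forall>i. \<exists>\<rho>>R. \<forall>n. jet n (sqi \<rho>) (\<delta> - 1) (pd i f)" unfolding cls_def by blast
  then obtain r' where r': "\<And>i. r' i > R" "\<And>i n. jet n (sqi (r' i)) (\<delta> - 1) (pd i f)" by metis
  define \<rho> where "\<rho> = max (Max (range r)) (Max (range r'))"
  define M where "M = (\<Sum>i\<in>UNIV. \<bar>C i\<bar>)"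
  have r: "r i \<le> \<rho>" "r' i \<le> \<rho>" for i unfolding \<rho>_def by (auto simp: le_max_iff_disj)
  have \<rho>: "\<rho> > R" "\<rho> > 0" using rC(1)[of 1] r[of 1] R_pos by auto
  have CM: "C i \<le> M" for i unfolding M_def using member_le_sum[of i UNIV "\<lambda>i. \<bar>C i\<bar>"] by simp
  have M: "norm (pd i f z) \<le> M * norm z powr (\<delta> - 1)" if "\<rho> < norm z" for z i
  proof -
    have "norm (pd i f z) \<le> C i * norm z powr (\<delta> - 1)" using rC(2) r[of i] that by auto
    also have "\<dots> \<le> M * norm z powr (\<delta> - 1)" by (intro mult_right_mono CM) simp
    finally show ?thesis .
  qed
  have df: "f differentiable at z" if "\<rho> < norm z" for z
    using smooth_on_imp_diff[OF open_ext f, of z] that \<rho> by auto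
  obtain L K where L: "\<And>x. \<rho> < norm x \<Longrightarrow> norm (f x - L) \<le> K * norm x powr \<delta>"
    using limit_at_infinity[OF df M \<delta> \<rho>(2)] by blast
  let ?g = "\<lambda>x. f x - L"
  have pdg: "pd i ?g x = pd i f x" if "R < norm x" for i x
    using pd_diff[of f x "\<lambda>_. L" i] smooth_on_imp_diff[OF open_ext f, of x] that by simp
  have g: "smooth ?g" by (intro smooth_on_diff f) auto
  have dg: "small (\<delta> - 1) (pd i ?g)" for i by (rule small_cong[OF d]) (simp add: pdg)
  have "weighted_norm_finite norm (ext \<rho>) \<delta> ?g"
  proof (rule hardy[OF smooth_on_ext_antimono[OF g] \<rho>(2) \<delta>])
    show "((\<lambda>t. f (t *\<^sub>R x) - L) \<longlongrightarrow> 0) at_top" if x: "\<rho> < norm x" for x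
    proof (rule Lim_null_comparison)
      have "((\<lambda>t. K * (t * norm x) powr \<delta>) \<longlongrightarrow> K * 0) at_top"
        using x \<rho> \<delta> by (intro tendsto_intros tendsto_neg_powr filterlim_tendsto_pos_mult_at_top[OF tendsto_const, of "norm x", unfolded mult.commute[of "norm x"]] filterlim_ident) auto
      then show "((\<lambda>t. K * (t * norm x) powr \<delta>) \<longlongrightarrow> 0) at_top" by simp
      show "\<forall>\<^sub>F t in at_top. norm (f (t *\<^sub>R x) - L) \<le> K * (t * norm x) powr \<delta>"
      proof (rule eventually_at_top_linorderI[of 1])
        fix t :: real assume t: "1 \<le> t"
        have "norm x \<le> t * norm x" using t by (simp add: mult_le_cancel_right1)
        then show "norm (f (t *\<^sub>R x) - L) \<le> K * (t * norm x) powr \<delta>"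
          using L[of "t *\<^sub>R x"] t x by simp
      qed
    qed
    show "weighted_norm_finite norm (ext \<rho>) (\<delta> - 1) (pd i ?g)" for i
    proof -
      have s: "sqi \<rho> (\<delta> - 1) (pd i f)" using sqi_antimono[OF jet_0D[OF r'(2)[of 0]] r(2)] .
      then have "sqi \<rho> (\<delta> - 1) (pd i ?g)"
        by (rule jet_class.G_cong[OF jet_class_sqi[OF \<rho>(2)]]) (use \<rho> pdg in auto)
      then show ?thesis by (simp add: sqi_def)
    qed
  qed (use \<rho> in auto)
  moreover have "?g differentiable_on ext \<rho>"
    using df by (auto simp: differentiable_on_eq_differentiable_at intro!: differentiable_diff)
  ultimately have "sqi \<rho> \<delta> ?g" unfolding sqi_def by blast
  then show ?thesis using sqi.cls_SucI[OF g \<rho>(1) _ dg] by blast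
qed

text \<open>Both \<open>f\<close> and \<open>f - C\<close> tend to 0, hence the constant of
  integration vanishes.\<close>

lemma small_integrate_inwards_null:
  fixes f :: "real^3 \<Rightarrow> 'b::banach"
  assumes "symb a f" "a < 0" "\<delta> < 0" "\<And>i. small (\<delta> - 1) (pd i f)"
  shows "small \<delta> f"
proof -
  obtain C where C: "small \<delta> (\<lambda>x. f x - C)"
    using small_integrate_inwards[OF symb_smooth[OF assms(1)] assms(3,4)] by blast
  have "symb (max a \<delta>) (\<lambda>x. f x - (f x - C))"
    by (intro symb_diff symb_mono[OF _ assms(1)] symb_mono[OF _ small_imp_symb[OF C]]) auto
  then obtain \<rho> K where r: "\<rho> > R" "\<And>x::real^3. \<rho> < norm x \<Longrightarrow> norm (f x - (f x - C)) \<le> K * norm x powr (max a \<delta>)"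
    by (rule symb_bound) blast
  have "norm C \<le> 0"
  proof (rule tendsto_lowerbound)
    show "((\<lambda>t. K * t powr (max a \<delta>)) \<longlongrightarrow> 0) at_top"
      using tendsto_mult[OF tendsto_const tendsto_neg_powr[OF _ filterlim_ident], of "max a \<delta>" K] assms by simp
    show "\<forall>\<^sub>F t in at_top. norm C \<le> K * t powr (max a \<delta>)"
    proof (rule eventually_at_top_linorderI[of "\<rho> + 1"])
      fix t assume "\<rho> + 1 \<le> t"
      then show "norm C \<le> K * t powr (max a \<delta>)"
        using r(2)[of "t *\<^sub>R axis 1 1"] r(1) R_pos by (simp add: norm_axis_1)
    qed
  qed simp
  then show ?thesis using C by simp
qed

end

section \<open>The leading parts of the metric and of the extrinsic curvature as symbols\<close>

lemma open_punctured [simp]: "open (- {0 :: real^3})"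
  by auto

lemma inner_eq_sum3: "x \<bullet> y = (\<Sum>i\<in>UNIV. x $ i * y $ i)" for x y :: "real^3"
  by (simp add: inner_vec_def)

lemma smooth_on_n_dot: "smooth_on (- {0}) (n_dot p)"
proof (rule smooth_on_cong[OF open_punctured])
  show "smooth_on (- {0}) (\<lambda>x. (\<Sum>i\<in>UNIV. x $ i * p $ i) * norm x powr (- 1))"
    by (intro smooth_on_mult smooth_on_sum smooth_on_powr smooth_on_norm smooth_on_coord) auto
  show "(\<Sum>i\<in>UNIV. x $ i * p $ i) * norm x powr (- 1) = n_dot p x" for x
    by (simp add: n_dot_def inner_eq_sum3 powr_minus_divide)
qed

lemma n_dot_scale: "t > 0 \<Longrightarrow> n_dot p (t *\<^sub>R x) = n_dot p x"
  by (simp add: n_dot_def)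

lemma adm_mass_pos: "E\<^sup>2 - p \<bullet> p > 0 \<Longrightarrow> adm_mass E p > 0"
  by (simp add: adm_mass_def)

lemma W_pos: "E\<^sup>2 - p \<bullet> p > 0 \<Longrightarrow> (adm_mass E p)\<^sup>2 + q\<^sup>2 > 0"
  using adm_mass_pos[of E p] by (simp add: add_pos_nonneg)

lemma smooth_on_W_powr:
  assumes "E\<^sup>2 - p \<bullet> p > 0"
  shows "smooth_on (- {0}) (\<lambda>x. ((adm_mass E p)\<^sup>2 + (n_dot p x)\<^sup>2) powr a)"
  using W_pos[OF assms] unfolding power2_eq_square[of "n_dot p _"]
  by (intro smooth_on_powr smooth_on_add smooth_on_mult smooth_on_n_dot)
    (auto simp flip: power2_eq_square)

lemma decay_alpha_eq:
  assumes "E\<^sup>2 - p \<bullet> p > 0"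
  shows "decay_alpha E p x = (2 * (adm_mass E p)\<^sup>2 + 4 * (n_dot p x * n_dot p x)) *
    ((adm_mass E p)\<^sup>2 + (n_dot p x)\<^sup>2) powr (- 1/2) - 2 * E"
  using powr_minus_half[OF W_pos[OF assms, of "n_dot p x"]]
  by (simp add: decay_alpha_def Let_def power2_eq_square)

lemma decay_beta_eq:
  assumes "E\<^sup>2 - p \<bullet> p > 0"
  shows "decay_beta E p x = n_dot p x * (E * (3 * (adm_mass E p)\<^sup>2 + 2 * (n_dot p x * n_dot p x))) *
    ((adm_mass E p)\<^sup>2 + (n_dot p x)\<^sup>2) powr (- 3/2)"
  using powr_minus_divide[of "(adm_mass E p)\<^sup>2 + (n_dot p x)\<^sup>2" "3/2"]
  by (simp add: decay_beta_def Let_def power2_eq_square)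

lemma smooth_on_decay_alpha: "E\<^sup>2 - p \<bullet> p > 0 \<Longrightarrow> smooth_on (- {0}) (decay_alpha E p)"
  by (rule smooth_on_cong[OF open_punctured _ decay_alpha_eq[symmetric]])
    (auto intro!: smooth_on_diff smooth_on_mult smooth_on_add smooth_on_n_dot smooth_on_W_powr)

lemma smooth_on_decay_beta: "E\<^sup>2 - p \<bullet> p > 0 \<Longrightarrow> smooth_on (- {0}) (decay_beta E p)"
  by (rule smooth_on_cong[OF open_punctured _ decay_beta_eq[symmetric]])
    (auto intro!: smooth_on_diff smooth_on_mult smooth_on_add smooth_on_n_dot smooth_on_W_powr)

definition h_lead :: "real \<Rightarrow> real^3 \<Rightarrow> 3 \<Rightarrow> 3 \<Rightarrow> real^3 \<Rightarrow> real" where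
  "h_lead E p i j x = - (1 + 2 * E / norm x) * kronecker i j
    - decay_alpha E p x / norm x * (2 * x $ i * x $ j / (norm x)\<^sup>2 - kronecker i j)"

definition K_lead :: "real \<Rightarrow> real^3 \<Rightarrow> 3 \<Rightarrow> 3 \<Rightarrow> real^3 \<Rightarrow> real" where
  "K_lead E p i j x = decay_beta E p x / (norm x)\<^sup>2 * (2 * x $ i * x $ j / (norm x)\<^sup>2 - kronecker i j)"

lemma schwarzschildean_decay_lead:
  "schwarzschildean_decay w R h K E p \<longleftrightarrow> (\<forall>i j.
     o_inf w R (- 3/2) (\<lambda>x. h x $ i $ j - h_lead E p i j x) \<and>
     o_inf w R (- 5/2) (\<lambda>x. K x $ i $ j - K_lead E p i j x))"
  unfolding schwarzschildean_decay_def h_lead_def K_lead_def ..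

context exterior
begin

lemma symb_n_dot: "symb 0 (n_dot p)"
  by (rule symb_homogeneous[OF smooth_on_n_dot]) (simp add: n_dot_scale)

lemma symb_decay_alpha: "E\<^sup>2 - p \<bullet> p > 0 \<Longrightarrow> symb 0 (decay_alpha E p)"
  by (rule symb_homogeneous[OF smooth_on_decay_alpha]) (simp_all add: n_dot_scale decay_alpha_def)

lemma symb_decay_beta: "E\<^sup>2 - p \<bullet> p > 0 \<Longrightarrow> symb 0 (decay_beta E p)"
  by (rule symb_homogeneous[OF smooth_on_decay_beta]) (simp_all add: n_dot_scale decay_beta_def)

lemma symb_divide_norm:
  fixes f :: "real^3 \<Rightarrow> real"
  assumes "symb a f" shows "symb (a - 1) (\<lambda>x. f x / norm x)"
proof -
  have "symb (a + - 1) (\<lambda>x. f x * norm x powr (- 1))"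
    by (intro symb_mult assms symb_norm_powr)
  then show ?thesis using symb_cong[of "a - 1" "\<lambda>x. f x * norm x powr (- 1)"]
    by (simp add: powr_minus_divide)
qed

lemma symb_angular: "symb 0 (\<lambda>x. 2 * x $ i * x $ j / (norm x)\<^sup>2 - kronecker i j)"
proof -
  have 1: "symb (1 - 1) (\<lambda>x. x $ i / norm x)" for i by (rule symb_divide_norm[OF symb_coord])
  have "symb (0 + 0) (\<lambda>x. (x $ i / norm x) * (x $ j / norm x))" using symb_mult[OF 1 1] by simp
  then have "symb 0 (\<lambda>x. 2 * ((x $ i / norm x) * (x $ j / norm x)) - kronecker i j)"
    by (intro symb_diff symb_cmult symb_const) simp
  then show ?thesis by (rule symb_cong) (simp add: power2_eq_square)
qed

lemma symb_h_lead:
  assumes "E\<^sup>2 - p \<bullet> p > 0"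
  shows "symb (- 1) (\<lambda>x. h_lead E p i j x + kronecker i j)"
proof -
  have "symb (0 - 1 + 0) (\<lambda>x. decay_alpha E p x / norm x * (2 * x $ i * x $ j / (norm x)\<^sup>2 - kronecker i j))"
    by (intro symb_mult symb_divide_norm symb_decay_alpha symb_angular assms)
  moreover have "symb (0 - 1) (\<lambda>x. (2 * E * kronecker i j) / norm x)"
    by (intro symb_divide_norm symb_const)
  ultimately have "symb (- 1) (\<lambda>x. - ((2 * E * kronecker i j) / norm x) -
      decay_alpha E p x / norm x * (2 * x $ i * x $ j / (norm x)\<^sup>2 - kronecker i j))"
    by (intro symb_diff symb_minus) simp_all
  then show ?thesis by (rule symb_cong) (simp add: h_lead_def algebra_simps)
qed

lemma symb_K_lead:
  assumes "E\<^sup>2 - p \<bullet> p > 0"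
  shows "symb (- 2) (K_lead E p i j)"
proof -
  have "symb (0 - 1 - 1 + 0) (\<lambda>x. decay_beta E p x / norm x / norm x * (2 * x $ i * x $ j / (norm x)\<^sup>2 - kronecker i j))"
    by (intro symb_mult symb_divide_norm symb_decay_beta symb_angular assms)
  then show ?thesis
    using symb_cong[of "- 2" "\<lambda>x. decay_beta E p x / norm x / norm x * (2 * x $ i * x $ j / (norm x)\<^sup>2 - kronecker i j)" "K_lead E p i j"]
    by (simp add: K_lead_def power2_eq_square)
qed

end

subsection \<open>Unweighted decay of the metric\<close>

text \<open>Continuity from above of the measure with density \<open>f\<close>, along exteriors of
  balls that shrink to the empty set.\<close>

lemma tail_integral_small:
  fixes f :: "real^3 \<Rightarrow> ennreal"
  assumes [measurable]: "f \<in> borel_measurable borel" and fin: "(\<integral>\<^sup>+x. f x \<partial>lborel) < \<infinity>" and e: "e > 0"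
  shows "\<exists>n. (\<integral>\<^sup>+x. f x * indicator (ext n) x \<partial>lborel) < ennreal e"
proof -
  let ?M = "density lborel f"
  have M: "emeasure ?M (ext (real n)) = (\<integral>\<^sup>+x. f x * indicator (ext (real n)) x \<partial>lborel)" for n
    by (rule emeasure_density) auto
  have "(\<lambda>n. emeasure ?M (ext (real n))) \<longlonglongrightarrow> emeasure ?M (\<Inter>n. ext (real n))"
  proof (rule Lim_emeasure_decseq)
    show "decseq (\<lambda>n. ext (real n))" by (auto simp: decseq_def)
    show "emeasure ?M (ext (real n)) \<noteq> \<infinity>" for n
    proof -
      have "emeasure ?M (ext (real n)) \<le> (\<integral>\<^sup>+x. f x \<partial>lborel)"
        unfolding M by (intro nn_integral_mono) (auto simp: indicator_def)
      then show ?thesis using fin by (metis infinity_ennreal_def leD)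
    qed
  qed auto
  moreover have "(\<Inter>n. ext (real n)) = {}"
  proof -
    have "\<exists>n. \<not> real n < norm x" for x :: "real^3" using real_arch_simple[of "norm x"] by (auto simp: not_less)
    then show ?thesis by auto
  qed
  ultimately have "(\<lambda>n. emeasure ?M (ext (real n))) \<longlonglongrightarrow> 0" by simp
  then have "eventually (\<lambda>n. emeasure ?M (ext (real n)) < ennreal e) sequentially"
    using e by (intro order_tendstoD(2)) auto
  then show ?thesis unfolding M by (auto simp: eventually_sequentially)
qed

text \<open>At \<open>\<delta> = - 3/2\<close> the exponent \<open>- 2\<delta> - 3\<close> of the weight vanishes, and it is positive for the
  derivatives, so that \<open>w \<ge> 1\<close> is all that is needed.\<close>

lemma unweighted_decay:
  fixes u :: "real^3 \<Rightarrow> real"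
  assumes R: "R > 0" and w: "\<And>x. w x \<ge> 1" and u: "o_inf w R (- 3/2) u" and e: "e > 0"
  shows "\<exists>\<rho>>R. \<forall>x. \<rho> < norm x \<longrightarrow> \<bar>u x\<bar> < e"
proof -
  obtain R' where R': "R' > R" "\<And>s. weighted_sobolev w (ext R') s (- 3/2) u" and su: "smooth_on (ext R) u"
    using u unfolding o_inf_def by blast
  have su': "smooth_on (ext R') u" using su R' smooth_on_ext_antimono[of R u R'] by auto
  define g where "g is x = ennreal ((norm (pds is u x))\<^sup>2) * indicator (ext R') x" for "is" x
  have [measurable]: "g is \<in> borel_measurable borel" for "is"
    unfolding g_def using smooth_on_imp_continuous[OF smooth_on_pds[OF su']]
    by (intro measurable_ennreal_indicator continuous_intros) auto
  have gfin: "(\<integral>\<^sup>+x. g is x \<partial>lborel) < \<infinity>" for "is"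
  proof -
    have "weighted_norm_finite w (ext R') (- 3/2 - real (length is)) (pds is u)"
      using R'(2)[of "length is"] unfolding weighted_sobolev_def by auto
    then have f: "(\<integral>\<^sup>+x\<in>ext R'. ennreal ((norm (pds is u x))\<^sup>2 * w x powr (2 * real (length is))) \<partial>lborel) < \<infinity>"
      unfolding weighted_norm_finite_def by simp
    have "(\<integral>\<^sup>+x. g is x \<partial>lborel) \<le> (\<integral>\<^sup>+x\<in>ext R'. ennreal ((norm (pds is u x))\<^sup>2 * w x powr (2 * real (length is))) \<partial>lborel)"
    proof (rule nn_integral_mono)
      fix x
      have "1 \<le> w x powr (2 * real (length is))" using w by (intro ge_one_powr_ge_zero) auto
      then have "(norm (pds is u x))\<^sup>2 * 1 \<le> (norm (pds is u x))\<^sup>2 * w x powr (2 * real (length is))"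
        by (intro mult_left_mono) auto
      then show "g is x \<le> ennreal ((norm (pds is u x))\<^sup>2 * w x powr (2 * real (length is))) * indicator (ext R') x"
        unfolding g_def by (intro mult_right_mono ennreal_leI) auto
    qed
    with f show ?thesis by (rule le_less_trans[rotated])
  qed
  define f where "f x = g [] x + ((\<Sum>i\<in>UNIV. g [i] x) + (\<Sum>i\<in>UNIV. \<Sum>j\<in>UNIV. g [j, i] x))" for x
  have f_eq: "f x = ennreal (jet_sq u 1 x) * indicator (ext R') x" for x
    unfolding f_def g_def jet_sq_def
    by (auto simp: indicator_def sum_nonneg sum_ennreal simp flip: ennreal_plus)
  have [measurable]: "f \<in> borel_measurable borel" unfolding f_def by measurable
  have ffin: "(\<integral>\<^sup>+x. f x \<partial>lborel) < \<infinity>"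
    unfolding f_def using gfin by (simp add: nn_integral_add nn_integral_sum less_top)
  define V where "V = unit_ball_vol 3"
  have V: "V > 0" unfolding V_def by simp
  \<comment> \<open>Here \<open>576 = 4 * 144\<close>, the constants of \<open>sobolev_ball\<close>
    and \<open>sob_density_sq_le\<close>.\<close>
  define e' where "e' = e\<^sup>2 * V / 576"
  have e': "e' > 0" using e V by (simp add: e'_def)
  obtain n where n: "(\<integral>\<^sup>+x. f x * indicator (ext n) x \<partial>lborel) < ennreal e'"
    using tail_integral_small[OF _ ffin e'] by auto
  have "\<bar>u x\<bar> < e" if x: "\<bar>n\<bar> + R' + 1 < norm x" for x
  proof -
    have b: "norm x - 1 < norm z" if "z \<in> ball x 1" for z
    proof -
      have "norm (x - z) < 1" using that by (simp add: dist_norm)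
      then show ?thesis using norm_triangle_ineq2[of x z] by linarith
    qed
    have sub: "z \<in> ext R'" "z \<in> ext n" if "z \<in> ball x 1" for z using b[OF that] x R' R by auto
    have "ennreal ((norm (u x))\<^sup>2 * (unit_ball_vol 3 * 1 ^ 3)) \<le>
        4 * (\<integral>\<^sup>+z. ennreal ((sob_density 1 u z)\<^sup>2) * indicator (ball x 1) z \<partial>lborel)"
      by (rule sobolev_ball[OF open_ext su']) (use sub in auto)
    also have "\<dots> \<le> 4 * (\<integral>\<^sup>+z. 144 * (f z * indicator (ext n) z) \<partial>lborel)"
    proof (intro mult_left_mono nn_integral_mono)
      fix z
      show "ennreal ((sob_density 1 u z)\<^sup>2) * indicator (ball x 1) z \<le> 144 * (f z * indicator (ext n) z)"
        using ennreal_leI[OF sob_density_sq_le[of 1 u z]] sub[of z] jet_sq_nonneg[of u 1 z]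
        by (auto simp: f_eq indicator_def ennreal_mult)
    qed simp
    also have "\<dots> = 576 * (\<integral>\<^sup>+z. f z * indicator (ext n) z \<partial>lborel)"
      by (subst nn_integral_cmult) (auto simp flip: mult.assoc)
    also have "\<dots> < 576 * ennreal e'" using n by (intro ennreal_mult_strict_left_mono) auto
    also have "\<dots> = ennreal (576 * e')" using e' by (simp add: ennreal_mult)
    finally have "(norm (u x))\<^sup>2 * V < 576 * e'" using e' by (subst (asm) ennreal_less_iff) (auto simp: V_def)
    then have "\<bar>u x\<bar>\<^sup>2 < e\<^sup>2" using V by (simp add: e'_def)
    then show ?thesis using e by (intro power2_less_imp_less[of "\<bar>u x\<bar>" e]) auto
  qed
  then show ?thesis using R R' by (intro exI[of _ "\<bar>n\<bar> + R' + 1"]) auto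
qed

text \<open>By Cauchy-Schwarz the square of the sum of the three absolute entries is at most
  \<open>3 * (norm v)\<^sup>2\<close>, so the deviation from the flat form is at most half of
  \<open>(norm v)\<^sup>2\<close>.\<close>

lemma quadratic_form_close:
  fixes H :: "real^3^3"
  assumes "\<And>i j. \<bar>H $ i $ j + kronecker i j\<bar> \<le> 1 / 6"
  shows "(norm v)\<^sup>2 / 2 \<le> - (v \<bullet> (H *v v))" "- (v \<bullet> (H *v v)) \<le> 3 / 2 * (norm v)\<^sup>2"
proof -
  have s: "v \<bullet> (H *v v) + (norm v)\<^sup>2 = (\<Sum>i\<in>UNIV. \<Sum>j\<in>UNIV. (H $ i $ j + kronecker i j) * (v $ i * v $ j))"
    unfolding power2_norm_eq_inner inner_eq_sum3 matrix_vector_mult_def kronecker_def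
    by (simp add: sum_distrib_left sum_3 algebra_simps)
  have "\<bar>v \<bullet> (H *v v) + (norm v)\<^sup>2\<bar> \<le> (\<Sum>i\<in>UNIV. \<Sum>j\<in>UNIV. 1/6 * (\<bar>v $ i\<bar> * \<bar>v $ j\<bar>))"
    unfolding s
  proof (rule order_trans[OF sum_abs], rule sum_mono, rule order_trans[OF sum_abs], rule sum_mono)
    fix i j
    show "\<bar>(H $ i $ j + kronecker i j) * (v $ i * v $ j)\<bar> \<le> 1/6 * (\<bar>v $ i\<bar> * \<bar>v $ j\<bar>)"
      unfolding abs_mult by (intro mult_right_mono assms) auto
  qed
  also have "\<dots> = 1/6 * (\<Sum>i\<in>UNIV. \<bar>v $ i\<bar>)\<^sup>2"
    unfolding power2_eq_square sum_product by (simp only: sum_distrib_left)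
  also have "\<dots> \<le> 1/6 * (3 * (\<Sum>i\<in>UNIV. \<bar>v $ i\<bar>\<^sup>2))"
    by (intro mult_left_mono sum_sq_le) auto
  also have "\<dots> = (norm v)\<^sup>2 / 2"
    unfolding power2_norm_eq_inner inner_eq_sum3 by (simp add: power2_eq_square)
  finally have "\<bar>v \<bullet> (H *v v) + (norm v)\<^sup>2\<bar> \<le> (norm v)\<^sup>2 / 2" .
  then show "(norm v)\<^sup>2 / 2 \<le> - (v \<bullet> (H *v v))" "- (v \<bullet> (H *v v)) \<le> 3 / 2 * (norm v)\<^sup>2"
    by linarith+
qed

text \<open>Half of the tolerance 1/6 is spent on the remainder, where only \<open>w \<ge> 1\<close>
  is available, and half on the leading part, a symbol of order -1.\<close>

lemma (in exterior) metric_close_to_flat: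
  assumes m: "E\<^sup>2 - p \<bullet> p > 0" and w: "\<And>x. w x \<ge> 1" and d: "schwarzschildean_decay w R h K E p"
  obtains \<rho> where "\<rho> > R" "\<And>x i j. \<rho> < norm x \<Longrightarrow> \<bar>h x $ i $ j + kronecker i j\<bar> \<le> 1 / 6"
proof -
  have "\<exists>\<rho>>R. \<forall>x. \<rho> < norm x \<longrightarrow> \<bar>h x $ i $ j + kronecker i j\<bar> \<le> 1 / 6" for i j
  proof -
    obtain \<rho>1 where 1: "\<rho>1 > R" "\<And>x. \<rho>1 < norm x \<Longrightarrow> \<bar>h x $ i $ j - h_lead E p i j x\<bar> < 1 / 12"
      using unweighted_decay[where w = w and R = R and u = "\<lambda>x. h x $ i $ j - h_lead E p i j x" and e = "1/12"] R_pos w d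
      unfolding schwarzschildean_decay_lead by auto
    obtain \<rho>2 C where 2: "\<rho>2 > R" "\<And>x. \<rho>2 < norm x \<Longrightarrow> norm (h_lead E p i j x + kronecker i j) \<le> C * norm x powr (- 1)"
      by (rule symb_bound[OF symb_h_lead[OF m, of i j]]) blast
    have "\<bar>h x $ i $ j + kronecker i j\<bar> \<le> 1 / 6" if x: "max (max \<rho>1 \<rho>2) (12 * \<bar>C\<bar>) < norm x" for x
    proof -
      have x0: "norm x > 0" using x R_pos 1(1) by linarith
      have "C * norm x powr (- 1) \<le> \<bar>C\<bar> / norm x"
        using x0 by (simp add: powr_minus_divide divide_right_mono)
      also have "\<dots> \<le> 1 / 12" using x x0 by (simp add: field_simps)
      finally have "C * norm x powr (- 1) \<le> 1 / 12" .
      moreover have "\<bar>h x $ i $ j - h_lead E p i j x\<bar> < 1 / 12" using x by (intro 1(2)) auto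
      moreover have "\<bar>h_lead E p i j x + kronecker i j\<bar> \<le> C * norm x powr (- 1)"
        using 2(2)[of x] x by auto
      ultimately show ?thesis by linarith
    qed
    then show ?thesis using 1(1) by (intro exI[of _ "max (max \<rho>1 \<rho>2) (12 * \<bar>C\<bar>)"]) auto
  qed
  then obtain r where r: "\<And>i j. r i j > R" "\<And>i j x. r i j < norm x \<Longrightarrow> \<bar>h x $ i $ j + kronecker i j\<bar> \<le> 1 / 6"
    by metis
  define \<rho> where "\<rho> = Max (range (case_prod r))"
  have "r i j \<le> \<rho>" for i j unfolding \<rho>_def by (rule Max_ge) (auto simp: image_iff)
  then show ?thesis using that[of \<rho>] r by (meson le_less_trans less_le_trans)
qed

subsection \<open>Lengths of paths\<close>

lemma quadratic_form_eq:
  "v \<bullet> (H *v v) = (\<Sum>i\<in>UNIV. v $ i * (\<Sum>j\<in>UNIV. H $ i $ j * v $ j))" for v :: "real^3"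
  by (simp add: inner_eq_sum3 matrix_vector_mult_def)

lemma has_length_nonneg:
  assumes "smooth_atlas \<A>" "has_length \<A> h \<gamma> L"
    and neg: "\<forall>c\<in>\<A>. \<forall>x\<in>chart_image c. \<forall>v. v \<bullet> (h c x *v v) \<le> 0"
  shows "L \<ge> 0"
proof -
  obtain F speed where F: "finite F" "(speed has_integral L) {0..1}"
    and s: "\<And>t c. t \<in> {0<..<1} - F \<Longrightarrow> c \<in> \<A> \<Longrightarrow> \<gamma> t \<in> fst c \<Longrightarrow>
      speed t = sqrt (- (vector_derivative (snd c \<circ> \<gamma>) (at t) \<bullet> (h c (snd c (\<gamma> t)) *v vector_derivative (snd c \<circ> \<gamma>) (at t))))"
    using assms(2) unfolding has_length_def Let_def by blast
  \<comment> \<open>At the exceptional times \<open>speed\<close> is arbitrary and might be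
    negative.\<close>
  have "((\<lambda>t. if t \<in> insert 0 (insert 1 F) then 0 else speed t) has_integral L) {0..1}"
    by (rule has_integral_spike_finite[OF _ _ F(2), of "insert 0 (insert 1 F)"]) (use F in auto)
  moreover have "(if t \<in> insert 0 (insert 1 F) then 0 else speed t) \<ge> 0" if "t \<in> {0..1}" for t
  proof (cases "t \<in> insert 0 (insert 1 F)")
    case False
    then have t: "t \<in> {0<..<1} - F" using that by auto
    obtain c where c: "c \<in> \<A>" "\<gamma> t \<in> fst c" using assms(1) unfolding smooth_atlas_def by blast
    have "speed t \<ge> 0" unfolding s[OF t c] using neg c by auto
    then show ?thesis using False by simp
  qed simp
  ultimately show ?thesis by (rule has_integral_nonneg)
qed

text \<open>On the reals \<open>Inf\<close> is a lower bound only of sets bounded below, which the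
  nonnegativity of lengths provides.\<close>

lemma riem_dist_le:
  assumes "smooth_atlas \<A>" "has_length \<A> h \<gamma> L" "\<gamma> 0 = p" "\<gamma> 1 = q"
    and neg: "\<forall>c\<in>\<A>. \<forall>x\<in>chart_image c. \<forall>v. v \<bullet> (h c x *v v) \<le> 0"
  shows "riem_dist \<A> h p q \<le> L"
  unfolding riem_dist_def
proof (rule cInf_lower)
  show "bdd_below {L. \<exists>\<gamma>. \<gamma> 0 = p \<and> \<gamma> 1 = q \<and> has_length \<A> h \<gamma> L}"
    using has_length_nonneg[OF assms(1) _ neg] by (intro bdd_belowI[of _ 0]) blast
qed (use assms in blast)

text \<open>The condition of \<open>has_length\<close> at a single time, isolated so that
  reparametrisations can be treated pointwise.\<close>

definition path_speed :: "'a::topological_space chart set \<Rightarrow> ('a chart \<Rightarrow> real^3 \<Rightarrow> real^3^3) \<Rightarrow> (real \<Rightarrow> 'a) \<Rightarrow> real \<Rightarrow> real \<Rightarrow> bool" where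
  "path_speed \<A> h \<gamma> t s \<longleftrightarrow> (\<forall>c\<in>\<A>. \<gamma> t \<in> fst c \<longrightarrow> (\<exists>e>0. (snd c \<circ> \<gamma>) C1_differentiable_on ball t e) \<and>
     (let v = vector_derivative (snd c \<circ> \<gamma>) (at t) in s = sqrt (- (v \<bullet> (h c (snd c (\<gamma> t)) *v v)))))"

lemma has_length_path_speed: "has_length \<A> h \<gamma> L \<longleftrightarrow> continuous_on {0..1} \<gamma> \<and>
   (\<exists>F speed. finite F \<and> (speed has_integral L) {0..1} \<and> (\<forall>t\<in>{0<..<1} - F. path_speed \<A> h \<gamma> t (speed t)))"
  unfolding has_length_def path_speed_def by (metis (no_types, opaque_lifting))

text \<open>Agreement near \<open>t\<close> is enough, so that this applies to each half of a joined
  path away from the junction.\<close>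

lemma path_speed_affine:
  assumes g: "path_speed \<A> h g (a * t + b) s" and a: "a > 0"
    and e: "e > 0" "\<And>u. u \<in> ball t e \<Longrightarrow> \<gamma> u = g (a * u + b)"
  shows "path_speed \<A> h \<gamma> t (a * s)"
  unfolding path_speed_def Let_def
proof (intro ballI impI)
  fix c assume c: "c \<in> \<A>" "\<gamma> t \<in> fst c"
  have gt: "\<gamma> t = g (a * t + b)" using e by auto
  obtain e1 where e1: "e1 > 0" "(snd c \<circ> g) C1_differentiable_on ball (a * t + b) e1"
    and s: "s = sqrt (- (vector_derivative (snd c \<circ> g) (at (a * t + b)) \<bullet> (h c (snd c (g (a * t + b))) *v vector_derivative (snd c \<circ> g) (at (a * t + b)))))"
    using g c unfolding path_speed_def Let_def gt by blast
  obtain D where D: "\<And>u. u \<in> ball (a * t + b) e1 \<Longrightarrow> ((snd c \<circ> g) has_vector_derivative D u) (at u)"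
    "continuous_on (ball (a * t + b) e1) D"
    using e1(2) unfolding C1_differentiable_on_def by blast
  define e2 where "e2 = min e (e1 / a)"
  have e2: "e2 > 0" using e e1 a by (simp add: e2_def)
  have inb: "a * u + b \<in> ball (a * t + b) e1" if "u \<in> ball t e2" for u
  proof -
    have "\<bar>t - u\<bar> < e1 / a" using that by (simp add: e2_def dist_real_def)
    then have "a * \<bar>t - u\<bar> < e1" using a by (simp add: field_simps)
    moreover have "dist (a * t + b) (a * u + b) = a * \<bar>t - u\<bar>"
      using a by (simp add: dist_real_def abs_mult flip: right_diff_distrib)
    ultimately show ?thesis by simp
  qed
  have d: "((snd c \<circ> \<gamma>) has_vector_derivative a *\<^sub>R D (a * u + b)) (at u)" if u: "u \<in> ball t e2" for u
  proof -
    have "((\<lambda>u. a * u + b) has_vector_derivative a) (at u)"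
      by (auto intro!: derivative_eq_intros)
    then have "(((snd c \<circ> g) \<circ> (\<lambda>u. a * u + b)) has_vector_derivative a *\<^sub>R D (a * u + b)) (at u)"
      using D(1)[OF inb[OF u]] by (rule vector_diff_chain_at)
    then show ?thesis
      by (rule has_vector_derivative_transform_within_open[of _ _ _ "ball t e2"])
        (use u e(2) in \<open>auto simp: e2_def\<close>)
  qed
  have "(snd c \<circ> \<gamma>) C1_differentiable_on ball t e2"
    unfolding C1_differentiable_on_def
    by (rule exI[of _ "\<lambda>u. a *\<^sub>R D (a * u + b)"])
      (use d inb in \<open>auto intro!: continuous_intros continuous_on_compose2[OF D(2)]\<close>)
  moreover have "vector_derivative (snd c \<circ> \<gamma>) (at t) = a *\<^sub>R vector_derivative (snd c \<circ> g) (at (a * t + b))"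
    using vector_derivative_at[OF d[of t]] vector_derivative_at[OF D(1)[OF inb[of t]]] e2 by simp
  moreover have "sqrt (- (a *\<^sub>R v \<bullet> (H *v (a *\<^sub>R v)))) = a * sqrt (- (v \<bullet> (H *v v)))" for v :: "real^3" and H :: "real^3^3"
  proof -
    have "- (a *\<^sub>R v \<bullet> (H *v (a *\<^sub>R v))) = a\<^sup>2 * (- (v \<bullet> (H *v v)))"
      by (simp add: matrix_vector_mult_scaleR power2_eq_square)
    then have "sqrt (- (a *\<^sub>R v \<bullet> (H *v (a *\<^sub>R v)))) = sqrt (a\<^sup>2) * sqrt (- (v \<bullet> (H *v v)))"
      by (simp only: real_sqrt_mult)
    moreover have "sqrt (a\<^sup>2) = a" using a by simp
    ultimately show ?thesis by (simp only:)
  qed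
  ultimately show "(\<exists>e>0. (snd c \<circ> \<gamma>) C1_differentiable_on ball t e) \<and>
      a * s = sqrt (- (vector_derivative (snd c \<circ> \<gamma>) (at t) \<bullet> (h c (snd c (\<gamma> t)) *v vector_derivative (snd c \<circ> \<gamma>) (at t))))"
    using e2 s gt by auto
qed

lemma has_length_join:
  assumes 1: "has_length \<A> h \<gamma>1 L1" and 2: "has_length \<A> h \<gamma>2 L2" and j: "\<gamma>1 1 = \<gamma>2 0"
  shows "has_length \<A> h (\<gamma>1 +++ \<gamma>2) (L1 + L2)"
proof -
  obtain F1 s1 where F1: "finite F1" "(s1 has_integral L1) {0..1}"
    and s1: "\<And>t. t \<in> {0<..<1} - F1 \<Longrightarrow> path_speed \<A> h \<gamma>1 t (s1 t)" and c1: "path \<gamma>1"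
    using 1 unfolding has_length_path_speed path_def by blast
  obtain F2 s2 where F2: "finite F2" "(s2 has_integral L2) {0..1}"
    and s2: "\<And>t. t \<in> {0<..<1} - F2 \<Longrightarrow> path_speed \<A> h \<gamma>2 t (s2 t)" and c2: "path \<gamma>2"
    using 2 unfolding has_length_path_speed path_def by blast
  define s where "s t = (if t \<le> 1/2 then 2 * s1 (2 * t) else 2 * s2 (2 * t - 1))" for t :: real
  \<comment> \<open>At the junction the velocity may jump, so 1/2 joins the rescaled exceptional
    times.\<close>
  define F where "F = insert (1/2) ((\<lambda>x. x / 2) ` F1 \<union> (\<lambda>x. (x + 1) / 2) ` F2)"
  have "((\<lambda>t. s1 (2 *\<^sub>R t + 0)) has_integral ((1 / \<bar>2\<bar> ^ DIM(real)) *\<^sub>R L1)) ((\<lambda>x. (1 / 2) *\<^sub>R x + - ((1 / 2) *\<^sub>R 0)) ` cbox 0 (1::real))"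
    by (rule has_integral_affinity) (use F1 in auto)
  then have "((\<lambda>t. s1 (2 * t)) has_integral L1 / 2) {0..1/2}"
    by (simp add: image_affinity_atLeastAtMost image_divide_atLeastAtMost)
  then have i1: "((\<lambda>t. 2 * s1 (2 * t)) has_integral L1) {0..1/2}"
    using has_integral_mult_right[of "\<lambda>t. s1 (2 * t)" "L1 / 2" _ 2] by simp
  have "((\<lambda>t. s2 (2 *\<^sub>R t + - 1)) has_integral ((1 / \<bar>2\<bar> ^ DIM(real)) *\<^sub>R L2)) ((\<lambda>x. (1 / 2) *\<^sub>R x + - ((1 / 2) *\<^sub>R (- 1))) ` cbox 0 (1::real))"
    by (rule has_integral_affinity) (use F2 in auto)
  moreover have "(\<lambda>x. (1 / 2) *\<^sub>R x + - ((1 / 2) *\<^sub>R (- 1))) ` cbox 0 (1::real) = {1/2..1}"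
    using image_affinity_atLeastAtMost[of "1/2" "1/2::real" 0 1] by simp
  ultimately have "((\<lambda>t. s2 (2 * t - 1)) has_integral L2 / 2) {1/2..1}" by simp
  then have i2: "((\<lambda>t. 2 * s2 (2 * t - 1)) has_integral L2) {1/2..1}"
    using has_integral_mult_right[of "\<lambda>t. s2 (2 * t - 1)" "L2 / 2" _ 2] by simp
  have "(s has_integral L1) {0..1/2}"
    by (rule has_integral_eq[OF _ i1]) (simp add: s_def)
  moreover have "(s has_integral L2) {1/2..1}"
    by (rule has_integral_spike_finite[OF _ _ i2, of "{1/2}"]) (auto simp: s_def)
  ultimately have "(s has_integral (L1 + L2)) {0..1}"
    by (intro has_integral_combine[of 0 "1/2" 1]) auto
  moreover have "path_speed \<A> h (\<gamma>1 +++ \<gamma>2) t (s t)" if t: "t \<in> {0<..<1} - F" for t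
  proof (cases "t < 1/2")
    case True
    have "2 * t \<notin> F1"
    proof
      assume "2 * t \<in> F1"
      then have "t \<in> (\<lambda>x. x / 2) ` F1" by (rule rev_image_eqI) simp
      then show False using t by (simp add: F_def)
    qed
    then have "path_speed \<A> h (\<gamma>1 +++ \<gamma>2) t (2 * s1 (2 * t + 0))"
      using True t by (intro path_speed_affine[OF s1, of 2 t 0 "1/2 - t"]) (auto simp: joinpaths_def dist_real_def)
    then show ?thesis using True by (simp add: s_def)
  next
    case False
    then have t1: "t > 1/2" using t by (auto simp: F_def)
    have "2 * t - 1 \<notin> F2"
    proof
      assume "2 * t - 1 \<in> F2"
      then have "t \<in> (\<lambda>x. (x + 1) / 2) ` F2" by (rule rev_image_eqI) simp
      then show False using t by (simp add: F_def)
    qed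
    then have "path_speed \<A> h (\<gamma>1 +++ \<gamma>2) t (2 * s2 (2 * t + - 1))"
      using t1 t by (intro path_speed_affine[OF s2, of 2 t "- 1" "t - 1/2"]) (auto simp: joinpaths_def dist_real_def)
    then show ?thesis using t1 by (simp add: s_def)
  qed
  moreover have "finite F" using F1 F2 by (simp add: F_def)
  moreover have "path (\<gamma>1 +++ \<gamma>2)" using c1 c2 j by (simp add: pathstart_def pathfinish_def)
  ultimately show ?thesis unfolding has_length_path_speed path_def by blast
qed

lemma matrix_frechet_derivative_mult:
  fixes f :: "real^3 \<Rightarrow> real^3"
  assumes "f differentiable at x"
  shows "jacobian f (at x) *v v = (\<Sum>i\<in>UNIV. v $ i *\<^sub>R pd i f x)"
  unfolding jacobian_def using matrix_works[of "frechet_derivative f (at x)" v] linear_frechet_derivative[OF assms]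
    frechet_derivative_eq_pd[OF assms] by (simp add: linear_matrix_vector_mul_eq)

lemma chart_facts:
  assumes "smooth_atlas \<A>" "c \<in> \<A>"
  shows "open (fst c)" "open (chart_image c)" "homeomorphism (fst c) (chart_image c) (snd c) (chart_inv c)"
  using assms unfolding smooth_atlas_def by auto

lemma open_chart_overlap:
  assumes "smooth_atlas \<A>" "c \<in> \<A>" "open V"
  shows "open (snd c ` (fst c \<inter> V))"
proof -
  note h = chart_facts[OF assms(1,2)]
  have "snd c ` (fst c \<inter> V) = chart_image c \<inter> chart_inv c -` V"
    using h(3) unfolding homeomorphism_def by auto
  moreover have "open (chart_image c \<inter> chart_inv c -` V)"
    using h assms(3) by (intro continuous_open_preimage) (auto simp: homeomorphism_def)
  ultimately show ?thesis by simp
qed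

text \<open>The speed is tested in every chart that meets the path, not only in \<open>c\<close>.
  The transformation law of \<open>h\<close> makes it the same in all of them.\<close>

lemma has_length_segment:
  assumes A: "smooth_atlas \<A>" "symmetric_tensor_field \<A> h" and c: "c \<in> \<A>"
    and seg: "\<And>t. t \<in> {0..1} \<Longrightarrow> a + t *\<^sub>R (b - a) \<in> chart_image c"
  shows "has_length \<A> h (\<lambda>t. chart_inv c (a + t *\<^sub>R (b - a)))
    (integral {0..1} (\<lambda>t. sqrt (- ((b - a) \<bullet> (h c (a + t *\<^sub>R (b - a)) *v (b - a))))))"
  unfolding has_length_path_speed
proof (intro conjI exI ballI)
  note hc = chart_facts[OF A(1) c]
  define v where "v = b - a"
  define l where "l t = a + t *\<^sub>R v" for t
  have l: "l t \<in> chart_image c" if "t \<in> {0..1}" for t using seg[OF that] by (simp add: l_def v_def)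
  have cl: "continuous_on S l" for S unfolding l_def by (intro continuous_intros)
  show "continuous_on {0..1} (\<lambda>t. chart_inv c (a + t *\<^sub>R (b - a)))"
  proof -
    have "continuous_on (l ` {0..1}) (chart_inv c)"
      by (rule continuous_on_subset[of "chart_image c"]) (use hc(3) l in \<open>auto simp: homeomorphism_def\<close>)
    from continuous_on_compose[OF cl this] show ?thesis by (simp add: o_def l_def v_def)
  qed
  have ch: "continuous_on (chart_image c) (\<lambda>x. h c x $ i $ j)" for i j
    using A(2) c unfolding symmetric_tensor_field_def by (auto intro: smooth_on_imp_continuous)
  have hij: "continuous_on {0..1} (\<lambda>t. h c (l t) $ i $ j)" for i j
    using l by (intro continuous_on_compose2[OF ch cl]) auto
  have "continuous_on {0..1} (\<lambda>t. sqrt (- (v \<bullet> (h c (l t) *v v))))"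
    unfolding quadratic_form_eq
      by (intro continuous_on_real_sqrt continuous_on_minus continuous_on_sum continuous_on_mult continuous_on_const) (rule hij)
  from integrable_integral[OF integrable_continuous_interval[OF this]]
  show "((\<lambda>t. sqrt (- ((b - a) \<bullet> (h c (a + t *\<^sub>R (b - a)) *v (b - a))))) has_integral
    (integral {0..1} (\<lambda>t. sqrt (- ((b - a) \<bullet> (h c (a + t *\<^sub>R (b - a)) *v (b - a))))))) {0..1}"
    by (simp add: l_def v_def)
  show "finite {}" by simp
  fix t :: real assume "t \<in> {0<..<1} - {}"
  then have t: "0 < t" "t < 1" by auto
  have "path_speed \<A> h (\<lambda>t. chart_inv c (l t)) t (sqrt (- (v \<bullet> (h c (l t) *v v))))"
    unfolding path_speed_def Let_def
  proof (intro ballI impI)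
    fix d assume d: "d \<in> \<A>" "chart_inv c (l t) \<in> fst d"
    define O' where "O' = snd c ` (fst c \<inter> fst d)"
    have O: "open O'" unfolding O'_def by (rule open_chart_overlap[OF A(1) c chart_facts(1)[OF A(1) d(1)]])
    have sm: "smooth_on O' (transition c d)" using A(1) c d(1) unfolding smooth_atlas_def O'_def by blast
    have lt: "l t \<in> O'"
    proof -
      have "l t \<in> chart_image c" using l t by auto
      then have "snd c (chart_inv c (l t)) = l t" "chart_inv c (l t) \<in> fst c"
        using hc(3) unfolding homeomorphism_def by auto
      then show ?thesis unfolding O'_def using d by (metis IntI image_eqI)
    qed
    have "open (l -` O')" by (rule open_vimage[OF O]) (rule cl)
    then obtain e where e: "e > 0" "ball t e \<subseteq> l -` O'" using lt openE by blast
    define D where "D u = (\<Sum>i\<in>UNIV. v $ i *\<^sub>R pd i (transition c d) (l u))" for u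
    have D: "((snd d \<circ> (\<lambda>t. chart_inv c (l t))) has_vector_derivative D u) (at u)" if "u \<in> ball t e" for u
      using has_vector_derivative_line[OF smooth_on_imp_diff[OF O sm], of a u v UNIV] e(2) that
      by (auto simp: l_def D_def transition_def o_def)
    have cD: "continuous_on (ball t e) D" unfolding D_def
      by (intro continuous_intros continuous_on_compose2[OF smooth_on_imp_continuous[OF smooth_on_pd[OF sm]] cl])
        (use e in auto)
    have "(snd d \<circ> (\<lambda>t. chart_inv c (l t))) C1_differentiable_on ball t e"
      unfolding C1_differentiable_on_def using D cD by blast
    moreover have "vector_derivative (snd d \<circ> (\<lambda>t. chart_inv c (l t))) (at t) = D t"
      using e(1) by (intro vector_derivative_at D) simp
    moreover have "v \<bullet> (h c (l t) *v v) = D t \<bullet> (h d (snd d (chart_inv c (l t))) *v D t)"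
    proof -
      define J where "J = jacobian (transition c d) (at (l t))"
      have "h c (l t) = transpose J ** h d (transition c d (l t)) ** J"
        using A(2) c d(1) lt unfolding symmetric_tensor_field_def O'_def J_def Let_def by blast
      moreover have "J *v v = D t" unfolding J_def D_def
        by (rule matrix_frechet_derivative_mult[OF smooth_on_imp_diff[OF O sm lt]])
      ultimately have "v \<bullet> (h c (l t) *v v) = v \<bullet> (transpose J *v (h d (transition c d (l t)) *v D t))"
        by (simp add: matrix_vector_mul_assoc[symmetric])
      also have "\<dots> = (J *v v) \<bullet> (h d (transition c d (l t)) *v D t)"
        by (metis dot_lmul_matrix inner_commute transpose_matrix_vector transpose_transpose)
      finally show ?thesis using \<open>J *v v = D t\<close> by (simp add: transition_def)
    qed
    ultimately show "(\<exists>e>0. (snd d \<circ> (\<lambda>t. chart_inv c (l t))) C1_differentiable_on ball t e) \<and>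
        sqrt (- (v \<bullet> (h c (l t) *v v))) = sqrt (- (vector_derivative (snd d \<circ> (\<lambda>t. chart_inv c (l t))) (at t) \<bullet>
         (h d (snd d (chart_inv c (l t))) *v vector_derivative (snd d \<circ> (\<lambda>t. chart_inv c (l t))) (at t))))"
      using e(1) by auto
  qed
  then show "path_speed \<A> h (\<lambda>t. chart_inv c (a + t *\<^sub>R (b - a))) t
      (sqrt (- ((b - a) \<bullet> (h c (a + t *\<^sub>R (b - a)) *v (b - a)))))"
    by (simp add: l_def v_def)
qed

definition reachable :: "'a::topological_space chart set \<Rightarrow> ('a chart \<Rightarrow> real^3 \<Rightarrow> real^3^3) \<Rightarrow> 'a \<Rightarrow> 'a \<Rightarrow> real \<Rightarrow> bool" where
  "reachable \<A> h p q L \<longleftrightarrow> (\<exists>\<gamma>. \<gamma> 0 = p \<and> \<gamma> 1 = q \<and> has_length \<A> h \<gamma> L)"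

lemma reachable_trans: "reachable \<A> h p q L \<Longrightarrow> reachable \<A> h q r M \<Longrightarrow> reachable \<A> h p r (L + M)"
proof -
  assume "reachable \<A> h p q L" "reachable \<A> h q r M"
  then obtain g1 g2 where "g1 0 = p" "g1 1 = q" "has_length \<A> h g1 L" "g2 0 = q" "g2 1 = r" "has_length \<A> h g2 M"
    unfolding reachable_def by blast
  moreover from this have "has_length \<A> h (g1 +++ g2) (L + M)" by (intro has_length_join) auto
  moreover have "(g1 +++ g2) 0 = g1 0" "(g1 +++ g2) 1 = g2 1" by (simp_all add: joinpaths_def)
  ultimately show ?thesis unfolding reachable_def by (intro exI[of _ "g1 +++ g2"]) simp
qed

lemma reachable_segment:
  assumes A: "smooth_atlas \<A>" "symmetric_tensor_field \<A> h" and c: "c \<in> \<A>"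
    and seg: "\<And>t. t \<in> {0..1} \<Longrightarrow> a + t *\<^sub>R (b - a) \<in> chart_image c"
  obtains L where "reachable \<A> h (chart_inv c a) (chart_inv c b) L"
    "\<And>B. (\<And>t. t \<in> {0..1} \<Longrightarrow> - ((b - a) \<bullet> (h c (a + t *\<^sub>R (b - a)) *v (b - a))) \<le> B\<^sup>2) \<Longrightarrow> 0 \<le> B \<Longrightarrow> L \<le> B"
proof -
  let ?s = "\<lambda>t. sqrt (- ((b - a) \<bullet> (h c (a + t *\<^sub>R (b - a)) *v (b - a))))"
  have l: "has_length \<A> h (\<lambda>t. chart_inv c (a + t *\<^sub>R (b - a))) (integral {0..1} ?s)"
    by (rule has_length_segment[OF A c seg])
  have r: "reachable \<A> h (chart_inv c a) (chart_inv c b) (integral {0..1} ?s)"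
    unfolding reachable_def by (intro exI[of _ "\<lambda>t. chart_inv c (a + t *\<^sub>R (b - a))"] conjI l) simp_all
  show ?thesis
  proof (rule that[OF r])
    fix B :: real assume B: "\<And>t. t \<in> {0..1} \<Longrightarrow> - ((b - a) \<bullet> (h c (a + t *\<^sub>R (b - a)) *v (b - a))) \<le> B\<^sup>2" "0 \<le> B"
    have "?s t \<le> B" if "t \<in> {0..1}" for t using B(1)[OF that] B(2) by (simp add: real_le_lsqrt)
    moreover have "?s integrable_on {0..1}"
    proof (rule integrable_continuous_interval)
      have ch: "continuous_on (chart_image c) (\<lambda>x. h c x $ i $ j)" for i j
        using A(2) c unfolding symmetric_tensor_field_def by (auto intro: smooth_on_imp_continuous)
      have hij: "continuous_on {0..1} (\<lambda>t. h c (a + t *\<^sub>R (b - a)) $ i $ j)" for i j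
        using seg by (intro continuous_on_compose2[OF ch]) (auto intro!: continuous_intros)
      show "continuous_on {0..1} ?s"
        unfolding quadratic_form_eq
      by (intro continuous_on_real_sqrt continuous_on_minus continuous_on_sum continuous_on_mult continuous_on_const) (rule hij)
    qed
    ultimately have "integral {0..1} ?s \<le> integral {0..1} (\<lambda>t::real. B)"
      by (intro integral_le) auto
    then show "integral {0..1} ?s \<le> B" by simp
  qed
qed

text \<open>The set of points reachable from \<open>z\<close> is open and closed, since inside a
  coordinate ball segments join its centre to every point in both directions. This makes the set of
  lengths in \<open>riem_dist\<close> nonempty.\<close>

lemma reachable_all:
  fixes \<A> :: "'a::t2_space chart set"
  assumes A: "smooth_atlas \<A>" "symmetric_tensor_field \<A> h" and con: "connected (UNIV :: 'a set)"
  shows "\<exists>L. reachable \<A> h z q L"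
proof -
  define S where "S = {q. \<exists>L. reachable \<A> h z q L}"
  have nbhd: "\<exists>N. open N \<and> q \<in> N \<and> (\<forall>q'\<in>N. (\<exists>L. reachable \<A> h q q' L) \<and> (\<exists>L. reachable \<A> h q' q L))" for q
  proof -
    obtain c where c: "c \<in> \<A>" "q \<in> fst c" using A(1) unfolding smooth_atlas_def by blast
    note hc = chart_facts[OF A(1) c(1)]
    have inv: "chart_inv c (snd c q') = q'" if "q' \<in> fst c" for q'
      using hc(3) that unfolding homeomorphism_def by auto
    obtain e where e: "e > 0" "ball (snd c q) e \<subseteq> chart_image c" using hc(2) c(2) openE by blast
    define N where "N = fst c \<inter> snd c -` ball (snd c q) e"
    have "open N" unfolding N_def
      using hc(1,3) by (intro continuous_open_preimage) (auto simp: homeomorphism_def)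
    moreover have "q \<in> N" using c e by (simp add: N_def)
    moreover have "(\<exists>L. reachable \<A> h q q' L) \<and> (\<exists>L. reachable \<A> h q' q L)" if q': "q' \<in> N" for q'
    proof -
      have b: "snd c q' \<in> ball (snd c q) e" "snd c q \<in> ball (snd c q) e" "q' \<in> fst c" using q' e by (auto simp: N_def)
      have s: "a + t *\<^sub>R (b - a) \<in> chart_image c" if "a \<in> ball (snd c q) e" "b \<in> ball (snd c q) e" "t \<in> {0..1}" for a b t
      proof -
        have "(1 - t) *\<^sub>R a + t *\<^sub>R b \<in> ball (snd c q) e"
          using that by (intro convexD[OF convex_ball]) auto
        then show ?thesis using e(2) by (auto simp: algebra_simps)
      qed
      obtain L where "reachable \<A> h (chart_inv c (snd c q)) (chart_inv c (snd c q')) L"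
        using reachable_segment[OF A c(1) s[OF b(2,1)]] by blast
      moreover obtain L' where "reachable \<A> h (chart_inv c (snd c q')) (chart_inv c (snd c q)) L'"
        using reachable_segment[OF A c(1) s[OF b(1,2)]] by blast
      ultimately show ?thesis using inv b(3) c(2) by auto
    qed
    ultimately show ?thesis by blast
  qed
  have "open S"
  proof (rule open_subopen[THEN iffD2], rule ballI)
    fix q assume "q \<in> S"
    then obtain L where L: "reachable \<A> h z q L" unfolding S_def by blast
    obtain N where N: "open N" "q \<in> N" "\<forall>q'\<in>N. (\<exists>L. reachable \<A> h q q' L) \<and> (\<exists>L. reachable \<A> h q' q L)"
      using nbhd[of q] by (elim exE conjE) rule
    have "q' \<in> S" if "q' \<in> N" for q'
      using N(3)[rule_format, OF that] reachable_trans[OF L] unfolding S_def by auto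
    then have "N \<subseteq> S" by auto
    then show "\<exists>T. open T \<and> q \<in> T \<and> T \<subseteq> S" using N(1,2) by auto
  qed
  moreover have "open (- S)"
  proof (rule open_subopen[THEN iffD2], rule ballI)
    fix q assume q: "q \<in> - S"
    obtain N where N: "open N" "q \<in> N" "\<forall>q'\<in>N. (\<exists>L. reachable \<A> h q q' L) \<and> (\<exists>L. reachable \<A> h q' q L)"
      using nbhd[of q] by (elim exE conjE) rule
    have "q' \<notin> S" if "q' \<in> N" for q'
    proof
      assume "q' \<in> S"
      then obtain M where M: "reachable \<A> h z q' M" unfolding S_def by auto
      from N(3)[rule_format, OF that] obtain L where "reachable \<A> h q' q L" by auto
      from reachable_trans[OF M this] show False using q unfolding S_def by auto
    qed
    then have "N \<subseteq> - S" by auto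
    then show "\<exists>T. open T \<and> q \<in> T \<and> T \<subseteq> - S" using N(1,2) by auto
  qed
  moreover have "z \<in> S"
  proof -
    obtain N where N: "open N" "z \<in> N" "\<forall>q'\<in>N. (\<exists>L. reachable \<A> h z q' L) \<and> (\<exists>L. reachable \<A> h q' z L)"
      using nbhd[of z] by (elim exE conjE) rule
    then show ?thesis unfolding S_def using N(3)[rule_format, OF N(2)] by auto
  qed
  ultimately have "S = UNIV"
    using connectedD[OF con, of S "- S"] by auto
  then show ?thesis unfolding S_def by blast
qed

text \<open>The mixed term is nonnegative and \<open>(1 - t)\<^sup>2 + t\<^sup>2\<close> is at least
  1/2, more than the 1/4 that is needed.\<close>

lemma norm_segment_ge:
  fixes x y :: "'a::real_inner"
  assumes y: "norm y = norm x" and xy: "x \<bullet> y \<ge> 0" and t: "0 \<le> t" "t \<le> 1"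
  shows "norm x / 2 \<le> norm (x + t *\<^sub>R (y - x))"
proof (rule power2_le_imp_le)
  have "x + t *\<^sub>R (y - x) = (1 - t) *\<^sub>R x + t *\<^sub>R y" by (simp add: algebra_simps)
  then have E: "(norm (x + t *\<^sub>R (y - x)))\<^sup>2 = (1 - t)\<^sup>2 * (norm x)\<^sup>2 + t\<^sup>2 * (norm y)\<^sup>2 + 2 * ((1 - t) * t * (x \<bullet> y))"
    unfolding power2_norm_eq_inner by (simp add: inner_add_left inner_add_right inner_commute power2_eq_square algebra_simps)
  have "(1 - t)\<^sup>2 + t\<^sup>2 = 1/2 + 2 * (t - 1/2)\<^sup>2" by (simp add: power2_eq_square algebra_simps)
  then have "1 / 4 * (norm x)\<^sup>2 \<le> ((1 - t)\<^sup>2 + t\<^sup>2) * (norm x)\<^sup>2" by (intro mult_right_mono) auto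
  also have "\<dots> \<le> (norm (x + t *\<^sub>R (y - x)))\<^sup>2" unfolding E using t xy y by (simp add: distrib_right)
  finally show "(norm x / 2)\<^sup>2 \<le> (norm (x + t *\<^sub>R (y - x)))\<^sup>2" by (simp add: power_divide)
qed simp

text \<open>After its last time outside the coordinate ball the path runs within one chart from the
  boundary to the centre. Its displacement there is \<open>r\<close>, and \<open>norm v\<close> is
  at most twice the speed.\<close>

lemma length_ge_exit:
  fixes \<A> :: "'a::t2_space chart set"
  assumes A: "smooth_atlas \<A>" and c: "c \<in> \<A>"
    and neg: "\<forall>c\<in>\<A>. \<forall>x\<in>chart_image c. \<forall>v. v \<bullet> (h c x *v v) \<le> 0"
    and len: "has_length \<A> h \<gamma> L" and end1: "\<gamma> 1 = chart_inv c x" and r: "r > 0"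
    and sub: "cball x r \<subseteq> chart_image c"
    and low: "\<And>y v. y \<in> ball x r \<Longrightarrow> (norm v)\<^sup>2 / 4 \<le> - (v \<bullet> (h c y *v v))"
    and out: "\<gamma> 0 \<notin> chart_inv c ` ball x r"
  shows "r / 2 \<le> L"
proof -
  note hc = chart_facts[OF A c]
  have inv: "snd c (chart_inv c y) = y" "chart_inv c y \<in> fst c" if "y \<in> chart_image c" for y
    using hc(3) that unfolding homeomorphism_def by auto
  have inv': "chart_inv c (snd c q) = q" if "q \<in> fst c" for q
    using hc(3) that unfolding homeomorphism_def by auto
  obtain F speed where F: "finite F" "(speed has_integral L) {0..1}"
    and s: "\<And>t. t \<in> {0<..<1} - F \<Longrightarrow> path_speed \<A> h \<gamma> t (speed t)" and cg: "continuous_on {0..1} \<gamma>"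
    using len unfolding has_length_path_speed by blast
  define V where "V = chart_inv c ` ball x r"
  define K where "K = chart_inv c ` cball x r"
  have "V = fst c \<inter> snd c -` ball x r"
  proof -
    have b: "ball x r \<subseteq> chart_image c" using sub by auto
    show ?thesis unfolding V_def
    proof (intro set_eqI iffI)
      fix q assume "q \<in> chart_inv c ` ball x r"
      then obtain y where "q = chart_inv c y" "y \<in> ball x r" by auto
      then show "q \<in> fst c \<inter> snd c -` ball x r" using inv[of y] b by auto
    next
      fix q assume "q \<in> fst c \<inter> snd c -` ball x r"
      then show "q \<in> chart_inv c ` ball x r" using inv'[of q] by (intro image_eqI[of _ _ "snd c q"]) auto
    qed
  qed
  then have V: "open V" using hc(1,3) by (auto intro!: continuous_open_preimage simp: homeomorphism_def)
  have "compact K" unfolding K_def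
    by (intro compact_continuous_image compact_cball continuous_on_subset[OF _ sub])
      (use hc(3) in \<open>simp add: homeomorphism_def\<close>)
  \<comment> \<open>The Hausdorff property of the manifold enters here.\<close>
  then have K: "closed K" by (rule compact_imp_closed)
  have VK: "V \<subseteq> K" unfolding V_def K_def by auto
  have Kc: "K \<subseteq> fst c" unfolding K_def using inv(2) sub by auto
  define T where "T = {0..1} \<inter> \<gamma> -` (- V)"
  have "closed T" unfolding T_def using cg V by (intro continuous_closed_preimage) auto
  moreover have "bounded T" unfolding T_def by (rule bounded_subset[of "{0..1}"]) auto
  ultimately have "compact T" by (simp add: compact_eq_bounded_closed)
  moreover have "0 \<in> T" using out by (simp add: T_def V_def)
  \<comment> \<open>The last time outside the ball, by compactness.\<close>
  ultimately obtain t1 where t1: "t1 \<in> T" "\<And>s. s \<in> T \<Longrightarrow> s \<le> t1"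
    using compact_attains_sup[of T] by auto
  have "1 \<notin> T" using end1 r by (auto simp: T_def V_def)
  then have t1': "0 \<le> t1" "t1 < 1" "\<gamma> t1 \<notin> V" using t1(1) by (auto simp: T_def less_le)
  have inV: "\<gamma> u \<in> V" if "t1 < u" "u \<le> 1" for u
    using t1(2)[of u] that t1' by (auto simp: T_def)
  \<comment> \<open>By continuity the path is in the closed ball at the time \<open>t1\<close>, and
    being outside the open one it is on the boundary.\<close>
  have "\<gamma> t1 \<in> K"
  proof -
    have "closure {t1<..1} = {t1..1}" using t1' by simp
    moreover have "\<gamma> ` closure {t1<..1} \<subseteq> K"
      by (rule image_closure_subset[OF _ K])
        (use t1' inV VK continuous_on_subset[OF cg] calculation in auto)
    ultimately show ?thesis using t1' by auto
  qed
  then obtain y where y: "\<gamma> t1 = chart_inv c y" "y \<in> cball x r" unfolding K_def by blast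
  have "y \<notin> ball x r" using t1'(3) y(1) unfolding V_def by blast
  then have dist_y: "norm (x - y) = r" using y(2) by (simp add: dist_norm)
  define \<xi> where "\<xi> t = snd c (\<gamma> t)" for t
  have \<xi>_eq: "\<xi> = snd c \<circ> \<gamma>" by (auto simp: \<xi>_def)
  have inK: "\<gamma> u \<in> K" if "u \<in> {t1..1}" for u
    using \<open>\<gamma> t1 \<in> K\<close> inV[of u] VK that by (cases "u = t1") auto
  have c\<xi>: "continuous_on {t1..1} \<xi>" unfolding \<xi>_def
    by (rule continuous_on_compose2[of "fst c" "snd c"])
      (use hc(3) inK Kc t1' continuous_on_subset[OF cg] in \<open>auto simp: homeomorphism_def\<close>)
  have "x \<in> chart_image c" "y \<in> chart_image c" using sub y(2) r by auto
  then have ends: "\<xi> 1 = x" "\<xi> t1 = y" unfolding \<xi>_def end1 y(1) using inv(1) by auto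
  define G where "G = insert 0 (insert 1 (insert t1 F))"
  have fG: "finite G" using F by (simp add: G_def)
  \<comment> \<open>At the finitely many exceptional times velocity and speed are set to 0; the
    integrals do not notice.\<close>
  define vd where "vd t = (if t \<in> G then 0 else vector_derivative (snd c \<circ> \<gamma>) (at t))" for t
  define sp where "sp t = (if t \<in> G then 0 else speed t)" for t
  have ok: "path_speed \<A> h \<gamma> t (speed t)" if "t \<in> {0..1}" "t \<notin> G" for t
    using s[of t] that by (auto simp: G_def)
  have sp_int: "(sp has_integral L) {0..1}" unfolding sp_def
    by (rule has_integral_spike_finite[OF fG _ F(2)]) auto
  have sp0: "sp t \<ge> 0" if t: "t \<in> {0..1}" for t
  proof (cases "t \<in> G")
    case False
    obtain d where d: "d \<in> \<A>" "\<gamma> t \<in> fst d" using A unfolding smooth_atlas_def by blast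
    have "speed t = sqrt (- (vector_derivative (snd d \<circ> \<gamma>) (at t) \<bullet> (h d (snd d (\<gamma> t)) *v vector_derivative (snd d \<circ> \<gamma>) (at t))))"
      using ok[OF t False] d unfolding path_speed_def Let_def by blast
    then show ?thesis using False neg d by (simp add: sp_def)
  qed (simp add: sp_def)
  have der: "(\<xi> has_vector_derivative vd t) (at t)" and vd_le: "norm (vd t) \<le> 2 * sp t"
    if t: "t \<in> {t1<..<1} - G" for t
  proof -
    have tV: "\<gamma> t \<in> V" using inV t by auto
    then have "\<gamma> t \<in> fst c" using VK Kc by auto
    then obtain e where e: "e > 0" "(snd c \<circ> \<gamma>) C1_differentiable_on ball t e"
      and sp: "speed t = sqrt (- (vector_derivative (snd c \<circ> \<gamma>) (at t) \<bullet> (h c (snd c (\<gamma> t)) *v vector_derivative (snd c \<circ> \<gamma>) (at t))))"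
      using ok[of t] t t1' c unfolding path_speed_def Let_def by auto
    obtain D where "\<And>u. u \<in> ball t e \<Longrightarrow> ((snd c \<circ> \<gamma>) has_vector_derivative D u) (at u)"
      using e(2) unfolding C1_differentiable_on_def by blast
    then have "((snd c \<circ> \<gamma>) has_vector_derivative D t) (at t)" using e(1) by simp
    then show "(\<xi> has_vector_derivative vd t) (at t)"
      using vector_derivative_at[of "snd c \<circ> \<gamma>" "D t" t] t \<xi>_eq by (simp add: vd_def)
    have "snd c (\<gamma> t) \<in> ball x r"
    proof -
      obtain y' where y': "\<gamma> t = chart_inv c y'" "y' \<in> ball x r" using tV unfolding V_def by blast
      then have "y' \<in> chart_image c" using sub by (metis ball_subset_cball subset_iff)
      then show ?thesis using y' inv(1) by simp
    qed
    from low[OF this, of "vd t"] have "(norm (vd t) / 2)\<^sup>2 \<le> - (vd t \<bullet> (h c (snd c (\<gamma> t)) *v vd t))"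
      by (simp add: power_divide)
    then have "norm (vd t) / 2 \<le> sqrt (- (vd t \<bullet> (h c (snd c (\<gamma> t)) *v vd t)))" by (rule real_le_rsqrt)
    then show "norm (vd t) \<le> 2 * sp t" using sp t by (simp add: sp_def vd_def)
  qed
  have vd_int: "(vd has_integral (\<xi> 1 - \<xi> t1)) {t1..1}"
    by (rule fundamental_theorem_of_calculus_interior_strong[OF fG]) (use der c\<xi> t1' in auto)
  have sub01: "{t1..1} \<subseteq> {0..1}" using t1' by auto
  have sp_sub: "sp integrable_on {t1..1}"
    by (rule integrable_on_subinterval[OF has_integral_integrable[OF sp_int]]) (use sub01 in auto)
  have "norm (integral {t1..1} vd) \<le> integral {t1..1} (\<lambda>t. 2 * sp t)"
  proof (rule integral_norm_bound_integral[OF has_integral_integrable[OF vd_int]])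
    show "(\<lambda>t. 2 * sp t) integrable_on {t1..1}" using sp_sub by (simp add: integrable_on_cmult_left)
    show "norm (vd t) \<le> 2 * sp t" if "t \<in> {t1..1}" for t
      using vd_le[of t] that by (cases "t \<in> G") (auto simp: vd_def sp_def G_def)
  qed
  also have "\<dots> = 2 * integral {t1..1} sp" by simp
  also have "integral {t1..1} sp \<le> integral {0..1} sp"
    by (rule integral_subset_le[OF sub01 sp_sub has_integral_integrable[OF sp_int]]) (use sp0 in blast)
  also have "integral {0..1} sp = L" by (rule integral_unique[OF sp_int])
  finally show ?thesis using integral_unique[OF vd_int] ends dist_y by simp
qed

section \<open>Comparison of the weight with the radius\<close>

lemma vacuum_neg:
  assumes "vacuum_initial_data \<A> h K"
  shows "\<forall>c\<in>\<A>. \<forall>x\<in>chart_image c. \<forall>v. v \<bullet> (h c x *v v) \<le> 0"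
proof (intro ballI allI)
  fix c x v assume "c \<in> \<A>" "x \<in> chart_image c"
  then show "v \<bullet> (h c x *v v) \<le> 0"
    using assms unfolding vacuum_initial_data_def by (cases "v = 0") (auto simp: less_imp_le)
qed

text \<open>In the weight only the decay of \<open>h\<close> without weights is available a priori. It controls \<open>h\<close>
  from both sides, hence the distance, and shows that the weight is comparable to \<open>r\<close>.\<close>

theorem (in exterior) end_weight_comparable:
  fixes \<A> :: "'a::{t2_space,second_countable_topology} chart set"
  assumes vac: "vacuum_initial_data \<A> h K" and ae: "asymptotic_end \<A> c R" and w: "w = end_weight \<A> h z c"
    and m: "E\<^sup>2 - p \<bullet> p > 0" and dec: "schwarzschildean_decay w R (h c) (K c) E p"
  obtains \<rho> a b where "\<rho> > R" "a > 0" "b > 0" "\<And>x. \<rho> < norm x \<Longrightarrow> a * norm x \<le> w x" "\<And>x. \<rho> < norm x \<Longrightarrow> w x \<le> b * norm x"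
proof -
  have A: "smooth_atlas \<A>" "symmetric_tensor_field \<A> h" "connected (UNIV :: 'a set)"
    using vac unfolding vacuum_initial_data_def by auto
  have c: "c \<in> \<A>" "chart_image c = ext R" using ae unfolding asymptotic_end_def by auto
  note neg = vacuum_neg[OF vac]
  note hc = chart_facts[OF A(1) c(1)]
  have w1: "w x \<ge> 1" for x unfolding w end_weight_def by simp
  obtain \<rho> where \<rho>: "\<rho> > R" and close: "\<And>x i j. \<rho> < norm x \<Longrightarrow> \<bar>h c x $ i $ j + kronecker i j\<bar> \<le> 1 / 6"
    using metric_close_to_flat[OF m w1 dec] by blast
  have \<rho>0: "\<rho> > 0" using \<rho> R_pos by simp
  have hlow: "(norm v)\<^sup>2 / 4 \<le> - (v \<bullet> (h c y *v v))" if "\<rho> < norm y" for y v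
  proof -
    have "(norm v)\<^sup>2 / 2 \<le> - (v \<bullet> (h c y *v v))" by (rule quadratic_form_close(1)) (rule close[OF that])
    moreover have "(norm v)\<^sup>2 \<ge> 0" by simp
    ultimately show ?thesis by linarith
  qed
  have hup: "- (v \<bullet> (h c y *v v)) \<le> (2 * norm v)\<^sup>2" if "\<rho> < norm y" for y v
  proof -
    have "- (v \<bullet> (h c y *v v)) \<le> 3 / 2 * (norm v)\<^sup>2" by (rule quadratic_form_close(2)) (rule close[OF that])
    moreover have "(norm v)\<^sup>2 \<ge> 0" by simp
    moreover have "(2 * norm v)\<^sup>2 = 4 * (norm v)\<^sup>2" by (simp add: power_mult_distrib)
    ultimately show ?thesis by linarith
  qed
  define dst where "dst q = riem_dist \<A> h z q" for q
  have dst_le: "dst q \<le> L" if "reachable \<A> h z q L" for q L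
    using that riem_dist_le[OF A(1) _ _ _ neg] unfolding reachable_def dst_def by blast
  have dst_ge: "B \<le> dst q" if "\<And>\<gamma> L. \<gamma> 0 = z \<Longrightarrow> \<gamma> 1 = q \<Longrightarrow> has_length \<A> h \<gamma> L \<Longrightarrow> B \<le> L" for B q
    unfolding dst_def riem_dist_def
  proof (rule cInf_greatest)
    show "{L. \<exists>\<gamma>. \<gamma> 0 = z \<and> \<gamma> 1 = q \<and> has_length \<A> h \<gamma> L} \<noteq> {}"
      using reachable_all[OF A, of z q] unfolding reachable_def by blast
  qed (use that in blast)
  have dst0: "dst q \<ge> 0" for q by (rule dst_ge) (rule has_length_nonneg[OF A(1) _ neg])
  have w_dst: "w x = sqrt (1 + (dst (chart_inv c x))\<^sup>2)" for x
    unfolding w end_weight_def dst_def ..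
  have w_ge: "dst (chart_inv c x) \<le> w x" for x
    unfolding w_dst by (rule real_le_rsqrt) simp
  have w_le: "w x \<le> 1 + dst (chart_inv c x)" for x
    unfolding w_dst by (rule real_le_lsqrt) (use dst0[of "chart_inv c x"] in \<open>auto simp: power2_sum\<close>)
  have seg: "\<exists>L\<le>2 * norm (y - x). reachable \<A> h (chart_inv c x) (chart_inv c y) L"
    if s: "\<And>t. t \<in> {0..1} \<Longrightarrow> \<rho> < norm (x + t *\<^sub>R (y - x))" for x y
  proof -
    have "x + t *\<^sub>R (y - x) \<in> chart_image c" if "t \<in> {0..1}" for t using s[OF that] \<rho> c by auto
    from reachable_segment[OF A(1,2) c(1) this] obtain L where
      "reachable \<A> h (chart_inv c x) (chart_inv c y) L"
      "\<And>B. (\<And>t. t \<in> {0..1} \<Longrightarrow> - ((y - x) \<bullet> (h c (x + t *\<^sub>R (y - x)) *v (y - x))) \<le> B\<^sup>2) \<Longrightarrow> 0 \<le> B \<Longrightarrow> L \<le> B" by blast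
    then show ?thesis using hup[OF s] by (intro exI[of _ L]) auto
  qed
  define x0 :: "real^3" where "x0 = (4 * \<rho>) *\<^sub>R axis 1 1"
  have x0: "norm x0 = 4 * \<rho>" using \<rho>0 by (simp add: x0_def norm_axis_1)
  obtain L0 where L0: "reachable \<A> h z (chart_inv c x0) L0" using reachable_all[OF A] by blast
  have turn: "\<exists>L\<le>4 * norm x. reachable \<A> h (chart_inv c x) (chart_inv c y) L"
    if "norm y = norm x" "x \<bullet> y \<ge> 0" "norm x \<ge> 4 * \<rho>" for x y
  proof -
    have "\<rho> < norm (x + t *\<^sub>R (y - x))" if "t \<in> {0..1}" for t
      using norm_segment_ge[of y x t] that \<open>norm y = norm x\<close> \<open>x \<bullet> y \<ge> 0\<close> \<open>norm x \<ge> 4 * \<rho>\<close> \<rho>0 by auto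
    then obtain L where "L \<le> 2 * norm (y - x)" "reachable \<A> h (chart_inv c x) (chart_inv c y) L" using seg by blast
    moreover have "norm (y - x) \<le> 2 * norm x" using norm_triangle_ineq4[of y x] that(1) by simp
    ultimately show ?thesis by (intro exI[of _ L]) auto
  qed
  \<comment> \<open>The path goes from \<open>z\<close> to the reference point \<open>x0\<close>,
    radially to the sphere through \<open>x\<close>, and on to \<open>x\<close> by at most two turns
    of at most a right angle. The last two stages cost at most \<open>2 * norm x\<close> and
    \<open>8 * norm x\<close>.\<close>
  have upper: "dst (chart_inv c x) \<le> L0 + 10 * norm x" if x: "norm x \<ge> 4 * \<rho>" for x
  proof -
    define y where "y = (norm x / norm x0) *\<^sub>R x0"
    have y: "norm y = norm x" using x0 \<rho>0 by (simp add: y_def)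
    have "\<rho> < norm (x0 + t *\<^sub>R (y - x0))" if t: "t \<in> {0..1}" for t
    proof -
      have "1 \<le> norm x / norm x0" using x x0 \<rho>0 by (simp add: field_simps)
      then have "1 \<le> 1 + t * (norm x / norm x0 - 1)" using t by simp
      moreover have "x0 + t *\<^sub>R (y - x0) = (1 + t * (norm x / norm x0 - 1)) *\<^sub>R x0"
        unfolding y_def by (simp add: algebra_simps)
      ultimately have "norm (x0 + t *\<^sub>R (y - x0)) \<ge> 1 * norm x0"
        by (simp only: norm_scaleR) (intro mult_right_mono, auto)
      then show ?thesis using x0 \<rho>0 by simp
    qed
    then obtain L1 where L1: "L1 \<le> 2 * norm (y - x0)" "reachable \<A> h (chart_inv c x0) (chart_inv c y) L1" using seg by blast
    have "y - x0 = (norm x / norm x0 - 1) *\<^sub>R x0" unfolding y_def by (simp add: algebra_simps)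
    then have "norm (y - x0) = (norm x / norm x0 - 1) * norm x0" using x x0 \<rho>0 by (simp add: field_simps)
    then have "norm (y - x0) = norm x - norm x0" using x0 \<rho>0 by (simp add: left_diff_distrib)
    then have L1': "L1 \<le> 2 * norm x" using L1(1) x0 \<rho>0 by simp
    have "\<exists>L2\<le>8 * norm x. reachable \<A> h (chart_inv c y) (chart_inv c x) L2"
    proof (cases "y \<bullet> x \<ge> 0")
      case True
      then obtain L where "L \<le> 4 * norm x" "reachable \<A> h (chart_inv c y) (chart_inv c x) L"
        using turn[of x y] y x by auto
      then show ?thesis using norm_ge_zero[of x] by (intro exI[of _ L]) linarith
    next
      case False
      obtain u0 where u0: "u0 \<noteq> 0" "orthogonal y u0" using orthogonal_to_vector_exists[of y] by auto
      define u where "u = (norm x / norm u0) *\<^sub>R u0"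
      have u: "norm u = norm x" "y \<bullet> u = 0" using u0 by (auto simp: u_def orthogonal_def)
      have "\<exists>u. norm u = norm x \<and> y \<bullet> u = 0 \<and> u \<bullet> x \<ge> 0"
      proof (cases "u \<bullet> x \<ge> 0")
        case False
        then show ?thesis using u by (intro exI[of _ "- u"]) auto
      qed (use u in blast)
      then obtain v where v: "norm v = norm x" "y \<bullet> v = 0" "v \<bullet> x \<ge> 0" by blast
      obtain L2 L3 where "L2 \<le> 4 * norm y" "reachable \<A> h (chart_inv c y) (chart_inv c v) L2"
        "L3 \<le> 4 * norm v" "reachable \<A> h (chart_inv c v) (chart_inv c x) L3"
        using turn[of v y] turn[of x v] v x y by auto
      then show ?thesis using v y reachable_trans[of \<A> h "chart_inv c y" "chart_inv c v" L2 "chart_inv c x" L3]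
        by (intro exI[of _ "L2 + L3"]) auto
    qed
    then obtain L2 where L2: "L2 \<le> 8 * norm x" "reachable \<A> h (chart_inv c y) (chart_inv c x) L2" by blast
    have "dst (chart_inv c x) \<le> L0 + (L1 + L2)"
      by (intro dst_le reachable_trans[OF L0] reachable_trans[OF L1(2)] L2(2))
    then show ?thesis using L1' L2(1) by simp
  qed
  \<comment> \<open>The ball about \<open>x\<close> of radius \<open>norm x - R3\<close> stays where
    \<open>h\<close> is controlled and misses \<open>z\<close>. If \<open>z\<close> lies outside the
    end, \<open>snd c z\<close> has no meaning but does no harm.\<close>
  define R3 where "R3 = max \<rho> (norm (snd c z))"
  have lower: "(norm x - R3) / 2 \<le> dst (chart_inv c x)" if x: "norm x > R3" for x
  proof (rule dst_ge)
    fix \<gamma> L assume g: "\<gamma> 0 = z" "\<gamma> 1 = chart_inv c x" "has_length \<A> h \<gamma> L"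
    have n: "R3 \<le> norm y" if "y \<in> cball x (norm x - R3)" for y
    proof -
      have "norm (x - y) \<le> norm x - R3" using that by (simp add: dist_norm)
      then show ?thesis using norm_triangle_ineq2[of x y] by linarith
    qed
    have n': "R3 < norm y" if "y \<in> ball x (norm x - R3)" for y
    proof -
      have "norm (x - y) < norm x - R3" using that by (simp add: dist_norm)
      then show ?thesis using norm_triangle_ineq2[of x y] by linarith
    qed
    have R3: "R3 \<ge> \<rho>" "R3 > R" using \<rho> by (auto simp: R3_def)
    show "(norm x - R3) / 2 \<le> L"
    proof (rule length_ge_exit[OF A(1) c(1) neg g(3,2)])
      show "cball x (norm x - R3) \<subseteq> chart_image c" using n R3 c by force
      show "(norm v)\<^sup>2 / 4 \<le> - (v \<bullet> (h c y *v v))" if "y \<in> ball x (norm x - R3)" for y v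
        using n'[OF that] R3 by (intro hlow) auto
      show "\<gamma> 0 \<notin> chart_inv c ` ball x (norm x - R3)"
      proof
        assume "\<gamma> 0 \<in> chart_inv c ` ball x (norm x - R3)"
        then obtain y where y: "z = chart_inv c y" "y \<in> ball x (norm x - R3)" using g(1) by blast
        have "y \<in> chart_image c" using n'[OF y(2)] R3 c by auto
        then have "snd c z = y" using hc(3) y(1) unfolding homeomorphism_def by auto
        then show False using n'[OF y(2)] by (simp add: R3_def)
      qed
    qed (use x in auto)
  qed
  \<comment> \<open>Beyond \<open>2 * R3\<close> the lower bound \<open>(norm x - R3) / 2\<close> is
    at least \<open>norm x / 4\<close>.\<close>
  define \<sigma> where "\<sigma> = max (4 * \<rho>) (2 * R3)"
  define b where "b = (1 + \<bar>L0\<bar>) / (4 * \<rho>) + 10"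
  show ?thesis
  proof (rule that[of \<sigma> "1/4" b])
    show "\<sigma> > R" using \<rho> \<rho>0 by (auto simp: \<sigma>_def)
    show "b > 0" unfolding b_def using \<rho>0 by (intro add_nonneg_pos divide_nonneg_pos) auto
    fix x :: "real^3" assume x: "\<sigma> < norm x"
    have R30: "R3 > 0" using \<rho>0 by (simp add: R3_def)
    show "1/4 * norm x \<le> w x" using lower[of x] w_ge[of x] x R30 by (simp add: \<sigma>_def)
    have "1 + \<bar>L0\<bar> \<le> (1 + \<bar>L0\<bar>) / (4 * \<rho>) * norm x"
    proof -
      have "(1 + \<bar>L0\<bar>) * (4 * \<rho>) \<le> (1 + \<bar>L0\<bar>) * norm x" using x by (intro mult_left_mono) (auto simp: \<sigma>_def)
      then show ?thesis using \<rho>0 by (simp add: field_simps)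
    qed
    moreover have "w x \<le> 1 + (L0 + 10 * norm x)" using upper[of x] w_le[of x] x by (simp add: \<sigma>_def)
    ultimately show "w x \<le> b * norm x" unfolding b_def distrib_right by linarith
  qed simp
qed

text \<open>Measurability is required of the smaller integrand only: the weight \<open>w\<close> is not known to be
  measurable.\<close>

lemma weighted_norm_finite_dominated':
  assumes fin: "weighted_norm_finite w V \<delta> g" and [measurable]: "V \<in> sets borel"
    and m: "(\<lambda>x. ennreal ((norm (f x))\<^sup>2 * v x powr (- 2 * \<epsilon> - 3)) * indicator V x) \<in> borel_measurable borel"
    and C: "C > 0"
    and le: "\<And>x. x \<in> V \<Longrightarrow> (norm (f x))\<^sup>2 * v x powr (- 2 * \<epsilon> - 3)
      \<le> C * ((norm (g x))\<^sup>2 * w x powr (- 2 * \<delta> - 3))"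
  shows "weighted_norm_finite v V \<epsilon> f"
proof -
  let ?I = "\<integral>\<^sup>+x\<in>V. ennreal ((norm (f x))\<^sup>2 * v x powr (- 2 * \<epsilon> - 3)) \<partial>lborel"
  have "ennreal (1 / C) * ?I = (\<integral>\<^sup>+x. ennreal (1 / C) * (ennreal ((norm (f x))\<^sup>2 * v x powr (- 2 * \<epsilon> - 3)) * indicator V x) \<partial>lborel)"
    using m by (intro nn_integral_cmult[symmetric]) simp
  also have "\<dots> \<le> (\<integral>\<^sup>+x\<in>V. ennreal ((norm (g x))\<^sup>2 * w x powr (- 2 * \<delta> - 3)) \<partial>lborel)"
  proof (rule nn_integral_mono)
    fix x :: "real^3"
    show "ennreal (1 / C) * (ennreal ((norm (f x))\<^sup>2 * v x powr (- 2 * \<epsilon> - 3)) * indicator V x)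
      \<le> ennreal ((norm (g x))\<^sup>2 * w x powr (- 2 * \<delta> - 3)) * indicator V x"
    proof (cases "x \<in> V")
      case True
      have "1 / C * ((norm (f x))\<^sup>2 * v x powr (- 2 * \<epsilon> - 3)) \<le> (norm (g x))\<^sup>2 * w x powr (- 2 * \<delta> - 3)"
        using le[OF True] C by (simp add: field_simps)
      then have "ennreal (1 / C * ((norm (f x))\<^sup>2 * v x powr (- 2 * \<epsilon> - 3))) \<le> ennreal ((norm (g x))\<^sup>2 * w x powr (- 2 * \<delta> - 3))"
        by (rule ennreal_leI)
      moreover have "ennreal (1 / C * ((norm (f x))\<^sup>2 * v x powr (- 2 * \<epsilon> - 3))) =
          ennreal (1 / C) * ennreal ((norm (f x))\<^sup>2 * v x powr (- 2 * \<epsilon> - 3))"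
        using C by (intro ennreal_mult) auto
      ultimately have "ennreal (1 / C) * ennreal ((norm (f x))\<^sup>2 * v x powr (- 2 * \<epsilon> - 3))
          \<le> ennreal ((norm (g x))\<^sup>2 * w x powr (- 2 * \<delta> - 3))" by (simp only:)
      then show ?thesis using True by simp
    qed simp
  qed
  also have "\<dots> < \<infinity>" using fin unfolding weighted_norm_finite_def .
  finally have "?I \<noteq> top" using C by (auto simp: ennreal_mult_top)
  then show ?thesis unfolding weighted_norm_finite_def by (simp add: less_top)
qed

text \<open>Whether the power increases or decreases depends on the sign of \<open>e\<close>; the
  sum of the constants of both cases covers either sign.\<close>

lemma powr_comparable:
  fixes r w :: real
  assumes "a > 0" "b > 0" "r > 0" "a * r \<le> w" "w \<le> b * r"
  shows "w powr e \<le> (a powr e + b powr e) * r powr e" "r powr e \<le> (a powr (- e) + b powr (- e)) * w powr e"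
proof -
  have w: "w > 0" using assms by (smt (verit) mult_pos_pos)
  show "w powr e \<le> (a powr e + b powr e) * r powr e"
  proof (cases "e \<ge> 0")
    case True
    then have "w powr e \<le> (b * r) powr e" using assms w by (intro powr_mono2) auto
    also have "\<dots> \<le> (a powr e + b powr e) * r powr e" using assms by (simp add: powr_mult distrib_right)
    finally show ?thesis .
  next
    case False
    then have "w powr e \<le> (a * r) powr e" using assms w by (intro powr_mono2') auto
    also have "\<dots> \<le> (a powr e + b powr e) * r powr e" using assms by (simp add: powr_mult distrib_right)
    finally show ?thesis .
  qed
  show "r powr e \<le> (a powr (- e) + b powr (- e)) * w powr e"
  proof (cases "e \<ge> 0")
    case True
    have "r powr e = a powr (- e) * (a * r) powr e" using assms by (simp add: powr_mult powr_minus field_simps)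
    also have "\<dots> \<le> a powr (- e) * w powr e" using assms True by (intro mult_left_mono powr_mono2) auto
    also have "\<dots> \<le> (a powr (- e) + b powr (- e)) * w powr e" by (simp add: distrib_right)
    finally show ?thesis .
  next
    case False
    have "r powr e = b powr (- e) * (b * r) powr e" using assms by (simp add: powr_mult powr_minus field_simps)
    also have "\<dots> \<le> b powr (- e) * w powr e" using assms w False by (intro mult_left_mono powr_mono2') auto
    also have "\<dots> \<le> (a powr (- e) + b powr (- e)) * w powr e" by (simp add: distrib_right)
    finally show ?thesis .
  qed
qed

text \<open>The weight \<open>w\<close> is not known to be measurable. Each direction therefore uses
  the domination lemma that asks for measurability of the integrand with
  \<open>norm\<close>.\<close>

lemma (in exterior) o_inf_weight:
  fixes u :: "real^3 \<Rightarrow> 'b::real_normed_vector"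
  assumes c: "\<rho> > R" "a > 0" "b > 0" "\<And>x. \<rho> < norm x \<Longrightarrow> a * norm x \<le> w x" "\<And>x. \<rho> < norm x \<Longrightarrow> w x \<le> b * norm x"
  shows "o_inf w R \<delta> u \<longleftrightarrow> small \<delta> u"
proof -
  have r: "\<rho> > 0" using c R_pos by simp
  have eq: "weighted_norm_finite w (ext \<sigma>) d f \<longleftrightarrow> weighted_norm_finite norm (ext \<sigma>) d f"
    if f: "continuous_on (ext \<sigma>) f" and s: "\<sigma> \<ge> \<rho>" for f :: "real^3 \<Rightarrow> 'b" and d \<sigma>
  proof -
    define e where "e = - 2 * d - 3"
    have s0: "\<sigma> > 0" using s r by simp
    have pw: "w x powr e \<le> (a powr e + b powr e) * norm x powr e"
      "norm x powr e \<le> (a powr (- e) + b powr (- e)) * w x powr e" if "x \<in> ext \<sigma>" for x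
    proof -
      have x: "\<rho> < norm x" "norm x > 0" using that s r by auto
      show "w x powr e \<le> (a powr e + b powr e) * norm x powr e"
        "norm x powr e \<le> (a powr (- e) + b powr (- e)) * w x powr e"
        using powr_comparable[OF c(2,3) x(2) c(4)[OF x(1)] c(5)[OF x(1)]] by auto
    qed
    show ?thesis
    proof
      assume W: "weighted_norm_finite w (ext \<sigma>) d f"
      show "weighted_norm_finite norm (ext \<sigma>) d f"
      proof (rule weighted_norm_finite_dominated'[OF W _ measurable_weighted[OF f s0]])
        show "a powr (- e) + b powr (- e) > 0" using c by (simp add: add_pos_pos)
        show "(norm (f x))\<^sup>2 * norm x powr (- 2 * d - 3) \<le> (a powr (- e) + b powr (- e)) * ((norm (f x))\<^sup>2 * w x powr (- 2 * d - 3))"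
          if "x \<in> ext \<sigma>" for x
          using mult_left_mono[OF pw(2)[OF that], of "(norm (f x))\<^sup>2"] unfolding e_def by (simp add: mult_ac)
      qed auto
    next
      assume W: "weighted_norm_finite norm (ext \<sigma>) d f"
      show "weighted_norm_finite w (ext \<sigma>) d f"
      proof (rule weighted_norm_finite_dominated[OF W _ measurable_weighted[OF f s0]])
        show "(norm (f x))\<^sup>2 * w x powr (- 2 * d - 3) \<le> (a powr e + b powr e) * ((norm (f x))\<^sup>2 * norm x powr (- 2 * d - 3))"
          if "x \<in> ext \<sigma>" for x
          using mult_left_mono[OF pw(1)[OF that], of "(norm (f x))\<^sup>2"] unfolding e_def by (simp add: mult_ac)
      qed auto
    qed
  qed
  have mono: "weighted_sobolev v (ext \<sigma>) s \<delta> u \<Longrightarrow> \<sigma> \<le> \<tau> \<Longrightarrow> weighted_sobolev v (ext \<tau>) s \<delta> u" for v s \<sigma> \<tau>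
    unfolding weighted_sobolev_def by (auto elim!: weighted_norm_finite_subset)
  have eq': "weighted_sobolev w (ext \<sigma>) s \<delta> u \<longleftrightarrow> weighted_sobolev norm (ext \<sigma>) s \<delta> u"
    if "smooth u" "\<sigma> \<ge> \<rho>" for s \<sigma>
  proof -
    have "smooth_on (ext \<sigma>) u" using smooth_on_ext_antimono[OF that(1)] that(2) c(1) by simp
    then have "continuous_on (ext \<sigma>) (pds is u)" for "is"
      by (intro smooth_on_imp_continuous smooth_on_pds)
    then show ?thesis unfolding weighted_sobolev_def using eq[OF _ that(2)] by blast
  qed
  have half: "(\<exists>R'>R. \<forall>s. weighted_sobolev v (ext R') s \<delta> u) \<longleftrightarrow> (\<exists>R'>R. R' \<ge> \<rho> \<and> (\<forall>s. weighted_sobolev v (ext R') s \<delta> u))" for v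
  proof
    assume "\<exists>R'>R. \<forall>s. weighted_sobolev v (ext R') s \<delta> u"
    then obtain R' where "R' > R" "\<And>s. weighted_sobolev v (ext R') s \<delta> u" by blast
    then show "\<exists>R'>R. R' \<ge> \<rho> \<and> (\<forall>s. weighted_sobolev v (ext R') s \<delta> u)"
      using mono[of v R' _ "max R' \<rho>"] by (intro exI[of _ "max R' \<rho>"]) auto
  qed blast
  have "o_inf w R \<delta> u \<longleftrightarrow> o_inf norm R \<delta> u"
    unfolding o_inf_def half[of w] half[of norm] using eq' by blast
  then show ?thesis by (simp add: o_inf_cls)
qed

subsection \<open>Mixed partial derivatives\<close>

lemma vector_mvt:
  fixes \<phi> :: "real \<Rightarrow> 'b::real_normed_vector"
  assumes h: "0 < h" and d: "\<And>t. 0 \<le> t \<Longrightarrow> t \<le> h \<Longrightarrow> (\<phi> has_vector_derivative \<phi>' t) (at t)"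
    and B: "\<And>t. 0 \<le> t \<Longrightarrow> t \<le> h \<Longrightarrow> norm (\<phi>' t) \<le> B"
  shows "norm (\<phi> h - \<phi> 0) \<le> B * h"
proof -
  have "norm (\<phi> h - \<phi> 0) \<le> B * h - B * 0"
  proof (rule differentiable_bound_general[where f = \<phi> and f' = \<phi>' and \<phi> = "\<lambda>t. B * t" and \<phi>' = "\<lambda>_. B", OF h])
    show "continuous_on {0..h} \<phi>"
      unfolding continuous_on_eq_continuous_within
    proof
      fix t assume "t \<in> {0..h}"
      then show "continuous (at t within {0..h}) \<phi>"
        using has_vector_derivative_continuous[OF has_vector_derivative_at_within[OF d]] by simp
    qed
    show "((\<lambda>t. B * t) has_vector_derivative B) (at t)" for t
      by (auto intro!: derivative_eq_intros)
  qed (use d B in \<open>auto intro!: continuous_intros\<close>)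
  then show ?thesis by simp
qed

lemma has_vector_derivative_axis:
  fixes f :: "real^3 \<Rightarrow> 'b::real_normed_vector"
  assumes "f differentiable at (x + t *\<^sub>R axis i 1)"
  shows "((\<lambda>t. f (x + t *\<^sub>R axis i 1)) has_vector_derivative pd i f (x + t *\<^sub>R axis i 1)) (at t)"
proof -
  have "(\<Sum>k\<in>UNIV. (axis i 1 :: real^3) $ k *\<^sub>R g k) = g i" for g :: "3 \<Rightarrow> 'b"
  proof -
    have "(\<Sum>k\<in>UNIV. (axis i 1 :: real^3) $ k *\<^sub>R g k) = (\<Sum>k\<in>UNIV. if k = i then g k else 0)"
      by (rule sum.cong) (auto simp: axis_def)
    then show ?thesis by simp
  qed
  then show ?thesis using has_vector_derivative_line[OF assms] by simp
qed

text \<open>The mean value inequality is applied to \<open>pd i f\<close> in direction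
  \<open>j\<close> and then to a difference of \<open>f\<close> in direction \<open>i\<close>;
  continuity of the mixed derivative at \<open>x\<close> provides \<open>e\<close>.\<close>

lemma second_difference:
  fixes f :: "real^3 \<Rightarrow> 'b::real_normed_vector"
  assumes U: "open U" "smooth_on U f" and x: "x \<in> U" and e: "e > 0"
  shows "\<exists>d>0. \<forall>h. 0 < h \<and> h < d \<longrightarrow> norm (f (x + h *\<^sub>R axis i 1 + h *\<^sub>R axis j 1) - f (x + h *\<^sub>R axis i 1)
    - f (x + h *\<^sub>R axis j 1) + f x - (h * h) *\<^sub>R pd j (pd i f) x) \<le> e * (h * h)"
proof -
  let ?P = "pd j (pd i f)"
  have "continuous_on U ?P" by (intro smooth_on_imp_continuous smooth_on_pd U)
  then obtain d1 where d1: "d1 > 0" "\<And>y. y \<in> U \<Longrightarrow> dist y x < d1 \<Longrightarrow> dist (?P y) (?P x) < e"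
    using x e unfolding continuous_on_iff by blast
  obtain d2 where d2: "d2 > 0" "ball x d2 \<subseteq> U" using U x openE by blast
  define d where "d = min d1 d2 / 2"
  have "d > 0" using d1 d2 by (simp add: d_def)
  moreover have "norm (f (x + h *\<^sub>R axis i 1 + h *\<^sub>R axis j 1) - f (x + h *\<^sub>R axis i 1)
    - f (x + h *\<^sub>R axis j 1) + f x - (h * h) *\<^sub>R ?P x) \<le> e * (h * h)" if h: "0 < h" "h < d" for h
  proof -
    have near: "dist (x + s *\<^sub>R axis i 1 + t *\<^sub>R axis j 1) x < min d1 d2"
      if "0 \<le> s" "s \<le> h" "0 \<le> t" "t \<le> h" for s t
    proof -
      have "dist (x + s *\<^sub>R axis i 1 + t *\<^sub>R axis j 1) x \<le> norm (s *\<^sub>R axis i 1 :: real^3) + norm (t *\<^sub>R axis j 1 :: real^3)"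
        unfolding dist_norm using norm_triangle_ineq[of "s *\<^sub>R axis i 1 :: real^3" "t *\<^sub>R axis j 1"] by (simp add: algebra_simps)
      also have "\<dots> < min d1 d2" using that h by (simp add: norm_axis_1 d_def)
      finally show ?thesis .
    qed
    have inU: "x + s *\<^sub>R axis i 1 + t *\<^sub>R axis j 1 \<in> U" if "0 \<le> s" "s \<le> h" "0 \<le> t" "t \<le> h" for s t
      using near[OF that] d2(2) by (auto simp: dist_commute)
    have inner: "norm (pd i f (x + s *\<^sub>R axis i 1 + h *\<^sub>R axis j 1) - pd i f (x + s *\<^sub>R axis i 1) - h *\<^sub>R ?P x) \<le> e * h"
      if s: "0 \<le> s" "s \<le> h" for s
    proof -
      let ?\<psi> = "\<lambda>t. pd i f (x + s *\<^sub>R axis i 1 + t *\<^sub>R axis j 1) - t *\<^sub>R ?P x"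
      have "norm (?\<psi> h - ?\<psi> 0) \<le> e * h"
      proof (rule vector_mvt[OF h(1)])
        fix t assume t: "0 \<le> t" "t \<le> h"
        show "(?\<psi> has_vector_derivative (?P (x + s *\<^sub>R axis i 1 + t *\<^sub>R axis j 1) - ?P x)) (at t)"
          by (intro has_vector_derivative_diff has_vector_derivative_axis smooth_on_imp_diff[OF U(1)] smooth_on_pd U inU s t)
            (auto intro!: derivative_eq_intros)
        show "norm (?P (x + s *\<^sub>R axis i 1 + t *\<^sub>R axis j 1) - ?P x) \<le> e"
          using d1(2)[OF inU[OF s t]] near[OF s t] by (simp add: dist_norm)
      qed
      then show ?thesis by (simp add: algebra_simps)
    qed
    let ?\<phi> = "\<lambda>s. f (x + h *\<^sub>R axis j 1 + s *\<^sub>R axis i 1) - f (x + s *\<^sub>R axis i 1) - s *\<^sub>R h *\<^sub>R ?P x"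
    have "norm (?\<phi> h - ?\<phi> 0) \<le> (e * h) * h"
    proof (rule vector_mvt[OF h(1)])
      fix s assume s: "0 \<le> s" "s \<le> h"
      have c: "x + h *\<^sub>R axis j 1 + s *\<^sub>R axis i 1 = x + s *\<^sub>R axis i 1 + h *\<^sub>R axis j 1" by simp
      have U1: "x + h *\<^sub>R axis j 1 + s *\<^sub>R axis i 1 \<in> U" unfolding c using inU[of s h] s h by simp
      have U2: "x + s *\<^sub>R axis i 1 \<in> U" using inU[of s 0] s h by simp
      show "(?\<phi> has_vector_derivative (pd i f (x + s *\<^sub>R axis i 1 + h *\<^sub>R axis j 1) - pd i f (x + s *\<^sub>R axis i 1) - h *\<^sub>R ?P x)) (at s)"
        unfolding c[symmetric]
        by (intro has_vector_derivative_diff has_vector_derivative_axis smooth_on_imp_diff[OF U] U1 U2)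
          (auto intro!: derivative_eq_intros)
      show "norm (pd i f (x + s *\<^sub>R axis i 1 + h *\<^sub>R axis j 1) - pd i f (x + s *\<^sub>R axis i 1) - h *\<^sub>R ?P x) \<le> e * h"
        by (rule inner[OF s])
    qed
    then show ?thesis by (simp add: algebra_simps)
  qed
  ultimately show ?thesis by blast
qed

text \<open>Both mixed derivatives are limits of the same second difference quotient, whose form is
  symmetric in \<open>i\<close> and \<open>j\<close>.\<close>

lemma pd_commute:
  fixes f :: "real^3 \<Rightarrow> 'b::real_normed_vector"
  assumes U: "open U" "smooth_on U f" and x: "x \<in> U"
  shows "pd i (pd j f) x = pd j (pd i f) x"
proof (rule ccontr)
  let ?a = "pd j (pd i f) x" and ?b = "pd i (pd j f) x"
  assume "?b \<noteq> ?a"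
  then have e: "norm (?a - ?b) / 3 > 0" by simp
  obtain d1 where d1: "d1 > 0" "\<And>h. 0 < h \<and> h < d1 \<Longrightarrow> norm (f (x + h *\<^sub>R axis i 1 + h *\<^sub>R axis j 1) - f (x + h *\<^sub>R axis i 1)
    - f (x + h *\<^sub>R axis j 1) + f x - (h * h) *\<^sub>R ?a) \<le> norm (?a - ?b) / 3 * (h * h)"
    using second_difference[OF U x e, of i j] by blast
  obtain d2 where d2: "d2 > 0" "\<And>h. 0 < h \<and> h < d2 \<Longrightarrow> norm (f (x + h *\<^sub>R axis j 1 + h *\<^sub>R axis i 1) - f (x + h *\<^sub>R axis j 1)
    - f (x + h *\<^sub>R axis i 1) + f x - (h * h) *\<^sub>R ?b) \<le> norm (?a - ?b) / 3 * (h * h)"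
    using second_difference[OF U x e, of j i] by blast
  define h where "h = min d1 d2 / 2"
  have h: "0 < h" "h < d1" "h < d2" using d1 d2 by (auto simp: h_def)
  define \<Delta> where "\<Delta> = f (x + h *\<^sub>R axis i 1 + h *\<^sub>R axis j 1) - f (x + h *\<^sub>R axis i 1) - f (x + h *\<^sub>R axis j 1) + f x"
  have 1: "norm (\<Delta> - (h * h) *\<^sub>R ?a) \<le> norm (?a - ?b) / 3 * (h * h)"
    using d1(2)[of h] h by (simp add: \<Delta>_def)
  have "f (x + h *\<^sub>R axis j 1 + h *\<^sub>R axis i 1) - f (x + h *\<^sub>R axis j 1) - f (x + h *\<^sub>R axis i 1) + f x = \<Delta>"
    unfolding \<Delta>_def by (simp add: add.commute add.left_commute)
  then have 2: "norm (\<Delta> - (h * h) *\<^sub>R ?b) \<le> norm (?a - ?b) / 3 * (h * h)"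
    using d2(2)[of h] h by simp
  have "norm ((h * h) *\<^sub>R (?a - ?b)) = norm ((\<Delta> - (h * h) *\<^sub>R ?b) - (\<Delta> - (h * h) *\<^sub>R ?a))"
    by (simp add: algebra_simps)
  also have "\<dots> \<le> norm (\<Delta> - (h * h) *\<^sub>R ?b) + norm (\<Delta> - (h * h) *\<^sub>R ?a)" by (rule norm_triangle_ineq4)
  also have "\<dots> \<le> 2 * (norm (?a - ?b) / 3 * (h * h))" using 1 2 by linarith
  finally have "norm (?a - ?b) * (h * h) \<le> 2 / 3 * (norm (?a - ?b) * (h * h))" by (simp add: mult_ac)
  moreover have "norm (?a - ?b) * (h * h) > 0" using e h by simp
  ultimately show False by linarith
qed

subsection \<open>The flat conformal Killing operator\<close>

text \<open>The flat conformal Killing operator is of finite type. With \<open>a i j k = \<partial>\<^sub>i\<partial>\<^sub>j X\<^sub>k\<close> and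
  \<open>b l i j k = \<partial>\<^sub>l\<partial>\<^sub>i\<partial>\<^sub>j X\<^sub>k\<close>, the array \<open>f\<close> consists of derivatives of the operator applied to \<open>X\<close>
  and \<open>d\<close> of derivatives of the divergence: the Hessian of the divergence is determined by the
  operator, and then so is the Hessian of \<open>X\<close>.\<close>

lemma conformal_killing_algebra2:
  fixes a :: "3 \<Rightarrow> 3 \<Rightarrow> 3 \<Rightarrow> complex"
  assumes "\<And>i j k. a i j k = a j i k"
  defines "d \<equiv> \<lambda>i. \<Sum>k\<in>UNIV. a i k k"
  defines "f \<equiv> \<lambda>l i j. a l i j + a l j i - 2/3 * complex_of_real (kronecker i j) * d l"
  shows "a i j k = (f i j k + f j i k - f k i j) / 2 +
    (complex_of_real (kronecker j k) * d i + complex_of_real (kronecker i k) * d j - complex_of_real (kronecker i j) * d k) / 3"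
proof -
  have "(f i j k + f j i k - f k i j) / 2 +
    (complex_of_real (kronecker j k) * d i + complex_of_real (kronecker i k) * d j - complex_of_real (kronecker i j) * d k) / 3
    = (a i j k + a i k j + a j i k + a j k i - a k i j - a k j i) / 2"
    unfolding f_def by (simp add: field_simps)
  also have "\<dots> = a i j k" using assms(1)[of i k j] assms(1)[of j i k] assms(1)[of j k i] by simp
  finally show ?thesis by simp
qed

text \<open>Contracting one derivative with the operator yields derivatives of the Laplacian of
  \<open>X\<close>, collected in \<open>L\<close>, plus a third of the Hessian of the divergence.
  The symmetrised \<open>L\<close> cancels against the Laplacian of the operator, and a second
  contraction fixes the trace.\<close>

lemma conformal_killing_algebra3:
  fixes b :: "3 \<Rightarrow> 3 \<Rightarrow> 3 \<Rightarrow> 3 \<Rightarrow> complex"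
  assumes s1: "\<And>l i j k. b l i j k = b i l j k" and s2: "\<And>l i j k. b l i j k = b l j i k"
  defines "d \<equiv> \<lambda>l m. \<Sum>k\<in>UNIV. b l m k k"
  defines "f \<equiv> \<lambda>l m i j. b l m i j + b l m j i - 2/3 * complex_of_real (kronecker i j) * d l m"
  shows "d j k = 3/2 * (\<Sum>i\<in>UNIV. f i j i k + f i k i j - f i i j k)
    - 3/4 * complex_of_real (kronecker j k) * (\<Sum>i\<in>UNIV. \<Sum>l\<in>UNIV. f i l i l)"
proof -
  have dsym: "d l m = d m l" for l m unfolding d_def using s1 by simp
  define L where "L k = (\<lambda>j. \<Sum>i\<in>UNIV. b i i j k)" for k
  have kr: "(\<Sum>i\<in>(UNIV::3 set). complex_of_real (kronecker i k) * g i) = g k" for k g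
  proof -
    have "(\<Sum>i\<in>UNIV. complex_of_real (kronecker i k) * g i) = (\<Sum>i\<in>UNIV. if i = k then g i else 0)"
      by (rule sum.cong) (auto simp: kronecker_def)
    then show ?thesis by simp
  qed
  have 1: "(\<Sum>i\<in>UNIV. f i j i k) = L k j + 1/3 * d j k" for j k
  proof -
    have "b i j i k = b i i j k" "b i j k i = b j k i i" for i
      using s1 s2 by metis+
    then have "(\<Sum>i\<in>UNIV. f i j i k) = L k j + (\<Sum>i\<in>UNIV. b j k i i) - 2/3 * (\<Sum>i\<in>UNIV. complex_of_real (kronecker i k) * d i j)"
      unfolding f_def L_def by (simp add: sum.distrib sum_subtractf sum_distrib_left mult.assoc)
    moreover have "(\<Sum>i\<in>UNIV. b j k i i) = d j k" by (simp add: d_def)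
    ultimately show ?thesis unfolding kr using dsym[of k j] by simp
  qed
  define tr where "tr = (\<Sum>i\<in>UNIV. d i i)"
  have 2: "(\<Sum>i\<in>UNIV. f i i j k) = L k j + L j k - 2/3 * complex_of_real (kronecker j k) * tr" for j k
    unfolding f_def L_def tr_def by (simp add: sum.distrib sum_subtractf sum_distrib_left)
  have "(\<Sum>j\<in>UNIV. L j j) = tr"
  proof -
    have "(\<Sum>j\<in>UNIV. L j j) = (\<Sum>i\<in>UNIV. \<Sum>j\<in>UNIV. b i i j j)" unfolding L_def by (rule sum.swap)
    then show ?thesis by (simp add: tr_def d_def)
  qed
  moreover have "(\<Sum>i\<in>UNIV. \<Sum>l\<in>UNIV. f i l i l) = (\<Sum>l\<in>UNIV. L l l + 1/3 * d l l)"
    by (subst sum.swap) (simp only: 1)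
  ultimately have 3: "(\<Sum>i\<in>UNIV. \<Sum>l\<in>UNIV. f i l i l) = 4/3 * tr"
    by (simp add: sum.distrib tr_def flip: sum_divide_distrib)
  have "(\<Sum>i\<in>UNIV. f i j i k + f i k i j - f i i j k) =
      (L k j + 1/3 * d j k) + (L j k + 1/3 * d k j) - (L k j + L j k - 2/3 * complex_of_real (kronecker j k) * tr)"
    by (simp only: sum.distrib sum_subtractf 1 2)
  also have "\<dots> = 2/3 * d j k + 2/3 * complex_of_real (kronecker j k) * tr"
    using dsym[of k j] by simp
  finally show ?thesis unfolding 3 by (simp add: field_simps)
qed

context exterior
begin

definition ckf :: "(3 \<Rightarrow> real^3 \<Rightarrow> complex) \<Rightarrow> 3 \<Rightarrow> 3 \<Rightarrow> real^3 \<Rightarrow> complex" where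
  "ckf X i j x = pd i (X j) x + pd j (X i) x
    - 2/3 * complex_of_real (kronecker i j) * (\<Sum>k\<in>UNIV. pd k (X k) x)"

lemma pd_lincomb:
  fixes f g :: "real^3 \<Rightarrow> complex"
  assumes "f differentiable at x" "g differentiable at x" "\<And>k. u k differentiable at x"
  shows "pd l (\<lambda>x. f x + g x - c * (\<Sum>k\<in>(UNIV::3 set). u k x)) x = pd l f x + pd l g x - c * (\<Sum>k\<in>UNIV. pd l (u k) x)"
proof -
  have s: "(\<lambda>x. \<Sum>k\<in>UNIV. u k x) differentiable at x" using assms(3) by (intro differentiable_sum) auto
  have "(\<lambda>x. c * (\<Sum>k\<in>UNIV. u k x)) differentiable at x" using s by (intro differentiable_mult) auto
  moreover have "(\<lambda>x. f x + g x) differentiable at x" using assms by (intro differentiable_add)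
  ultimately have "pd l (\<lambda>x. f x + g x - c * (\<Sum>k\<in>UNIV. u k x)) x =
      pd l (\<lambda>x. f x + g x) x - pd l (\<lambda>x. c * (\<Sum>k\<in>UNIV. u k x)) x" by (rule pd_diff[rotated])
  also have "pd l (\<lambda>x. f x + g x) x = pd l f x + pd l g x" by (rule pd_add[OF assms(1,2)])
  also have "pd l (\<lambda>x. c * (\<Sum>k\<in>UNIV. u k x)) x = c * pd l (\<lambda>x. \<Sum>k\<in>UNIV. u k x) x"
    by (rule pd_bounded_linear[OF bounded_linear_mult_right s])
  also have "pd l (\<lambda>x. \<Sum>k\<in>UNIV. u k x) x = (\<Sum>k\<in>UNIV. pd l (u k) x)"
    using assms(3) by (intro pd_sum) auto
  finally show ?thesis .
qed

text \<open>The finite type is read from the top: the operator bounds the Hessian of the divergence,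
  hence by integration its gradient, then the Hessian of \<open>X\<close>, then \<open>dX\<close>,
  and finally \<open>X\<close> up to a constant. Each integration from infinity raises the order by
  one.\<close>

lemma conformal_killing_decay:
  assumes X: "\<And>a. smooth (X a)" and dX: "\<And>a b. symb \<epsilon> (pd a (X b))" and \<epsilon>: "\<epsilon> < 0"
    and F: "\<And>a b. small \<delta> (ckf X a b)" and \<delta>: "\<delta> + 1 < 0"
  shows "\<exists>C. \<forall>a. small (\<delta> + 1) (\<lambda>x. X a x - C a)"
proof -
  have Xd: "pds is (X a) differentiable at x" if "x \<in> ext R" for a "is" x
    by (rule smooth_on_pds_diff[OF open_ext X that])
  have Xd1: "pd j (X a) differentiable at x" if "x \<in> ext R" for a j x using Xd[of x "[j]" a] that by simp
  have Xd2: "pd i (pd j (X a)) differentiable at x" if "x \<in> ext R" for a i j x using Xd[of x "[i, j]" a] that by simp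
  have com: "pd i (pd j (X a)) x = pd j (pd i (X a)) x" if "x \<in> ext R" for i j a x
    by (rule pd_commute[OF open_ext X that])
  have com3: "pd l (pd i (pd j (X a))) x = pd l (pd j (pd i (X a))) x" if "x \<in> ext R" for l i j a x
    by (rule pd_cong_open[OF open_ext that]) (rule com)
  have com3': "pd l (pd i (pd j (X a))) x = pd i (pd l (pd j (X a))) x" if "x \<in> ext R" for l i j a x
    by (rule pd_commute[OF open_ext smooth_on_pd[OF X] that])
  define d where "d x = (\<Sum>k\<in>UNIV. pd k (X k) x)" for x
  have F1: "pd l (ckf X i j) x = pd l (pd i (X j)) x + pd l (pd j (X i)) x
      - 2/3 * complex_of_real (kronecker i j) * (\<Sum>k\<in>UNIV. pd l (pd k (X k)) x)" if x: "x \<in> ext R" for l i j x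
    unfolding ckf_def[abs_def] using Xd1[OF x] by (intro pd_lincomb) auto
  have F2: "pd m (pd l (ckf X i j)) x = pd m (pd l (pd i (X j))) x + pd m (pd l (pd j (X i))) x
      - 2/3 * complex_of_real (kronecker i j) * (\<Sum>k\<in>UNIV. pd m (pd l (pd k (X k))) x)" if x: "x \<in> ext R" for m l i j x
  proof -
    have "pd m (pd l (ckf X i j)) x = pd m (\<lambda>x. pd l (pd i (X j)) x + pd l (pd j (X i)) x
      - 2/3 * complex_of_real (kronecker i j) * (\<Sum>k\<in>UNIV. pd l (pd k (X k)) x)) x"
      by (rule pd_cong_open[OF open_ext x]) (rule F1)
    also have "\<dots> = pd m (pd l (pd i (X j))) x + pd m (pd l (pd j (X i))) x
      - 2/3 * complex_of_real (kronecker i j) * (\<Sum>k\<in>UNIV. pd m (pd l (pd k (X k))) x)"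
      using Xd2[OF x] by (intro pd_lincomb) auto
    finally show ?thesis .
  qed
  have d1: "pd l d x = (\<Sum>k\<in>UNIV. pd l (pd k (X k)) x)" if x: "x \<in> ext R" for l x
    unfolding d_def[abs_def] using Xd1[OF x] by (intro pd_sum) auto
  have d2: "pd m (pd l d) x = (\<Sum>k\<in>UNIV. pd m (pd l (pd k (X k))) x)" if x: "x \<in> ext R" for m l x
  proof -
    have "pd m (pd l d) x = pd m (\<lambda>x. \<Sum>k\<in>UNIV. pd l (pd k (X k)) x) x"
      by (rule pd_cong_open[OF open_ext x]) (rule d1)
    also have "\<dots> = (\<Sum>k\<in>UNIV. pd m (pd l (pd k (X k))) x)"
      using Xd2[OF x] by (intro pd_sum) auto
    finally show ?thesis .
  qed
  have s_d: "symb \<epsilon> d" unfolding d_def[abs_def] by (intro symb_sum dX)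
  have ddd: "small (\<delta> - 2) (pd j (pd k d))" for j k
  proof (rule small_cong)
    have FF: "small (\<delta> - 2) (pd l (pd m (ckf X i j)))" for l m i j
      using small_pd[OF small_pd[OF F[of i j], of m], of l] by (simp add: algebra_simps)
    show "small (\<delta> - 2) (\<lambda>x. 3/2 * (\<Sum>i\<in>UNIV. pd i (pd j (ckf X i k)) x + pd i (pd k (ckf X i j)) x - pd i (pd i (ckf X j k)) x)
      - 3/4 * complex_of_real (kronecker j k) * (\<Sum>i\<in>UNIV. \<Sum>l\<in>UNIV. pd i (pd l (ckf X i l)) x))"
      by (intro small_diff small_cmult small_sum small_add FF)
    fix x :: "real^3" assume "R < norm x"
    then have x: "x \<in> ext R" by simp
    define b where "b l i j k = pd l (pd i (pd j (X k))) x" for l i j k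
    have "(\<Sum>m\<in>UNIV. b j k m m) = 3/2 * (\<Sum>i\<in>UNIV.
       (b i j i k + b i j k i - 2/3 * complex_of_real (kronecker i k) * (\<Sum>m\<in>UNIV. b i j m m))
     + (b i k i j + b i k j i - 2/3 * complex_of_real (kronecker i j) * (\<Sum>m\<in>UNIV. b i k m m))
     - (b i i j k + b i i k j - 2/3 * complex_of_real (kronecker j k) * (\<Sum>m\<in>UNIV. b i i m m)))
     - 3/4 * complex_of_real (kronecker j k) * (\<Sum>i\<in>UNIV. \<Sum>l\<in>UNIV.
       (b i l i l + b i l l i - 2/3 * complex_of_real (kronecker i l) * (\<Sum>m\<in>UNIV. b i l m m)))"
      by (rule conformal_killing_algebra3) (simp_all add: b_def com3'[OF x] com3[OF x])
    then show "3/2 * (\<Sum>i\<in>UNIV. pd i (pd j (ckf X i k)) x + pd i (pd k (ckf X i j)) x - pd i (pd i (ckf X j k)) x)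
      - 3/4 * complex_of_real (kronecker j k) * (\<Sum>i\<in>UNIV. \<Sum>l\<in>UNIV. pd i (pd l (ckf X i l)) x) = pd j (pd k d) x"
      unfolding F2[OF x] d2[OF x] b_def by simp
  qed
  \<comment> \<open>No constant of integration appears: the first derivatives of \<open>X\<close>
    are symbols of negative order, so the gradient of the divergence tends to 0.\<close>
  have dd: "small (\<delta> - 1) (pd k d)" for k
  proof (rule small_integrate_inwards_null[OF symb_pd[OF s_d]])
    show "small (\<delta> - 1 - 1) (pd i (pd k d))" for i using ddd[of i k] by (simp add: algebra_simps)
  qed (use \<epsilon> \<delta> in auto)
  have ddX: "small (\<delta> - 1) (pd i (pd j (X k)))" for i j k
  proof (rule small_cong)
    show "small (\<delta> - 1) (\<lambda>x. 1/2 * (pd i (ckf X j k) x + pd j (ckf X i k) x - pd k (ckf X i j) x) +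
      1/3 * (complex_of_real (kronecker j k) * pd i d x + complex_of_real (kronecker i k) * pd j d x - complex_of_real (kronecker i j) * pd k d x))"
      by (intro small_add small_cmult small_diff small_pd F dd)
    fix x :: "real^3" assume "R < norm x"
    then have x: "x \<in> ext R" by simp
    show "1/2 * (pd i (ckf X j k) x + pd j (ckf X i k) x - pd k (ckf X i j) x) +
      1/3 * (complex_of_real (kronecker j k) * pd i d x + complex_of_real (kronecker i k) * pd j d x - complex_of_real (kronecker i j) * pd k d x)
      = pd i (pd j (X k)) x"
      using conformal_killing_algebra2[of "\<lambda>i j k. pd i (pd j (X k)) x" i j k, OF com[OF x]]
      unfolding F1[OF x] d1[OF x] by simp
  qed
  have dX': "small \<delta> (pd j (X k))" for j k
    by (rule small_integrate_inwards_null[OF dX \<epsilon> _ ddX]) (use \<delta> in simp)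
  have "\<exists>C. small (\<delta> + 1) (\<lambda>x. X a x - C)" for a
    by (rule small_integrate_inwards[OF X \<delta>]) (simp add: dX')
  then show ?thesis by metis
qed

end

subsection \<open>Spinor algebra in the frame\<close>

text \<open>The Levi-Civita symbol with complex values.\<close>

definition lc :: "3 \<Rightarrow> 3 \<Rightarrow> 3 \<Rightarrow> complex" where
  "lc i j k = (if (i, j, k) \<in> {(1, 2, 3), (2, 3, 1), (3, 1, 2)} then 1
     else if (i, j, k) \<in> {(2, 1, 3), (1, 3, 2), (3, 2, 1)} then - 1 else 0)"

lemma solder0_sym: "solder0 k A B = solder0 k B A"
  unfolding solder0_def by (simp add: add.commute)

lemma sqrt2_sq: "complex_of_real (sqrt 2) * complex_of_real (sqrt 2) = 2"
  by (simp flip: of_real_mult)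

lemma sqrt2_sq': "complex_of_real (sqrt 2) * (complex_of_real (sqrt 2) * z) = 2 * z"
  by (simp flip: of_real_mult mult.assoc)

lemma symmetrise4_eq:
  "symmetrise4 T A B C D = (T A B C D + T A B D C + T A C B D + T A C D B + T A D B C + T A D C B +
     T B A C D + T B A D C + T B C A D + T B C D A + T B D A C + T B D C A +
     T C A B D + T C A D B + T C B A D + T C B D A + T C D A B + T C D B A +
     T D A B C + T D A C B + T D B A C + T D B C A + T D C A B + T D C B A) / 24"
proof -
  have s: "{..<4::nat} = insert 0 (insert 1 (insert 2 {3}))" by auto
  have f: "finite {1, 2, 3 :: nat}" "0 \<notin> {1, 2, 3 :: nat}" "finite {2, 3 :: nat}" "1 \<notin> {2, 3 :: nat}"
    "finite {3 :: nat}" "2 \<notin> {3 :: nat}" by auto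
  show ?thesis
    unfolding symmetrise4_def s sum_over_permutations_insert[OF f(1,2)] sum_over_permutations_insert[OF f(3,4)]
      sum_over_permutations_insert[OF f(5,6)] permutes_sing Let_def
    by (simp add: transpose_def eval_nat_numeral add_ac)
qed

text \<open>It projects a pair of frame indices to the symmetric trace-free part, whose spinor is
  totally symmetric.\<close>

definition sym_solder :: "3 \<Rightarrow> 3 \<Rightarrow> 2 \<Rightarrow> 2 \<Rightarrow> 2 \<Rightarrow> 2 \<Rightarrow> complex" where
  "sym_solder k l = symmetrise4 (\<lambda>A B C D. solder0 k A B * solder0 l C D)"

lemma sym_solder_commute: "sym_solder k l A B C D = sym_solder l k A B C D"
  unfolding sym_solder_def symmetrise4_eq by (simp add: mult.commute add_ac)

text \<open>By the normalisation of the solder forms the trace consists of products of two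
  \<open>eps\<close>, which total symmetrisation annihilates.\<close>

lemma sym_solder_trace: "(\<Sum>k\<in>UNIV. sym_solder k k A B C D) = 0"
proof -
  have "(\<Sum>k\<in>UNIV. sym_solder k k A B C D) = symmetrise4 (\<lambda>A B C D. \<Sum>k\<in>UNIV. solder0 k A B * solder0 k C D) A B C D"
    unfolding sym_solder_def symmetrise4_eq by (simp only: sum_divide_distrib[symmetric] sum.distrib)
  also have "(\<lambda>A B C D. \<Sum>k\<in>UNIV. solder0 k A B * solder0 k C D) =
      (\<lambda>A B C D. - ((eps A C * eps B D + eps A D * eps B C) / 2))"
    by (intro ext) (simp flip: solder0_normalisation)
  also have "symmetrise4 \<dots> A B C D = 0"
  proof -
    have e: "eps X Y = - eps Y X" for X Y using exhaust_2[of X] exhaust_2[of Y] by (auto simp: eps_def)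
    show ?thesis unfolding symmetrise4_eq
      using e[of A B] e[of A C] e[of A D] e[of B C] e[of B D] e[of C D] by (simp add: algebra_simps)
  qed
  finally show ?thesis .
qed

definition frame_spinor :: "(3 \<Rightarrow> 3 \<Rightarrow> complex) \<Rightarrow> 2 \<Rightarrow> 2 \<Rightarrow> 2 \<Rightarrow> 2 \<Rightarrow> complex" where
  "frame_spinor S A B C D = (\<Sum>k\<in>UNIV. \<Sum>l\<in>UNIV. solder0 k A B * solder0 l C D * S k l)"

lemma symmetrise4_frame_spinor:
  "symmetrise4 (frame_spinor S) A B C D = (\<Sum>k\<in>UNIV. \<Sum>l\<in>UNIV. sym_solder k l A B C D * S k l)"
  unfolding sym_solder_def symmetrise4_eq frame_spinor_def
  by (simp add: sum_divide_distrib sum.distrib distrib_right add_divide_distrib)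

text \<open>The symmetrised solder forms annihilate antisymmetric and trace parts, so the multiple
  \<open>\<mu>\<close> of the Kronecker symbol may be chosen at will.\<close>

lemma symmetrise4_frame_spinor_stf:
  "symmetrise4 (frame_spinor S) A B C D =
    (\<Sum>k\<in>UNIV. \<Sum>l\<in>UNIV. sym_solder k l A B C D * (S k l + S l k - \<mu> * complex_of_real (kronecker k l))) / 2"
proof -
  have 1: "(\<Sum>k\<in>UNIV. \<Sum>l\<in>UNIV. sym_solder k l A B C D * S l k) = symmetrise4 (frame_spinor S) A B C D"
    unfolding symmetrise4_frame_spinor by (subst sum.swap) (simp add: sym_solder_commute)
  have "(\<Sum>k\<in>UNIV. \<Sum>l\<in>UNIV. sym_solder k l A B C D * (\<mu> * complex_of_real (kronecker k l))) =
      (\<Sum>k\<in>UNIV. \<Sum>l\<in>UNIV. if k = l then sym_solder k l A B C D * \<mu> else 0)"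
    by (intro sum.cong) (auto simp: kronecker_def)
  also have "\<dots> = (\<Sum>k\<in>UNIV. sym_solder k k A B C D) * \<mu>" by (simp add: sum_distrib_right)
  finally have 2: "(\<Sum>k\<in>UNIV. \<Sum>l\<in>UNIV. sym_solder k l A B C D * (\<mu> * complex_of_real (kronecker k l))) = 0"
    by (simp add: sym_solder_trace)
  have "(\<Sum>k\<in>UNIV. \<Sum>l\<in>UNIV. sym_solder k l A B C D * (S k l + S l k - \<mu> * complex_of_real (kronecker k l))) =
      (\<Sum>k\<in>UNIV. \<Sum>l\<in>UNIV. sym_solder k l A B C D * S k l) + (\<Sum>k\<in>UNIV. \<Sum>l\<in>UNIV. sym_solder k l A B C D * S l k)
      - (\<Sum>k\<in>UNIV. \<Sum>l\<in>UNIV. sym_solder k l A B C D * (\<mu> * complex_of_real (kronecker k l)))"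
    by (simp only: distrib_left right_diff_distrib sum.distrib sum_subtractf)
  then show ?thesis using 1 2 by (simp add: symmetrise4_frame_spinor)
qed

text \<open>For uniqueness: the five independent components of the symmetrised spinor return the
  symmetric trace-free part of \<open>S\<close>.\<close>

lemma symmetrise4_frame_spinor_values:
  fixes S :: "3 \<Rightarrow> 3 \<Rightarrow> complex"
  defines "x \<equiv> symmetrise4 (frame_spinor S)"
  shows "S 1 1 - S 2 2 = x 1 1 1 1 + x 2 2 2 2"
    "S 1 2 + S 2 1 = \<i> * (x 1 1 1 1 - x 2 2 2 2)"
    "S 1 3 + S 3 1 = 2 * (x 1 2 2 2 - x 1 1 1 2)"
    "S 2 3 + S 3 2 = - 2 * \<i> * (x 1 1 1 2 + x 1 2 2 2)"
    "2 * S 3 3 - S 1 1 - S 2 2 = 6 * x 1 1 2 2"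
  unfolding x_def symmetrise4_eq frame_spinor_def sum_3
  by (simp_all add: solder0_values field_simps sqrt2_sq sqrt2_sq')

lemma frame_spinor_trace:
  "(\<Sum>P\<in>UNIV. \<Sum>Q\<in>UNIV. \<Sum>A\<in>UNIV. \<Sum>B\<in>UNIV. eps P A * eps Q B * frame_spinor S A B P Q) = - (\<Sum>k\<in>UNIV. S k k)"
  unfolding frame_spinor_def sum_2 sum_3
  by (simp add: eps_def solder0_values field_simps sqrt2_sq sqrt2_sq')

text \<open>The contraction is a commutator of solder forms, which picks out the antisymmetric part
  of \<open>S\<close> and brings in the factor \<open>\<i>\<close>. Hence a real \<open>p\<close> in
  \<open>xi2\<close> calls for an imaginary rotation.\<close>

lemma frame_spinor_curl:
  "3/2 * (((\<Sum>D\<in>UNIV. \<Sum>F\<in>UNIV. eps D F * frame_spinor S A F B D) + (\<Sum>D\<in>UNIV. \<Sum>F\<in>UNIV. eps D F * frame_spinor S B F A D)) / 2)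
    = 3 * \<i> * complex_of_real (sqrt 2) / 4 * (\<Sum>m\<in>UNIV. (\<Sum>k\<in>UNIV. \<Sum>l\<in>UNIV. lc k l m * S k l) * solder0 m A B)"
proof -
  have "\<forall>A B. 3/2 * (((\<Sum>D\<in>UNIV. \<Sum>F\<in>UNIV. eps D F * frame_spinor S A F B D) + (\<Sum>D\<in>UNIV. \<Sum>F\<in>UNIV. eps D F * frame_spinor S B F A D)) / 2)
    = 3 * \<i> * complex_of_real (sqrt 2) / 4 * (\<Sum>m\<in>UNIV. (\<Sum>k\<in>UNIV. \<Sum>l\<in>UNIV. lc k l m * S k l) * solder0 m A B)"
    unfolding forall_2 frame_spinor_def sum_2 sum_3
    by (simp add: eps_def lc_def solder0_values field_simps sqrt2_sq sqrt2_sq')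
  then show ?thesis by blast
qed

text \<open>The frame components of a symmetric spinor: the inverse of contraction with
  \<open>solder0\<close>.\<close>

definition comp3 :: "(2 \<Rightarrow> 2 \<Rightarrow> complex) \<Rightarrow> 3 \<Rightarrow> complex" where
  "comp3 W k = (if k = 1 then (W 2 2 - W 1 1) / complex_of_real (sqrt 2)
     else if k = 2 then - \<i> * (W 1 1 + W 2 2) / complex_of_real (sqrt 2)
     else complex_of_real (sqrt 2) * W 1 2)"

lemma solder0_comp3:
  assumes "W 1 2 = W 2 1"
  shows "(\<Sum>k\<in>UNIV. solder0 k A B * comp3 W k) = W A B"
proof -
  have "\<forall>A B. (\<Sum>k\<in>UNIV. solder0 k A B * comp3 W k) = W A B"
    unfolding forall_2 sum_3 using assms
    by (simp add: solder0_values comp3_def field_simps sqrt2_sq sqrt2_sq')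
  then show ?thesis by blast
qed

lemma comp3_solder0: "comp3 (\<lambda>A B. \<Sum>m\<in>UNIV. u m * solder0 m A B) k = u k"
proof -
  have "\<forall>k. comp3 (\<lambda>A B. \<Sum>m\<in>UNIV. u m * solder0 m A B) k = u k"
    unfolding forall_3 sum_3 by (simp add: solder0_values comp3_def field_simps sqrt2_sq sqrt2_sq')
  then show ?thesis by blast
qed

section \<open>The Sen derivative in terms of a vector field and an orthonormal frame\<close>

locale spin_end = exterior R for R +
  fixes h K e :: "real^3 \<Rightarrow> real^3^3" and \<Gamma> :: "real^3 \<Rightarrow> 3 \<Rightarrow> 2 \<Rightarrow> 2 \<Rightarrow> complex"
    and E :: real and p :: "real^3"
  assumes timelike: "E\<^sup>2 - p \<bullet> p > 0"
    and decay_h: "\<And>i j. small (- 3/2) (\<lambda>x. h x $ i $ j - h_lead E p i j x)"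
    and decay_K: "\<And>i j. small (- 5/2) (\<lambda>x. K x $ i $ j - K_lead E p i j x)"
    and h_sym: "\<And>x i j. R < norm x \<Longrightarrow> h x $ i $ j = h x $ j $ i"
    and h_inv: "\<And>x. R < norm x \<Longrightarrow> invertible (h x)"
    and frame: "\<And>x k l. R < norm x \<Longrightarrow> (e x $ k) \<bullet> (h x *v (e x $ l)) = - kronecker k l"
    and decay_e: "\<And>k i. small (- 1/2) (\<lambda>x. e x $ k $ i - kronecker k i)"
    and spin: "spin_connection R h e \<Gamma>"
begin

abbreviation hc :: "3 \<Rightarrow> 3 \<Rightarrow> real^3 \<Rightarrow> complex" where
  "hc a b x \<equiv> complex_of_real (h x $ a $ b)"

abbreviation Kc :: "3 \<Rightarrow> 3 \<Rightarrow> real^3 \<Rightarrow> complex" where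
  "Kc a b x \<equiv> complex_of_real (K x $ a $ b)"

abbreviation ec :: "3 \<Rightarrow> 3 \<Rightarrow> real^3 \<Rightarrow> complex" where
  "ec k a x \<equiv> complex_of_real (e x $ k $ a)"

abbreviation kr :: "3 \<Rightarrow> 3 \<Rightarrow> complex" where
  "kr a b \<equiv> complex_of_real (kronecker a b)"

lemma sum_kr: "(\<Sum>a\<in>UNIV. kr a b * f a) = f b" "(\<Sum>a\<in>UNIV. kr b a * f a) = f b"
  "(\<Sum>a\<in>UNIV. f a * kr a b) = f b" "(\<Sum>a\<in>UNIV. f a * kr b a) = f b"
proof -
  have *: "(\<Sum>a\<in>UNIV. kr a b * f a) = (\<Sum>a\<in>UNIV. if a = b then f a else 0)" for b and f :: "3 \<Rightarrow> complex"
    by (rule sum.cong) (auto simp: kronecker_def)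
  then show 1: "(\<Sum>a\<in>UNIV. kr a b * f a) = f b" by simp
  have s: "kr b a = kr a b" for a b by (simp add: kronecker_def)
  show "(\<Sum>a\<in>UNIV. kr b a * f a) = f b" "(\<Sum>a\<in>UNIV. f a * kr a b) = f b" "(\<Sum>a\<in>UNIV. f a * kr b a) = f b"
    using 1 by (simp_all add: s[of b] mult.commute)
qed

lemma small_ec: "small (- 1/2) (\<lambda>x. ec k a x - kr k a)"
  using small_of_real[OF decay_e[of k a]] by simp

lemma symb_ec: "symb 0 (ec k a)"
proof -
  have "symb 0 (\<lambda>x. (ec k a x - kr k a) + kr k a)"
    by (intro symb_add symb_const symb_mono[OF _ small_imp_symb[OF small_ec]]) auto
  then show ?thesis by simp
qed

lemma symb_hc_flat: "symb (- 1) (\<lambda>x. hc a b x + kr a b)"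
proof -
  have "symb (- 1) (\<lambda>x. complex_of_real (h x $ a $ b - h_lead E p a b x) + complex_of_real (h_lead E p a b x + kronecker a b))"
    by (intro symb_add symb_of_real symb_h_lead timelike symb_mono[OF _ small_imp_symb[OF decay_h]]) auto
  then show ?thesis by simp
qed

lemma symb_hc: "symb 0 (hc a b)"
proof -
  have "symb 0 (\<lambda>x. (hc a b x + kr a b) - kr a b)"
    by (intro symb_diff symb_const symb_mono[OF _ symb_hc_flat]) auto
  then show ?thesis by simp
qed

lemma smooth_hc: "smooth (hc a b)"
  by (rule symb_smooth[OF symb_hc])

lemma diff_hc: "R < norm x \<Longrightarrow> hc a b differentiable at x"
  using smooth_on_imp_diff[OF open_ext smooth_hc] by simp

lemma diff_h: "R < norm x \<Longrightarrow> (\<lambda>x. h x $ a $ b) differentiable at x"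
proof -
  assume x: "R < norm x"
  have "(\<lambda>x. Re (hc a b x)) differentiable at x"
    using diff_hc[OF x] bounded_linear_Re unfolding differentiable_def
    using bounded_linear.has_derivative by blast
  then show ?thesis by simp
qed

lemma pd_hc: "R < norm x \<Longrightarrow> pd d (hc a b) x = complex_of_real (pd d (\<lambda>x. h x $ a $ b) x)"
  by (rule pd_bounded_linear[OF bounded_linear_of_real diff_h])

lemma symb_pd_hc: "symb (- 2) (pd d (hc a b))"
proof -
  have "symb (- 1 - 1) (pd d (\<lambda>x. hc a b x + kr a b))" by (rule symb_pd[OF symb_hc_flat])
  then have "symb (- 2) (pd d (\<lambda>x. hc a b x + kr a b))" by simp
  then show ?thesis
    by (rule symb_cong) (simp add: pd_add diff_hc)
qed

lemma symb_Kc: "symb (- 2) (Kc a b)"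
proof -
  have "symb (- 2) (\<lambda>x. complex_of_real (K x $ a $ b - K_lead E p a b x) + complex_of_real (K_lead E p a b x))"
    by (intro symb_add symb_of_real symb_K_lead timelike symb_mono[OF _ small_imp_symb[OF decay_K]]) auto
  then show ?thesis by simp
qed

text \<open>A one-sided inverse of a square matrix is two-sided: this turns orthonormality, the
  first identity, into completeness, the second.\<close>

lemma frame_matrix:
  assumes x: "R < norm x"
  shows "(\<Sum>a\<in>UNIV. \<Sum>b\<in>UNIV. ec k a x * hc a b x * ec l b x) = - kr k l"
    and "(\<Sum>k\<in>UNIV. ec k a x * (\<Sum>b\<in>UNIV. hc b c x * ec k b x)) = - kr a c"
proof -
  have r: "(\<Sum>a\<in>UNIV. \<Sum>b\<in>UNIV. e x $ k $ a * h x $ a $ b * e x $ l $ b) = - kronecker k l" for k l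
    using frame[OF x, of k l]
    by (simp add: inner_eq_sum3 matrix_vector_mult_def sum_distrib_left mult.assoc)
  have "(\<Sum>a\<in>UNIV. \<Sum>b\<in>UNIV. ec k a x * hc a b x * ec l b x) =
      complex_of_real (\<Sum>a\<in>UNIV. \<Sum>b\<in>UNIV. e x $ k $ a * h x $ a $ b * e x $ l $ b)" by simp
  then show "(\<Sum>a\<in>UNIV. \<Sum>b\<in>UNIV. ec k a x * hc a b x * ec l b x) = - kr k l"
    unfolding r by simp
  define N where "N = (\<chi> k a. - (\<Sum>b\<in>UNIV. h x $ b $ a * e x $ k $ b))"
  have "e x ** transpose N = mat 1"
  proof -
    have "(e x ** transpose N) $ k $ l = (mat 1 :: real^3^3) $ k $ l" for k l
    proof -
      have "(e x ** transpose N) $ k $ l = - (\<Sum>a\<in>UNIV. e x $ k $ a * (\<Sum>b\<in>UNIV. h x $ b $ a * e x $ l $ b))"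
        by (simp add: matrix_matrix_mult_def transpose_def N_def sum_negf)
      also have "\<dots> = - (\<Sum>a\<in>UNIV. \<Sum>b\<in>UNIV. e x $ k $ a * h x $ a $ b * e x $ l $ b)"
        using h_sym[OF x] by (simp add: sum_distrib_left mult.assoc)
      also have "\<dots> = kronecker k l" unfolding r by simp
      finally show ?thesis by (simp add: mat_def kronecker_def)
    qed
    then show ?thesis by (simp add: vec_eq_iff)
  qed
  then have t: "transpose N ** e x = mat 1" by (simp add: matrix_left_right_inverse)
  have "(\<Sum>k\<in>UNIV. e x $ k $ a * (\<Sum>b\<in>UNIV. h x $ b $ c * e x $ k $ b)) = - kronecker a c"
  proof -
    have "(transpose N ** e x) $ c $ a = - (\<Sum>k\<in>UNIV. e x $ k $ a * (\<Sum>b\<in>UNIV. h x $ b $ c * e x $ k $ b))"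
      by (simp add: matrix_matrix_mult_def transpose_def N_def sum_negf mult.commute)
    moreover have "(mat 1 :: real^3^3) $ c $ a = kronecker a c" by (simp add: mat_def kronecker_def)
    ultimately show ?thesis unfolding t by linarith
  qed
  moreover have "(\<Sum>k\<in>UNIV. ec k a x * (\<Sum>b\<in>UNIV. hc b c x * ec k b x)) =
      complex_of_real (\<Sum>k\<in>UNIV. e x $ k $ a * (\<Sum>b\<in>UNIV. h x $ b $ c * e x $ k $ b))" by simp
  ultimately show "(\<Sum>k\<in>UNIV. ec k a x * (\<Sum>b\<in>UNIV. hc b c x * ec k b x)) = - kr a c" by simp
qed

lemma h_matrix_inv:
  assumes x: "R < norm x"
  shows "(\<Sum>c\<in>UNIV. complex_of_real (matrix_inv (h x) $ c $ l) * hc c d x) = kr l d"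
proof -
  have "h x ** matrix_inv (h x) = mat 1" using someI_ex[OF h_inv[OF x, unfolded invertible_def]] unfolding matrix_inv_def by blast
  then have "(h x ** matrix_inv (h x)) $ d $ l = kronecker l d" by (simp add: mat_def kronecker_def)
  then have "(\<Sum>c\<in>UNIV. matrix_inv (h x) $ c $ l * h x $ c $ d) = kronecker l d"
    using h_sym[OF x] by (simp add: matrix_matrix_mult_def mult.commute)
  moreover have "(\<Sum>c\<in>UNIV. complex_of_real (matrix_inv (h x) $ c $ l) * hc c d x) =
     complex_of_real (\<Sum>c\<in>UNIV. matrix_inv (h x) $ c $ l * h x $ c $ d)" by simp
  ultimately show ?thesis by simp
qed

text \<open>Every symmetric spinor field on the end is \<open>\<kappa>\<^sub>A\<^sub>B = \<sigma>\<^sup>b\<^sub>A\<^sub>B h\<^sub>b\<^sub>a X\<^sup>a\<close> for a complex vector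
  field \<open>X\<close>. In these terms \<open>tens X a b\<close> is \<open>D\<^sub>a (h\<^sub>b\<^sub>c X\<^sup>c)\<close>, written without the inverse metric.\<close>

definition low :: "(3 \<Rightarrow> real^3 \<Rightarrow> complex) \<Rightarrow> 3 \<Rightarrow> real^3 \<Rightarrow> complex" where
  "low X b x = (\<Sum>a\<in>UNIV. hc b a x * X a x)"

definition spinor_of :: "(3 \<Rightarrow> real^3 \<Rightarrow> complex) \<Rightarrow> real^3 \<Rightarrow> 2 \<Rightarrow> 2 \<Rightarrow> complex" where
  "spinor_of X x A B = (\<Sum>b\<in>UNIV. solder e x b A B * low X b x)"

definition tens :: "(3 \<Rightarrow> real^3 \<Rightarrow> complex) \<Rightarrow> 3 \<Rightarrow> 3 \<Rightarrow> real^3 \<Rightarrow> complex" where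
  "tens X a b x = (\<Sum>d\<in>UNIV. hc b d x * pd a (X d) x)
     + 1/2 * (\<Sum>d\<in>UNIV. (pd a (hc b d) x - pd b (hc a d) x + pd d (hc a b) x) * X d x)"

definition vec_fr :: "(3 \<Rightarrow> real^3 \<Rightarrow> complex) \<Rightarrow> 3 \<Rightarrow> real^3 \<Rightarrow> complex" where
  "vec_fr X n x = (\<Sum>b\<in>UNIV. ec n b x * low X b x)"

definition K_fr :: "3 \<Rightarrow> 3 \<Rightarrow> real^3 \<Rightarrow> complex" where
  "K_fr k m x = (\<Sum>a\<in>UNIV. \<Sum>b\<in>UNIV. ec k a x * ec m b x * Kc a b x)"

text \<open>Up to the factor in front, this is the cross product of the row \<open>k\<close> of
  \<open>K\<close> with the lowered \<open>X\<close>, in frame components; it is how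
  \<open>K\<close> enters the Sen derivative.\<close>

definition K_part :: "(3 \<Rightarrow> real^3 \<Rightarrow> complex) \<Rightarrow> 3 \<Rightarrow> 3 \<Rightarrow> real^3 \<Rightarrow> complex" where
  "K_part X k l x = - \<i> / complex_of_real (sqrt 2) * (\<Sum>m\<in>UNIV. \<Sum>n\<in>UNIV. lc m n l * (K_fr k m x * vec_fr X n x))"

definition sen_fr :: "(3 \<Rightarrow> real^3 \<Rightarrow> complex) \<Rightarrow> 3 \<Rightarrow> 3 \<Rightarrow> real^3 \<Rightarrow> complex" where
  "sen_fr X k l x = (\<Sum>a\<in>UNIV. \<Sum>b\<in>UNIV. ec k a x * ec l b x * tens X a b x) + K_part X k l x"

lemma solder_eq: "solder e x a A B = (\<Sum>k\<in>UNIV. ec k a x * solder0 k A B)"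
  by (simp add: solder_def)

lemma spinor_of_eq: "spinor_of X x A B = (\<Sum>n\<in>UNIV. solder0 n A B * vec_fr X n x)"
  unfolding spinor_of_def solder_eq vec_fr_def sum_3 by (simp add: algebra_simps)

lemma K_spinor_eq: "K_spinor e K x A B C F = - (\<Sum>k\<in>UNIV. solder0 k A B * (\<Sum>m\<in>UNIV. solder0 m C F * K_fr k m x))"
  unfolding K_spinor_def solder_eq K_fr_def grad_tau_def sum_3 by (simp add: algebra_simps)

text \<open>The action on both indices of a symmetric spinor is the adjoint representation, that is
  the cross product of complex three-vectors. The minus sign before the inner sums is that of
  \<open>grad_tau\<close>.\<close>

lemma K_commutator:
  fixes u v :: "3 \<Rightarrow> complex"
  shows "1/2 * (\<Sum>Q\<in>UNIV. (\<Sum>F\<in>UNIV. eps Q F * - (\<Sum>m\<in>UNIV. solder0 m C F * v m)) * (\<Sum>n\<in>UNIV. solder0 n Q D * u n)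
     + (\<Sum>F\<in>UNIV. eps Q F * - (\<Sum>m\<in>UNIV. solder0 m D F * v m)) * (\<Sum>n\<in>UNIV. solder0 n C Q * u n))
    = (\<Sum>l\<in>UNIV. solder0 l C D * (- \<i> / complex_of_real (sqrt 2) * (\<Sum>m\<in>UNIV. \<Sum>n\<in>UNIV. lc m n l * (v m * u n))))"
proof -
  have "\<forall>C D. 1/2 * (\<Sum>Q\<in>UNIV. (\<Sum>F\<in>UNIV. eps Q F * - (\<Sum>m\<in>UNIV. solder0 m C F * v m)) * (\<Sum>n\<in>UNIV. solder0 n Q D * u n)
     + (\<Sum>F\<in>UNIV. eps Q F * - (\<Sum>m\<in>UNIV. solder0 m D F * v m)) * (\<Sum>n\<in>UNIV. solder0 n C Q * u n))
    = (\<Sum>l\<in>UNIV. solder0 l C D * (- \<i> / complex_of_real (sqrt 2) * (\<Sum>m\<in>UNIV. \<Sum>n\<in>UNIV. lc m n l * (v m * u n))))"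
    unfolding forall_2 sum_2 sum_3
    by (simp add: eps_def lc_def solder0_values field_simps sqrt2_sq sqrt2_sq')
  then show ?thesis by blast
qed

lemma K_term:
  "1/2 * (\<Sum>Q\<in>UNIV. K_spinor_up e K x A B C Q * spinor_of X x Q D + K_spinor_up e K x A B D Q * spinor_of X x C Q)
    = (\<Sum>k\<in>UNIV. \<Sum>l\<in>UNIV. solder0 k A B * solder0 l C D * K_part X k l x)"
proof -
  define g where "g k C Q = (\<Sum>F\<in>UNIV. eps Q F * - (\<Sum>m\<in>UNIV. solder0 m C F * K_fr k m x))" for k C Q
  have up: "K_spinor_up e K x A B C Q = (\<Sum>k\<in>UNIV. solder0 k A B * g k C Q)" for C Q
    unfolding K_spinor_up_def K_spinor_eq g_def sum_2 sum_3 by (simp add: algebra_simps)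
  have "1/2 * (\<Sum>Q\<in>UNIV. K_spinor_up e K x A B C Q * spinor_of X x Q D + K_spinor_up e K x A B D Q * spinor_of X x C Q)
    = (\<Sum>k\<in>UNIV. solder0 k A B * (1/2 * (\<Sum>Q\<in>UNIV. g k C Q * spinor_of X x Q D + g k D Q * spinor_of X x C Q)))"
    unfolding up sum_2 sum_3 by (simp add: algebra_simps)
  also have "\<dots> = (\<Sum>k\<in>UNIV. solder0 k A B * (\<Sum>l\<in>UNIV. solder0 l C D * K_part X k l x))"
    unfolding g_def spinor_of_eq K_part_def K_commutator ..
  finally show ?thesis by (simp add: sum_distrib_left mult.assoc)
qed

text \<open>Lowering the vector cancels the inverse metric in the Christoffel symbols. So only first
  derivatives of \<open>h\<close>, of order -2, are left, and no inverse has to be expanded.\<close>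

lemma christoffel_low:
  assumes x: "R < norm x"
  shows "(\<Sum>c\<in>UNIV. complex_of_real (christoffel h x c a b) * low X c x) =
    1/2 * (\<Sum>d\<in>UNIV. (pd a (hc b d) x + pd b (hc a d) x - pd d (hc a b) x) * X d x)"
proof -
  define g where "g l = pd a (hc b l) x + pd b (hc a l) x - pd l (hc a b) x" for l
  have c: "complex_of_real (christoffel h x c a b) = 1/2 * (\<Sum>l\<in>UNIV. complex_of_real (matrix_inv (h x) $ c $ l) * g l)" for c
    unfolding christoffel_def g_def by (simp add: pd_hc[OF x])
  have "(\<Sum>c\<in>UNIV. complex_of_real (christoffel h x c a b) * low X c x) =
     1/2 * (\<Sum>l\<in>UNIV. \<Sum>d\<in>UNIV. g l * (X d x * (\<Sum>c\<in>UNIV. complex_of_real (matrix_inv (h x) $ c $ l) * hc c d x)))"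
    unfolding c low_def sum_3 by (simp add: algebra_simps)
  also have "\<dots> = 1/2 * (\<Sum>l\<in>UNIV. g l * X l x)"
    unfolding h_matrix_inv[OF x] by (simp add: sum_kr flip: sum_distrib_left)
  finally show ?thesis unfolding g_def .
qed

lemma low_smooth: "(\<And>a. smooth (X a)) \<Longrightarrow> smooth (low X b)"
  unfolding low_def[abs_def] by (intro smooth_on_sum smooth_on_mult smooth_hc) auto

lemma smooth_solder: "smooth (\<lambda>x. solder e x a A B)"
  unfolding solder_eq by (intro smooth_on_sum smooth_on_mult symb_smooth[OF symb_ec]) auto

text \<open>By \<open>spin_connection\<close> the solder forms are parallel. This trades the spin
  coefficients for Christoffel symbols acting on the lowered vector.\<close>

lemma D_spinor_eq:
  assumes X: "\<And>a. smooth (X a)" and x: "R < norm x"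
  shows "D_spinor e \<Gamma> (spinor_of X) x A B C D =
    (\<Sum>a\<in>UNIV. solder e x a A B * (\<Sum>b\<in>UNIV. solder e x b C D * tens X a b x))"
proof -
  have xe: "x \<in> ext R" using x by simp
  have Xd: "X a differentiable at x" for a by (rule smooth_on_imp_diff[OF open_ext X xe])
  have ld: "low X b differentiable at x" for b by (rule smooth_on_imp_diff[OF open_ext low_smooth[OF X] xe])
  have sd: "(\<lambda>x. solder e x b C D) differentiable at x" for b C D
    by (rule smooth_on_imp_diff[OF open_ext smooth_solder xe])
  have "pd a (\<lambda>y. spinor_of X y C D) x - (\<Sum>Q\<in>UNIV. \<Gamma> x a C Q * spinor_of X x Q D + \<Gamma> x a D Q * spinor_of X x C Q)
    = (\<Sum>b\<in>UNIV. solder e x b C D * tens X a b x)" for a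
  proof -
    have "pd a (\<lambda>y. spinor_of X y C D) x = (\<Sum>b\<in>UNIV. pd a (\<lambda>y. solder e y b C D * low X b y) x)"
      unfolding spinor_of_def by (intro pd_sum differentiable_mult sd ld) auto
    also have "\<dots> = (\<Sum>b\<in>UNIV. pd a (\<lambda>y. solder e y b C D) x * low X b x + solder e x b C D * pd a (low X b) x)"
      by (intro sum.cong refl pd_mult sd ld)
    finally have 1: "pd a (\<lambda>y. spinor_of X y C D) x =
      (\<Sum>b\<in>UNIV. pd a (\<lambda>y. solder e y b C D) x * low X b x + solder e x b C D * pd a (low X b) x)" .
    have 2: "pd a (\<lambda>y. solder e y b C D) x =
       (\<Sum>Q\<in>UNIV. \<Gamma> x a C Q * solder e x b Q D + \<Gamma> x a D Q * solder e x b C Q)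
       - (\<Sum>c\<in>UNIV. complex_of_real (christoffel h x b a c) * solder e x c C D)" for b
      using spin x unfolding spin_connection_def by (simp add: algebra_simps)
    have 3: "pd a (low X b) x = (\<Sum>d\<in>UNIV. pd a (hc b d) x * X d x + hc b d x * pd a (X d) x)" for b
    proof -
      have "pd a (low X b) x = (\<Sum>d\<in>UNIV. pd a (\<lambda>y. hc b d y * X d y) x)"
        unfolding low_def[abs_def] by (intro pd_sum differentiable_mult diff_hc[OF x] Xd) auto
      also have "\<dots> = (\<Sum>d\<in>UNIV. pd a (hc b d) x * X d x + hc b d x * pd a (X d) x)"
        by (intro sum.cong refl pd_mult diff_hc[OF x] Xd)
      finally show ?thesis .
    qed
    have 4: "tens X a b x = pd a (low X b) x - (\<Sum>c\<in>UNIV. complex_of_real (christoffel h x c a b) * low X c x)" for b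
      unfolding tens_def christoffel_low[OF x] 3 sum_3 by (simp add: field_simps)
    show ?thesis unfolding 1 2 4 unfolding spinor_of_def sum_3 sum_2 by (simp add: algebra_simps)
  qed
  then show ?thesis unfolding D_spinor_def by simp
qed

text \<open>One complex frame matrix \<open>sen_fr\<close> carries everything: its symmetric
  trace-free part gives \<open>xi4\<close>, its antisymmetric part \<open>xi2\<close> and its trace
  \<open>xi0\<close>.\<close>

theorem sen_spinor_of:
  assumes X: "\<And>a. smooth (X a)" and x: "R < norm x"
  shows "sen e \<Gamma> K (spinor_of X) x A B C D = frame_spinor (\<lambda>k l. sen_fr X k l x) A B C D"
proof -
  have "(\<Sum>a\<in>UNIV. solder e x a A B * (\<Sum>b\<in>UNIV. solder e x b C D * tens X a b x)) =
    (\<Sum>k\<in>UNIV. \<Sum>l\<in>UNIV. solder0 k A B * solder0 l C D * (\<Sum>a\<in>UNIV. \<Sum>b\<in>UNIV. ec k a x * ec l b x * tens X a b x))"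
    unfolding solder_eq sum_3 by (simp add: algebra_simps)
  then show ?thesis
    unfolding sen_def D_spinor_eq[OF X x] K_term frame_spinor_def sen_fr_def
    by (simp only: distrib_left sum.distrib)
qed

end

subsection \<open>Derivatives of the leading terms\<close>

text \<open>Named so that the identities below become polynomial in \<open>x\<close>,
  \<open>p\<close> and \<open>inv_norm x\<close>, with \<open>inv_norm_sq\<close> relating
  \<open>x\<close> and \<open>inv_norm x\<close>.\<close>

definition inv_norm :: "real^3 \<Rightarrow> real" where
  "inv_norm x = 1 / norm x"

lemma inv_norm_sq: "x \<noteq> 0 \<Longrightarrow> inv_norm x * inv_norm x * (\<Sum>i\<in>UNIV. x $ i * x $ i) = 1"
  using dot_square_norm[of x] by (simp add: inv_norm_def inner_eq_sum3 power2_eq_square)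

lemma pd_norm: "x \<noteq> 0 \<Longrightarrow> pd d norm x = x $ d / norm x"
proof -
  assume "x \<noteq> 0"
  then have "(norm has_derivative (\<lambda>h. h \<bullet> sgn x)) (at x)"
    by (rule has_derivative_norm)
  from pd_eqI[OF this, of d] show ?thesis
    by (simp add: inner_axis' sgn_div_norm divide_inverse mult.commute)
qed

lemma pd_compose:
  assumes "(A has_real_derivative A') (at (f x))" "f differentiable at x"
  shows "pd i (\<lambda>x. A (f x)) x = A' * pd i f x"
proof -
  have "((\<lambda>x. A (f x)) has_derivative (\<lambda>h. A' * frechet_derivative f (at x) h)) (at x)"
    by (rule has_derivative_compose[OF frechet_derivative_worksI[OF assms(2)]])
      (use assms(1) in \<open>simp add: has_field_derivative_def\<close>)
  from pd_eqI[OF this] show ?thesis by (simp add: pd_def)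
qed

lemma diff_norm: "x \<noteq> 0 \<Longrightarrow> (norm :: real^3 \<Rightarrow> real) differentiable at x"
  using has_derivative_norm unfolding differentiable_def by blast

lemma pd_inv_norm:
  assumes "x \<noteq> 0"
  shows "pd d inv_norm x = - x $ d * inv_norm x ^ 3" and "inv_norm differentiable at x"
proof -
  have d: "((\<lambda>y. 1 / y) has_real_derivative - (1 / (norm x)\<^sup>2)) (at (norm x))"
    using assms by (auto intro!: derivative_eq_intros simp: power2_eq_square)
  have "pd d (\<lambda>x. 1 / norm x) x = - (1 / (norm x)\<^sup>2) * pd d norm x"
    by (rule pd_compose[OF d diff_norm[OF assms]])
  then show "pd d inv_norm x = - x $ d * inv_norm x ^ 3"
    using assms by (simp add: inv_norm_def[abs_def] pd_norm field_simps eval_nat_numeral)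
  have "(\<lambda>x. 1 / norm x) differentiable at x"
    using diff_norm[OF assms] assms by (intro differentiable_divide) auto
  then show "inv_norm differentiable at x" by (simp add: inv_norm_def[abs_def])
qed

lemma diff_coord: "(\<lambda>x::real^3. x $ d) differentiable F"
  by (simp add: bounded_linear_imp_differentiable bounded_linear_vec_nth)

text \<open>The derivative of \<open>decay_alpha\<close> with respect to \<open>q\<close>, both of
  its terms being brought to the power -3/2.\<close>

definition dalpha :: "real \<Rightarrow> real^3 \<Rightarrow> real^3 \<Rightarrow> real" where
  "dalpha E p x = (let m = adm_mass E p; q = n_dot p x in
     2 * q * (3 * m\<^sup>2 + 2 * q\<^sup>2) * (m\<^sup>2 + q\<^sup>2) powr (- 3/2))"

text \<open>The angular functions of the metric and of the extrinsic curvature match: \<open>E \<alpha>' = 2 \<beta>\<close>, where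
  the derivative is with respect to \<open>n \<cdot> p\<close>. This is what makes the solution below possible.\<close>

lemma dalpha_beta:
  assumes "E\<^sup>2 - p \<bullet> p > 0"
  shows "E * dalpha E p x = 2 * decay_beta E p x"
  unfolding decay_beta_eq[OF assms] dalpha_def Let_def by (simp add: power2_eq_square algebra_simps)

lemma pd_decay_alpha:
  assumes m: "E\<^sup>2 - p \<bullet> p > 0" and x: "x \<noteq> 0"
  shows "pd d (decay_alpha E p) x = dalpha E p x * (p $ d * inv_norm x - (x \<bullet> p) * x $ d * inv_norm x ^ 3)"
    and "decay_alpha E p differentiable at x"
proof -
  show "decay_alpha E p differentiable at x"
    by (rule smooth_on_imp_diff[OF open_punctured smooth_on_decay_alpha[OF m]]) (use x in simp)
  have dn: "n_dot p differentiable at x"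
    by (rule smooth_on_imp_diff[OF open_punctured smooth_on_n_dot]) (use x in simp)
  have li: "(\<lambda>x. x \<bullet> p) differentiable at x" by simp
  have "pd d (n_dot p) x = pd d (\<lambda>x. (x \<bullet> p) * inv_norm x) x"
    by (simp add: n_dot_def[abs_def] inv_norm_def)
  also have "\<dots> = pd d (\<lambda>x. x \<bullet> p) x * inv_norm x + (x \<bullet> p) * pd d inv_norm x"
    by (rule pd_mult[OF li pd_inv_norm(2)[OF x]])
  also have "pd d (\<lambda>x. x \<bullet> p) x = p $ d"
  proof -
    have "((\<lambda>x. x \<bullet> p) has_derivative (\<lambda>h. h \<bullet> p)) (at x)"
      by (rule bounded_linear_imp_has_derivative[OF bounded_linear_inner_left])
    from pd_eqI[OF this, of d] show ?thesis by (simp add: inner_axis')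
  qed
  finally have n: "pd d (n_dot p) x = p $ d * inv_norm x - (x \<bullet> p) * x $ d * inv_norm x ^ 3"
    unfolding pd_inv_norm(1)[OF x] by simp
  define M where "M = (adm_mass E p)\<^sup>2"
  define q where "q = n_dot p x"
  have W: "M + q\<^sup>2 > 0" using W_pos[OF m] by (simp add: M_def)
  have "((\<lambda>q. (2 * M + 4 * (q * q)) * (M + q\<^sup>2) powr (- 1/2) - 2 * E) has_real_derivative
      (8 * q * (M + q\<^sup>2) powr (- 1/2) + (2 * M + 4 * (q * q)) * ((- 1/2) * (M + q\<^sup>2) powr (- 1/2 - 1) * (2 * q)))) (at q)"
    using W by (auto intro!: derivative_eq_intros simp: powr_diff field_simps)
  moreover have "8 * q * (M + q\<^sup>2) powr (- 1/2) + (2 * M + 4 * (q * q)) * ((- 1/2) * (M + q\<^sup>2) powr (- 1/2 - 1) * (2 * q))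
      = 2 * q * (3 * M + 2 * q\<^sup>2) * (M + q\<^sup>2) powr (- 3/2)"
  proof -
    have "- 1/2 - 1 = (- 3/2 :: real)" "(- 1/2 :: real) = 1 + - 3/2" by simp_all
    moreover have "(M + q\<^sup>2) powr (1 + - 3/2) = (M + q\<^sup>2) * (M + q\<^sup>2) powr (- 3/2)"
      using W by (subst powr_add) simp
    ultimately have "(M + q\<^sup>2) powr (- 1/2 - 1) = (M + q\<^sup>2) powr (- 3/2)"
      "(M + q\<^sup>2) powr (- 1/2) = (M + q\<^sup>2) * (M + q\<^sup>2) powr (- 3/2)" by metis+
    then show ?thesis by (simp only:) (simp add: power2_eq_square algebra_simps)
  qed
  ultimately have A: "((\<lambda>q. (2 * M + 4 * (q * q)) * (M + q\<^sup>2) powr (- 1/2) - 2 * E) has_real_derivative dalpha E p x) (at (n_dot p x))"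
    by (simp add: dalpha_def Let_def M_def q_def)
  have "decay_alpha E p = (\<lambda>x. (2 * M + 4 * (n_dot p x * n_dot p x)) * (M + (n_dot p x)\<^sup>2) powr (- 1/2) - 2 * E)"
    using decay_alpha_eq[OF m] by (auto simp: M_def)
  then show "pd d (decay_alpha E p) x = dalpha E p x * (p $ d * inv_norm x - (x \<bullet> p) * x $ d * inv_norm x ^ 3)"
    using pd_compose[OF A dn, of d] n by simp
qed

lemma h_lead_eq: "h_lead E p a b = (\<lambda>x. - kronecker a b + ((- 2 * E * kronecker a b) * inv_norm x
    - (decay_alpha E p x * inv_norm x) * (2 * ((x $ a * x $ b) * (inv_norm x * inv_norm x)) - kronecker a b)))"
  by (rule ext) (simp add: h_lead_def inv_norm_def power2_eq_square algebra_simps)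

lemma pd_h_lead:
  assumes m: "E\<^sup>2 - p \<bullet> p > 0" and x: "x \<noteq> 0"
  defines "r \<equiv> inv_norm x"
  shows "pd d (h_lead E p a b) x = 2 * E * kronecker a b * x $ d * r ^ 3
    - (dalpha E p x * (p $ d * r - (x \<bullet> p) * x $ d * r ^ 3) * r - decay_alpha E p x * x $ d * r ^ 3) * (2 * x $ a * x $ b * r\<^sup>2 - kronecker a b)
    - decay_alpha E p x * r * (2 * (kronecker d a * x $ b + x $ a * kronecker d b) * r\<^sup>2 - 4 * x $ a * x $ b * x $ d * r ^ 4)"
proof -
  note d = pd_inv_norm(2)[OF x] pd_decay_alpha(2)[OF m x] diff_coord
  have d1: "(\<lambda>x. decay_alpha E p x * inv_norm x) differentiable at x" by (intro differentiable_mult d)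
  have d2: "(\<lambda>x. inv_norm x * inv_norm x) differentiable at x" by (intro differentiable_mult d)
  have d3: "(\<lambda>x::real^3. x $ a * x $ b) differentiable at x" by (intro differentiable_mult d)
  have d4: "(\<lambda>x. (x $ a * x $ b) * (inv_norm x * inv_norm x)) differentiable at x" by (intro differentiable_mult d2 d3)
  have d4': "(\<lambda>x. 2 * ((x $ a * x $ b) * (inv_norm x * inv_norm x))) differentiable at x"
    by (intro differentiable_mult d4) auto
  have d5: "(\<lambda>x. 2 * ((x $ a * x $ b) * (inv_norm x * inv_norm x)) - kronecker a b) differentiable at x"
    by (intro differentiable_diff d4') auto
  have d6: "(\<lambda>x. (decay_alpha E p x * inv_norm x) * (2 * ((x $ a * x $ b) * (inv_norm x * inv_norm x)) - kronecker a b)) differentiable at x"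
    by (intro differentiable_mult d1 d5)
  have d7: "(\<lambda>x. (- 2 * E * kronecker a b) * inv_norm x) differentiable at x" by (intro differentiable_mult d) auto
  have "pd d (h_lead E p a b) x = pd d (\<lambda>x. - kronecker a b) x + (pd d (\<lambda>x. (- 2 * E * kronecker a b) * inv_norm x) x
    - pd d (\<lambda>x. (decay_alpha E p x * inv_norm x) * (2 * ((x $ a * x $ b) * (inv_norm x * inv_norm x)) - kronecker a b)) x)"
    by (simp only: h_lead_eq pd_add[OF differentiable_const differentiable_diff[OF d7 d6]] pd_diff[OF d7 d6])
  also have "pd d (\<lambda>x. (- 2 * E * kronecker a b) * inv_norm x) x = (- 2 * E * kronecker a b) * pd d inv_norm x"
    by (rule pd_bounded_linear[OF bounded_linear_mult_right d(1)])
  also have "pd d (\<lambda>x. (decay_alpha E p x * inv_norm x) * (2 * ((x $ a * x $ b) * (inv_norm x * inv_norm x)) - kronecker a b)) x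
    = pd d (\<lambda>x. decay_alpha E p x * inv_norm x) x * (2 * ((x $ a * x $ b) * (inv_norm x * inv_norm x)) - kronecker a b)
     + (decay_alpha E p x * inv_norm x) * pd d (\<lambda>x. 2 * ((x $ a * x $ b) * (inv_norm x * inv_norm x)) - kronecker a b) x"
    by (rule pd_mult[OF d1 d5])
  also have "pd d (\<lambda>x. decay_alpha E p x * inv_norm x) x = pd d (decay_alpha E p) x * inv_norm x + decay_alpha E p x * pd d inv_norm x"
    by (rule pd_mult[OF d(2,1)])
  also have "pd d (\<lambda>x. 2 * ((x $ a * x $ b) * (inv_norm x * inv_norm x)) - kronecker a b) x
    = 2 * pd d (\<lambda>x. (x $ a * x $ b) * (inv_norm x * inv_norm x)) x"
    using pd_diff[OF d4', of "\<lambda>_. kronecker a b" d] pd_bounded_linear[OF bounded_linear_mult_right d4, of d 2] by simp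
  also have "pd d (\<lambda>x. (x $ a * x $ b) * (inv_norm x * inv_norm x)) x =
     pd d (\<lambda>x. x $ a * x $ b) x * (inv_norm x * inv_norm x) + (x $ a * x $ b) * pd d (\<lambda>x. inv_norm x * inv_norm x) x"
    by (rule pd_mult[OF d3 d2])
  also have "pd d (\<lambda>x. x $ a * x $ b) x = kronecker d a * x $ b + x $ a * kronecker d b"
    by (simp add: pd_mult[OF diff_coord diff_coord] pd_coord)
  also have "pd d (\<lambda>x. inv_norm x * inv_norm x) x = pd d inv_norm x * inv_norm x + inv_norm x * pd d inv_norm x"
    by (rule pd_mult[OF d(1,1)])
  finally show ?thesis
    unfolding pd_inv_norm(1)[OF x] pd_decay_alpha(1)[OF m x] r_def
    by (simp add: algebra_simps eval_nat_numeral)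
qed

lemma kronecker_values [simp]: "kronecker i i = 1" "i \<noteq> j \<Longrightarrow> kronecker i j = 0"
  by (simp_all add: kronecker_def)

lemma h_lead_alt: "h_lead E p a b x = - kronecker a b - 2 * E * kronecker a b * inv_norm x
    - decay_alpha E p x * inv_norm x * (2 * x $ a * x $ b * (inv_norm x)\<^sup>2 - kronecker a b)"
  unfolding h_lead_eq by (simp add: power2_eq_square algebra_simps)

text \<open>Euler's relation: \<open>h_lead + \<delta>\<close> is homogeneous of degree \<open>- 1\<close>.\<close>

lemma h_lead_dilation:
  assumes m: "E\<^sup>2 - p \<bullet> p > 0" and x: "x \<noteq> 0"
  shows "(\<Sum>d\<in>UNIV. x $ d * pd d (h_lead E p a b) x) = - (h_lead E p a b x + kronecker a b)"
proof -
  define r where "r = inv_norm x"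
  define P where "P = x \<bullet> p"
  define S where "S = (\<Sum>d\<in>UNIV. x $ d * x $ d)"
  have S: "r * r * S = 1" unfolding r_def S_def by (rule inv_norm_sq[OF x])
  have P: "P = (\<Sum>d\<in>UNIV. x $ d * p $ d)" unfolding P_def inner_eq_sum3 ..
  have k: "(\<Sum>d\<in>UNIV. x $ d * kronecker d a) = x $ a" for a
    using exhaust_3[of a] by (auto simp: sum_3 kronecker_def)
  define dal al where "dal = dalpha E p x" and "al = decay_alpha E p x"
  have "(\<Sum>d\<in>UNIV. x $ d * pd d (h_lead E p a b) x) =
    2 * E * kronecker a b * S * r ^ 3
    - (dal * (P * r - P * S * r ^ 3) * r - al * S * r ^ 3) * (2 * x $ a * x $ b * r\<^sup>2 - kronecker a b)
    - al * r * (2 * ((\<Sum>d\<in>UNIV. x $ d * kronecker d a) * x $ b + x $ a * (\<Sum>d\<in>UNIV. x $ d * kronecker d b)) * r\<^sup>2 - 4 * x $ a * x $ b * S * r ^ 4)"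
    unfolding pd_h_lead[OF m x] r_def[symmetric] dal_def[symmetric] al_def[symmetric] P_def[symmetric]
    unfolding S_def unfolding P unfolding sum_3 by (simp add: algebra_simps)
  also have "\<dots> = 2 * E * kronecker a b * (r * r * S) * r
    - (dal * (P * r - P * (r * r * S) * r) * r - al * (r * r * S) * r) * (2 * x $ a * x $ b * r\<^sup>2 - kronecker a b)
    - al * r * (4 * x $ a * x $ b * r\<^sup>2 - 4 * x $ a * x $ b * (r * r * S) * r\<^sup>2)"
    unfolding k by (simp add: eval_nat_numeral algebra_simps)
  also have "\<dots> = - (h_lead E p a b x + kronecker a b)"
    unfolding S h_lead_alt r_def[symmetric] al_def[symmetric] by (simp add: algebra_simps)
  finally show ?thesis .
qed

text \<open>The leading metric is invariant under rotations about the momentum.\<close>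

lemma h_lead_rotation:
  assumes m: "E\<^sup>2 - p \<bullet> p > 0" and x: "x \<noteq> 0"
  shows "(\<Sum>d\<in>UNIV. h_lead E p b d x * cross3 p (axis a 1) $ d + h_lead E p a d x * cross3 p (axis b 1) $ d)
    + (\<Sum>d\<in>UNIV. cross3 p x $ d * pd d (h_lead E p a b) x) = 0"
proof -
  define r where "r = inv_norm x"
  define P where "P = x \<bullet> p"
  define dal al where "dal = dalpha E p x" and "al = decay_alpha E p x"
  define v where "v = cross3 p x"
  have v1: "(\<Sum>d\<in>UNIV. v $ d * x $ d) = 0" "(\<Sum>d\<in>UNIV. v $ d * p $ d) = 0"
    using dot_cross_self[of p x] by (simp_all add: v_def inner_eq_sum3[symmetric] inner_commute)
  have k: "(\<Sum>d\<in>UNIV. v $ d * kronecker d a) = v $ a" for a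
    using exhaust_3[of a] by (auto simp: sum_3 kronecker_def)
  have "(\<Sum>d\<in>UNIV. v $ d * pd d (h_lead E p a b) x) =
    2 * E * kronecker a b * (\<Sum>d\<in>UNIV. v $ d * x $ d) * r ^ 3
    - (dal * ((\<Sum>d\<in>UNIV. v $ d * p $ d) * r - P * (\<Sum>d\<in>UNIV. v $ d * x $ d) * r ^ 3) * r - al * (\<Sum>d\<in>UNIV. v $ d * x $ d) * r ^ 3) * (2 * x $ a * x $ b * r\<^sup>2 - kronecker a b)
    - al * r * (2 * ((\<Sum>d\<in>UNIV. v $ d * kronecker d a) * x $ b + x $ a * (\<Sum>d\<in>UNIV. v $ d * kronecker d b)) * r\<^sup>2 - 4 * x $ a * x $ b * (\<Sum>d\<in>UNIV. v $ d * x $ d) * r ^ 4)"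
    unfolding pd_h_lead[OF m x] r_def[symmetric] dal_def[symmetric] al_def[symmetric] P_def[symmetric]
    unfolding sum_3 by (simp add: algebra_simps)
  also have "\<dots> = - al * r * (2 * (v $ a * x $ b + x $ a * v $ b) * r\<^sup>2)"
    unfolding v1 k by simp
  finally have 1: "(\<Sum>d\<in>UNIV. v $ d * pd d (h_lead E p a b) x) = - al * r * (2 * (v $ a * x $ b + x $ a * v $ b) * r\<^sup>2)" .
  have c: "(\<Sum>d\<in>UNIV. x $ d * cross3 p (axis a 1) $ d) = - v $ a" for a
    using exhaust_3[of a] by (auto simp: v_def cross3_def axis_def sum_3 vector_3)
  have ks: "(\<Sum>d\<in>UNIV. kronecker b d * f d) = f b" for b and f :: "3 \<Rightarrow> real"
    using exhaust_3[of b] by (auto simp: sum_3 kronecker_def)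
  have 2: "(\<Sum>d\<in>UNIV. h_lead E p b d x * cross3 p (axis a 1) $ d) =
     (- 1 - 2 * E * r + al * r) * cross3 p (axis a 1) $ b + al * r * (2 * x $ b * r\<^sup>2) * v $ a" for a b
  proof -
    have "(\<Sum>d\<in>UNIV. h_lead E p b d x * cross3 p (axis a 1) $ d) =
      (- 1 - 2 * E * r + al * r) * (\<Sum>d\<in>UNIV. kronecker b d * cross3 p (axis a 1) $ d)
      - al * r * (2 * x $ b * r\<^sup>2) * (\<Sum>d\<in>UNIV. x $ d * cross3 p (axis a 1) $ d)"
      unfolding h_lead_alt r_def[symmetric] al_def[symmetric] sum_3 by (simp add: algebra_simps)
    then show ?thesis unfolding c ks by simp
  qed
  have 3: "cross3 p (axis a 1) $ b = - cross3 p (axis b 1) $ a"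
    using exhaust_3[of a] exhaust_3[of b] by (auto simp: cross3_def axis_def vector_3)
  show ?thesis unfolding sum.distrib 2 v_def[symmetric] 1 3 by (simp add: algebra_simps)
qed

text \<open>Contracting \<open>lc\<close> with \<open>p \<times> x\<close> leaves
  \<open>p\<^sub>l x\<^sub>m - x\<^sub>l p\<^sub>m\<close>. The result is symmetric in
  \<open>k\<close> and \<open>l\<close>: it is \<open>decay_beta\<close> times what is called
  \<open>shear\<close> below.\<close>

lemma K_lead_rotation:
  assumes x: "x \<noteq> 0"
  shows "(\<Sum>m\<in>UNIV. \<Sum>n\<in>UNIV. lc m n l * complex_of_real (K_lead E p k m x * cross3 p x $ n)) =
    complex_of_real (decay_beta E p x * (inv_norm x)\<^sup>2 * (x $ k * p $ l + x $ l * p $ k - 2 * (x \<bullet> p) * x $ k * x $ l * (inv_norm x)\<^sup>2))"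
proof -
  define r where "r = inv_norm x"
  define B where "B = decay_beta E p x"
  have S: "r * r * (\<Sum>d\<in>UNIV. x $ d * x $ d) = 1" unfolding r_def by (rule inv_norm_sq[OF x])
  have K: "K_lead E p k m x = B * r\<^sup>2 * (2 * x $ k * x $ m * r\<^sup>2 - kronecker k m)" for m
    by (simp add: K_lead_def B_def r_def inv_norm_def power_divide)
  have c: "(\<Sum>n\<in>UNIV. lc m n l * complex_of_real (cross3 p x $ n)) = complex_of_real (p $ l * x $ m - x $ l * p $ m)" for m
    using exhaust_3[of m] exhaust_3[of l] by (auto simp: cross3_def vector_3 lc_def sum_3)
  have "(\<Sum>m\<in>UNIV. \<Sum>n\<in>UNIV. lc m n l * complex_of_real (K_lead E p k m x * cross3 p x $ n)) =
     (\<Sum>m\<in>UNIV. complex_of_real (K_lead E p k m x) * (\<Sum>n\<in>UNIV. lc m n l * complex_of_real (cross3 p x $ n)))"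
    by (simp add: sum_distrib_left mult_ac)
  also have "\<dots> = complex_of_real (\<Sum>m\<in>UNIV. K_lead E p k m x * (p $ l * x $ m - x $ l * p $ m))"
    unfolding c by simp
  also have "(\<Sum>m\<in>UNIV. K_lead E p k m x * (p $ l * x $ m - x $ l * p $ m)) =
     B * r\<^sup>2 * (2 * x $ k * (p $ l * (r * r * (\<Sum>d\<in>UNIV. x $ d * x $ d)) - x $ l * (\<Sum>d\<in>UNIV. x $ d * p $ d) * r\<^sup>2)
       - (\<Sum>m\<in>UNIV. kronecker k m * (p $ l * x $ m - x $ l * p $ m)))"
    unfolding K sum_3 by (simp add: algebra_simps power2_eq_square)
  also have "(\<Sum>m\<in>UNIV. kronecker k m * (p $ l * x $ m - x $ l * p $ m)) = p $ l * x $ k - x $ l * p $ k"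
    using exhaust_3[of k] by (auto simp: sum_3 kronecker_def)
  also have "B * r\<^sup>2 * (2 * x $ k * (p $ l * (r * r * (\<Sum>d\<in>UNIV. x $ d * x $ d)) - x $ l * (\<Sum>d\<in>UNIV. x $ d * p $ d) * r\<^sup>2)
       - (p $ l * x $ k - x $ l * p $ k)) =
    decay_beta E p x * (inv_norm x)\<^sup>2 * (x $ k * p $ l + x $ l * p $ k - 2 * (x \<bullet> p) * x $ k * x $ l * (inv_norm x)\<^sup>2)"
    unfolding S unfolding inner_eq_sum3 r_def B_def by (simp add: algebra_simps)
  finally show ?thesis .
qed

text \<open>The radial part of \<open>K_lead\<close> has no cross product with \<open>x\<close>, and
  the Kronecker part gives a matrix antisymmetric in \<open>k\<close> and \<open>l\<close>. So the
  dilation does not feel \<open>K\<close> in the symmetric part.\<close>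

lemma K_lead_dilation:
  "(\<Sum>m\<in>UNIV. \<Sum>n\<in>UNIV. lc m n l * complex_of_real (K_lead E p k m x * x $ n))
    + (\<Sum>m\<in>UNIV. \<Sum>n\<in>UNIV. lc m n k * complex_of_real (K_lead E p l m x * x $ n)) = 0"
proof -
  define B where "B = decay_beta E p x / (norm x)\<^sup>2"
  have K: "K_lead E p k m x = B * (2 * x $ k * x $ m / (norm x)\<^sup>2 - kronecker k m)" for k m
    by (simp add: K_lead_def B_def)
  have "\<forall>k l. (\<Sum>m\<in>UNIV. \<Sum>n\<in>UNIV. lc m n l * complex_of_real (K_lead E p k m x * x $ n))
    + (\<Sum>m\<in>UNIV. \<Sum>n\<in>UNIV. lc m n k * complex_of_real (K_lead E p l m x * x $ n)) = 0"
    unfolding forall_3 K sum_3 by (simp add: lc_def kronecker_def algebra_simps)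
  then show ?thesis by blast
qed

lemma pd_alpha_radial:
  assumes m: "E\<^sup>2 - p \<bullet> p > 0" and x: "x \<noteq> 0"
  defines "r \<equiv> inv_norm x"
  shows "pd a (\<lambda>x. decay_alpha E p x * (x $ b * inv_norm x)) x =
    dalpha E p x * (p $ a * r - (x \<bullet> p) * x $ a * r ^ 3) * (x $ b * r)
    + decay_alpha E p x * (kronecker a b * r - x $ a * x $ b * r ^ 3)"
    and "(\<lambda>x. decay_alpha E p x * (x $ b * inv_norm x)) differentiable at x"
proof -
  note d = pd_inv_norm(2)[OF x] pd_decay_alpha(2)[OF m x] diff_coord
  have d1: "(\<lambda>x. x $ b * inv_norm x) differentiable at x" by (intro differentiable_mult d)
  show "(\<lambda>x. decay_alpha E p x * (x $ b * inv_norm x)) differentiable at x" by (intro differentiable_mult d d1)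
  have "pd a (\<lambda>x. decay_alpha E p x * (x $ b * inv_norm x)) x =
    pd a (decay_alpha E p) x * (x $ b * inv_norm x) + decay_alpha E p x * pd a (\<lambda>x. x $ b * inv_norm x) x"
    by (rule pd_mult[OF d(2) d1])
  also have "pd a (\<lambda>x. x $ b * inv_norm x) x = pd a (\<lambda>x. x $ b) x * inv_norm x + x $ b * pd a inv_norm x"
    by (rule pd_mult[OF d(3) d(1)])
  finally show "pd a (\<lambda>x. decay_alpha E p x * (x $ b * inv_norm x)) x =
    dalpha E p x * (p $ a * r - (x \<bullet> p) * x $ a * r ^ 3) * (x $ b * r)
    + decay_alpha E p x * (kronecker a b * r - x $ a * x $ b * r ^ 3)"
    unfolding pd_inv_norm(1)[OF x] pd_decay_alpha(1)[OF m x] pd_coord r_def by (simp add: algebra_simps)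
qed

context exterior
begin

lemma symb0_mult:
  fixes f g :: "real^3 \<Rightarrow> 'b::real_normed_algebra"
  shows "symb 0 f \<Longrightarrow> symb c g \<Longrightarrow> symb c (\<lambda>x. f x * g x)"
  using symb_mult[of 0 f c g] by simp

lemma symb0_small:
  fixes f g :: "real^3 \<Rightarrow> 'b::real_normed_algebra"
  shows "symb 0 f \<Longrightarrow> small c g \<Longrightarrow> small c (\<lambda>x. f x * g x)"
  using symb_small_mult[of 0 f c g] by simp

lemma symb_linear:
  fixes f :: "real^3 \<Rightarrow> complex"
  assumes "linear f"
  shows "symb 1 f"
proof -
  have "symb (1 + 0) (\<lambda>x. \<Sum>k\<in>UNIV. complex_of_real (x $ k) * f (axis k 1))"
    by (intro symb_sum symb_mult symb_of_real symb_coord symb_const)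
  then have "symb 1 (\<lambda>x. \<Sum>k\<in>UNIV. complex_of_real (x $ k) * f (axis k 1))" by simp
  then show ?thesis
  proof (rule symb_cong)
    fix x :: "real^3"
    interpret linear f by fact
    have "x = (\<Sum>k\<in>UNIV. x $ k *\<^sub>R axis k 1)"
      by (simp add: basis_expansion scalar_mult_eq_scaleR flip: scalar_mult_eq_scaleR)
    then have "f x = f (\<Sum>k\<in>UNIV. x $ k *\<^sub>R axis k 1)" by simp
    then show "(\<Sum>k\<in>UNIV. complex_of_real (x $ k) * f (axis k 1)) = f x"
      by (simp add: sum scaleR scaleR_conv_of_real[of _ "f _"])
  qed
qed

lemma pd_linear: "linear f \<Longrightarrow> pd i f x = f (axis i 1)" for f :: "real^3 \<Rightarrow> complex"
  using pd_eqI[OF linear_imp_has_derivative] by blast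

end

section \<open>Comparison of frame components with coordinate components\<close>

context spin_end
begin

lemma low_symb: "(\<And>a. symb c (X a)) \<Longrightarrow> symb c (low X b)"
  unfolding low_def[abs_def] by (intro symb_sum symb0_mult symb_hc)

lemma low_flat:
  assumes "\<And>a. symb c (X a)"
  shows "symb (c - 1) (\<lambda>x. low X b x + X b x)"
proof -
  have "symb (- 1 + c) (\<lambda>x. \<Sum>a\<in>UNIV. (hc b a x + kr b a) * X a x)"
    by (intro symb_sum symb_mult symb_hc_flat assms)
  then have "symb (c - 1) (\<lambda>x. \<Sum>a\<in>UNIV. (hc b a x + kr b a) * X a x)" by simp
  then show ?thesis by (rule symb_cong) (simp add: low_def distrib_right sum.distrib sum_kr)
qed

lemma vec_fr_symb: "(\<And>a. symb c (X a)) \<Longrightarrow> symb c (vec_fr X n)"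
  unfolding vec_fr_def[abs_def] by (intro symb_sum symb0_mult symb_ec low_symb)

text \<open>Lowering turns \<open>X\<close> into \<open>- X\<close> with a relative error of order
  -1; the passage to the frame costs -1/2, and this decides.\<close>

lemma vec_fr_flat:
  assumes X: "\<And>a. symb c (X a)"
  shows "small (c - 1/2) (\<lambda>x. vec_fr X n x + X n x)"
proof (rule small_cong)
  have 1: "small (c - 1/2) (\<lambda>x. ec n b x * (low X b x + X b x))" for b
    by (intro symb0_small symb_ec symb_imp_small[OF _ low_flat[OF X]]) simp
  have "small (- 1/2 + c) (\<lambda>x. (ec n b x - kr n b) * X b x)" for b
    by (intro small_symb_mult small_ec X)
  then have "small (c - 1/2) (\<lambda>x. (ec n b x - kr n b) * X b x)" for b by simp
  with 1 show "small (c - 1/2) (\<lambda>x. (\<Sum>b\<in>UNIV. ec n b x * (low X b x + X b x)) - (\<Sum>b\<in>UNIV. (ec n b x - kr n b) * X b x))"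
    by (intro small_diff small_sum)
  show "(\<Sum>b\<in>UNIV. ec n b x * (low X b x + X b x)) - (\<Sum>b\<in>UNIV. (ec n b x - kr n b) * X b x) = vec_fr X n x + X n x" for x
    by (simp add: vec_fr_def distrib_left left_diff_distrib sum.distrib sum_subtractf sum_kr)
qed

lemma frame_pair_symb:
  "(\<And>a b. symb c (T a b)) \<Longrightarrow> symb c (\<lambda>x. \<Sum>a\<in>UNIV. \<Sum>b\<in>UNIV. ec k a x * ec l b x * T a b x)"
  by (intro symb_sum symb0_mult symb_ec)

lemma frame_pair_small:
  assumes "\<And>a b. small c (T a b)"
  shows "small c (\<lambda>x. \<Sum>a\<in>UNIV. \<Sum>b\<in>UNIV. ec k a x * ec l b x * T a b x)"
  by (intro small_sum symb0_small symb0_mult symb_ec assms)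

text \<open>The relative error -1/2 is that of the frame. An error of order -3/2 is thus available
  for tensors of order -1.\<close>

lemma frame_pair_flat:
  assumes T: "\<And>a b. symb c (T a b)"
  shows "small (c - 1/2) (\<lambda>x. (\<Sum>a\<in>UNIV. \<Sum>b\<in>UNIV. ec k a x * ec l b x * T a b x) - T k l x)"
proof (rule small_cong)
  have "small (- 1/2 + c) (\<lambda>x. (ec k a x - kr k a) * (ec l b x * T a b x))" for a b
    by (intro small_symb_mult small_ec symb0_mult symb_ec T)
  moreover have "small (- 1/2 + c) (\<lambda>x. (ec l b x - kr l b) * T k b x)" for b
    by (intro small_symb_mult small_ec T)
  ultimately show "small (c - 1/2) (\<lambda>x. (\<Sum>a\<in>UNIV. \<Sum>b\<in>UNIV. (ec k a x - kr k a) * (ec l b x * T a b x))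
     + (\<Sum>b\<in>UNIV. (ec l b x - kr l b) * T k b x))"
    by (intro small_add small_sum) simp_all
  have 1: "(\<Sum>a\<in>UNIV. \<Sum>b\<in>UNIV. kr k a * (ec l b x * T a b x)) = (\<Sum>b\<in>UNIV. ec l b x * T k b x)" for x
    by (simp add: sum_kr flip: sum_distrib_left)
  show "(\<Sum>a\<in>UNIV. \<Sum>b\<in>UNIV. (ec k a x - kr k a) * (ec l b x * T a b x))
     + (\<Sum>b\<in>UNIV. (ec l b x - kr l b) * T k b x) = (\<Sum>a\<in>UNIV. \<Sum>b\<in>UNIV. ec k a x * ec l b x * T a b x) - T k l x" for x
    using 1[of x] by (simp add: left_diff_distrib sum_subtractf sum_kr mult.assoc)
qed

lemma K_fr_symb: "symb (- 2) (K_fr k m)"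
  unfolding K_fr_def[abs_def] by (intro frame_pair_symb symb_Kc)

lemma K_fr_lead: "small (- 5/2) (\<lambda>x. K_fr k m x - complex_of_real (K_lead E p k m x))"
proof -
  have "small (- 2 - 1/2) (\<lambda>x. K_fr k m x - Kc k m x)"
    unfolding K_fr_def by (intro frame_pair_flat symb_Kc)
  moreover have "small (- 5/2) (\<lambda>x. complex_of_real (K x $ k $ m - K_lead E p k m x))"
    by (intro small_of_real decay_K)
  ultimately have "small (- 5/2) (\<lambda>x. (K_fr k m x - Kc k m x) + complex_of_real (K x $ k $ m - K_lead E p k m x))"
    by (intro small_add) simp_all
  then show ?thesis by simp
qed

lemma K_part_symb: "(\<And>a. symb c (X a)) \<Longrightarrow> symb (c - 2) (K_part X k l)"
proof -
  assume X: "\<And>a. symb c (X a)"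
  have "symb (- 2 + c) (\<lambda>x. K_fr k m x * vec_fr X n x)" for m n
    by (intro symb_mult K_fr_symb vec_fr_symb X)
  then show ?thesis unfolding K_part_def[abs_def] by (intro symb_cmult symb_sum) simp
qed

lemma pd_hc_sym: "R < norm x \<Longrightarrow> pd d (hc a b) x = pd d (hc b a) x"
proof (rule pd_cong_open[OF open_ext])
  show "hc a b y = hc b a y" if "y \<in> ext R" for y using h_sym[of y a b] that by simp
qed simp

text \<open>The symmetrisation is the Lie derivative of \<open>h\<close> along \<open>X\<close>: two
  of the three derivatives of \<open>h\<close> cancel.\<close>

lemma tens_sym:
  assumes "R < norm x"
  shows "tens X a b x + tens X b a x = (\<Sum>d\<in>UNIV. hc b d x * pd a (X d) x + hc a d x * pd b (X d) x)
    + (\<Sum>d\<in>UNIV. pd d (hc a b) x * X d x)"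
  unfolding tens_def pd_hc_sym[OF assms, of _ b a] sum_3 by (simp add: field_simps)

lemma sum_frame_pair_sym:
  "sen_fr X k l x + sen_fr X l k x =
    (\<Sum>a\<in>UNIV. \<Sum>b\<in>UNIV. ec k a x * ec l b x * (tens X a b x + tens X b a x)) + (K_part X k l x + K_part X l k x)"
proof -
  have "(\<Sum>a\<in>UNIV. \<Sum>b\<in>UNIV. ec l a x * ec k b x * tens X a b x) = (\<Sum>a\<in>UNIV. \<Sum>b\<in>UNIV. ec k a x * ec l b x * tens X b a x)"
    by (subst sum.swap) (simp add: mult_ac)
  then show ?thesis unfolding sen_fr_def by (simp add: distrib_left sum.distrib)
qed

lemma xi4_eq:
  assumes "\<And>a. smooth (X a)" "R < norm x"
  shows "xi4 e \<Gamma> K (spinor_of X) x = symmetrise4 (frame_spinor (\<lambda>k l. sen_fr X k l x))"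
  unfolding xi4_def using sen_spinor_of[OF assms] by (intro arg_cong[of _ _ symmetrise4] ext)

lemma xi0_eq:
  assumes "\<And>a. smooth (X a)" "R < norm x"
  shows "xi0 e \<Gamma> K (spinor_of X) x = - (\<Sum>k\<in>UNIV. sen_fr X k k x)"
  unfolding xi0_def sen_spinor_of[OF assms] by (rule frame_spinor_trace)

lemma xi2_eq:
  assumes "\<And>a. smooth (X a)" "R < norm x"
  shows "xi2 e \<Gamma> K (spinor_of X) x A B = 3 * \<i> * complex_of_real (sqrt 2) / 4 *
    (\<Sum>m\<in>UNIV. (\<Sum>k\<in>UNIV. \<Sum>l\<in>UNIV. lc k l m * sen_fr X k l x) * solder0 m A B)"
  unfolding xi2_def sen_curl_def sen_spinor_of[OF assms] by (rule frame_spinor_curl)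

subsection \<open>Existence\<close>

text \<open>The ratio of the two coefficients is forced by \<open>K_lead_sym_part\<close>, where
  \<open>t * E / sqrt 2 * dalpha\<close> must match \<open>sqrt 2 * t * decay_beta\<close>. The
  leading parts of \<open>xi0\<close> and \<open>xi2\<close> then come out in the ratio of
  \<open>E\<close> to \<open>p\<close>.\<close>

definition X_lin :: "real \<Rightarrow> 3 \<Rightarrow> real^3 \<Rightarrow> complex" where
  "X_lin t d x = complex_of_real (t * E / sqrt 2 * x $ d) + \<i> * complex_of_real (t * cross3 p x $ d)"

definition X_rad :: "real \<Rightarrow> 3 \<Rightarrow> real^3 \<Rightarrow> complex" where
  "X_rad t d x = complex_of_real (- (t * E / sqrt 2) * (decay_alpha E p x * (x $ d * inv_norm x)))"

definition X_sol :: "real \<Rightarrow> 3 \<Rightarrow> real^3 \<Rightarrow> complex" where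
  "X_sol t d x = X_lin t d x + X_rad t d x"

lemma linear_X_lin: "linear (X_lin t d)"
  by (rule linearI)
    (simp_all add: X_lin_def cross_add_right cross_mult_right complex_eq_iff algebra_simps add_divide_distrib)

lemma pd_X_lin: "pd b (X_lin t d) x = complex_of_real (t * E / sqrt 2 * kronecker b d) + \<i> * complex_of_real (t * cross3 p (axis b 1) $ d)"
  unfolding pd_linear[OF linear_X_lin] X_lin_def by (auto simp: axis_def kronecker_def)

lemma symb_X_lin: "symb 1 (X_lin t d)"
  by (rule symb_linear[OF linear_X_lin])

lemma symb_X_rad: "symb 0 (X_rad t d)"
proof -
  have "symb (1 - 1) (\<lambda>x. x $ d / norm x)" by (rule symb_divide_norm[OF symb_coord])
  then have *: "symb 0 (\<lambda>x. x $ d * inv_norm x)" by (simp add: inv_norm_def)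
  show ?thesis unfolding X_rad_def[abs_def]
    by (intro symb_of_real symb_cmult symb0_mult[OF symb_decay_alpha[OF timelike] *])
qed

lemma symb_X_sol: "symb 1 (X_sol t d)"
  unfolding X_sol_def[abs_def] by (intro symb_add symb_X_lin symb_mono[OF _ symb_X_rad]) simp

lemma smooth_X_sol: "smooth (X_sol t d)"
  by (rule symb_smooth[OF symb_X_sol])

text \<open>With \<open>n = x / norm x\<close>, this is the gradient of \<open>n \<cdot> p\<close>
  times \<open>n\<close>, plus the transpose; it is trace-free and of order -1.\<close>

definition shear :: "real^3 \<Rightarrow> 3 \<Rightarrow> 3 \<Rightarrow> real" where
  "shear x a b = (inv_norm x)\<^sup>2 * (p $ a * x $ b + p $ b * x $ a - 2 * (x \<bullet> p) * x $ a * x $ b * (inv_norm x)\<^sup>2)"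

text \<open>What is left of the Lie derivative beyond a multiple of \<open>h\<close>: a trace and a
  shear, both of order -1.\<close>

definition tens_lead :: "real \<Rightarrow> 3 \<Rightarrow> 3 \<Rightarrow> real^3 \<Rightarrow> complex" where
  "tens_lead t a b x = complex_of_real (t * E / sqrt 2 * ((2 * E + decay_alpha E p x) * inv_norm x * kronecker a b
      + dalpha E p x * shear x a b))"

lemma x_nz: "R < norm x \<Longrightarrow> x \<noteq> 0"
  using R_pos by auto

text \<open>Let \<open>c = t * E / sqrt 2\<close>. The rotation contributes nothing, the dilation by
  Euler's relation \<open>2 c h - c (h + \<delta>)\<close>. The radial field removes the part of
  \<open>h + \<delta>\<close> along \<open>\<alpha> n n\<close>, and differentiating
  \<open>\<alpha>\<close> creates the shear.\<close>

lemma lie_lead: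
  assumes x: "R < norm x"
  shows "(\<Sum>d\<in>UNIV. complex_of_real (h_lead E p b d x) * pd a (X_lin t d) x + complex_of_real (h_lead E p a d x) * pd b (X_lin t d) x)
    + (\<Sum>d\<in>UNIV. complex_of_real (pd d (h_lead E p a b) x) * X_lin t d x)
    - (pd a (X_rad t b) x + pd b (X_rad t a) x)
    = complex_of_real (2 * (t * E / sqrt 2) * h_lead E p a b x) + tens_lead t a b x"
proof -
  define c where "c = t * E / sqrt 2"
  note nz = x_nz[OF x]
  have hs: "h_lead E p a b x = h_lead E p b a x" for a b by (simp add: h_lead_def kronecker_def mult_ac)
  have 1: "(\<Sum>d\<in>UNIV. h_lead E p b d x * kronecker a d) = h_lead E p b a x" for a b
    using exhaust_3[of a] by (auto simp: sum_3 kronecker_def)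
  have rot: "(\<Sum>d\<in>UNIV. h_lead E p b d x * cross3 p (axis a 1) $ d + h_lead E p a d x * cross3 p (axis b 1) $ d)
    + (\<Sum>d\<in>UNIV. cross3 p x $ d * pd d (h_lead E p a b) x) = 0" by (rule h_lead_rotation[OF timelike nz])
  have dil: "(\<Sum>d\<in>UNIV. x $ d * pd d (h_lead E p a b) x) = - (h_lead E p a b x + kronecker a b)"
    by (rule h_lead_dilation[OF timelike nz])
  have "(\<Sum>d\<in>UNIV. complex_of_real (h_lead E p b d x) * pd a (X_lin t d) x + complex_of_real (h_lead E p a d x) * pd b (X_lin t d) x)
    + (\<Sum>d\<in>UNIV. complex_of_real (pd d (h_lead E p a b) x) * X_lin t d x)
    = complex_of_real (c * ((\<Sum>d\<in>UNIV. h_lead E p b d x * kronecker a d) + (\<Sum>d\<in>UNIV. h_lead E p a d x * kronecker b d)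
        + (\<Sum>d\<in>UNIV. x $ d * pd d (h_lead E p a b) x)))
     + \<i> * complex_of_real (t * ((\<Sum>d\<in>UNIV. h_lead E p b d x * cross3 p (axis a 1) $ d + h_lead E p a d x * cross3 p (axis b 1) $ d)
    + (\<Sum>d\<in>UNIV. cross3 p x $ d * pd d (h_lead E p a b) x)))"
    unfolding pd_X_lin X_lin_def c_def[symmetric] sum_3 by (simp add: algebra_simps)
  also have "\<dots> = complex_of_real (c * (h_lead E p a b x - kronecker a b))"
    unfolding rot dil 1 using hs[of a b] by simp
  finally have A: "(\<Sum>d\<in>UNIV. complex_of_real (h_lead E p b d x) * pd a (X_lin t d) x + complex_of_real (h_lead E p a d x) * pd b (X_lin t d) x)
    + (\<Sum>d\<in>UNIV. complex_of_real (pd d (h_lead E p a b) x) * X_lin t d x) = complex_of_real (c * (h_lead E p a b x - kronecker a b))" .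
  have B: "pd a (X_rad t b) x = complex_of_real (- c * (dalpha E p x * (p $ a * inv_norm x - (x \<bullet> p) * x $ a * inv_norm x ^ 3) * (x $ b * inv_norm x)
    + decay_alpha E p x * (kronecker a b * inv_norm x - x $ a * x $ b * inv_norm x ^ 3)))" for a b
  proof -
    note dd1 = pd_alpha_radial(1)[OF timelike nz, of a b] and dd2 = pd_alpha_radial(2)[OF timelike nz, of b]
    have bl: "bounded_linear (\<lambda>y. complex_of_real (- c * y))"
      by (rule bounded_linear_compose[OF bounded_linear_of_real bounded_linear_mult_right])
    show ?thesis unfolding X_rad_def[abs_def] c_def[symmetric] using pd_bounded_linear[OF bl dd2, of a] unfolding dd1 .
  qed
  have ks: "kronecker b a = kronecker a b" by (simp add: kronecker_def)
  have "c * (h_lead E p a b x - kronecker a b)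
     - (- c * (dalpha E p x * (p $ a * inv_norm x - (x \<bullet> p) * x $ a * inv_norm x ^ 3) * (x $ b * inv_norm x)
    + decay_alpha E p x * (kronecker a b * inv_norm x - x $ a * x $ b * inv_norm x ^ 3))
     + - c * (dalpha E p x * (p $ b * inv_norm x - (x \<bullet> p) * x $ b * inv_norm x ^ 3) * (x $ a * inv_norm x)
    + decay_alpha E p x * (kronecker b a * inv_norm x - x $ b * x $ a * inv_norm x ^ 3)))
    = 2 * c * h_lead E p a b x + c * ((2 * E + decay_alpha E p x) * inv_norm x * kronecker a b + dalpha E p x * shear x a b)"
    unfolding h_lead_alt shear_def ks by (simp add: algebra_simps eval_nat_numeral)
  from arg_cong[OF this, of complex_of_real] show ?thesis
    unfolding A B tens_lead_def c_def[symmetric] by (simp only: of_real_add of_real_diff)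
qed

lemma symb_tens_lead: "symb (- 1) (tens_lead t a b)"
proof -
  have r: "symb (0 - 1) (inv_norm)"
    using symb_divide_norm[OF symb_const[of "1::real"]] by (simp add: inv_norm_def[abs_def])
  have q: "symb 0 (\<lambda>x. n_dot p x)" by (rule symb_n_dot)
  have dal: "symb 0 (dalpha E p)"
  proof (rule symb_homogeneous)
    show "smooth_on (- {0}) (dalpha E p)"
      unfolding dalpha_def[abs_def] Let_def power2_eq_square[of "n_dot p _"]
      using smooth_on_W_powr[OF timelike, of "- 3/2"]
      by (intro smooth_on_mult smooth_on_add smooth_on_n_dot smooth_on_const open_punctured) (simp_all add: power2_eq_square)
  qed (simp add: dalpha_def Let_def n_dot_scale)
  have u: "symb (1 - 1) (\<lambda>x. x $ d / norm x)" for d by (rule symb_divide_norm[OF symb_coord])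
  have sh: "symb (- 1) (\<lambda>x. shear x a b)"
  proof (rule symb_cong)
    have n: "symb 0 (\<lambda>x. p $ a * (x $ b / norm x) + p $ b * (x $ a / norm x) - 2 * (n_dot p x * ((x $ a / norm x) * (x $ b / norm x))))"
      using u by (intro symb_add symb_diff symb_cmult symb0_mult symb_n_dot) auto
    have "symb (0 - 1) (\<lambda>x. (p $ a * (x $ b / norm x) + p $ b * (x $ a / norm x) - 2 * (n_dot p x * ((x $ a / norm x) * (x $ b / norm x)))) / norm x)"
      by (rule symb_divide_norm[OF n])
    then show "symb (- 1) (\<lambda>x. (p $ a * (x $ b / norm x) + p $ b * (x $ a / norm x) - 2 * (n_dot p x * ((x $ a / norm x) * (x $ b / norm x)))) / norm x)" by simp
    show "(p $ a * (x $ b / norm x) + p $ b * (x $ a / norm x) - 2 * (n_dot p x * ((x $ a / norm x) * (x $ b / norm x)))) / norm x = shear x a b"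
      if "R < norm x" for x
      using x_nz[OF that] by (simp add: shear_def inv_norm_def n_dot_def field_simps power2_eq_square)
  qed
  have 1: "symb (0 - 1) (\<lambda>x. (2 * E + decay_alpha E p x) * inv_norm x)"
    using symb_mult[OF symb_add[OF symb_const symb_decay_alpha[OF timelike]] r] by simp
  have "symb (- 1) (\<lambda>x. kronecker a b * ((2 * E + decay_alpha E p x) * inv_norm x) + dalpha E p x * shear x a b)"
    using 1 by (intro symb_add symb_cmult symb0_mult[OF dal sh]) simp
  then show ?thesis unfolding tens_lead_def[abs_def]
    by (intro symb_of_real symb_cmult) (simp add: mult.commute)
qed

text \<open>The multiple of the metric is stated with \<open>hc\<close>, not with
  \<open>h_lead\<close>, because its frame components are exactly \<open>- kr\<close>. The remainder
  of \<open>h\<close> has order -3/2 against a derivative of \<open>X\<close> of order 0; to this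
  accuracy \<open>X_rad\<close> meets only the flat part of \<open>h\<close>.\<close>

lemma tens_sol:
  "small (- 3/2) (\<lambda>x. (tens (X_sol t) a b x + tens (X_sol t) b a x)
     - (complex_of_real (2 * (t * E / sqrt 2)) * hc a b x + tens_lead t a b x))"
proof (rule small_cong)
  define c where "c = complex_of_real (2 * (t * E / sqrt 2))"
  let ?u = "\<lambda>a b x. complex_of_real (h x $ a $ b - h_lead E p a b x)"
  let ?g = "\<lambda>a b x. complex_of_real (h_lead E p a b x + kronecker a b)"
  have u: "small (- 3/2) (?u a b)" for a b by (intro small_of_real decay_h)
  have du: "small (- 3/2 - 1) (pd d (?u a b))" for d a b by (rule small_pd[OF u])
  have dX: "symb (1 - 1) (pd a (X_sol t d))" for a d by (rule symb_pd[OF symb_X_sol])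
  have dXr: "symb (0 - 1) (pd a (X_rad t d))" for a d by (rule symb_pd[OF symb_X_rad])
  have g: "symb (- 1) (?g a b)" for a b by (intro symb_of_real symb_h_lead timelike)
  have dg: "symb (- 1 - 1) (pd d (?g a b))" for d a b by (rule symb_pd[OF g])
  have t1: "small (- 3/2) (\<lambda>x. \<Sum>d\<in>UNIV. ?u b d x * pd a (X_sol t d) x + ?u a d x * pd b (X_sol t d) x)"
  proof -
    have "small (- 3/2 + (1 - 1)) (\<lambda>x. ?u b d x * pd a (X_sol t d) x)" for a b d
      by (rule small_symb_mult[OF u dX])
    then show ?thesis by (intro small_sum small_add) simp_all
  qed
  have t2: "small (- 3/2) (\<lambda>x. \<Sum>d\<in>UNIV. pd d (?u a b) x * X_sol t d x)"
  proof -
    have "small (- 3/2 - 1 + 1) (\<lambda>x. pd d (?u a b) x * X_sol t d x)" for d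
      by (rule small_symb_mult[OF du symb_X_sol])
    then show ?thesis by (intro small_sum) simp
  qed
  have t3: "small (- 3/2) (\<lambda>x. \<Sum>d\<in>UNIV. ?g b d x * pd a (X_rad t d) x + ?g a d x * pd b (X_rad t d) x)"
  proof -
    have "symb (- 1 + (0 - 1)) (\<lambda>x. ?g b d x * pd a (X_rad t d) x)" for a b d
      by (rule symb_mult[OF g dXr])
    then have "small (- 3/2) (\<lambda>x. ?g b d x * pd a (X_rad t d) x)" for a b d
      by (rule symb_imp_small[rotated]) simp
    then show ?thesis by (intro small_sum small_add)
  qed
  have t4: "small (- 3/2) (\<lambda>x. \<Sum>d\<in>UNIV. pd d (?g a b) x * X_rad t d x)"
  proof -
    have "symb (- 1 - 1 + 0) (\<lambda>x. pd d (?g a b) x * X_rad t d x)" for d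
      by (rule symb_mult[OF dg symb_X_rad])
    then have "small (- 3/2) (\<lambda>x. pd d (?g a b) x * X_rad t d x)" for d
      by (rule symb_imp_small[rotated]) simp
    then show ?thesis by (intro small_sum)
  qed
  show "small (- 3/2) (\<lambda>x. (\<Sum>d\<in>UNIV. ?u b d x * pd a (X_sol t d) x + ?u a d x * pd b (X_sol t d) x)
     + (\<Sum>d\<in>UNIV. pd d (?u a b) x * X_sol t d x)
     + (\<Sum>d\<in>UNIV. ?g b d x * pd a (X_rad t d) x + ?g a d x * pd b (X_rad t d) x)
     + (\<Sum>d\<in>UNIV. pd d (?g a b) x * X_rad t d x) - c * ?u a b x)"
    by (intro small_add small_diff t1 t2 t3 t4 small_cmult u)
  fix x :: "real^3" assume x: "R < norm x"
  then have xe: "x \<in> ext R" by simp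
  have Xd: "X_lin t d differentiable at x" "X_rad t d differentiable at x" for d
    using smooth_on_imp_diff[OF open_ext symb_smooth[OF symb_X_lin] xe]
      smooth_on_imp_diff[OF open_ext symb_smooth[OF symb_X_rad] xe] by auto
  have pX: "pd a (X_sol t d) x = pd a (X_lin t d) x + pd a (X_rad t d) x" for a d
    unfolding X_sol_def[abs_def] by (rule pd_add[OF Xd])
  have hd: "(\<lambda>x. h_lead E p a b x) differentiable at x" for a b
  proof -
    have "(\<lambda>x. Re (?g a b x)) differentiable at x"
      using bounded_linear.has_derivative[OF bounded_linear_Re] smooth_on_imp_diff[OF open_ext symb_smooth[OF g] xe, of a b]
      unfolding differentiable_def by blast
    from differentiable_diff[OF this, of "\<lambda>_. kronecker a b"] show ?thesis by simp
  qed
  have pg: "pd d (?g a b) x = complex_of_real (pd d (h_lead E p a b) x)" for a b d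
  proof -
    have "(\<lambda>x. h_lead E p a b x + kronecker a b) differentiable at x" by (intro differentiable_add hd) auto
    from pd_bounded_linear[OF bounded_linear_of_real this, of d] show ?thesis by (simp add: pd_add[OF hd])
  qed
  have pu: "pd d (?u a b) x = pd d (hc a b) x - complex_of_real (pd d (h_lead E p a b) x)" for a b d
  proof -
    have "(\<lambda>x. h x $ a $ b - h_lead E p a b x) differentiable at x" by (intro differentiable_diff diff_h[OF x] hd)
    from pd_bounded_linear[OF bounded_linear_of_real this, of d] show ?thesis
      by (simp add: pd_diff[OF diff_h[OF x] hd] pd_hc[OF x])
  qed
  have key: "tens_lead t a b x = (\<Sum>d\<in>UNIV. complex_of_real (h_lead E p b d x) * pd a (X_lin t d) x + complex_of_real (h_lead E p a d x) * pd b (X_lin t d) x)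
    + (\<Sum>d\<in>UNIV. complex_of_real (pd d (h_lead E p a b) x) * X_lin t d x)
    - (pd a (X_rad t b) x + pd b (X_rad t a) x) - c * complex_of_real (h_lead E p a b x)"
    using lie_lead[OF x, of b a t] by (simp add: c_def)
  have k1: "(\<Sum>d\<in>UNIV. ?g b d x * pd a (X_rad t d) x + ?g a d x * pd b (X_rad t d) x) =
     (\<Sum>d\<in>UNIV. complex_of_real (h_lead E p b d x) * pd a (X_rad t d) x + complex_of_real (h_lead E p a d x) * pd b (X_rad t d) x)
     + (pd a (X_rad t b) x + pd b (X_rad t a) x)"
    by (simp add: distrib_right sum.distrib sum_kr)
  show "(\<Sum>d\<in>UNIV. ?u b d x * pd a (X_sol t d) x + ?u a d x * pd b (X_sol t d) x)
     + (\<Sum>d\<in>UNIV. pd d (?u a b) x * X_sol t d x)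
     + (\<Sum>d\<in>UNIV. ?g b d x * pd a (X_rad t d) x + ?g a d x * pd b (X_rad t d) x)
     + (\<Sum>d\<in>UNIV. pd d (?g a b) x * X_rad t d x) - c * ?u a b x
    = (tens (X_sol t) a b x + tens (X_sol t) b a x) - (complex_of_real (2 * (t * E / sqrt 2)) * hc a b x + tens_lead t a b x)"
    unfolding c_def[symmetric] unfolding tens_sym[OF x] key k1 pg pu pX X_sol_def sum_3 by (simp add: algebra_simps)
qed

text \<open>\<open>K\<close> has order -2 and \<open>X\<close> order 1, so relative errors of order
  -1/2 are admissible and \<open>X_rad\<close> drops out. The sign changes since lowering with the
  negative definite \<open>h\<close> turns \<open>X\<close> into \<open>- X\<close>.\<close>

lemma K_part_sol:
  "small (- 3/2) (\<lambda>x. K_part (X_sol t) k l x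
     - \<i> / complex_of_real (sqrt 2) * (\<Sum>m\<in>UNIV. \<Sum>n\<in>UNIV. lc m n l * (complex_of_real (K_lead E p k m x) * X_lin t n x)))"
proof (rule small_cong)
  let ?K = "\<lambda>k m x. complex_of_real (K_lead E p k m x)"
  have KL: "symb (- 2) (?K k m)" for k m by (intro symb_of_real symb_K_lead timelike)
  have "small (- 5/2 + 1) (\<lambda>x. (K_fr k m x - ?K k m x) * vec_fr (X_sol t) n x)" for m n
    by (rule small_symb_mult[OF K_fr_lead vec_fr_symb]) (rule symb_X_sol)
  then have "small (- 3/2) (\<lambda>x. (K_fr k m x - ?K k m x) * vec_fr (X_sol t) n x)" for m n by simp
  moreover have "small (- 2 + (1 - 1/2)) (\<lambda>x. ?K k m x * (vec_fr (X_sol t) n x + X_sol t n x))" for m n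
    by (rule symb_small_mult[OF KL vec_fr_flat]) (rule symb_X_sol)
  then have "small (- 3/2) (\<lambda>x. ?K k m x * (vec_fr (X_sol t) n x + X_sol t n x))" for m n by simp
  moreover have "small (- 3/2) (\<lambda>x. ?K k m x * X_rad t n x)" for m n
    by (rule symb_imp_small[OF _ symb_mult[OF KL symb_X_rad]]) simp
  ultimately show "small (- 3/2) (\<lambda>x. - \<i> / complex_of_real (sqrt 2) * (\<Sum>m\<in>UNIV. \<Sum>n\<in>UNIV. lc m n l *
     ((K_fr k m x - ?K k m x) * vec_fr (X_sol t) n x + ?K k m x * (vec_fr (X_sol t) n x + X_sol t n x) - ?K k m x * X_rad t n x)))"
    by (intro small_cmult small_sum small_add small_diff)
  fix x
  have "(\<Sum>m\<in>UNIV. \<Sum>n\<in>UNIV. lc m n l *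
     ((K_fr k m x - ?K k m x) * vec_fr (X_sol t) n x + ?K k m x * (vec_fr (X_sol t) n x + X_sol t n x) - ?K k m x * X_rad t n x))
     = (\<Sum>m\<in>UNIV. \<Sum>n\<in>UNIV. lc m n l * (K_fr k m x * vec_fr (X_sol t) n x)) + (\<Sum>m\<in>UNIV. \<Sum>n\<in>UNIV. lc m n l * (?K k m x * X_lin t n x))"
    unfolding X_sol_def sum.distrib[symmetric] by (intro sum.cong refl) (simp add: algebra_simps)
  then show "- \<i> / complex_of_real (sqrt 2) * (\<Sum>m\<in>UNIV. \<Sum>n\<in>UNIV. lc m n l *
     ((K_fr k m x - ?K k m x) * vec_fr (X_sol t) n x + ?K k m x * (vec_fr (X_sol t) n x + X_sol t n x) - ?K k m x * X_rad t n x))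
     = K_part (X_sol t) k l x - \<i> / complex_of_real (sqrt 2) * (\<Sum>m\<in>UNIV. \<Sum>n\<in>UNIV. lc m n l * (?K k m x * X_lin t n x))"
    unfolding K_part_def by (simp add: algebra_simps)
qed

text \<open>Only the rotation in \<open>X_lin\<close> contributes; its \<open>\<i>\<close> and that
  of the commutator multiply to a real number. By \<open>dalpha_beta\<close> the outcome is the
  negative of the shear in \<open>tens_lead\<close>.\<close>

lemma K_lead_sym_part:
  assumes x: "R < norm x"
  shows "\<i> / complex_of_real (sqrt 2) * (\<Sum>m\<in>UNIV. \<Sum>n\<in>UNIV. lc m n l * (complex_of_real (K_lead E p k m x) * X_lin t n x))
    + \<i> / complex_of_real (sqrt 2) * (\<Sum>m\<in>UNIV. \<Sum>n\<in>UNIV. lc m n k * (complex_of_real (K_lead E p l m x) * X_lin t n x))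
    = - complex_of_real (t * E / sqrt 2 * (dalpha E p x * shear x k l))"
proof -
  define c where "c = t * E / sqrt 2"
  let ?D = "\<lambda>k l. (\<Sum>m\<in>UNIV. \<Sum>n\<in>UNIV. lc m n l * complex_of_real (K_lead E p k m x * x $ n))"
  let ?R = "\<lambda>k l. (\<Sum>m\<in>UNIV. \<Sum>n\<in>UNIV. lc m n l * complex_of_real (K_lead E p k m x * cross3 p x $ n))"
  have 1: "(\<Sum>m\<in>UNIV. \<Sum>n\<in>UNIV. lc m n l * (complex_of_real (K_lead E p k m x) * X_lin t n x)) =
      complex_of_real c * ?D k l + \<i> * complex_of_real t * ?R k l" for k l
    unfolding X_lin_def c_def[symmetric] sum_distrib_left sum.distrib[symmetric]
    by (intro sum.cong refl) (simp add: algebra_simps)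
  have 2: "?R k l = complex_of_real (decay_beta E p x * shear x k l)" for k l
    unfolding K_lead_rotation[OF x_nz[OF x]] shear_def by (simp add: algebra_simps)
  have 3: "?D k l + ?D l k = 0" by (rule K_lead_dilation)
  have sh: "shear x l k = shear x k l" by (simp add: shear_def algebra_simps)
  have cd: "c * dalpha E p x = sqrt 2 * t * decay_beta E p x"
  proof -
    have "c * dalpha E p x = t / sqrt 2 * (E * dalpha E p x)" by (simp add: c_def)
    also have "\<dots> = t * (2 / sqrt 2) * decay_beta E p x" unfolding dalpha_beta[OF timelike] by simp
    also have "2 / sqrt 2 = sqrt (2::real)" by (simp add: real_div_sqrt)
    finally show ?thesis by (simp add: mult_ac)
  qed
  have "\<i> / complex_of_real (sqrt 2) * (complex_of_real c * ?D k l + \<i> * complex_of_real t * ?R k l)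
    + \<i> / complex_of_real (sqrt 2) * (complex_of_real c * ?D l k + \<i> * complex_of_real t * ?R l k)
    = \<i> / complex_of_real (sqrt 2) * (complex_of_real c * (?D k l + ?D l k)) - complex_of_real t / complex_of_real (sqrt 2) * (?R k l + ?R l k)"
    by (simp add: field_simps)
  also have "\<dots> = - complex_of_real (t * (2 / sqrt 2) * (decay_beta E p x * shear x k l))"
    unfolding 3 2 sh by simp
  also have "2 / sqrt 2 = sqrt (2::real)" by (simp add: real_div_sqrt)
  also have "t * sqrt 2 * (decay_beta E p x * shear x k l) = c * (dalpha E p x * shear x k l)"
    using cd by (metis (no_types, opaque_lifting) mult.assoc mult.commute)
  finally show ?thesis unfolding 1 c_def .
qed

text \<open>The \<open>- 2\<close> stems from the multiple of the metric, whose frame components are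
  \<open>- kr\<close>.\<close>

definition trace_sol :: "real \<Rightarrow> real^3 \<Rightarrow> complex" where
  "trace_sol t x = complex_of_real (t * E / sqrt 2 * ((2 * E + decay_alpha E p x) * inv_norm x - 2))"

theorem sen_fr_sol_sym:
  "small (- 3/2) (\<lambda>x. sen_fr (X_sol t) k l x + sen_fr (X_sol t) l k x - trace_sol t x * kr k l)"
proof (rule small_cong)
  let ?c = "complex_of_real (2 * (t * E / sqrt 2))"
  let ?Q = "\<lambda>k l x. \<i> / complex_of_real (sqrt 2) * (\<Sum>m\<in>UNIV. \<Sum>n\<in>UNIV. lc m n l * (complex_of_real (K_lead E p k m x) * X_lin t n x))"
  let ?T = "\<lambda>a b x. (tens (X_sol t) a b x + tens (X_sol t) b a x) - (?c * hc a b x + tens_lead t a b x)"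
  let ?P = "\<lambda>f x. (\<Sum>a\<in>UNIV. \<Sum>b\<in>UNIV. ec k a x * ec l b x * f a b x)"
  have "small (- 1 - 1/2) (\<lambda>x. ?P (tens_lead t) x - tens_lead t k l x)"
    by (rule frame_pair_flat[OF symb_tens_lead])
  then have "small (- 3/2) (\<lambda>x. ?P (tens_lead t) x - tens_lead t k l x)" by simp
  then show "small (- 3/2) (\<lambda>x. ?P ?T x + (?P (tens_lead t) x - tens_lead t k l x)
      + ((K_part (X_sol t) k l x - ?Q k l x) + (K_part (X_sol t) l k x - ?Q l k x)))"
    by (intro small_add K_part_sol frame_pair_small tens_sol)
  fix x :: "real^3" assume x: "R < norm x"
  have 1: "?P (\<lambda>a b x. tens (X_sol t) a b x + tens (X_sol t) b a x) x = ?P ?T x + ?c * (- kr k l) + ?P (tens_lead t) x"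
    unfolding frame_matrix(1)[OF x, symmetric] sum_distrib_left sum.distrib[symmetric]
    by (intro sum.cong refl) (simp add: algebra_simps)
  have 2: "?Q k l x + ?Q l k x = - complex_of_real (t * E / sqrt 2 * (dalpha E p x * shear x k l))"
    by (rule K_lead_sym_part[OF x])
  have 3: "tens_lead t k l x = trace_sol t x * kr k l + ?c * kr k l + complex_of_real (t * E / sqrt 2 * (dalpha E p x * shear x k l))"
  proof -
    define c where "c = t * E / sqrt 2"
    show ?thesis unfolding tens_lead_def trace_sol_def c_def[symmetric] by (simp add: algebra_simps)
  qed
  show "?P ?T x + (?P (tens_lead t) x - tens_lead t k l x)
      + ((K_part (X_sol t) k l x - ?Q k l x) + (K_part (X_sol t) l k x - ?Q l k x))
     = sen_fr (X_sol t) k l x + sen_fr (X_sol t) l k x - trace_sol t x * kr k l"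
    unfolding sum_frame_pair_sym 1 using 2 3 by (simp add: algebra_simps)
qed

end

context spin_end
begin

text \<open>To leading order \<open>h\<close> is \<open>- \<delta>\<close>; the corrections are of
  order -1 on the derivative of \<open>X\<close> and of order -2 on \<open>X\<close> itself.\<close>

lemma tens_flat:
  assumes X: "\<And>a. symb c (X a)"
  shows "symb (c - 2) (\<lambda>x. tens X a b x + pd a (X b) x)"
proof (rule symb_cong)
  have "symb (- 1 + (c - 1)) (\<lambda>x. (hc b d x + kr b d) * pd a (X d) x)" for d
    by (intro symb_mult symb_hc_flat symb_pd X)
  then have 1: "symb (c - 2) (\<lambda>x. (hc b d x + kr b d) * pd a (X d) x)" for d by simp
  have "symb (- 2 + c) (\<lambda>x. (pd a (hc b d) x - pd b (hc a d) x + pd d (hc a b) x) * X d x)" for d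
    by (intro symb_mult symb_add symb_diff symb_pd_hc X)
  then have 2: "symb (c - 2) (\<lambda>x. (pd a (hc b d) x - pd b (hc a d) x + pd d (hc a b) x) * X d x)" for d by simp
  show "symb (c - 2) (\<lambda>x. (\<Sum>d\<in>UNIV. (hc b d x + kr b d) * pd a (X d) x)
      + 1/2 * (\<Sum>d\<in>UNIV. (pd a (hc b d) x - pd b (hc a d) x + pd d (hc a b) x) * X d x))"
    by (intro symb_add symb_cmult symb_sum 1 2)
  show "(\<Sum>d\<in>UNIV. (hc b d x + kr b d) * pd a (X d) x)
      + 1/2 * (\<Sum>d\<in>UNIV. (pd a (hc b d) x - pd b (hc a d) x + pd d (hc a b) x) * X d x) = tens X a b x + pd a (X b) x" for x
    by (simp add: tens_def distrib_right sum.distrib sum_kr)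
qed

lemma sen_fr_flat:
  assumes X: "\<And>a. symb 1 (X a)"
  shows "small (- 1/2) (\<lambda>x. sen_fr X k l x + pd k (X l) x)"
proof (rule small_cong)
  have dX: "symb 0 (pd a (X b))" for a b using symb_pd[OF X[of b], of a] by simp
  have t1: "symb (- 1) (\<lambda>x. tens X a b x + pd a (X b) x)" for a b using tens_flat[of 1 X a b, OF X] by simp
  have t: "symb 0 (tens X a b)" for a b
  proof (rule symb_cong)
    show "symb 0 (\<lambda>x. (tens X a b x + pd a (X b) x) - pd a (X b) x)"
      by (intro symb_diff dX symb_mono[OF _ t1]) simp
  qed simp
  have "small (0 - 1/2) (\<lambda>x. (\<Sum>a\<in>UNIV. \<Sum>b\<in>UNIV. ec k a x * ec l b x * tens X a b x) - tens X k l x)"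
    by (rule frame_pair_flat[OF t])
  then have s1: "small (- 1/2) (\<lambda>x. (\<Sum>a\<in>UNIV. \<Sum>b\<in>UNIV. ec k a x * ec l b x * tens X a b x) - tens X k l x)"
    by simp
  have s2: "small (- 1/2) (\<lambda>x. tens X k l x + pd k (X l) x)" by (rule symb_imp_small[OF _ t1]) simp
  have "symb (1 - 2) (K_part X k l)" by (rule K_part_symb[OF X])
  then have s3: "small (- 1/2) (K_part X k l)" by (rule symb_imp_small[rotated]) simp
  show "small (- 1/2) (\<lambda>x. ((\<Sum>a\<in>UNIV. \<Sum>b\<in>UNIV. ec k a x * ec l b x * tens X a b x) - tens X k l x)
     + (tens X k l x + pd k (X l) x) + K_part X k l x)"
    by (rule small_add[OF small_add[OF s1 s2] s3])
qed (simp add: sen_fr_def)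

lemma xi4_sol: "small (- 3/2) (\<lambda>x. xi4 e \<Gamma> K (spinor_of (X_sol t)) x A B C D)"
proof (rule small_cong)
  show "small (- 3/2) (\<lambda>x. 1/2 * (\<Sum>k\<in>UNIV. \<Sum>l\<in>UNIV. sym_solder k l A B C D *
      (sen_fr (X_sol t) k l x + sen_fr (X_sol t) l k x - trace_sol t x * kr k l)))"
    by (intro small_cmult small_sum sen_fr_sol_sym)
  show "1/2 * (\<Sum>k\<in>UNIV. \<Sum>l\<in>UNIV. sym_solder k l A B C D *
      (sen_fr (X_sol t) k l x + sen_fr (X_sol t) l k x - trace_sol t x * kr k l))
      = xi4 e \<Gamma> K (spinor_of (X_sol t)) x A B C D" if "R < norm x" for x
    unfolding xi4_eq[OF smooth_X_sol that]
    using symmetrise4_frame_spinor_stf[of "\<lambda>k l. sen_fr (X_sol t) k l x" A B C D "trace_sol t x"] by simp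
qed

text \<open>There are three diagonal entries, each close to half of \<open>trace_sol\<close>, which
  tends to \<open>- 2 * (t * E / sqrt 2)\<close>.\<close>

lemma xi0_sol: "small (- 1/2) (\<lambda>x. xi0 e \<Gamma> K (spinor_of (X_sol t)) x - complex_of_real (3 * (t * E / sqrt 2)))"
proof (rule small_cong)
  let ?s = "\<lambda>k x. sen_fr (X_sol t) k k x + sen_fr (X_sol t) k k x - trace_sol t x * kr k k"
  let ?r = "\<lambda>x. (2 * E + decay_alpha E p x) / norm x"
  have "symb (0 - 1) ?r"
    by (intro symb_divide_norm symb_add symb_const symb_decay_alpha timelike)
  then have r: "small (- 1/2) ?r" by (rule symb_imp_small[rotated]) simp
  have s: "small (- 1/2) (?s k)" for k
    by (rule symb_imp_small[OF _ small_imp_symb[OF sen_fr_sol_sym]]) simp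
  show "small (- 1/2) (\<lambda>x. - (1/2) * (\<Sum>k\<in>UNIV. ?s k x) - complex_of_real (3/2 * (t * E / sqrt 2) * ?r x))"
    by (intro small_diff small_cmult small_sum s small_of_real r)
  fix x :: "real^3" assume x: "R < norm x"
  define c where "c = t * E / sqrt 2"
  have "complex_of_real (norm x) \<noteq> 0" using x R_pos by auto
  then show "- (1/2) * (\<Sum>k\<in>UNIV. ?s k x) - complex_of_real (3/2 * (t * E / sqrt 2) * ?r x)
     = xi0 e \<Gamma> K (spinor_of (X_sol t)) x - complex_of_real (3 * (t * E / sqrt 2))"
    unfolding xi0_eq[OF smooth_X_sol x] trace_sol_def c_def[symmetric] inv_norm_def sum_3
    by (simp add: field_simps)
qed

text \<open>The curl of \<open>p \<times> x\<close> is \<open>2 p\<close>; the dilation has a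
  symmetric derivative and no curl.\<close>

lemma lc_cross:
  "(\<Sum>k\<in>UNIV. \<Sum>l\<in>UNIV. lc k l m * (complex_of_real (c * kronecker k l) + \<i> * complex_of_real (t * cross3 p (axis k 1) $ l)))
    = 2 * \<i> * complex_of_real (t * p $ m)"
  using exhaust_3[of m]
  by (auto simp: sum_3 lc_def kronecker_def cross3_def vector_3 axis_def algebra_simps)

text \<open>An error of order -1/2 is allowed, so frame and coordinates may be exchanged,
  \<open>K\<close> and the radial field drop out, and only the curl of the rotation is left.\<close>

lemma xi2_sol:
  "small (- 1/2) (\<lambda>x. xi2 e \<Gamma> K (spinor_of (X_sol t)) x A B
     - complex_of_real (3 * t / sqrt 2) * covector_spinor e p x A B)"
proof (rule small_cong)
  define C where "C = 3 * \<i> * complex_of_real (sqrt 2) / 4"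
  let ?L = "\<lambda>k l x. sen_fr (X_sol t) k l x + pd k (X_lin t l) x"
  have "symb (0 - 1) (pd k (X_rad t l))" for k l by (rule symb_pd[OF symb_X_rad])
  then have rr: "small (- 1/2) (pd k (X_rad t l))" for k l by (rule symb_imp_small[rotated]) simp
  have L: "small (- 1/2) (?L k l)" for k l
  proof (rule small_cong)
    show "small (- 1/2) (\<lambda>x. (sen_fr (X_sol t) k l x + pd k (X_sol t l) x) - pd k (X_rad t l) x)"
      by (intro small_diff rr sen_fr_flat symb_X_sol)
    show "(sen_fr (X_sol t) k l x + pd k (X_sol t l) x) - pd k (X_rad t l) x = ?L k l x" if x: "R < norm x" for x
    proof -
      have "pd k (X_sol t l) x = pd k (X_lin t l) x + pd k (X_rad t l) x"
        unfolding X_sol_def[abs_def]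
        by (rule pd_add; rule smooth_on_imp_diff[OF open_ext symb_smooth])
          (use x symb_X_lin symb_X_rad in auto)
      then show ?thesis by simp
    qed
  qed
  show "small (- 1/2) (\<lambda>x. C * (\<Sum>m\<in>UNIV. (\<Sum>k\<in>UNIV. \<Sum>l\<in>UNIV. lc k l m * ?L k l x) * solder0 m A B)
      - complex_of_real (3 * t / sqrt 2) * (\<Sum>i\<in>UNIV. \<Sum>k\<in>UNIV. solder0 k A B * complex_of_real (p $ i) * (ec k i x - kr k i)))"
  proof -
    have "small (- 1/2) (\<lambda>x. (\<Sum>k\<in>UNIV. \<Sum>l\<in>UNIV. lc k l m * ?L k l x) * solder0 m A B)" for m
      by (rule small_bounded_linear[OF bounded_linear_mult_left]) (intro small_sum small_cmult L)
    then have "small (- 1/2) (\<lambda>x. C * (\<Sum>m\<in>UNIV. (\<Sum>k\<in>UNIV. \<Sum>l\<in>UNIV. lc k l m * ?L k l x) * solder0 m A B))"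
      by (intro small_cmult small_sum)
    moreover have "small (- 1/2) (\<lambda>x. complex_of_real (3 * t / sqrt 2) *
        (\<Sum>i\<in>UNIV. \<Sum>k\<in>UNIV. solder0 k A B * complex_of_real (p $ i) * (ec k i x - kr k i)))"
      by (intro small_cmult small_sum small_ec)
    ultimately show ?thesis by (rule small_diff)
  qed
  fix x :: "real^3" assume x: "R < norm x"
  have 1: "(\<Sum>k\<in>UNIV. \<Sum>l\<in>UNIV. lc k l m * ?L k l x) = (\<Sum>k\<in>UNIV. \<Sum>l\<in>UNIV. lc k l m * sen_fr (X_sol t) k l x)
      + 2 * \<i> * complex_of_real (t * p $ m)" for m
    unfolding lc_cross[where m = m and c = "t * E / sqrt 2" and t = t, symmetric] pd_X_lin by (simp add: distrib_left sum.distrib)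
  \<comment> \<open>The minus sign is that of \<open>\<i> * \<i>\<close>; it is compensated because
    \<open>sen_fr\<close> is minus the derivative to leading order.\<close>
  have Cc: "C * (2 * \<i> * complex_of_real t) = - complex_of_real (3 * t / sqrt 2)"
    unfolding C_def by (simp add: field_simps sqrt2_sq sqrt2_sq')
  have 2: "C * (\<Sum>m\<in>UNIV. (2 * \<i> * complex_of_real (t * p $ m)) * solder0 m A B)
     = - complex_of_real (3 * t / sqrt 2) * (\<Sum>m\<in>UNIV. complex_of_real (p $ m) * solder0 m A B)"
    unfolding Cc[symmetric] sum_distrib_left by (intro sum.cong) simp_all
  have 3: "(\<Sum>i\<in>UNIV. \<Sum>k\<in>UNIV. solder0 k A B * complex_of_real (p $ i) * (ec k i x - kr k i)) =
     covector_spinor e p x A B - (\<Sum>m\<in>UNIV. complex_of_real (p $ m) * solder0 m A B)"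
  proof -
    have "(\<Sum>i\<in>UNIV. \<Sum>k\<in>UNIV. solder0 k A B * complex_of_real (p $ i) * kr k i) = (\<Sum>m\<in>UNIV. complex_of_real (p $ m) * solder0 m A B)"
      by (simp add: sum_kr mult.commute)
    moreover have "(\<Sum>i\<in>UNIV. \<Sum>k\<in>UNIV. solder0 k A B * complex_of_real (p $ i) * ec k i x) = covector_spinor e p x A B"
      unfolding covector_spinor_def solder_eq by (simp add: sum_distrib_left sum_distrib_right mult_ac)
    ultimately show ?thesis by (simp only: right_diff_distrib sum_subtractf)
  qed
  show "C * (\<Sum>m\<in>UNIV. (\<Sum>k\<in>UNIV. \<Sum>l\<in>UNIV. lc k l m * ?L k l x) * solder0 m A B)
      - complex_of_real (3 * t / sqrt 2) * (\<Sum>i\<in>UNIV. \<Sum>k\<in>UNIV. solder0 k A B * complex_of_real (p $ i) * (ec k i x - kr k i))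
    = xi2 e \<Gamma> K (spinor_of (X_sol t)) x A B - complex_of_real (3 * t / sqrt 2) * covector_spinor e p x A B"
    unfolding xi2_eq[OF smooth_X_sol x] 1 3 C_def[symmetric]
    unfolding distrib_right sum.distrib
    unfolding distrib_left 2
    by (simp add: right_diff_distrib)
qed

lemma spinor_of_small:
  assumes "\<And>a. symb c (X a)" "c < \<delta>"
  shows "small \<delta> (\<lambda>x. spinor_of X x A B)"
  unfolding spinor_of_eq
  by (intro symb_imp_small[OF assms(2)] symb_sum symb_cmult vec_fr_symb assms(1))

theorem existence:
  fixes s :: real
  shows "\<exists>\<kappa>. symmetric_spinor R \<kappa> \<and> (\<forall>A B. small (3/2) (\<lambda>x. \<kappa> x A B)) \<and>
     (\<forall>A B C D. small (- 3/2) (\<lambda>x. xi4 e \<Gamma> K \<kappa> x A B C D)) \<and>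
     (\<forall>A B. small (- 1/2) (\<lambda>x. xi2 e \<Gamma> K \<kappa> x A B
        - complex_of_real (s * sqrt 2 / adm_mass E p) * covector_spinor e p x A B)) \<and>
     small (- 1/2) (\<lambda>x. xi0 e \<Gamma> K \<kappa> x - complex_of_real (s * sqrt 2 * E / adm_mass E p))"
proof -
  \<comment> \<open>The value for which \<open>3 * t / sqrt 2\<close> is
    \<open>s * sqrt 2 / adm_mass E p\<close>.\<close>
  define t where "t = 2 * s / (3 * adm_mass E p)"
  have q: "2 / sqrt 2 = sqrt (2::real)" by (simp add: real_div_sqrt)
  have "3 * t / sqrt 2 = s / adm_mass E p * (2 / sqrt 2)" by (simp add: t_def)
  then have 1: "3 * t / sqrt 2 = s * sqrt 2 / adm_mass E p" unfolding q by simp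
  have "3 * (t * E / sqrt 2) = (3 * t / sqrt 2) * E" by simp
  then have 2: "3 * (t * E / sqrt 2) = s * sqrt 2 * E / adm_mass E p" unfolding 1 by simp
  have "symmetric_spinor R (spinor_of (X_sol t))"
    unfolding symmetric_spinor_def spinor_of_eq
    by (intro allI impI sum.cong refl arg_cong2[where f = "(*)"] solder0_sym)
  moreover have "small (3/2) (\<lambda>x. spinor_of (X_sol t) x A B)" for A B
    by (rule spinor_of_small[OF symb_X_sol]) simp
  ultimately show ?thesis
    using xi4_sol[of t] xi2_sol[of t] xi0_sol[of t] unfolding 1 2 by blast
qed

subsection \<open>Uniqueness\<close>

text \<open>The inverse of \<open>spinor_of\<close> on symmetric spinors. The sign is that of
  \<open>h\<close>, which is minus the unit matrix in the frame.\<close>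

definition vec_of :: "(real^3 \<Rightarrow> 2 \<Rightarrow> 2 \<Rightarrow> complex) \<Rightarrow> 3 \<Rightarrow> real^3 \<Rightarrow> complex" where
  "vec_of \<omega> a x = - (\<Sum>k\<in>UNIV. ec k a x * comp3 (\<omega> x) k)"

lemma vec_fr_vec_of:
  assumes x: "R < norm x"
  shows "vec_fr (vec_of \<omega>) n x = comp3 (\<omega> x) n"
proof -
  have "vec_fr (vec_of \<omega>) n x = - (\<Sum>k\<in>UNIV. (\<Sum>a\<in>UNIV. \<Sum>b\<in>UNIV. ec n a x * hc a b x * ec k b x) * comp3 (\<omega> x) k)"
    unfolding vec_fr_def low_def vec_of_def sum_3 by (simp add: algebra_simps)
  also have "\<dots> = comp3 (\<omega> x) n" unfolding frame_matrix(1)[OF x] by (simp add: sum_negf sum_kr)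
  finally show ?thesis .
qed

lemma spinor_of_vec_of:
  assumes "R < norm x" "\<omega> x 1 2 = \<omega> x 2 1"
  shows "spinor_of (vec_of \<omega>) x A B = \<omega> x A B"
  unfolding spinor_of_eq vec_fr_vec_of[OF assms(1)] by (rule solder0_comp3[OF assms(2)])

lemma small_comp3:
  assumes "\<And>A B. small \<delta> (\<lambda>x. \<omega> x A B)"
  shows "small \<delta> (\<lambda>x. comp3 (\<omega> x) k)"
proof -
  have "small \<delta> (\<lambda>x. 1 / complex_of_real (sqrt 2) * (\<omega> x 2 2 - \<omega> x 1 1))"
    "small \<delta> (\<lambda>x. - \<i> / complex_of_real (sqrt 2) * (\<omega> x 1 1 + \<omega> x 2 2))"
    "small \<delta> (\<lambda>x. complex_of_real (sqrt 2) * \<omega> x 1 2)"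
    by (intro small_cmult small_diff small_add assms)+
  then show ?thesis unfolding comp3_def by (cases "k = 1"; cases "k = 2") simp_all
qed

lemma small_vec_of: "(\<And>A B. small \<delta> (\<lambda>x. \<omega> x A B)) \<Longrightarrow> small \<delta> (vec_of \<omega> a)"
  unfolding vec_of_def[abs_def] by (intro small_minus small_sum symb0_small symb_ec small_comp3)

text \<open>The dual coframe, written with \<open>h\<close> instead of an inverse matrix; it leads
  back from frame components to coordinate components.\<close>

definition coframe :: "3 \<Rightarrow> 3 \<Rightarrow> real^3 \<Rightarrow> complex" where
  "coframe k a x = - (\<Sum>b\<in>UNIV. hc b a x * ec k b x)"

lemma symb_coframe: "symb 0 (coframe k a)"
  unfolding coframe_def[abs_def] by (intro symb_minus symb_sum symb0_mult symb_hc symb_ec)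

lemma coframe_inverse: "R < norm x \<Longrightarrow> (\<Sum>k\<in>UNIV. ec k a x * coframe k c x) = kr a c"
  using frame_matrix(2)[of x a c] by (simp add: coframe_def sum_negf)

lemma coframe_metric:
  assumes x: "R < norm x"
  shows "(\<Sum>k\<in>UNIV. coframe k a x * coframe k b x) = - hc a b x"
proof -
  have "(\<Sum>k\<in>UNIV. coframe k a x * coframe k b x) = - (\<Sum>c\<in>UNIV. hc c a x * (\<Sum>k\<in>UNIV. ec k c x * coframe k b x))"
    unfolding coframe_def[of _ a] sum_3 by (simp add: algebra_simps)
  then show ?thesis unfolding coframe_inverse[OF x] by (simp add: sum_kr h_sym[OF x, of b a])
qed

lemma tens_coframe:
  assumes x: "R < norm x"
  shows "tens X a b x = (\<Sum>k\<in>UNIV. \<Sum>l\<in>UNIV. coframe k a x * coframe l b x * (sen_fr X k l x - K_part X k l x))"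
proof -
  have "(\<Sum>k\<in>UNIV. \<Sum>l\<in>UNIV. coframe k a x * coframe l b x * (sen_fr X k l x - K_part X k l x)) =
    (\<Sum>c\<in>UNIV. \<Sum>d\<in>UNIV. (\<Sum>k\<in>UNIV. ec k c x * coframe k a x) * ((\<Sum>l\<in>UNIV. ec l d x * coframe l b x) * tens X c d x))"
    unfolding sen_fr_def sum_3 by (simp add: algebra_simps)
  then show ?thesis unfolding coframe_inverse[OF x] by (simp add: sum_kr flip: sum_distrib_left)
qed

lemma small_mono: "a \<le> \<delta> \<Longrightarrow> small a f \<Longrightarrow> small \<delta> f" for f :: "real^3 \<Rightarrow> 'b::banach"
  using symb_imp_small[of a \<delta> f] small_imp_symb[of a f] by (cases "a = \<delta>") auto

lemma sym_pair_sum: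
  fixes u v :: "3 \<Rightarrow> complex"
  shows "(\<Sum>k\<in>UNIV. \<Sum>l\<in>UNIV. u k * v l * (S k l - P k l)) + (\<Sum>k\<in>UNIV. \<Sum>l\<in>UNIV. u k * v l * (S l k - P l k))
    = (\<Sum>k\<in>UNIV. \<Sum>l\<in>UNIV. u k * v l * (S k l + S l k - 2/3 * kr k l * T - (P k l + P l k)))
      + 2/3 * T * (\<Sum>k\<in>UNIV. \<Sum>l\<in>UNIV. u k * (kr k l * v l))"
  unfolding sum_3 by (simp add: algebra_simps)

section \<open>The vector field of the difference of two solutions\<close>

context
  fixes X :: "3 \<Rightarrow> real^3 \<Rightarrow> complex"
  assumes X32: "\<And>a. small (3/2) (X a)"
    and trace: "small (- 1/2) (\<lambda>x. \<Sum>k\<in>UNIV. sen_fr X k k x)"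
    and stf: "\<And>k l. small (- 3/2) (\<lambda>x. sen_fr X k l x + sen_fr X l k x - 2/3 * kr k l * (\<Sum>k\<in>UNIV. sen_fr X k k x))"
    and skew: "\<And>m. small (- 1/2) (\<lambda>x. \<Sum>k\<in>UNIV. \<Sum>l\<in>UNIV. lc k l m * sen_fr X k l x)"
begin

abbreviation (input) tr :: "real^3 \<Rightarrow> complex" where
  "tr x \<equiv> \<Sum>k\<in>UNIV. sen_fr X k k x"

text \<open>Contracting \<open>lc\<close> with itself rebuilds the antisymmetric part from its dual
  vector; the other two parts are given.\<close>

lemma small_sen_fr: "small (- 1/2) (sen_fr X k l)"
proof (rule small_cong)
  have "small (- 1/2) (\<lambda>x. sen_fr X k l x + sen_fr X l k x - 2/3 * kr k l * tr x)"
    by (rule small_mono[OF _ stf]) simp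
  then show "small (- 1/2) (\<lambda>x. 1/2 * ((sen_fr X k l x + sen_fr X l k x - 2/3 * kr k l * tr x) + 2/3 * kr k l * tr x
     + (\<Sum>m\<in>UNIV. lc k l m * (\<Sum>k\<in>UNIV. \<Sum>l\<in>UNIV. lc k l m * sen_fr X k l x))))"
    by (intro small_cmult small_add small_sum skew trace)
  have "\<forall>k l. (\<Sum>m\<in>UNIV. lc k l m * (\<Sum>k\<in>UNIV. \<Sum>l\<in>UNIV. lc k l m * sen_fr X k l x)) = sen_fr X k l x - sen_fr X l k x" for x
    unfolding forall_3 sum_3 by (simp add: lc_def)
  then show "1/2 * ((sen_fr X k l x + sen_fr X l k x - 2/3 * kr k l * tr x) + 2/3 * kr k l * tr x
     + (\<Sum>m\<in>UNIV. lc k l m * (\<Sum>k\<in>UNIV. \<Sum>l\<in>UNIV. lc k l m * sen_fr X k l x))) = sen_fr X k l x" for x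
    by simp
qed

text \<open>For \<open>X\<close> of order 3/2 the terms with \<open>K\<close> and with derivatives
  of \<open>h\<close> have order \<open>3/2 - 2\<close>, the same as \<open>sen_fr\<close>. So the
  full gradient of \<open>X\<close> is of order -1/2, and not merely 1/2.\<close>

lemma symb_pd_X: "symb (- 1/2) (pd a (X b))"
proof (rule symb_cong)
  have X: "symb (3/2) (X a)" for a by (rule small_imp_symb[OF X32])
  have K: "symb (- 1/2) (K_part X k l)" for k l using K_part_symb[of "3/2" X k l, OF X] by simp
  have "symb (- 1/2) (\<lambda>x. sen_fr X k l x - K_part X k l x)" for k l
    by (intro symb_diff K small_imp_symb small_sen_fr)
  then have t: "symb (- 1/2) (tens X a b)"
    by (intro symb_cong[OF _ tens_coframe[symmetric]] symb_sum symb0_mult symb_coframe) auto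
  have "symb (3/2 - 2) (\<lambda>x. tens X a b x + pd a (X b) x)" by (rule tens_flat[OF X])
  then have "symb (- 1/2) (\<lambda>x. tens X a b x + pd a (X b) x)" by simp
  then show "symb (- 1/2) (\<lambda>x. (tens X a b x + pd a (X b) x) - tens X a b x)"
    by (intro symb_diff t)
qed simp

lemma symb_X_half: "symb (1/2) (X a)"
  by (rule symb_integrate_outwards[OF small_smooth[OF X32]]) (use symb_pd_X in auto)

text \<open>The corrections by \<open>h\<close> and \<open>K\<close> lie two orders below
  \<open>X\<close>, and the trace times \<open>h + \<delta>\<close> has order -3/2. A sharper bound
  on \<open>X\<close> thus brings the flat operator closer to order -3/2.\<close>

lemma small_ckf:
  assumes X: "\<And>a. symb c (X a)" and \<delta>: "c - 2 < \<delta>" "- 3/2 \<le> \<delta>"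
  shows "small \<delta> (ckf X a b)"
proof -
  let ?stf = "\<lambda>k l x. sen_fr X k l x + sen_fr X l k x - 2/3 * kr k l * tr x"
  let ?G = "\<lambda>a b x. pd a (X b) x + pd b (X a) x + 2/3 * kr a b * tr x"
  have G: "small \<delta> (?G a b)" for a b
  proof (rule small_cong)
    have f: "small \<delta> (\<lambda>x. tens X a b x + pd a (X b) x)" for a b
      by (rule symb_imp_small[OF \<delta>(1) tens_flat[OF X]])
    have s: "small \<delta> (?stf k l)" for k l by (rule small_mono[OF \<delta>(2) stf])
    have K: "small \<delta> (K_part X k l)" for k l by (rule symb_imp_small[OF \<delta>(1) K_part_symb[OF X]])
    have "small (- 1/2 + - 1) (\<lambda>x. tr x * (hc a b x + kr a b))"
      by (rule small_symb_mult[OF trace symb_hc_flat])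
    then have "small (- 3/2) (\<lambda>x. tr x * (hc a b x + kr a b))" by simp
    then have T: "small \<delta> (\<lambda>x. tr x * (hc a b x + kr a b))" by (rule small_mono[OF \<delta>(2)])
    show "small \<delta> (\<lambda>x. (tens X a b x + pd a (X b) x) + (tens X b a x + pd b (X a) x)
       - (\<Sum>k\<in>UNIV. \<Sum>l\<in>UNIV. coframe k a x * coframe l b x * (?stf k l x - (K_part X k l x + K_part X l k x)))
       + 2/3 * (tr x * (hc a b x + kr a b)))"
      by (intro small_add small_diff small_cmult small_sum symb0_small symb0_mult symb_coframe f s K T)
    fix x :: "real^3" assume x: "R < norm x"
    have "tens X b a x = (\<Sum>k\<in>UNIV. \<Sum>l\<in>UNIV. coframe k a x * coframe l b x * (sen_fr X l k x - K_part X l k x))"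
      unfolding tens_coframe[OF x] by (subst sum.swap) (simp add: mult_ac)
    then have "tens X a b x + tens X b a x = (\<Sum>k\<in>UNIV. \<Sum>l\<in>UNIV. coframe k a x * coframe l b x *
        (?stf k l x - (K_part X k l x + K_part X l k x))) + 2/3 * tr x * (\<Sum>k\<in>UNIV. \<Sum>l\<in>UNIV. coframe k a x * (kr k l * coframe l b x))"
      unfolding tens_coframe[OF x, of X a b] by (simp only: sym_pair_sum)
    also have "(\<Sum>k\<in>UNIV. \<Sum>l\<in>UNIV. coframe k a x * (kr k l * coframe l b x)) = - hc a b x"
      by (simp add: sum_kr coframe_metric[OF x] flip: sum_distrib_left)
    finally show "(tens X a b x + pd a (X b) x) + (tens X b a x + pd b (X a) x)
       - (\<Sum>k\<in>UNIV. \<Sum>l\<in>UNIV. coframe k a x * coframe l b x * (?stf k l x - (K_part X k l x + K_part X l k x)))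
       + 2/3 * (tr x * (hc a b x + kr a b)) = ?G a b x"
      by (simp add: algebra_simps)
  qed
  show ?thesis
  proof (rule small_cong)
    \<comment> \<open>\<open>?G\<close> contains the trace of \<open>sen_fr\<close> in place of the
      flat divergence; removing its own trace exchanges one for the other.\<close>
    show "small \<delta> (\<lambda>x. ?G a b x - 1/3 * kr a b * (\<Sum>c\<in>UNIV. ?G c c x))"
      by (intro small_diff small_cmult small_sum G)
    show "?G a b x - 1/3 * kr a b * (\<Sum>c\<in>UNIV. ?G c c x) = ckf X a b x" for x
    proof -
      have "(\<Sum>c\<in>UNIV. ?G c c x) = 2 * (\<Sum>c\<in>UNIV. pd c (X c) x) + 2 * tr x"
        unfolding sum_3[of "\<lambda>c. ?G c c x"] by (simp add: sum_3[of "\<lambda>c. pd c (X c) x"])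
      then show ?thesis unfolding ckf_def by (simp add: algebra_simps)
    qed
  qed
qed

lemma vector_asymptotically_constant: "\<exists>C. \<forall>a. small (- 1/2) (\<lambda>x. X a x - C a)" "symb 0 (X a)"
proof -
  note sX = small_smooth[OF X32]
  have "\<exists>C. \<forall>a. small (- 5/4 + 1) (\<lambda>x. X a x - C a)"
    by (rule conformal_killing_decay[OF sX symb_pd_X _ small_ckf[OF symb_X_half]]) auto
  then obtain C where C: "\<And>a. small (- 1/4) (\<lambda>x. X a x - C a)" by auto
  show X0: "symb 0 (X a)" for a
  proof (rule symb_cong)
    show "symb 0 (\<lambda>x. (X a x - C a) + C a)"
      by (intro symb_add symb_const symb_mono[OF _ small_imp_symb[OF C]]) simp
  qed simp
  have "\<exists>C. \<forall>a. small (- 3/2 + 1) (\<lambda>x. X a x - C a)"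
    by (rule conformal_killing_decay[OF sX symb_pd_X _ small_ckf[OF X0]]) auto
  then show "\<exists>C. \<forall>a. small (- 1/2) (\<lambda>x. X a x - C a)" by simp
qed

end

lemma sen_diff:
  assumes "R < norm x" "\<And>A B. smooth (\<lambda>x. \<kappa> x A B)" "\<And>A B. smooth (\<lambda>x. \<kappa>' x A B)"
  shows "sen e \<Gamma> K (\<lambda>x A B. \<kappa>' x A B - \<kappa> x A B) x A B C D = sen e \<Gamma> K \<kappa>' x A B C D - sen e \<Gamma> K \<kappa> x A B C D"
proof -
  have "x \<in> ext R" using assms(1) by simp
  then have p: "pd a (\<lambda>x. \<kappa>' x C D - \<kappa> x C D) x = pd a (\<lambda>x. \<kappa>' x C D) x - pd a (\<lambda>x. \<kappa> x C D) x" for a C D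
    using smooth_on_imp_diff[OF open_ext assms(2)] smooth_on_imp_diff[OF open_ext assms(3)] by (intro pd_diff)
  show ?thesis unfolding sen_def D_spinor_def p sum_2 sum_3 by (simp add: algebra_simps)
qed

lemma sen_cong:
  assumes "R < norm x" "\<And>y A B. R < norm y \<Longrightarrow> \<kappa> y A B = \<kappa>' y A B"
  shows "sen e \<Gamma> K \<kappa> x A B C D = sen e \<Gamma> K \<kappa>' x A B C D"
proof -
  have p: "pd a (\<lambda>y. \<kappa> y C D) x = pd a (\<lambda>y. \<kappa>' y C D) x" for a C D
    by (rule pd_cong_open[OF open_ext]) (use assms in auto)
  show ?thesis unfolding sen_def D_spinor_def p assms(2)[OF assms(1)] ..
qed

text \<open>The prescribed leading parts \<open>u\<close> and \<open>v\<close> cancel in the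
  difference, which becomes a vector field all three parts of whose Sen derivative are
  small.\<close>

theorem uniqueness:
  assumes sym: "symmetric_spinor R \<kappa>" "symmetric_spinor R \<kappa>'"
    and k: "\<And>A B. small (3/2) (\<lambda>x. \<kappa> x A B)" "\<And>A B. small (3/2) (\<lambda>x. \<kappa>' x A B)"
    and x4: "\<And>A B C D. small (- 3/2) (\<lambda>x. xi4 e \<Gamma> K \<kappa> x A B C D)" "\<And>A B C D. small (- 3/2) (\<lambda>x. xi4 e \<Gamma> K \<kappa>' x A B C D)"
    and x2: "\<And>A B. small (- 1/2) (\<lambda>x. xi2 e \<Gamma> K \<kappa> x A B - v x A B)" "\<And>A B. small (- 1/2) (\<lambda>x. xi2 e \<Gamma> K \<kappa>' x A B - v x A B)"
    and x0: "small (- 1/2) (\<lambda>x. xi0 e \<Gamma> K \<kappa> x - u x)" "small (- 1/2) (\<lambda>x. xi0 e \<Gamma> K \<kappa>' x - u x)"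
  shows "\<exists>C. (\<forall>A B. C A B = C B A) \<and> (\<forall>A B. small (- 1/2) (\<lambda>x. \<kappa>' x A B - \<kappa> x A B - C A B))"
proof -
  define \<omega> where "\<omega> = (\<lambda>x A B. \<kappa>' x A B - \<kappa> x A B)"
  define X where "X = vec_of \<omega>"
  have \<omega>: "small (3/2) (\<lambda>x. \<omega> x A B)" for A B unfolding \<omega>_def by (intro small_diff k)
  have X32: "small (3/2) (X a)" for a unfolding X_def by (rule small_vec_of[OF \<omega>])
  have sX: "smooth (X a)" for a by (rule small_smooth[OF X32])
  have \<omega>sym: "\<omega> x A B = \<omega> x B A" if "R < norm x" for x A B
    using sym that unfolding symmetric_spinor_def \<omega>_def
    by (intro arg_cong2[where f = minus]) blast+
  have \<omega>X: "spinor_of X x A B = \<omega> x A B" if "R < norm x" for x A B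
    unfolding X_def by (rule spinor_of_vec_of[of x \<omega>, OF that \<omega>sym[OF that]])
  have sen: "sen e \<Gamma> K (spinor_of X) x A B C D = sen e \<Gamma> K \<kappa>' x A B C D - sen e \<Gamma> K \<kappa> x A B C D" if "R < norm x" for x A B C D
  proof -
    have "sen e \<Gamma> K (spinor_of X) x A B C D = sen e \<Gamma> K \<omega> x A B C D"
      by (rule sen_cong[OF that \<omega>X])
    also have "\<dots> = sen e \<Gamma> K \<kappa>' x A B C D - sen e \<Gamma> K \<kappa> x A B C D"
      unfolding \<omega>_def by (rule sen_diff[OF that small_smooth[OF k(1)] small_smooth[OF k(2)]])
    finally show ?thesis .
  qed
  have d4: "small (- 3/2) (\<lambda>x. symmetrise4 (frame_spinor (\<lambda>k l. sen_fr X k l x)) A B C D)" for A B C D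
  proof (rule small_cong)
    show "small (- 3/2) (\<lambda>x. xi4 e \<Gamma> K \<kappa>' x A B C D - xi4 e \<Gamma> K \<kappa> x A B C D)" by (intro small_diff x4)
    show "xi4 e \<Gamma> K \<kappa>' x A B C D - xi4 e \<Gamma> K \<kappa> x A B C D = symmetrise4 (frame_spinor (\<lambda>k l. sen_fr X k l x)) A B C D"
      if x: "R < norm x" for x
      unfolding xi4_eq[OF sX x, symmetric] unfolding xi4_def symmetrise4_eq sen[OF x] by (simp add: field_simps)
  qed
  have d0: "small (- 1/2) (\<lambda>x. \<Sum>k\<in>UNIV. sen_fr X k k x)"
  proof (rule small_cong)
    show "small (- 1/2) (\<lambda>x. - ((xi0 e \<Gamma> K \<kappa>' x - u x) - (xi0 e \<Gamma> K \<kappa> x - u x)))" by (intro small_minus small_diff x0)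
    show "- ((xi0 e \<Gamma> K \<kappa>' x - u x) - (xi0 e \<Gamma> K \<kappa> x - u x)) = (\<Sum>k\<in>UNIV. sen_fr X k k x)" if x: "R < norm x" for x
    proof -
      have "xi0 e \<Gamma> K (spinor_of X) x = xi0 e \<Gamma> K \<kappa>' x - xi0 e \<Gamma> K \<kappa> x"
        unfolding xi0_def sen[OF x] sum_2 by (simp add: algebra_simps)
      then have "- (\<Sum>k\<in>UNIV. sen_fr X k k x) = xi0 e \<Gamma> K \<kappa>' x - xi0 e \<Gamma> K \<kappa> x"
        unfolding xi0_eq[OF sX x] .
      then have "(\<Sum>k\<in>UNIV. sen_fr X k k x) = - (xi0 e \<Gamma> K \<kappa>' x - xi0 e \<Gamma> K \<kappa> x)"
        by (metis minus_minus)
      then show ?thesis by simp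
    qed
  qed
  have d2: "small (- 1/2) (\<lambda>x. \<Sum>k\<in>UNIV. \<Sum>l\<in>UNIV. lc k l m * sen_fr X k l x)" for m
  proof (rule small_cong)
    let ?C = "3 * \<i> * complex_of_real (sqrt 2) / 4"
    let ?W = "\<lambda>x A B. (xi2 e \<Gamma> K \<kappa>' x A B - v x A B) - (xi2 e \<Gamma> K \<kappa> x A B - v x A B)"
    show "small (- 1/2) (\<lambda>x. 1 / ?C * comp3 (?W x) m)" by (intro small_cmult small_comp3 small_diff x2)
    show "1 / ?C * comp3 (?W x) m = (\<Sum>k\<in>UNIV. \<Sum>l\<in>UNIV. lc k l m * sen_fr X k l x)" if x: "R < norm x" for x
    proof -
      have "xi2 e \<Gamma> K (spinor_of X) x A B = xi2 e \<Gamma> K \<kappa>' x A B - xi2 e \<Gamma> K \<kappa> x A B" for A B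
        unfolding xi2_def sen_curl_def sen[OF x] sum_2 by (simp add: field_simps)
      then have "?W x A B = ?C * (\<Sum>m\<in>UNIV. (\<Sum>k\<in>UNIV. \<Sum>l\<in>UNIV. lc k l m * sen_fr X k l x) * solder0 m A B)" for A B
        using xi2_eq[of X x, OF sX x, where A = A and B = B] by simp
      then have "?W x = (\<lambda>A B. \<Sum>m\<in>UNIV. (?C * (\<Sum>k\<in>UNIV. \<Sum>l\<in>UNIV. lc k l m * sen_fr X k l x)) * solder0 m A B)"
        unfolding sum_distrib_left[where r = ?C and A = UNIV and f = "\<lambda>m. (\<Sum>k\<in>UNIV. \<Sum>l\<in>UNIV. lc k l m * sen_fr X k l x) * g m" for g] by (intro ext) (simp only: mult.assoc)
      then have "comp3 (?W x) m = ?C * (\<Sum>k\<in>UNIV. \<Sum>l\<in>UNIV. lc k l m * sen_fr X k l x)"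
        by (simp only: comp3_solder0)
      moreover have "1 / ?C * (?C * z) = z" for z by simp
      ultimately show ?thesis by (simp only:)
    qed
  qed
  have d4': "small (- 3/2) (\<lambda>x. sen_fr X k l x + sen_fr X l k x - 2/3 * kr k l * (\<Sum>k\<in>UNIV. sen_fr X k k x))" for k l
  proof -
    let ?x = "\<lambda>A B C D x. symmetrise4 (frame_spinor (\<lambda>k l. sen_fr X k l x)) A B C D"
    let ?S = "\<lambda>k l x. sen_fr X k l x"
    note v = symmetrise4_frame_spinor_values[of "\<lambda>k l. sen_fr X k l x" for x]
    have 12: "small (- 3/2) (\<lambda>x. ?S 1 2 x + ?S 2 1 x)" unfolding v by (intro small_cmult small_diff d4)
    have 13: "small (- 3/2) (\<lambda>x. ?S 1 3 x + ?S 3 1 x)" unfolding v by (intro small_cmult small_diff d4)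
    have 23: "small (- 3/2) (\<lambda>x. ?S 2 3 x + ?S 3 2 x)" unfolding v by (intro small_cmult small_add d4)
    have a: "small (- 3/2) (\<lambda>x. ?S 1 1 x - ?S 2 2 x)" unfolding v by (intro small_add d4)
    have b: "small (- 3/2) (\<lambda>x. 2 * ?S 3 3 x - ?S 1 1 x - ?S 2 2 x)" unfolding v by (intro small_cmult d4)
    \<comment> \<open>The diagonal entries of twice the trace-free part are combinations of
      \<open>a\<close> and \<open>b\<close>.\<close>
    have 11: "small (- 3/2) (\<lambda>x. ?S 1 1 x + ?S 1 1 x - 2/3 * (\<Sum>k\<in>UNIV. ?S k k x))"
      by (rule small_cong[OF small_diff[OF a small_cmult[OF b, of "1/3"]]]) (simp add: sum_3 field_simps)
    have 22: "small (- 3/2) (\<lambda>x. ?S 2 2 x + ?S 2 2 x - 2/3 * (\<Sum>k\<in>UNIV. ?S k k x))"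
      by (rule small_cong[OF small_diff[OF small_minus[OF a] small_cmult[OF b, of "1/3"]]]) (simp add: sum_3 field_simps)
    have 33: "small (- 3/2) (\<lambda>x. ?S 3 3 x + ?S 3 3 x - 2/3 * (\<Sum>k\<in>UNIV. ?S k k x))"
      by (rule small_cong[OF small_cmult[OF b, of "2/3"]]) (simp add: sum_3 field_simps)
    show ?thesis using exhaust_3[of k] exhaust_3[of l] 11 22 33 12 13 23
      by (auto simp: kronecker_def add.commute)
  qed
  obtain C where C: "\<And>a. small (- 1/2) (\<lambda>x. X a x - C a)" and X0: "\<And>a. symb 0 (X a)"
    using vector_asymptotically_constant[OF X32 d0 d4' d2] by blast
  \<comment> \<open>Up to order -1/2 the frame components of the lowered field are
    \<open>- X\<close>, hence the sign.\<close>
  define C' where "C' A B = - (\<Sum>n\<in>UNIV. solder0 n A B * C n)" for A B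
  have "small (- 1/2) (\<lambda>x. \<kappa>' x A B - \<kappa> x A B - C' A B)" for A B
  proof (rule small_cong)
    have "small (0 - 1/2) (\<lambda>x. vec_fr X n x + X n x)" for n by (rule vec_fr_flat[OF X0])
    then show "small (- 1/2) (\<lambda>x. \<Sum>n\<in>UNIV. solder0 n A B * ((vec_fr X n x + X n x) - (X n x - C n)))"
      by (intro small_sum small_cmult small_diff C) simp
    show "(\<Sum>n\<in>UNIV. solder0 n A B * ((vec_fr X n x + X n x) - (X n x - C n))) = \<kappa>' x A B - \<kappa> x A B - C' A B"
      if x: "R < norm x" for x
    proof -
      have "(\<Sum>n\<in>UNIV. solder0 n A B * ((vec_fr X n x + X n x) - (X n x - C n))) = spinor_of X x A B - C' A B"
        unfolding spinor_of_eq C'_def by (simp add: algebra_simps sum.distrib)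
      then show ?thesis unfolding \<omega>X[OF x] by (simp add: \<omega>_def)
    qed
  qed
  moreover have "C' A B = C' B A" for A B unfolding C'_def
    by (intro arg_cong[where f = uminus] sum.cong refl arg_cong2[where f = "(*)"] solder0_sym)
  ultimately show ?thesis by blast
qed

end

section \<open>From the data on the manifold to the analytic setting of the end\<close>

lemma negative_definite_invertible:
  fixes H :: "real^3^3"
  assumes "\<And>v. v \<noteq> 0 \<Longrightarrow> v \<bullet> (H *v v) < 0"
  shows "invertible H"
proof -
  have "v = 0" if "H *v v = 0" for v using assms[of v] that by force
  then show ?thesis
    by (simp add: invertible_left_inverse matrix_left_invertible_ker)
qed

theorem theorem17:
  fixes \<A> :: "'a::{t2_space,second_countable_topology} chart set"
    and h K :: "'a chart \<Rightarrow> real^3 \<Rightarrow> real^3^3"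
    and z :: 'a
    and c :: "'a chart"
    and R E s :: real
    and p :: "real^3"
    and w :: "real^3 \<Rightarrow> real"
    and e :: "real^3 \<Rightarrow> real^3^3"
    and \<Gamma> :: "real^3 \<Rightarrow> 3 \<Rightarrow> 2 \<Rightarrow> 2 \<Rightarrow> complex"
  assumes "vacuum_initial_data \<A> h K"
    and "asymptotic_end \<A> c R"
    and "w = end_weight \<A> h z c"
    and "adm_energy (h c) E" and "adm_momentum (h c) (K c) p"
    and "E\<^sup>2 - p \<bullet> p > 0"
    and "schwarzschildean_decay w R (h c) (K c) E p"
    and "asymptotically_cartesian_frame w R (h c) e"
    and "spin_connection R (h c) e \<Gamma>"
    and "s = 1 \<or> s = - 1"
  shows "(\<exists>\<kappa>. asymptotic_killing_spinor w R e \<Gamma> (K c) E p s \<kappa>) \<and>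
    (\<forall>\<kappa> \<kappa>'. asymptotic_killing_spinor w R e \<Gamma> (K c) E p s \<kappa> \<and>
        asymptotic_killing_spinor w R e \<Gamma> (K c) E p s \<kappa>' \<longrightarrow>
      (\<exists>C. (\<forall>A B. C A B = C B A) \<and>
        (\<forall>A B. o_inf w R (- 1/2) (\<lambda>x. \<kappa>' x A B - \<kappa> x A B - C A B))))"
proof -
  have cR: "c \<in> \<A>" "0 < R" "chart_image c = ext R" using assms(2) unfolding asymptotic_end_def by auto
  interpret exterior R by unfold_locales (rule cR)
  obtain \<rho> a b where w: "\<rho> > R" "a > 0" "b > 0"
      "\<And>x. \<rho> < norm x \<Longrightarrow> a * norm x \<le> w x" "\<And>x. \<rho> < norm x \<Longrightarrow> w x \<le> b * norm x"
    using end_weight_comparable[OF assms(1,2,3,6,7)] by blast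
  \<comment> \<open>From here on the distance no longer enters: \<open>o_inf\<close> is replaced by
    \<open>small\<close>, once for spinor components and once for real tensor components.\<close>
  have oc: "o_inf w R \<delta> f \<longleftrightarrow> small \<delta> f" for \<delta> and f :: "real^3 \<Rightarrow> complex"
    by (rule o_inf_weight[OF w(1,2,3)]) (fact w)+
  have orl: "o_inf w R \<delta> f \<longleftrightarrow> small \<delta> f" for \<delta> and f :: "real^3 \<Rightarrow> real"
    by (rule o_inf_weight[OF w(1,2,3)]) (fact w)+
  have neg: "v \<bullet> (h c x *v v) < 0" if "R < norm x" "v \<noteq> 0" for x v
  proof -
    have "\<forall>x\<in>chart_image c. \<forall>v. v \<noteq> 0 \<longrightarrow> v \<bullet> (h c x *v v) < 0"
      using assms(1) cR(1) unfolding vacuum_initial_data_def by blast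
    moreover have "x \<in> chart_image c" using cR(3) that by simp
    ultimately show ?thesis using that by blast
  qed
  have sym: "h c x $ i $ j = h c x $ j $ i" if "R < norm x" for x i j
  proof -
    have "\<forall>x\<in>chart_image c. transpose (h c x) = h c x"
      using assms(1) cR(1) unfolding vacuum_initial_data_def symmetric_tensor_field_def by blast
    moreover have "x \<in> chart_image c" using cR(3) that by simp
    ultimately have "transpose (h c x) = h c x" by blast
    then have "transpose (h c x) $ i $ j = h c x $ i $ j" by simp
    then show ?thesis by (simp add: transpose_def)
  qed
  interpret spin_end R "h c" "K c" e \<Gamma> E p
  proof
    show "E\<^sup>2 - p \<bullet> p > 0" by fact
    show "small (- 3/2) (\<lambda>x. h c x $ i $ j - h_lead E p i j x)" "small (- 5/2) (\<lambda>x. K c x $ i $ j - K_lead E p i j x)" for i j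
      using assms(7) unfolding schwarzschildean_decay_lead orl by blast+
    show "(e x $ k) \<bullet> (h c x *v (e x $ l)) = - kronecker k l" if "R < norm x" for x k l
      using assms(8) that unfolding asymptotically_cartesian_frame_def by auto
    show "small (- 1/2) (\<lambda>x. e x $ k $ i - kronecker k i)" for k i
      using assms(8) unfolding asymptotically_cartesian_frame_def orl by auto
    show "invertible (h c x)" if "R < norm x" for x by (rule negative_definite_invertible) (rule neg[OF that])
  qed (fact sym assms(9))+
  show ?thesis
  proof (intro conjI allI impI)
    show "\<exists>\<kappa>. asymptotic_killing_spinor w R e \<Gamma> (K c) E p s \<kappa>"
      unfolding asymptotic_killing_spinor_def oc by (rule existence)
    fix \<kappa> \<kappa>'
    assume "asymptotic_killing_spinor w R e \<Gamma> (K c) E p s \<kappa> \<and> asymptotic_killing_spinor w R e \<Gamma> (K c) E p s \<kappa>'"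
    then show "\<exists>C. (\<forall>A B. C A B = C B A) \<and> (\<forall>A B. o_inf w R (- 1/2) (\<lambda>x. \<kappa>' x A B - \<kappa> x A B - C A B))"
      unfolding asymptotic_killing_spinor_def oc
      by (elim conjE)
        (rule uniqueness[of \<kappa> \<kappa>' "\<lambda>x A B. complex_of_real (s * sqrt 2 / adm_mass E p) * covector_spinor e p x A B"
           "\<lambda>x. complex_of_real (s * sqrt 2 * E / adm_mass E p)"]; blast)
  qed
qed

end
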